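(* Let $p\in[1,\infty]$, $k\in\{0,1,2\}$, and let $M\in\mathcal{M}_{\boldsymbol{h}}$ be a macro-element such that the restriction of $\mathcal{M}_{\boldsymbol{h}}$ to the associated macro-element patch $\omega_M$ is uniform with mesh size $h_M$ (all macro-elements $M'\subset\omega_M$ satisfy $h_1(M')=h_2(M')=h_M$). Then for every $u\in W_{3,p}(\omega_M)\cap C^1(M)$ $$\big|u-\tilde\Pi u\big|_{W_{k,p}(M)}\le C\,h_M^{3-k}\,|u|_{W_{3,p}(\omega_M)},$$ with a constant $C$ independent of $u$, $M$ and the mesh.
   Context: Mesh. $\mathcal{M}_{\boldsymbol{h}}$ (macro-element mesh) is the tensor product mesh of closed rectangles $[x_i,x_{i+1}]\times[y_j,y_{j+1}]$ generated by two arbitrary one-dimensional meshes $x_0<\dots<x_n$, $y_0<\dots<y_m$; its members are called macro-elements, and their edges macro-element edges. $h_k(T)$ denotes the side length of an axis-parallel rectangle $T$ in the $k$-th coordinate direction. 1D splines. For an interval $J=[a,b]$ with midpoint $m$ and half-length $h=(b-a)/2$ and $e\in\{a,b\}$ let $\varphi^J_e,\psi^J_e\in C^1(J)$ be the functions that are quadratic polynomials on each of $[a,m]$, $[m,b]$, determined by $\varphi^J_e(k)=\delta_{ek}$, $(\varphi_e^J)'(k)=0$, $\psi^J_e(k)=0$, $(\psi^J_e)'(k)=\delta_{ek}$ for $k\in\{a,b\}$. Let $\mathbb{V}^J=\mathrm{span}\{\psi^J_a+\psi^J_b,\ \theta^J\}$ with $\theta^J(x)=\left(\frac{x-m}{h}\right)^2-\frac16$,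 and let $d^J_a,d^J_b\in\mathbb{V}^J$ be the dual functions determined by $\int_J(\psi^J_k)'(x)\,d^J_e(x)\,dx=\delta_{ke}$ for $k,e\in\{a,b\}$. Operator. With every vertex $X=(x_i,y_j)$ of the macro-element mesh a macro-element edge $\sigma_X$ with $X\in\sigma_X$ is associated. Put $a_X=\int_J u_{xy}(x,y_j)\,d^J_{x_i}(x)\,dx$ if $\sigma_X=J\times\{y_j\}$ is horizontal and $a_X=\int_K u_{xy}(x_i,y)\,d^K_{y_j}(y)\,dy$ if $\sigma_X=\{x_i\}\times K$ is vertical. On a macro-element $M=J\times K$ the quasi-interpolant is $$\tilde\Pi u|_M=\sum_{X=(e,f)}\Big(u(X)\varphi^J_e(x)\varphi^K_f(y)+u_x(X)\psi^J_e(x)\varphi^K_f(y)+u_y(X)\varphi^J_e(x)\psi^K_f(y)+a_X\psi^J_e(x)\psi^K_f(y)\Big),$$ the sum being over the four vertices $X=(e,f)$ of $M$. The associated macro-element patch $\omega_M$ is the smallest (in area) rectangular patch of macro-elements containing the convex hull of the four edges $\sigma_X$, $X$ a vertex of $M$. *)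

theory Defs
  imports "HOL-Analysis.Analysis" "HOL-Probability.Essential_Supremum"
begin

section \<open>Partial derivatives and classical smoothness in the plane\<close>

text \<open>Derivatives are taken relative to \<open>S\<close>, so that they are one-sided on the boundary of a closed
  rectangle. These notions are only used for \<open>S = UNIV\<close> and for nondegenerate closed rectangles,
  where the derivative within \<open>S\<close> is unique.\<close>

definition dx :: "(real \<times> real) set \<Rightarrow> (real \<times> real \<Rightarrow> real) \<Rightarrow> real \<times> real \<Rightarrow> real" where
  "dx S f = (\<lambda>z. frechet_derivative f (at z within S) (1, 0))"

definition dy :: "(real \<times> real) set \<Rightarrow> (real \<times> real \<Rightarrow> real) \<Rightarrow> real \<times> real \<Rightarrow> real" where
  "dy S f = (\<lambda>z. frechet_derivative f (at z within S) (0, 1))"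

primrec cont_diff :: "nat \<Rightarrow> (real \<times> real) set \<Rightarrow> (real \<times> real \<Rightarrow> real) \<Rightarrow> bool" where
  "cont_diff 0 S f \<longleftrightarrow> continuous_on S f"
| "cont_diff (Suc r) S f \<longleftrightarrow> f differentiable_on S \<and> cont_diff r S (dx S f) \<and> cont_diff r S (dy S f)"

definition test_function :: "(real \<times> real) set \<Rightarrow> (real \<times> real \<Rightarrow> real) \<Rightarrow> bool" where
  "test_function \<Omega> \<phi> \<longleftrightarrow> (\<forall>r. cont_diff r UNIV \<phi>) \<and>
     compact (closure {z. \<phi> z \<noteq> 0}) \<and> closure {z. \<phi> z \<noteq> 0} \<subseteq> \<Omega>"


section \<open>Sobolev spaces on open sets of the plane\<close>

definition lp_norm :: "'a measure \<Rightarrow> ennreal \<Rightarrow> ('a \<Rightarrow> real) \<Rightarrow> ennreal" where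
  "lp_norm M p f =
     (if p = \<infinity> then esssup M (\<lambda>z. ennreal \<bar>f z\<bar>)
      else let I = (\<integral>\<^sup>+ z. ennreal (\<bar>f z\<bar> powr enn2real p) \<partial>M)
           in if I = \<infinity> then \<infinity> else ennreal (enn2real I powr (1 / enn2real p)))"

definition locally_integrable :: "(real \<times> real) set \<Rightarrow> (real \<times> real \<Rightarrow> real) \<Rightarrow> bool" where
  "locally_integrable \<Omega> f \<longleftrightarrow> (\<forall>K. compact K \<and> K \<subseteq> \<Omega> \<longrightarrow> integrable (lebesgue_on K) f)"

definition is_weak_deriv ::
  "(real \<times> real) set \<Rightarrow> nat \<Rightarrow> nat \<Rightarrow> (real \<times> real \<Rightarrow> real) \<Rightarrow> (real \<times> real \<Rightarrow> real) \<Rightarrow> bool" where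
  "is_weak_deriv \<Omega> i j u g \<longleftrightarrow> locally_integrable \<Omega> u \<and> locally_integrable \<Omega> g \<and>
     (\<forall>\<phi>. test_function \<Omega> \<phi> \<longrightarrow>
        (LINT z|lebesgue_on \<Omega>. u z * ((dx UNIV ^^ i) ((dy UNIV ^^ j) \<phi>)) z)
          = (-1) ^ (i + j) * (LINT z|lebesgue_on \<Omega>. g z * \<phi> z))"

text \<open>A weak derivative is determined only almost everywhere; any representative may be chosen.\<close>

definition weak_deriv ::
  "(real \<times> real) set \<Rightarrow> nat \<Rightarrow> nat \<Rightarrow> (real \<times> real \<Rightarrow> real) \<Rightarrow> real \<times> real \<Rightarrow> real" where
  "weak_deriv \<Omega> i j u = (SOME g. is_weak_deriv \<Omega> i j u g)"

definition sobolev :: "nat \<Rightarrow> ennreal \<Rightarrow> (real \<times> real) set \<Rightarrow> (real \<times> real \<Rightarrow> real) set" where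
  "sobolev k p \<Omega> = {u. \<forall>i j. i + j \<le> k \<longrightarrow>
     (\<exists>g. is_weak_deriv \<Omega> i j u g \<and> lp_norm (lebesgue_on \<Omega>) p g < \<infinity>)}"

text \<open>The seminorm is \<open>\<infinity>\<close> outside the Sobolev space, so that a finite upper bound for it includes
  membership in the space.\<close>

definition sobolev_seminorm ::
  "nat \<Rightarrow> ennreal \<Rightarrow> (real \<times> real) set \<Rightarrow> (real \<times> real \<Rightarrow> real) \<Rightarrow> ennreal" where
  "sobolev_seminorm k p \<Omega> u =
     (if u \<notin> sobolev k p \<Omega> then \<infinity>
      else let N = (\<lambda>i. lp_norm (lebesgue_on \<Omega>) p (weak_deriv \<Omega> i (k - i) u))
           in if p = \<infinity> then Max (N ` {..k})
              else ennreal ((\<Sum>i\<le>k. enn2real (N i) powr enn2real p) powr (1 / enn2real p)))"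

text \<open>Traces on a segment \<open>\<gamma> ` J\<close> of a closed rectangle \<open>R\<close>, where \<open>\<gamma>\<close> is an arc-length
  parametrization: the trace operator \<open>W\<^sub>1\<^sub>,\<^sub>1(R) \<rightarrow> L\<^sub>1(J)\<close> is the continuous extension of the
  restriction map from the dense subspace \<open>C\<^sup>1(R)\<close>. Since \<open>R\<close> is bounded, this covers \<open>W\<^sub>1\<^sub>,\<^sub>p(R)\<close> for
  all \<open>p \<ge> 1\<close>.\<close>

definition is_trace ::
  "(real \<times> real) set \<Rightarrow> (real \<times> real \<Rightarrow> real) \<Rightarrow> (real \<Rightarrow> real \<times> real) \<Rightarrow> real set \<Rightarrow> (real \<Rightarrow> real) \<Rightarrow> bool"
  where
  "is_trace R v \<gamma> J g \<longleftrightarrow> integrable (lebesgue_on J) g \<and>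
     (\<exists>w. (\<forall>n::nat. cont_diff 1 R (w n)) \<and>
          (\<forall>l\<le>1. (\<lambda>n. sobolev_seminorm l 1 (interior R) (\<lambda>z. v z - w n z)) \<longlonglongrightarrow> 0) \<and>
          (\<lambda>n. lp_norm (lebesgue_on J) 1 (\<lambda>t. w n (\<gamma> t) - g t)) \<longlonglongrightarrow> 0)"

definition edge_trace ::
  "(real \<times> real) set \<Rightarrow> (real \<times> real \<Rightarrow> real) \<Rightarrow> (real \<Rightarrow> real \<times> real) \<Rightarrow> real set \<Rightarrow> real \<Rightarrow> real" where
  "edge_trace R v \<gamma> J = (SOME g. is_trace R v \<gamma> J g)"


section \<open>One-dimensional splines on an interval \<open>[a,b]\<close>\<close>

abbreviation deriv_on :: "real \<Rightarrow> real \<Rightarrow> (real \<Rightarrow> real) \<Rightarrow> real \<Rightarrow> real" where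
  "deriv_on a b f t \<equiv> vector_derivative f (at t within {a..b})"

text \<open>Functions on \<open>[a,b]\<close> are extended by zero, which makes them unique as total functions.\<close>

definition C1_quadratic_spline :: "real \<Rightarrow> real \<Rightarrow> (real \<Rightarrow> real) \<Rightarrow> bool" where
  "C1_quadratic_spline a b f \<longleftrightarrow>
     f differentiable_on {a..b} \<and> continuous_on {a..b} (deriv_on a b f) \<and>
     (\<exists>q::real poly. degree q \<le> 2 \<and> (\<forall>t\<in>{a..(a + b) / 2}. f t = poly q t)) \<and>
     (\<exists>q::real poly. degree q \<le> 2 \<and> (\<forall>t\<in>{(a + b) / 2..b}. f t = poly q t)) \<and>
     (\<forall>t. t \<notin> {a..b} \<longrightarrow> f t = 0)"

definition phi :: "real \<Rightarrow> real \<Rightarrow> real \<Rightarrow> real \<Rightarrow> real" where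
  "phi a b e = (THE f. C1_quadratic_spline a b f \<and>
     (\<forall>k\<in>{a, b}. f k = of_bool (e = k) \<and> deriv_on a b f k = 0))"

definition psi :: "real \<Rightarrow> real \<Rightarrow> real \<Rightarrow> real \<Rightarrow> real" where
  "psi a b e = (THE f. C1_quadratic_spline a b f \<and>
     (\<forall>k\<in>{a, b}. f k = 0 \<and> deriv_on a b f k = of_bool (e = k)))"

definition theta :: "real \<Rightarrow> real \<Rightarrow> real \<Rightarrow> real" where
  "theta a b t = ((t - (a + b) / 2) / ((b - a) / 2))\<^sup>2 - 1 / 6"

definition V_space :: "real \<Rightarrow> real \<Rightarrow> (real \<Rightarrow> real) set" where
  "V_space a b = {\<lambda>t. \<alpha> * (psi a b a t + psi a b b t) + \<beta> * theta a b t | \<alpha> \<beta>. True}"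

definition dual :: "real \<Rightarrow> real \<Rightarrow> real \<Rightarrow> real \<Rightarrow> real" where
  "dual a b e = (THE d. d \<in> V_space a b \<and>
     (\<forall>k\<in>{a, b}. (LINT t|lebesgue_on {a..b}. deriv_on a b (psi a b k) t * d t) = of_bool (k = e)))"


section \<open>Macro-element mesh, associated edges and patches\<close>

text \<open>A mesh is given by \<open>n\<close>, \<open>m\<close> and the nodes \<open>x 0 < \<dots> < x n\<close> and \<open>y 0 < \<dots> < y m\<close>; the values of
  \<open>x\<close> and \<open>y\<close> beyond \<open>n\<close> and \<open>m\<close> are irrelevant. Macro-elements are indexed by their lower left
  vertex.\<close>

definition mesh :: "nat \<Rightarrow> nat \<Rightarrow> (nat \<Rightarrow> real) \<Rightarrow> (nat \<Rightarrow> real) \<Rightarrow> bool" where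
  "mesh n m x y \<longleftrightarrow> strict_mono_on {..n} x \<and> strict_mono_on {..m} y"

definition elem :: "(nat \<Rightarrow> real) \<Rightarrow> (nat \<Rightarrow> real) \<Rightarrow> nat \<Rightarrow> nat \<Rightarrow> (real \<times> real) set" where
  "elem x y i j = {x i..x (Suc i)} \<times> {y j..y (Suc j)}"

text \<open>\<open>Horizontal k l\<close> is the edge \<open>[x k, x (k+1)] \<times> {y l}\<close>, and \<open>Vertical k l\<close> is
  \<open>{x k} \<times> [y l, y (l+1)]\<close>.\<close>

datatype edge = Horizontal nat nat | Vertical nat nat

primrec is_edge :: "nat \<Rightarrow> nat \<Rightarrow> edge \<Rightarrow> bool" where
  "is_edge n m (Horizontal k l) \<longleftrightarrow> k < n \<and> l \<le> m"
| "is_edge n m (Vertical k l) \<longleftrightarrow> k \<le> n \<and> l < m"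

primrec edge_set :: "(nat \<Rightarrow> real) \<Rightarrow> (nat \<Rightarrow> real) \<Rightarrow> edge \<Rightarrow> (real \<times> real) set" where
  "edge_set x y (Horizontal k l) = {x k..x (Suc k)} \<times> {y l}"
| "edge_set x y (Vertical k l) = {x k} \<times> {y l..y (Suc l)}"

definition edge_assignment ::
  "nat \<Rightarrow> nat \<Rightarrow> (nat \<Rightarrow> real) \<Rightarrow> (nat \<Rightarrow> real) \<Rightarrow> (nat \<Rightarrow> nat \<Rightarrow> edge) \<Rightarrow> bool" where
  "edge_assignment n m x y \<sigma> \<longleftrightarrow>
     (\<forall>i\<le>n. \<forall>j\<le>m. is_edge n m (\<sigma> i j) \<and> (x i, y j) \<in> edge_set x y (\<sigma> i j))"

definition rect_patches ::
  "nat \<Rightarrow> nat \<Rightarrow> (nat \<Rightarrow> real) \<Rightarrow> (nat \<Rightarrow> real) \<Rightarrow> (real \<times> real) set set" where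
  "rect_patches n m x y =
     {{x i..x i'} \<times> {y j..y j'} | i i' j j'. i < i' \<and> i' \<le> n \<and> j < j' \<and> j' \<le> m}"

definition macro_patch ::
  "nat \<Rightarrow> nat \<Rightarrow> (nat \<Rightarrow> real) \<Rightarrow> (nat \<Rightarrow> real) \<Rightarrow> (nat \<Rightarrow> nat \<Rightarrow> edge) \<Rightarrow> nat \<Rightarrow> nat \<Rightarrow> (real \<times> real) set"
  where
  "macro_patch n m x y \<sigma> i j =
     arg_min (measure lborel) (\<lambda>\<omega>. \<omega> \<in> rect_patches n m x y \<and>
       convex hull (\<Union>k\<in>{i, Suc i}. \<Union>l\<in>{j, Suc j}. edge_set x y (\<sigma> k l)) \<subseteq> \<omega>)"

definition uniform_on ::
  "nat \<Rightarrow> nat \<Rightarrow> (nat \<Rightarrow> real) \<Rightarrow> (nat \<Rightarrow> real) \<Rightarrow> (real \<times> real) set \<Rightarrow> real \<Rightarrow> bool" where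
  "uniform_on n m x y \<omega> h \<longleftrightarrow>
     (\<forall>i<n. \<forall>j<m. elem x y i j \<subseteq> \<omega> \<longrightarrow> x (Suc i) - x i = h \<and> y (Suc j) - y j = h)"


section \<open>Quasi-interpolation operator\<close>

text \<open>The averaged mixed derivative at the vertex \<open>(s, t)\<close> over an edge of the closed rectangle \<open>\<omega>\<close>.
  For \<open>u \<in> W\<^sub>3\<^sub>,\<^sub>p(\<omega>)\<close> the mixed derivative is a weak one, and its restriction to the edge is a trace.\<close>

primrec edge_average ::
  "(nat \<Rightarrow> real) \<Rightarrow> (nat \<Rightarrow> real) \<Rightarrow> (real \<times> real) set \<Rightarrow> (real \<times> real \<Rightarrow> real) \<Rightarrow> real \<Rightarrow> real \<Rightarrow> edge \<Rightarrow> real"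
  where
  "edge_average x y \<omega> u s t (Horizontal k l) =
     (LINT r|lebesgue_on {x k..x (Suc k)}.
        edge_trace \<omega> (weak_deriv (interior \<omega>) 1 1 u) (\<lambda>r. (r, y l)) {x k..x (Suc k)} r
          * dual (x k) (x (Suc k)) s r)"
| "edge_average x y \<omega> u s t (Vertical k l) =
     (LINT r|lebesgue_on {y l..y (Suc l)}.
        edge_trace \<omega> (weak_deriv (interior \<omega>) 1 1 u) (\<lambda>r. (x k, r)) {y l..y (Suc l)} r
          * dual (y l) (y (Suc l)) t r)"

text \<open>The restriction of the quasi-interpolant to the macro-element \<open>M\<close> with index \<open>(i, j)\<close>, for \<open>u\<close>
  given on a closed rectangle \<open>\<omega>\<close> that contains the edges associated with the vertices of \<open>M\<close>.\<close>

definition quasi_interp ::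
  "(nat \<Rightarrow> real) \<Rightarrow> (nat \<Rightarrow> real) \<Rightarrow> (nat \<Rightarrow> nat \<Rightarrow> edge) \<Rightarrow> (real \<times> real) set \<Rightarrow> nat \<Rightarrow> nat \<Rightarrow>
     (real \<times> real \<Rightarrow> real) \<Rightarrow> real \<times> real \<Rightarrow> real" where
  "quasi_interp x y \<sigma> \<omega> i j u = (\<lambda>(s, t).
     \<Sum>k\<in>{i, Suc i}. \<Sum>l\<in>{j, Suc j}.
       let M = elem x y i j; X = (x k, y l);
           \<phi>J = phi (x i) (x (Suc i)) (x k) s; \<psi>J = psi (x i) (x (Suc i)) (x k) s;
           \<phi>K = phi (y j) (y (Suc j)) (y l) t; \<psi>K = psi (y j) (y (Suc j)) (y l) t
       in u X * \<phi>J * \<phi>K + dx M u X * \<psi>J * \<phi>K + dy M u X * \<phi>J * \<psi>K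
          + edge_average x y \<omega> u (x k) (y l) (\<sigma> k l) * \<psi>J * \<psi>K)"

end

theory Submission
  imports Defs
begin

text \<open>For a smooth function, subtract the quadratic polynomial whose derivatives up to second order have
  the same means over the patch. Sobolev representation formulas and the Poincare inequality bound the
  remainder: its values and its gradient uniformly, its mixed derivative in the mean over every mesh line,
  and its second derivatives pointwise by integrals of the third derivatives over the patch and over one
  horizontal line. The quasi-interpolant reproduces quadratic polynomials, because the dual functions have
  integral one, and depends boundedly on these data. This gives a pointwise bound of the error and its
  derivatives which involves only integrals of third derivatives, and which therefore survives the limit
  along a smooth approximation in \<open>W\<^sub>3\<^sub>,\<^sub>1\<close>. Only then is Jensen's inequality used to pass to \<open>L\<^sub>p\<close>,
  so that all exponents, including infinity, are treated at once.\<close>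

text \<open>The obstacle is the dimension: on a rectangle, W_{1,1} does not embed into the bounded
  functions. Third derivatives in L_1 therefore control values, gradients and averages over lines,
  but not second derivatives at a point, and a line integral has to enter the pointwise bound. It
  does no harm: it depends on \<open>snd z\<close> only, so integrating its q-th power over the
  element restores an integral over the patch. The mixed derivative enters the operator as a trace,
  and \<open>edge_trace\<close> selects one by choice. Hence traces must be shown to exist, and
  every trace must be shown to be the L_1 limit of the mixed derivatives of one fixed smooth
  sequence. The same sequence converges uniformly together with its gradient, so that all vertex
  data of the interpolant pass to the limit together. Minimal area confines the patch to three
  macro-elements in each direction. All ratios of lengths are then bounded, every constant is an
  explicit number, and none of them depends on p.\<close>

text \<open>A set of functions closed under differentiation witnesses that all derivatives exist.\<close>

definition smooth :: "(real \<Rightarrow> real) \<Rightarrow> bool" where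
  "smooth f \<longleftrightarrow> (\<exists>S. f \<in> S \<and> (\<forall>g\<in>S. \<exists>g'\<in>S. \<forall>t. (g has_real_derivative g' t) (at t)))"

lemma smooth_has_deriv:
  assumes "smooth f" shows "(f has_real_derivative deriv f t) (at t)"
  using assms unfolding smooth_def by (metis DERIV_imp_deriv)

lemma smooth_deriv: assumes "smooth f" shows "smooth (deriv f)"
proof -
  from assms obtain S where S: "f \<in> S" "\<forall>g\<in>S. \<exists>g'\<in>S. \<forall>t. (g has_real_derivative g' t) (at t)"
    unfolding smooth_def by blast
  then obtain g' where g': "g' \<in> S" "\<forall>t. (f has_real_derivative g' t) (at t)" by blast
  then have "deriv f = g'" by (auto intro: DERIV_imp_deriv)
  then show ?thesis using g' S unfolding smooth_def by blast
qed

lemma smooth_deriv_iter: "smooth f \<Longrightarrow> smooth ((deriv ^^ k) f)"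
  by (induction k) (auto intro: smooth_deriv)

lemma smooth_continuous: "smooth f \<Longrightarrow> continuous_on S f"
  by (meson DERIV_continuous_on smooth_has_deriv has_field_derivative_at_within)

text \<open>The multiples \<open>e * g\<close> belong to the witnessing set because the chain rule
  produces a factor \<open>c\<close> at every differentiation.\<close>

lemma smooth_affine:
  assumes "smooth f" shows "smooth (\<lambda>t. f (c * t + d))"
proof -
  from assms obtain S where S: "f \<in> S" "\<forall>g\<in>S. \<exists>g'\<in>S. \<forall>t. (g has_real_derivative g' t) (at t)"
    unfolding smooth_def by blast
  let ?S = "{\<lambda>t. e * g (c * t + d) | e g. g \<in> S}"
  have 1: "(\<lambda>t. f (c * t + d)) \<in> ?S"
    using S by (auto intro!: exI[of _ 1])
  have 2: "\<exists>g'\<in>?S. \<forall>t. (g has_real_derivative g' t) (at t)" if gS: "g \<in> ?S" for g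
  proof -
    obtain e k where k: "k \<in> S" "g = (\<lambda>t. e * k (c * t + d))" using gS by blast
    obtain k' where k': "k' \<in> S" "\<forall>t. (k has_real_derivative k' t) (at t)" using S k by blast
    have "\<forall>t. (g has_real_derivative (e * c) * k' (c * t + d)) (at t)"
    proof
      fix t
      have "((\<lambda>t. k (c * t + d)) has_real_derivative k' (c * t + d) * c) (at t)"
        by (rule DERIV_chain2) (use k' in \<open>auto intro!: derivative_eq_intros\<close>)
      from DERIV_cmult[OF this, of e] show "(g has_real_derivative (e * c) * k' (c * t + d)) (at t)"
        unfolding k by (simp add: mult_ac)
    qed
    moreover have "(\<lambda>t. (e * c) * k' (c * t + d)) \<in> ?S" using k' by blast
    ultimately show ?thesis by (rule bexI)
  qed
  show ?thesis unfolding smooth_def by (rule exI[of _ ?S]) (use 1 2 in blast)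
qed

text \<open>The product rule leads out of the set of products but not out of the set of their finite
  sums, which is therefore the witnessing set for a product.\<close>

inductive_set mult_span :: "(real \<Rightarrow> real) set \<Rightarrow> (real \<Rightarrow> real) set \<Rightarrow> (real \<Rightarrow> real) set"
  for S T where
    mult: "f \<in> S \<Longrightarrow> g \<in> T \<Longrightarrow> (\<lambda>t. f t * g t) \<in> mult_span S T"
  | plus: "f \<in> mult_span S T \<Longrightarrow> g \<in> mult_span S T \<Longrightarrow> (\<lambda>t. f t + g t) \<in> mult_span S T"

lemma smooth_mult:
  assumes "smooth f" "smooth g" shows "smooth (\<lambda>t. f t * g t)"
proof -
  from assms(1) obtain S where S: "f \<in> S" "\<forall>g\<in>S. \<exists>g'\<in>S. \<forall>t. (g has_real_derivative g' t) (at t)"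
    unfolding smooth_def by blast
  from assms(2) obtain T where T: "g \<in> T" "\<forall>g\<in>T. \<exists>g'\<in>T. \<forall>t. (g has_real_derivative g' t) (at t)"
    unfolding smooth_def by blast
  have 2: "\<exists>h'\<in>mult_span S T. \<forall>t. (h has_real_derivative h' t) (at t)" if "h \<in> mult_span S T" for h
    using that
  proof induction
    case (mult f g)
    obtain f' g' where fg: "f' \<in> S" "\<forall>t. (f has_real_derivative f' t) (at t)"
       "g' \<in> T" "\<forall>t. (g has_real_derivative g' t) (at t)" using S T mult by meson
    have "\<forall>t. ((\<lambda>t. f t * g t) has_real_derivative f' t * g t + f t * g' t) (at t)"
      using fg by (auto intro!: derivative_eq_intros)
    then show ?case using fg mult
      by (intro bexI[of _ "\<lambda>t. f' t * g t + f t * g' t"] mult_span.intros)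
  next
    case (plus f g)
    then obtain f' g' where fg: "f' \<in> mult_span S T" "\<forall>t. (f has_real_derivative f' t) (at t)"
       "g' \<in> mult_span S T" "\<forall>t. (g has_real_derivative g' t) (at t)" by meson
    have "\<forall>t. ((\<lambda>t. f t + g t) has_real_derivative f' t + g' t) (at t)"
      using fg by (auto intro!: derivative_eq_intros)
    then show ?case using fg
      by (intro bexI[of _ "\<lambda>t. f' t + g' t"] mult_span.intros)
  qed
  show ?thesis unfolding smooth_def
    by (rule exI[of _ "mult_span S T"]) (use 2 mult_span.mult[OF S(1) T(1)] in blast)
qed

text \<open>The polynomial factor makes the family of functions P(1/t) exp(-1/t) closed under
  differentiation, so that its range is a witnessing set. The classical flat function is
  \<open>poly_exp 1\<close>.\<close>

definition poly_exp :: "real poly \<Rightarrow> real \<Rightarrow> real" where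
  "poly_exp P t = (if t > 0 then poly P (1 / t) * exp (- (1 / t)) else 0)"

lemma tendsto_poly_exp_at_top: "((\<lambda>x. poly P x * exp (- x)) \<longlongrightarrow> (0::real)) at_top"
proof -
  have "((\<lambda>x. \<Sum>i\<le>degree P. coeff P i * (x ^ i / exp x)) \<longlongrightarrow> (\<Sum>i\<le>degree P. coeff P i * 0)) at_top"
    by (intro tendsto_sum tendsto_mult tendsto_const tendsto_power_div_exp_0)
  then show ?thesis
    by (simp add: poly_altdef sum_distrib_right exp_minus divide_inverse mult.assoc)
qed

text \<open>With s = 1/t, the derivative of P(s) exp(-s) is s^2 (P(s) - P'(s)) exp(-s) up to the
  sign rules already absorbed. At t = 0 the difference quotient is of the same type and tends to
  zero, because the exponential beats every polynomial.\<close>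

lemma poly_exp_has_deriv:
  "(poly_exp P has_real_derivative poly_exp (monom 1 2 * (P - pderiv P)) t) (at t)"
proof -
  consider "t > 0" | "t < 0" | "t = 0" by linarith
  then show ?thesis
  proof cases
    case 1
    have "((\<lambda>t. poly P (1 / t) * exp (- (1 / t))) has_real_derivative
        poly_exp (monom 1 2 * (P - pderiv P)) t) (at t)"
      using 1 by (auto intro!: derivative_eq_intros simp: poly_exp_def poly_monom field_simps power2_eq_square)
    then show ?thesis
      by (rule has_field_derivative_transform_within_open[of _ _ _ "{0<..}"]) (use 1 in \<open>auto simp: poly_exp_def\<close>)
  next
    case 2
    have "((\<lambda>t. 0) has_real_derivative 0) (at t)" by simp
    then have "(poly_exp P has_real_derivative 0) (at t)"
      by (rule has_field_derivative_transform_within_open[of _ _ _ "{..<0}"]) (use 2 in \<open>auto simp: poly_exp_def\<close>)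
    with 2 show ?thesis by (simp add: poly_exp_def)
  next
    case 3
    have "((\<lambda>h. poly_exp P h / h) \<longlongrightarrow> 0) (at_right 0)"
    proof -
      \<comment> \<open>Division by h multiplies the polynomial in 1/h by its variable, hence
        \<open>pCons 0 P\<close>.\<close>
      have "((\<lambda>h. poly (pCons 0 P) (inverse h) * exp (- inverse h)) \<longlongrightarrow> 0) (at_right 0)"
        using tendsto_poly_exp_at_top filterlim_inverse_at_top_right by (rule filterlim_compose)
      then show ?thesis
        by (rule Lim_transform_eventually)
          (auto simp: eventually_at_filter poly_exp_def field_simps)
    qed
    moreover have "((\<lambda>h. poly_exp P h / h) \<longlongrightarrow> 0) (at_left 0)"
    proof -
      have "((\<lambda>h. 0) \<longlongrightarrow> (0::real)) (at_left 0)" by simp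
      then show ?thesis
        by (rule Lim_transform_eventually) (auto simp: eventually_at_filter poly_exp_def)
    qed
    ultimately have "((\<lambda>h. poly_exp P h / h) \<longlongrightarrow> 0) (at 0)"
      by (simp add: filterlim_split_at)
    then show ?thesis using 3 by (simp add: DERIV_def poly_exp_def)
  qed
qed

lemma smooth_poly_exp: "smooth (poly_exp P)"
  unfolding smooth_def by (rule exI[of _ "range poly_exp"]) (use poly_exp_has_deriv in blast)

lemma compact_subset_closed:
  fixes A B :: "'a::metric_space set"
  shows "closed A \<Longrightarrow> A \<subseteq> B \<Longrightarrow> compact B \<Longrightarrow> compact A"
  using compact_Int_closed[of B A] by (simp add: Int_absorb1)

section \<open>Tensor products of smooth functions\<close>

lemma tensor_has_derivative:
  assumes "(a has_real_derivative a') (at (fst z))" "(b has_real_derivative b') (at (snd z))"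
  shows "((\<lambda>z. a (fst z) * b (snd z)) has_derivative
     (\<lambda>h. fst h * (a' * b (snd z)) + snd h * (a (fst z) * b'))) (at z)"
proof -
  have 1: "((\<lambda>z::real\<times>real. a (fst z)) has_derivative (\<lambda>h. a' * fst h)) (at z)"
    using has_derivative_compose[OF has_derivative_fst[OF has_derivative_ident], of a "(*) a'" z UNIV] assms(1)
    by (simp add: has_field_derivative_def)
  have 2: "((\<lambda>z::real\<times>real. b (snd z)) has_derivative (\<lambda>h. b' * snd h)) (at z)"
    using has_derivative_compose[OF has_derivative_snd[OF has_derivative_ident], of b "(*) b'" z UNIV] assms(2)
    by (simp add: has_field_derivative_def)
  show ?thesis
    using has_derivative_mult[OF 1 2] by (simp add: algebra_simps)
qed

lemma dx_UNIV_eq: "(f has_derivative f') (at z) \<Longrightarrow> dx UNIV f z = f' (1, 0)"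
  and dy_UNIV_eq: "(f has_derivative f') (at z) \<Longrightarrow> dy UNIV f z = f' (0, 1)"
  by (simp_all add: dx_def dy_def flip: frechet_derivative_at)

lemma
  assumes "smooth a" "smooth b"
  shows dx_tensor: "dx UNIV (\<lambda>z. a (fst z) * b (snd z)) = (\<lambda>z. deriv a (fst z) * b (snd z))"
    and dy_tensor: "dy UNIV (\<lambda>z. a (fst z) * b (snd z)) = (\<lambda>z. a (fst z) * deriv b (snd z))"
  using dx_UNIV_eq[OF tensor_has_derivative[OF smooth_has_deriv smooth_has_deriv]]
    dy_UNIV_eq[OF tensor_has_derivative[OF smooth_has_deriv smooth_has_deriv]] assms
  by (auto simp: fun_eq_iff)

lemma cont_diff_tensor:
  "smooth a \<Longrightarrow> smooth b \<Longrightarrow> cont_diff r UNIV (\<lambda>z. a (fst z) * b (snd z))"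
proof (induction r arbitrary: a b)
  case 0
  have "continuous_on UNIV (\<lambda>z::real\<times>real. a (fst z))"
    by (rule continuous_on_compose2[OF smooth_continuous[OF 0(1), of UNIV] continuous_on_fst]) (auto intro: continuous_on_id)
  moreover have "continuous_on UNIV (\<lambda>z::real\<times>real. b (snd z))"
    by (rule continuous_on_compose2[OF smooth_continuous[OF 0(2), of UNIV] continuous_on_snd]) (auto intro: continuous_on_id)
  ultimately show ?case by (simp add: continuous_on_mult)
next
  case (Suc r)
  have "(\<lambda>z. a (fst z) * b (snd z)) differentiable_on UNIV"
    unfolding differentiable_on_def differentiable_def
    using tensor_has_derivative[OF smooth_has_deriv[OF Suc.prems(1)] smooth_has_deriv[OF Suc.prems(2)]] by blast
  then show ?case using Suc by (simp add: dx_tensor dy_tensor smooth_deriv)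
qed

lemma iter_tensor:
  assumes "smooth a" "smooth b"
  shows "(dx UNIV ^^ i) ((dy UNIV ^^ j) (\<lambda>z. a (fst z) * b (snd z))) =
    (\<lambda>z. (deriv ^^ i) a (fst z) * (deriv ^^ j) b (snd z))"
proof -
  have y: "(dy UNIV ^^ j) (\<lambda>z. a (fst z) * b (snd z)) = (\<lambda>z. a (fst z) * (deriv ^^ j) b (snd z))"
    by (induction j) (auto simp: dy_tensor assms smooth_deriv_iter)
  show ?thesis unfolding y
    by (induction i) (auto simp: dx_tensor assms smooth_deriv_iter)
qed

text \<open>The source of all concrete test functions below: cut-offs of rectangles and
  mollification kernels.\<close>

lemma test_function_tensor:
  assumes "smooth a" "smooth b"
    and supp: "\<And>t. t \<notin> {l1..u1} \<Longrightarrow> a t = 0" "\<And>t. t \<notin> {l2..u2} \<Longrightarrow> b t = 0"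
    and sub: "{l1..u1} \<times> {l2..u2} \<subseteq> \<Omega>"
  shows "test_function \<Omega> (\<lambda>z. a (fst z) * b (snd z))"
proof -
  have c: "compact ({l1..u1} \<times> {l2..u2})" by (intro compact_Times compact_Icc)
  have s: "{z. a (fst z) * b (snd z) \<noteq> 0} \<subseteq> {l1..u1} \<times> {l2..u2}"
  proof
    fix z assume "z \<in> {z. a (fst z) * b (snd z) \<noteq> 0}"
    then have "a (fst z) \<noteq> 0" "b (snd z) \<noteq> 0" by auto
    then show "z \<in> {l1..u1} \<times> {l2..u2}" using supp by (metis mem_Times_iff)
  qed
  then have cl: "closure {z. a (fst z) * b (snd z) \<noteq> 0} \<subseteq> {l1..u1} \<times> {l2..u2}"
    using c by (intro closure_minimal compact_imp_closed)
  then have "compact (closure {z. a (fst z) * b (snd z) \<noteq> 0})"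
    by (rule compact_subset_closed[OF closed_closure _ c])
  then show ?thesis using cl sub cont_diff_tensor assms(1,2) unfolding test_function_def by blast
qed

section \<open>Test functions\<close>

lemma test_function_has_derivative:
  assumes "test_function \<Omega> \<phi>"
  shows "(\<phi> has_derivative (\<lambda>h. fst h * dx UNIV \<phi> z + snd h * dy UNIV \<phi> z)) (at z)"
proof -
  have "cont_diff (Suc 0) UNIV \<phi>" using assms test_function_def by blast
  then have "\<phi> differentiable (at z)" using cont_diff.simps(2) differentiable_on_def by (metis UNIV_I)
  then have d: "(\<phi> has_derivative frechet_derivative \<phi> (at z)) (at z)"
    by (simp add: frechet_derivative_works)
  then have l: "linear (frechet_derivative \<phi> (at z))" by (rule has_derivative_linear)
  have "frechet_derivative \<phi> (at z) h = fst h * dx UNIV \<phi> z + snd h * dy UNIV \<phi> z" for h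
  proof -
    have "h = fst h *\<^sub>R (1,0) + snd h *\<^sub>R (0,1)" by (cases h) simp
    then have "frechet_derivative \<phi> (at z) h = frechet_derivative \<phi> (at z) (fst h *\<^sub>R (1,0) + snd h *\<^sub>R (0,1))" by simp
    also have "\<dots> = fst h * dx UNIV \<phi> z + snd h * dy UNIV \<phi> z"
      by (simp only: linear_add[OF l] linear_cmul[OF l] dx_def dy_def real_scaleR_def)
    finally show ?thesis .
  qed
  then have "frechet_derivative \<phi> (at z) = (\<lambda>h. fst h * dx UNIV \<phi> z + snd h * dy UNIV \<phi> z)" by blast
  with d show ?thesis by metis
qed

lemma test_function_continuous: "test_function \<Omega> \<phi> \<Longrightarrow> continuous_on S \<phi>"
  by (meson has_derivative_at_withinI has_derivative_continuous_on test_function_has_derivative)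

lemma test_function_zero: "test_function \<Omega> \<phi> \<Longrightarrow> z \<notin> \<Omega> \<Longrightarrow> \<phi> z = 0"
  unfolding test_function_def using closure_subset[of "{z. \<phi> z \<noteq> 0}"] by blast

lemma test_function_mono: "test_function \<Omega> \<phi> \<Longrightarrow> \<Omega> \<subseteq> \<Omega>' \<Longrightarrow> test_function \<Omega>' \<phi>"
  unfolding test_function_def by blast

text \<open>Off the closed support the function is zero on an open set, hence so are its partial
  derivatives; differentiation cannot enlarge the support.\<close>

lemma test_function_deriv:
  assumes "test_function \<Omega> \<phi>"
  shows "test_function \<Omega> (dx UNIV \<phi>)" "test_function \<Omega> (dy UNIV \<phi>)"
proof -
  let ?K = "closure {z. \<phi> z \<noteq> 0}"
  have K: "compact ?K" "?K \<subseteq> \<Omega>" using assms by (auto simp: test_function_def)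
  have z: "dx UNIV \<phi> z = 0 \<and> dy UNIV \<phi> z = 0" if "z \<notin> ?K" for z
  proof -
    have "((\<lambda>z. 0) has_derivative (\<lambda>h. 0::real)) (at z)" by simp
    then have "(\<phi> has_derivative (\<lambda>h. 0)) (at z)"
      by (rule has_derivative_transform_within_open[of _ _ _ _ "- ?K"])
        (use that closure_subset[of "{z. \<phi> z \<noteq> 0}"] in auto)
    then show ?thesis using dx_UNIV_eq dy_UNIV_eq by blast
  qed
  have *: "closure {z. f z \<noteq> 0} \<subseteq> ?K" if "\<And>z. z \<notin> ?K \<Longrightarrow> f z = 0" for f :: "real \<times> real \<Rightarrow> real"
    using that by (intro closure_minimal) auto
  have **: "compact (closure {z. f z \<noteq> 0}) \<and> closure {z. f z \<noteq> 0} \<subseteq> \<Omega>" if "\<And>z. z \<notin> ?K \<Longrightarrow> f z = 0"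
    for f :: "real \<times> real \<Rightarrow> real"
    using *[OF that] K compact_subset_closed[OF closed_closure _ K(1)] by (meson subset_trans)
  have c: "cont_diff (Suc r) UNIV \<phi>" for r using assms test_function_def by blast
  show "test_function \<Omega> (dx UNIV \<phi>)" "test_function \<Omega> (dy UNIV \<phi>)"
    unfolding test_function_def using c **[of "dx UNIV \<phi>"] **[of "dy UNIV \<phi>"] z
    by (simp_all only: cont_diff.simps) blast+
qed

lemma test_function_bounded:
  assumes "test_function \<Omega> \<phi>" obtains B where "\<And>z. \<bar>\<phi> z\<bar> \<le> B" "B > 0"
proof -
  let ?K = "closure {z. \<phi> z \<noteq> 0}"
  have "compact (\<phi> ` ?K)" using assms test_function_continuous[OF assms]
    by (intro compact_continuous_image) (auto simp: test_function_def)
  then obtain B where B: "B > 0" "\<forall>x\<in>\<phi> ` ?K. norm x \<le> B"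
    by (meson bounded_pos compact_imp_bounded)
  have "\<bar>\<phi> z\<bar> \<le> B" for z
    using B closure_subset[of "{z. \<phi> z \<noteq> 0}"] by (cases "\<phi> z = 0") auto
  then show ?thesis using that B by blast
qed

section \<open>Weak derivatives\<close>

lemma integrable_lebesgue_on_iff:
  fixes f :: "'a::euclidean_space \<Rightarrow> real"
  assumes "S \<in> sets lebesgue"
  shows "integrable (lebesgue_on S) f \<longleftrightarrow> integrable lebesgue (\<lambda>z. indicator S z * f z)"
  using integrable_restrict_space[of S lebesgue f] assms by simp

lemma integral_lebesgue_on_eq:
  fixes f :: "'a::euclidean_space \<Rightarrow> real"
  assumes "S \<in> sets lebesgue"
  shows "(LINT z|lebesgue_on S. f z) = (LINT z|lebesgue. indicator S z * f z)"
  using integral_restrict_space[of S lebesgue f] assms by simp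

lemma integrable_lebesgue_on_subset:
  fixes f :: "'a::euclidean_space \<Rightarrow> real"
  assumes "integrable (lebesgue_on S) f" "S \<in> sets lebesgue" "T \<in> sets lebesgue" "T \<subseteq> S"
  shows "integrable (lebesgue_on T) f"
proof -
  have "integrable lebesgue (\<lambda>z. indicator T z *\<^sub>R (indicator S z * f z))"
    using assms by (intro integrable_mult_indicator) (auto simp: integrable_lebesgue_on_iff)
  moreover have "(\<lambda>z. indicator T z *\<^sub>R (indicator S z * f z)) = (\<lambda>z. indicator T z * f z)"
    using assms(4) by (auto simp: indicator_def fun_eq_iff)
  ultimately show ?thesis using assms by (simp add: integrable_lebesgue_on_iff)
qed

lemma locally_integrableI:
  assumes "integrable (lebesgue_on S) f" "S \<in> sets lebesgue"
  shows "locally_integrable S f"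
  unfolding locally_integrable_def
  using assms integrable_lebesgue_on_subset lmeasurable_compact fmeasurableD by blast

text \<open>A test function is bounded and lives on a compact subset of \<Omega>, on which
  \<open>f\<close> is integrable.\<close>

lemma locally_integrable_test:
  assumes "locally_integrable \<Omega> f" "test_function \<Omega> \<phi>"
  shows "integrable lebesgue (\<lambda>z. f z * \<phi> z)"
proof -
  let ?K = "closure {z. \<phi> z \<noteq> 0}"
  have K: "compact ?K" "?K \<subseteq> \<Omega>" using assms(2) by (auto simp: test_function_def)
  then have Ks: "?K \<in> sets lebesgue" by (simp add: lmeasurable_compact fmeasurableD)
  have f: "integrable (lebesgue_on ?K) f" using K assms(1) by (simp add: locally_integrable_def)
  obtain B where B: "\<And>z. \<bar>\<phi> z\<bar> \<le> B" "B > 0" using test_function_bounded[OF assms(2)] by blast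
  have "\<phi> \<in> borel_measurable lebesgue"
    using test_function_continuous[OF assms(2), of UNIV]
    by (intro measurable_completion) (simp add: borel_measurable_continuous_onI)
  then have "integrable lebesgue (\<lambda>z. \<phi> z * (indicator ?K z * f z))"
    using f Ks B by (intro Bochner_Integration.integrable_bound[where f="\<lambda>z. B * (indicator ?K z * f z)" and g="\<lambda>z. \<phi> z * (indicator ?K z * f z)"])
     (auto simp: integrable_lebesgue_on_iff abs_mult mult_right_mono intro!: AE_I2 mult_mono borel_measurable_times)
  moreover have "(\<lambda>z. \<phi> z * (indicator ?K z * f z)) = (\<lambda>z. f z * \<phi> z)"
    using closure_subset[of "{z. \<phi> z \<noteq> 0}"] by (auto simp: indicator_def fun_eq_iff)
  ultimately show ?thesis by simp
qed

lemma integral_test_eq: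
  assumes "test_function \<Omega> \<phi>" "\<Omega> \<in> sets lebesgue"
  shows "(LINT z|lebesgue_on \<Omega>. f z * \<phi> z) = (LINT z|lebesgue. f z * \<phi> z)"
  unfolding integral_lebesgue_on_eq[OF assms(2)]
  by (rule Bochner_Integration.integral_cong) (use test_function_zero[OF assms(1)] in \<open>auto simp: indicator_def\<close>)

lemma test_function_iter:
  assumes "test_function \<Omega> \<phi>" shows "test_function \<Omega> ((dx UNIV ^^ i) ((dy UNIV ^^ j) \<phi>))"
proof -
  have "test_function \<Omega> ((dy UNIV ^^ j) \<phi>)" using assms by (induction j) (auto intro: test_function_deriv)
  then show ?thesis by (induction i) (auto intro: test_function_deriv)
qed

text \<open>Test functions vanish off \<Omega>, so all integrals may be taken over the whole plane.
  This removes restricted measures from the calculus of weak derivatives.\<close>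

lemma is_weak_deriv_iff:
  assumes "\<Omega> \<in> sets lebesgue"
  shows "is_weak_deriv \<Omega> i j u g \<longleftrightarrow> locally_integrable \<Omega> u \<and> locally_integrable \<Omega> g \<and>
     (\<forall>\<phi>. test_function \<Omega> \<phi> \<longrightarrow>
        (LINT z|lebesgue. u z * ((dx UNIV ^^ i) ((dy UNIV ^^ j) \<phi>)) z)
          = (-1) ^ (i + j) * (LINT z|lebesgue. g z * \<phi> z))"
  unfolding is_weak_deriv_def using integral_test_eq[OF test_function_iter assms] integral_test_eq[OF _ assms] by auto

lemma locally_integrable_lin:
  assumes "locally_integrable \<Omega> f" "locally_integrable \<Omega> g"
  shows "locally_integrable \<Omega> (\<lambda>z. a * f z + b * g z)"
  using assms unfolding locally_integrable_def by auto

lemma is_weak_deriv_lin: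
  assumes "\<Omega> \<in> sets lebesgue" "is_weak_deriv \<Omega> i j u g" "is_weak_deriv \<Omega> i j u' g'"
  shows "is_weak_deriv \<Omega> i j (\<lambda>z. a * u z + b * u' z) (\<lambda>z. a * g z + b * g' z)"
proof -
  have *: "(LINT z|lebesgue. (a * f z + b * f' z) * \<phi> z) =
      a * (LINT z|lebesgue. f z * \<phi> z) + b * (LINT z|lebesgue. f' z * \<phi> z)"
    if "locally_integrable \<Omega> f" "locally_integrable \<Omega> f'" "test_function \<Omega> \<phi>" for f f' \<phi>
  proof -
    have "(LINT z|lebesgue. (a * f z + b * f' z) * \<phi> z) = (LINT z|lebesgue. a * (f z * \<phi> z) + b * (f' z * \<phi> z))"
      by (simp add: algebra_simps)
    also have "\<dots> = a * (LINT z|lebesgue. f z * \<phi> z) + b * (LINT z|lebesgue. f' z * \<phi> z)"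
      using locally_integrable_test[OF that(1,3)] locally_integrable_test[OF that(2,3)] by simp
    finally show ?thesis .
  qed
  have u: "locally_integrable \<Omega> u" "locally_integrable \<Omega> u'" "locally_integrable \<Omega> g" "locally_integrable \<Omega> g'"
    using assms(2,3) by (auto simp: is_weak_deriv_def)
  show ?thesis
    unfolding is_weak_deriv_iff[OF assms(1)]
  proof (intro conjI allI impI locally_integrable_lin u)
    fix \<phi> assume t: "test_function \<Omega> \<phi>"
    show "(LINT z|lebesgue. (a * u z + b * u' z) * (dx UNIV ^^ i) ((dy UNIV ^^ j) \<phi>) z)
        = (- 1) ^ (i + j) * (LINT z|lebesgue. (a * g z + b * g' z) * \<phi> z)"
      using assms(2,3) t unfolding *[OF u(1,2) test_function_iter[OF t]] *[OF u(3,4) t] is_weak_deriv_iff[OF assms(1)]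
      by (simp add: algebra_simps)
  qed
qed

lemma is_weak_deriv_diff:
  assumes "\<Omega> \<in> sets lebesgue" "is_weak_deriv \<Omega> i j u g" "is_weak_deriv \<Omega> i j u' g'"
  shows "is_weak_deriv \<Omega> i j (\<lambda>z. u z - u' z) (\<lambda>z. g z - g' z)"
  using is_weak_deriv_lin[OF assms, of 1 "-1"] by simp

lemma is_weak_deriv_subset:
  assumes "\<Omega> \<in> sets lebesgue" "\<Omega>' \<in> sets lebesgue" "\<Omega>' \<subseteq> \<Omega>" "is_weak_deriv \<Omega> i j u g"
  shows "is_weak_deriv \<Omega>' i j u g"
  using assms test_function_mono[of \<Omega>' _ \<Omega>] unfolding is_weak_deriv_iff[OF assms(1)] is_weak_deriv_iff[OF assms(2)]
  by (auto simp: locally_integrable_def)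

lemma locally_integrable_AE_cong:
  assumes "locally_integrable \<Omega> f" "AE z in lebesgue_on \<Omega>. f z = g z" "\<Omega> \<in> sets lebesgue"
  shows "locally_integrable \<Omega> g"
  unfolding locally_integrable_def
proof (intro allI impI, elim conjE)
  fix K assume K: "compact K" "K \<subseteq> \<Omega>"
  have Ks: "K \<in> sets lebesgue" using K by (simp add: lmeasurable_compact fmeasurableD)
  have "integrable lebesgue (\<lambda>z. indicator K z * f z)"
    using assms(1) K unfolding locally_integrable_def integrable_lebesgue_on_iff[OF Ks, symmetric] by simp
  moreover have ae: "AE z in lebesgue. indicator K z * f z = indicator K z * g z"
    using assms(2,3) K by (auto simp: AE_restrict_space_iff indicator_def)
  moreover have "integrable lebesgue (\<lambda>z. indicator K z * f z) = integrable lebesgue (\<lambda>z. indicator K z * g z)"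
  proof (rule integrable_cong_AE[OF _ _ ae])
    show 1: "(\<lambda>z. indicat_real K z * f z) \<in> borel_measurable lebesgue" using calculation(1) by (rule borel_measurable_integrable)
    show "(\<lambda>z. indicat_real K z * g z) \<in> borel_measurable lebesgue"
      by (rule borel_measurable_AE[OF 1 ae])
  qed
  ultimately show "integrable (lebesgue_on K) g" by (simp add: integrable_lebesgue_on_iff[OF Ks])
qed

lemma integral_test_AE_cong:
  assumes "locally_integrable \<Omega> f" "AE z in lebesgue_on \<Omega>. f z = g z" "\<Omega> \<in> sets lebesgue" "test_function \<Omega> \<phi>"
  shows "(LINT z|lebesgue. f z * \<phi> z) = (LINT z|lebesgue. g z * \<phi> z)"
proof (rule integral_cong_AE)
  show "(\<lambda>z. f z * \<phi> z) \<in> borel_measurable lebesgue" "(\<lambda>z. g z * \<phi> z) \<in> borel_measurable lebesgue"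
    using locally_integrable_test locally_integrable_AE_cong assms by blast+
  show "AE z in lebesgue. f z * \<phi> z = g z * \<phi> z"
    using assms(2,3) test_function_zero[OF assms(4)] by (auto simp: AE_restrict_space_iff elim!: AE_mp)
qed

lemma is_weak_deriv_AE_cong:
  assumes "is_weak_deriv \<Omega> i j u g" "AE z in lebesgue_on \<Omega>. u z = u' z"
    "AE z in lebesgue_on \<Omega>. g z = g' z" "\<Omega> \<in> sets lebesgue"
  shows "is_weak_deriv \<Omega> i j u' g'"
  using assms locally_integrable_AE_cong[OF _ assms(2,4)] locally_integrable_AE_cong[OF _ assms(3,4)]
    integral_test_AE_cong[OF _ assms(2,4) test_function_iter] integral_test_AE_cong[OF _ assms(3,4)]
  unfolding is_weak_deriv_iff[OF assms(4)] by simp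

text \<open>The y-derivatives of a test function are test functions themselves; the x-derivatives
  are moved first, with \<open>(dy UNIV ^^ j) \<phi>\<close> in place of \<open>\<phi>\<close>, and
  then the y-derivatives.\<close>

lemma is_weak_deriv_comp:
  assumes "is_weak_deriv \<Omega> i 0 u g" "is_weak_deriv \<Omega> 0 j g g'" "\<Omega> \<in> sets lebesgue"
  shows "is_weak_deriv \<Omega> i j u g'"
  using assms(1,2) test_function_iter[of \<Omega> _ 0 j] unfolding is_weak_deriv_iff[OF assms(3)]
  by (auto simp: power_add)

lemma is_weak_deriv_Suc_x:
  assumes "is_weak_deriv \<Omega> i 0 u g" "is_weak_deriv \<Omega> 1 0 g g'" "\<Omega> \<in> sets lebesgue"
  shows "is_weak_deriv \<Omega> (Suc i) 0 u g'"
  using assms(1,2) test_function_deriv(1)[of \<Omega>] unfolding is_weak_deriv_iff[OF assms(3)]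
  by (auto simp: funpow_Suc_right simp del: funpow.simps(2))

lemma is_weak_deriv_Suc_y:
  assumes "is_weak_deriv \<Omega> 0 j u g" "is_weak_deriv \<Omega> 0 1 g g'" "\<Omega> \<in> sets lebesgue"
  shows "is_weak_deriv \<Omega> 0 (Suc j) u g'"
  using assms(1,2) test_function_deriv(2)[of \<Omega>] unfolding is_weak_deriv_iff[OF assms(3)]
  by (auto simp: funpow_Suc_right simp del: funpow.simps(2))


section \<open>The fundamental lemma of the calculus of variations\<close>

text \<open>Open boxes generate the Borel sets and are stable under intersection, so a Dynkin
  argument extends the vanishing of the integrals from boxes to all Borel sets.\<close>

lemma AE_zero_if_box_integrals_zero:
  fixes f :: "'a::euclidean_space \<Rightarrow> real"
  assumes f: "integrable lborel f" and z: "\<And>z. z \<notin> cbox a b \<Longrightarrow> f z = 0"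
    and box: "\<And>c d. (LINT z|lborel. indicator (box c d) z * f z) = 0"
  shows "AE z in lborel. f z = 0"
proof (rule sigma_finite_measure.density_zero[OF lborel.sigma_finite_measure_axioms f])
  let ?P = "\<lambda>A. (LINT z|lborel. indicator A z * f z) = 0"
  have int: "integrable lborel (\<lambda>z. indicator A z * f z)" if "A \<in> sets borel" for A
    using integrable_mult_indicator[OF _ f, of A] that by simp
  \<comment> \<open>The total integral is what the step for complements needs; it is a box integral
    because \<open>f\<close> vanishes off a bounded set.\<close>
  have U: "(LINT z|lborel. f z) = 0"
  proof -
    have "cbox a b \<subseteq> box (a - One) (b + One)"
      by (auto simp: mem_box inner_diff_left inner_add_left) (smt (verit) inner_Basis)+
    then have "indicator (box (a - One) (b + One)) z * f z = f z" for z
      using z[of z] by (auto simp: indicator_def)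
    then have "(LINT z|lborel. indicator (box (a - One) (b + One)) z * f z) = (LINT z|lborel. f z)" by presburger
    then show ?thesis using box[of "a - One" "b + One"] by simp
  qed
  fix A :: "'a set" assume "A \<in> sets lborel"
  then have A: "A \<in> sigma_sets UNIV (range (\<lambda>(a, b). box a b))"
    by (simp add: borel_eq_box)
  have "Int_stable (range (\<lambda>(a, b). box a b :: 'a set))"
    by (auto simp: Int_stable_def box_Int_box)
  moreover have "range (\<lambda>(a, b). box a b) \<subseteq> Pow (UNIV :: 'a set)" by simp
  ultimately have "?P A" using A
  proof (rule sigma_sets_induct_disjoint)
    show "(LINT z|lborel. indicator {} z * f z) = 0" by simp
  next
    fix A assume "A \<in> range (\<lambda>(a, b). box a b :: 'a set)"
    then show "?P A" using box by auto
  next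
    fix A :: "'a set" assume A: "A \<in> sigma_sets UNIV (range (\<lambda>(a, b). box a b))" and P: "?P A"
    have "A \<in> sets borel" using A by (simp add: borel_eq_box)
    have "(LINT z|lborel. indicator (UNIV - A) z * f z) = (LINT z|lborel. f z - indicator A z * f z)"
      by (rule Bochner_Integration.integral_cong) (auto simp: indicator_def)
    also have "\<dots> = 0" using U P f int[OF \<open>A \<in> sets borel\<close>] by simp
    finally show "?P (UNIV - A)" .
  next
    fix A :: "nat \<Rightarrow> 'a set" assume disj: "disjoint_family A"
      and A: "range A \<subseteq> sigma_sets UNIV (range (\<lambda>(a, b). box a b))" and P: "\<And>i. ?P (A i)"
    have As: "A i \<in> sets borel" for i using A by (auto simp: borel_eq_box)
    then have "set_lebesgue_integral lborel (\<Union>i. A i) f = (\<Sum>i. set_lebesgue_integral lborel (A i) f)"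
      using disj f by (intro lebesgue_integral_countable_add)
       (auto simp: disjoint_family_on_def set_integrable_def int)
    then show "?P (\<Union>i. A i)" using P by (simp add: set_lebesgue_integral_def)
  qed
  then show "set_lebesgue_integral lborel A f = 0" by (simp add: set_lebesgue_integral_def)
qed

text \<open>Smooth functions with values in [0,1], positive exactly on the open interval, which tend
  pointwise to its indicator because the distances to the end points are stretched by n + 1.
  \<open>Suc n\<close> keeps the factor positive for n = 0.\<close>

definition cutoff :: "nat \<Rightarrow> real \<Rightarrow> real \<Rightarrow> real \<Rightarrow> real" where
  "cutoff n a b t = poly_exp 1 (real (Suc n) * (t - a)) * poly_exp 1 (real (Suc n) * (b - t))"

lemma smooth_cutoff: "smooth (cutoff n a b)"
proof -
  have "smooth (\<lambda>t. poly_exp 1 (real (Suc n) * t + (- real (Suc n) * a)) * poly_exp 1 ((- real (Suc n)) * t + real (Suc n) * b))"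
    by (intro smooth_mult smooth_affine smooth_poly_exp)
  moreover have "cutoff n a b = (\<lambda>t. poly_exp 1 (real (Suc n) * t + (- real (Suc n) * a)) * poly_exp 1 ((- real (Suc n)) * t + real (Suc n) * b))"
    by (auto simp: cutoff_def fun_eq_iff algebra_simps)
  ultimately show ?thesis by simp
qed

lemma poly_exp_1_range: "0 \<le> poly_exp 1 t" "poly_exp 1 t \<le> 1"
  by (auto simp: poly_exp_def)

lemma cutoff_range: "0 \<le> cutoff n a b t" "cutoff n a b t \<le> 1"
  unfolding cutoff_def using poly_exp_1_range by (auto intro: mult_nonneg_nonneg mult_le_one)

lemma cutoff_pos_iff: "cutoff n a b t > 0 \<longleftrightarrow> a < t \<and> t < b"
  by (auto simp: cutoff_def poly_exp_def zero_less_mult_iff)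

lemma cutoff_zero: "\<not> (a < t \<and> t < b) \<Longrightarrow> cutoff n a b t = 0"
  using cutoff_pos_iff[of n a b t] cutoff_range(1)[of n a b t] by linarith

lemma tendsto_poly_exp_1: "t > 0 \<Longrightarrow> (\<lambda>n. poly_exp 1 (real (Suc n) * t)) \<longlonglongrightarrow> 1"
proof -
  assume t: "t > 0"
  have "(\<lambda>n. 1 / t * inverse (real (Suc n))) \<longlonglongrightarrow> 1 / t * 0"
    by (intro tendsto_mult tendsto_const LIMSEQ_inverse_real_of_nat)
  then have "(\<lambda>n. exp (- (1 / t * inverse (real (Suc n))))) \<longlonglongrightarrow> exp (- (1 / t * 0))"
    by (intro tendsto_exp tendsto_minus)
  moreover have "poly_exp 1 (real (Suc n) * t) = exp (- (1 / t * inverse (real (Suc n))))" for n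
    using t zero_less_mult_iff[of "real (Suc n)" t] by (simp add: poly_exp_def divide_inverse del: of_nat_Suc)
  ultimately show ?thesis by simp
qed

lemma tendsto_cutoff: "(\<lambda>n. cutoff n a b t) \<longlonglongrightarrow> indicator {a<..<b} t"
proof (cases "a < t \<and> t < b")
  case True
  then have "(\<lambda>n. cutoff n a b t) \<longlonglongrightarrow> 1 * 1"
    unfolding cutoff_def by (intro tendsto_mult tendsto_poly_exp_1) auto
  then show ?thesis using True by simp
qed (simp add: cutoff_zero)


lemma box_prod_real: "box (a, b) (c, d) = {a<..<c} \<times> {b<..<d::real}" for a c :: real
  by (auto simp: mem_box Basis_prod_def)

lemma cbox_prod_real: "cbox (a, b) (c, d) = {a..c} \<times> {b..d::real}" for a c :: real
  by (auto simp: mem_box Basis_prod_def)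

text \<open>Dominated convergence along tensor products of cut-offs. They are test functions of
  \<Omega>, and the indicator of the closed rectangle bounds them all.\<close>

lemma integral_box_zero:
  assumes f: "locally_integrable \<Omega> f"
    and t: "\<And>\<phi>. test_function \<Omega> \<phi> \<Longrightarrow> (LINT z|lebesgue. f z * \<phi> z) = 0"
    and sub: "{a1..b1} \<times> {a2..b2} \<subseteq> \<Omega>"
  shows "(LINT z|lebesgue. indicator ({a1<..<b1} \<times> {a2<..<b2}) z * f z) = 0"
proof -
  let ?R = "{a1..b1} \<times> {a2..b2}"
  let ?\<phi> = "\<lambda>n z. cutoff n a1 b1 (fst z) * cutoff n a2 b2 (snd z)"
  have R: "compact ?R" by (intro compact_Times compact_Icc)
  then have Rs: "?R \<in> sets lebesgue" by (simp add: lmeasurable_compact fmeasurableD)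
  have fR: "integrable lebesgue (\<lambda>z. indicator ?R z * f z)"
    using f R sub integrable_lebesgue_on_iff[OF Rs] unfolding locally_integrable_def by blast
  have test: "test_function \<Omega> (?\<phi> n)" for n
    by (rule test_function_tensor[OF smooth_cutoff smooth_cutoff _ _ sub]) (auto intro: cutoff_zero)
  have lim: "(\<lambda>n. f z * ?\<phi> n z) \<longlonglongrightarrow> indicator ({a1<..<b1} \<times> {a2<..<b2}) z * f z" for z
  proof -
    have "(\<lambda>n. f z * ?\<phi> n z) \<longlonglongrightarrow> f z * (indicator {a1<..<b1} (fst z) * indicator {a2<..<b2} (snd z))"
      by (intro tendsto_mult tendsto_const tendsto_cutoff)
    moreover have "f z * (indicator {a1<..<b1} (fst z) * indicator {a2<..<b2} (snd z)) = indicator ({a1<..<b1} \<times> {a2<..<b2}) z * f z"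
      by (auto simp: indicator_def mem_Times_iff)
    ultimately show ?thesis by simp
  qed
  have "(\<lambda>n. LINT z|lebesgue. f z * ?\<phi> n z) \<longlonglongrightarrow> (LINT z|lebesgue. indicator ({a1<..<b1} \<times> {a2<..<b2}) z * f z)"
  proof (rule integral_dominated_convergence)
    show "integrable lebesgue (\<lambda>z. \<bar>indicator ?R z * f z\<bar>)" using fR by simp
    show "(\<lambda>z. f z * ?\<phi> n z) \<in> borel_measurable lebesgue" for n
      by (rule borel_measurable_integrable[OF locally_integrable_test[OF f test]])
    then show "(\<lambda>z. indicator ({a1<..<b1} \<times> {a2<..<b2}) z * f z) \<in> borel_measurable lebesgue"
      using lim by (rule borel_measurable_LIMSEQ_real[rotated])
    show "AE z in lebesgue. (\<lambda>n. f z * ?\<phi> n z) \<longlonglongrightarrow> indicator ({a1<..<b1} \<times> {a2<..<b2}) z * f z"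
      using lim by blast
    show "AE z in lebesgue. norm (f z * ?\<phi> n z) \<le> \<bar>indicator ?R z * f z\<bar>" for n
    proof (intro AE_I2)
      fix z :: "real \<times> real"
      show "norm (f z * ?\<phi> n z) \<le> \<bar>indicator ?R z * f z\<bar>"
      proof (cases "z \<in> ?R")
        case True
        have "\<bar>?\<phi> n z\<bar> \<le> 1" using cutoff_range by (auto simp: abs_mult intro!: mult_le_one)
        then show ?thesis using True by (simp add: abs_mult mult_left_le)
      next
        case False
        then have "?\<phi> n z = 0" by (auto simp: mem_Times_iff intro!: cutoff_zero)
        then have "f z * ?\<phi> n z = 0" by (simp only: mult_zero_right)
        then show ?thesis by (simp only: norm_zero abs_ge_zero)
      qed
    qed
  qed
  then show ?thesis using t[OF test] by (simp add: LIMSEQ_const_iff)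
qed

text \<open>On a closed box inside \<Omega>, a Borel representative of \<open>f\<close> has
  vanishing integrals over all open boxes. Countably many closed boxes exhaust \<Omega>, so the
  exceptional sets add up to a null set.\<close>

lemma AE_zero_if_test_integrals_zero:
  assumes "open \<Omega>" and f: "locally_integrable \<Omega> f"
    and t: "\<And>\<phi>. test_function \<Omega> \<phi> \<Longrightarrow> (LINT z|lebesgue. f z * \<phi> z) = 0"
  shows "AE z in lebesgue_on \<Omega>. f z = 0"
proof -
  have main: "AE z in lebesgue. z \<in> cbox a b \<longrightarrow> f z = 0" if "cbox a b \<subseteq> \<Omega>" for a b
  proof -
    obtain a1 a2 b1 b2 where ab: "a = (a1, a2)" "b = (b1, b2)" by (cases a, cases b)
    have fR: "integrable lebesgue (\<lambda>z. indicator (cbox a b) z * f z)"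
      using f that integrable_lebesgue_on_iff[of "cbox a b" f] unfolding locally_integrable_def by simp
    then obtain F where F: "F \<in> borel_measurable lborel" "AE z in lborel. indicator (cbox a b) z * f z = F z"
      using completion_ex_borel_measurable_real borel_measurable_integrable by blast
    define G where "G z = indicator (cbox a b) z * F z" for z
    have [measurable]: "G \<in> borel_measurable borel" using F(1) unfolding G_def by measurable
    have FG: "AE z in lborel. indicator (cbox a b) z * f z = G z"
      using F(2) by eventually_elim (auto simp: G_def indicator_def)
    then have FG': "AE z in lebesgue. indicator (cbox a b) z * f z = G z"
      by (rule AE_completion)
    have "integrable lebesgue G"
      by (rule integrable_cong_AE_imp[OF fR _ FG']) (simp add: measurable_completion)
    then have G: "integrable lborel G"
      by (simp add: integrable_completion)
    have "AE z in lborel. G z = 0"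
    proof (rule AE_zero_if_box_integrals_zero[OF G])
      show "G z = 0" if "z \<notin> cbox a b" for z using that by (simp add: G_def)
      fix c d :: "real \<times> real"
      obtain c1 c2 d1 d2 where cd: "c = (c1, c2)" "d = (d1, d2)" by (cases c, cases d)
      \<comment> \<open>The intersection of \<open>box c d\<close> with the interior of
        \<open>cbox a b\<close>; the boundary that is lost is a null set.\<close>
      let ?B = "{max a1 c1<..<min b1 d1} \<times> {max a2 c2<..<min b2 d2}"
      have "(LINT z|lborel. indicator (box c d) z * G z) = (LINT z|lebesgue. indicator (box c d) z * G z)"
        by (rule integral_completion[symmetric]) simp
      also have "\<dots> = (LINT z|lebesgue. indicator ?B z * f z)"
      proof (rule integral_cong_AE)
        show "(\<lambda>z. indicator (box c d) z * G z) \<in> borel_measurable lebesgue"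
          by (simp add: measurable_completion)
        have "(\<lambda>z. indicator ?B z *\<^sub>R (indicator (cbox a b) z * f z)) = (\<lambda>z. indicator ?B z * f z)"
          unfolding ab cbox_prod_real by (auto simp: indicator_def fun_eq_iff)
        moreover have "?B \<in> sets lebesgue" by (simp add: borel_open open_Times)
        ultimately show "(\<lambda>z. indicator ?B z * f z) \<in> borel_measurable lebesgue"
          using borel_measurable_integrable[OF integrable_mult_indicator[OF _ fR, of ?B]] by metis
        have "AE z in lborel. z \<notin> cbox a b - box a b"
          by (rule AE_not_in) (simp add: null_sets_def emeasure_lborel_box_eq emeasure_Diff emeasure_lborel_cbox_eq box_subset_cbox inner_Basis)
        then have "AE z in lebesgue. z \<notin> cbox a b - box a b" by (rule AE_completion)
        then show "AE z in lebesgue. indicator (box c d) z * G z = indicator ?B z * f z"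
          using FG'
        proof eventually_elim
          case (elim z)
          have "indicator (box c d) z * G z = indicator (box c d) z * (indicator (cbox a b) z * f z)"
            using elim by simp
          also have "\<dots> = indicator ?B z * f z"
            using elim(1) unfolding ab cd box_prod_real cbox_prod_real by (auto simp: indicator_def)
          finally show ?case .
        qed
      qed
      also have "\<dots> = 0"
        by (rule integral_box_zero[OF f t]) (use that ab cbox_prod_real in auto)
      finally show "(LINT z|lborel. indicator (box c d) z * G z) = 0" .
    qed
    then have "AE z in lebesgue. G z = 0" by (rule AE_completion)
    with FG' show ?thesis by eventually_elim (auto simp: indicator_def)
  qed
  obtain D where D: "countable D" "D \<subseteq> Pow \<Omega>" "\<And>X. X \<in> D \<Longrightarrow> \<exists>a b. X = cbox a b" "\<Union>D = \<Omega>"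
    using open_countable_Union_open_cbox[OF \<open>open \<Omega>\<close>] by metis
  have "AE z in lebesgue. \<forall>X\<in>D. z \<in> X \<longrightarrow> f z = 0"
    using D main by (subst AE_ball_countable) (auto, blast)
  then have "AE z in lebesgue. z \<in> \<Omega> \<longrightarrow> f z = 0"
    by eventually_elim (use D(4) in blast)
  then show ?thesis using \<open>open \<Omega>\<close> by (simp add: AE_restrict_space_iff borel_open)
qed

lemma is_weak_deriv_unique:
  assumes "open \<Omega>" "is_weak_deriv \<Omega> i j u g" "is_weak_deriv \<Omega> i j u g'"
  shows "AE z in lebesgue_on \<Omega>. g z = g' z"
proof -
  have \<Omega>: "\<Omega> \<in> sets lebesgue" using assms(1) by (simp add: borel_open)
  have l: "locally_integrable \<Omega> g" "locally_integrable \<Omega> g'" using assms by (auto simp: is_weak_deriv_def)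
  have "AE z in lebesgue_on \<Omega>. g z - g' z = 0"
  proof (rule AE_zero_if_test_integrals_zero[OF assms(1)])
    show "locally_integrable \<Omega> (\<lambda>z. g z - g' z)" using locally_integrable_lin[OF l, of 1 "-1"] by simp
    fix \<phi> assume t: "test_function \<Omega> \<phi>"
    have "(LINT z|lebesgue. g z * \<phi> z) = (LINT z|lebesgue. g' z * \<phi> z)"
      using assms(2,3) t unfolding is_weak_deriv_iff[OF \<Omega>] by simp
    then show "(LINT z|lebesgue. (g z - g' z) * \<phi> z) = 0"
      using locally_integrable_test[OF l(1) t] locally_integrable_test[OF l(2) t] by (simp add: left_diff_distrib)
  qed
  then show ?thesis by simp
qed

section \<open>Integration by parts on rectangles\<close>

lemma lborel_fubini:
  fixes f :: "real \<times> real \<Rightarrow> real"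
  assumes "integrable lborel f"
  shows "(LINT z|lborel. f z) = (LINT y|lborel. LINT x|lborel. f (x, y))"
    and "AE y in lborel. integrable lborel (\<lambda>x. f (x, y))"
    and "integrable lborel (\<lambda>y. LINT x|lborel. f (x, y))"
    and "(LINT z|lborel. f z) = (LINT x|lborel. LINT y|lborel. f (x, y))"
    and "AE x in lborel. integrable lborel (\<lambda>y. f (x, y))"
    and "integrable lborel (\<lambda>x. LINT y|lborel. f (x, y))"
proof -
  have f: "integrable (lborel \<Otimes>\<^sub>M lborel) f" "integrable (lborel \<Otimes>\<^sub>M lborel) (\<lambda>(x, y). f (x, y))"
    using assms by (simp_all add: lborel_prod)
  show "(LINT z|lborel. f z) = (LINT y|lborel. LINT x|lborel. f (x, y))"
    using lborel_pair.integral_snd[OF f(2)] by (simp add: lborel_prod)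
  show "AE y in lborel. integrable lborel (\<lambda>x. f (x, y))"
    using lborel_pair.AE_integrable_snd[OF f(2)] .
  show "integrable lborel (\<lambda>y. LINT x|lborel. f (x, y))"
    using lborel_pair.integrable_snd[OF f(2)] .
  show "(LINT z|lborel. f z) = (LINT x|lborel. LINT y|lborel. f (x, y))"
    using lborel_pair.integral_fst'[OF f(1)] by (simp add: lborel_prod)
  show "AE x in lborel. integrable lborel (\<lambda>y. f (x, y))"
    using lborel_pair.AE_integrable_fst'[OF f(1)] .
  show "integrable lborel (\<lambda>x. LINT y|lborel. f (x, y))"
    using lborel_pair.integrable_fst'[OF f(1)] .
qed

lemma lborel_tonelli:
  fixes f :: "real \<times> real \<Rightarrow> ennreal"
  assumes "f \<in> borel_measurable borel"
  shows "(\<integral>\<^sup>+z. f z \<partial>lborel) = (\<integral>\<^sup>+y. \<integral>\<^sup>+x. f (x, y) \<partial>lborel \<partial>lborel)"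
    and "(\<integral>\<^sup>+z. f z \<partial>lborel) = (\<integral>\<^sup>+x. \<integral>\<^sup>+y. f (x, y) \<partial>lborel \<partial>lborel)"
proof -
  have f: "f \<in> borel_measurable (lborel \<Otimes>\<^sub>M lborel)"
    using assms by (simp add: lborel_prod)
  show "(\<integral>\<^sup>+z. f z \<partial>lborel) = (\<integral>\<^sup>+y. \<integral>\<^sup>+x. f (x, y) \<partial>lborel \<partial>lborel)"
    using lborel_pair.nn_integral_snd[OF f] by (simp add: lborel_prod)
  show "(\<integral>\<^sup>+z. f z \<partial>lborel) = (\<integral>\<^sup>+x. \<integral>\<^sup>+y. f (x, y) \<partial>lborel \<partial>lborel)"
    using lborel.nn_integral_fst[OF f] by (simp add: lborel_prod)
qed

text \<open>The bridge between the completed measure, in which Sobolev spaces are defined, and the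
  Borel measure, for which Fubini and affine substitutions are formulated.\<close>

lemma integrable_lebesgue_on_borel:
  fixes f :: "'a::euclidean_space \<Rightarrow> real"
  assumes "S \<in> sets borel" "set_integrable lborel S f"
  shows "integrable (lebesgue_on S) f" "(LINT z|lebesgue_on S. f z) = (LINT z:S|lborel. f z)"
proof -
  have S: "S \<in> sets lebesgue" using assms(1) by simp
  have i: "integrable lborel (\<lambda>z. indicator S z * f z)" using assms(2) by (simp add: set_integrable_def)
  show "integrable (lebesgue_on S) f" using i unfolding integrable_lebesgue_on_iff[OF S]
    by (subst integrable_completion) (auto dest: borel_measurable_integrable)
  show "(LINT z|lebesgue_on S. f z) = (LINT z:S|lborel. f z)"
    unfolding integral_lebesgue_on_eq[OF S] set_lebesgue_integral_def real_scaleR_def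
    by (rule integral_completion) (rule borel_measurable_integrable[OF i])
qed

lemma set_integrable_test:
  assumes f: "set_integrable lborel \<Omega> f" and t: "test_function \<Omega> \<phi>" and \<Omega>: "\<Omega> \<in> sets borel"
  shows "integrable lborel (\<lambda>z. f z * \<phi> z)"
    and "(LINT z|lebesgue. f z * \<phi> z) = (LINT z|lborel. f z * \<phi> z)"
proof -
  obtain B where B: "\<And>z. \<bar>\<phi> z\<bar> \<le> B" "B > 0" using test_function_bounded[OF t] by blast
  have f': "integrable lborel (\<lambda>z. indicator \<Omega> z * f z)" using f by (simp add: set_integrable_def)
  have "integrable lborel (\<lambda>z. (indicator \<Omega> z * f z) * \<phi> z)"
  proof (rule Bochner_Integration.integrable_bound)
    show "integrable lborel (\<lambda>z. B * (indicator \<Omega> z * f z))" using f' by simp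
    have "\<phi> \<in> borel_measurable lborel"
      using test_function_continuous[OF t, of UNIV] by (simp add: borel_measurable_continuous_onI)
    then show "(\<lambda>z. (indicator \<Omega> z * f z) * \<phi> z) \<in> borel_measurable lborel"
      using borel_measurable_integrable[OF f'] by (rule borel_measurable_times[rotated])
    show "AE z in lborel. norm ((indicator \<Omega> z * f z) * \<phi> z) \<le> norm (B * (indicator \<Omega> z * f z))"
    proof (intro AE_I2)
      fix z
      show "norm ((indicator \<Omega> z * f z) * \<phi> z) \<le> norm (B * (indicator \<Omega> z * f z))"
        using mult_right_mono[OF B(1)[of z], of "\<bar>indicator \<Omega> z * f z\<bar>"] B(2)
        by (simp add: abs_mult mult.commute)
    qed
  qed
  moreover have "(\<lambda>z. (indicator \<Omega> z * f z) * \<phi> z) = (\<lambda>z. f z * \<phi> z)"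
    using test_function_zero[OF t] by (auto simp: indicator_def fun_eq_iff)
  ultimately show i: "integrable lborel (\<lambda>z. f z * \<phi> z)" by simp
  show "(LINT z|lebesgue. f z * \<phi> z) = (LINT z|lborel. f z * \<phi> z)"
    by (rule integral_completion) (rule borel_measurable_integrable[OF i])
qed

text \<open>Fubini reduces the claim to lines, where the fundamental theorem of calculus applies to
  \<open>f\<close> times the test function, a product with vanishing boundary values. The finite
  exceptional set \<open>S\<close> admits the kink in the first derivative of a spline.\<close>

lemma is_weak_deriv_x:
  fixes f g :: "real \<times> real \<Rightarrow> real"
  assumes \<Omega>: "\<Omega> = {a1<..<b1} \<times> {a2<..<b2}" and ab: "a1 < b1" "a2 < b2"
    and f: "set_integrable lborel \<Omega> f" and g: "set_integrable lborel \<Omega> g"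
    and cont: "\<And>y. y \<in> {a2<..<b2} \<Longrightarrow> continuous_on {a1..b1} (\<lambda>x. f (x, y))"
    and S: "finite S"
    and deriv: "\<And>x y. (x, y) \<in> \<Omega> \<Longrightarrow> x \<notin> S \<Longrightarrow> ((\<lambda>x. f (x, y)) has_real_derivative g (x, y)) (at x)"
  shows "is_weak_deriv \<Omega> 1 0 f g"
proof -
  have \<Omega>b: "\<Omega> \<in> sets borel" unfolding \<Omega> by (simp add: borel_open open_Times)
  then have \<Omega>s: "\<Omega> \<in> sets lebesgue" by simp
  have "locally_integrable \<Omega> f" "locally_integrable \<Omega> g"
    using integrable_lebesgue_on_borel(1)[OF \<Omega>b] f g by (auto intro: locally_integrableI[OF _ \<Omega>s])
  moreover have "(LINT z|lebesgue. f z * dx UNIV \<phi> z) = - (LINT z|lebesgue. g z * \<phi> z)"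
    if t: "test_function \<Omega> \<phi>" for \<phi>
  proof -
    note t' = test_function_deriv(1)[OF t]
    define H where "H z = f z * dx UNIV \<phi> z + g z * \<phi> z" for z
    have H: "integrable lborel H" unfolding H_def
      using set_integrable_test(1)[OF f t' \<Omega>b] set_integrable_test(1)[OF g t \<Omega>b] by (rule Bochner_Integration.integrable_add)
    have "AE y in lborel. (LINT x|lborel. H (x, y)) = 0"
      using lborel_fubini(2)[OF H]
    proof eventually_elim
      case (elim y)
      show ?case
      proof (cases "y \<in> {a2<..<b2}")
        case False
        then have "(x, y) \<notin> \<Omega>" for x unfolding \<Omega> by auto
        then have "H (x, y) = 0" for x
          using test_function_zero[OF t, of "(x, y)"] test_function_zero[OF t', of "(x, y)"] unfolding H_def by simp
        then show ?thesis by simp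
      next
        case y: True
        have Hz: "H (x, y) = 0" if "x \<notin> {a1..b1}" for x
          using that test_function_zero[OF t, of "(x, y)"] test_function_zero[OF t', of "(x, y)"] unfolding H_def \<Omega> by auto
        have d\<phi>: "((\<lambda>x. \<phi> (x, y)) has_real_derivative dx UNIV \<phi> (x, y)) (at x)" for x
        proof -
          have "((\<lambda>x. (x, y)) has_derivative (\<lambda>h. (h, 0))) (at x)"
            by (intro derivative_intros)
          from has_derivative_compose[OF this test_function_has_derivative[OF t]]
          moreover have "(\<lambda>h. fst (h, 0) * dx UNIV \<phi> (x, y) + snd (h, 0) * dy UNIV \<phi> (x, y)) = (*) (dx UNIV \<phi> (x, y))"
            by (auto simp: fun_eq_iff)
          ultimately show ?thesis unfolding has_field_derivative_def by simp
        qed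
        have "((\<lambda>x. H (x, y)) has_integral (f (b1, y) * \<phi> (b1, y) - f (a1, y) * \<phi> (a1, y))) {a1..b1}"
        proof (rule fundamental_theorem_of_calculus_interior_strong[OF S])
          show "a1 \<le> b1" using ab by simp
          show "((\<lambda>x. f (x, y) * \<phi> (x, y)) has_vector_derivative H (x, y)) (at x)" if "x \<in> {a1<..<b1} - S" for x
            unfolding has_real_derivative_iff_has_vector_derivative[symmetric] H_def
            using DERIV_mult[OF deriv[of x y] d\<phi>] that y by (simp add: \<Omega> algebra_simps)
          have "continuous_on {a1..b1} (\<lambda>x. \<phi> (x, y))"
            by (rule DERIV_continuous_on) (rule has_field_derivative_at_within[OF d\<phi>])
          then show "continuous_on {a1..b1} (\<lambda>x. f (x, y) * \<phi> (x, y))"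
            by (rule continuous_on_mult[OF cont[OF y]])
        qed
        moreover have "(f (b1, y) * \<phi> (b1, y) - f (a1, y) * \<phi> (a1, y)) = 0"
          using test_function_zero[OF t] by (simp add: \<Omega>)
        ultimately have "((\<lambda>x. H (x, y)) has_integral 0) UNIV"
          using has_integral_on_superset[of "\<lambda>x. H (x, y)" 0 "{a1..b1}" UNIV] Hz by simp
        moreover have "((\<lambda>x. H (x, y)) has_integral (LINT x|lborel. H (x, y))) UNIV"
          by (rule has_integral_integral_lborel[OF elim])
        ultimately show ?thesis by (rule has_integral_unique[rotated])
      qed
    qed
    then have "(LINT y|lborel. LINT x|lborel. H (x, y)) = 0"
      by (rule integral_eq_zero_AE)
    then have "(LINT z|lborel. H z) = 0" using lborel_fubini(1)[OF H] by simp
    then show ?thesis unfolding H_def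
      using set_integrable_test[OF f t' \<Omega>b] set_integrable_test[OF g t \<Omega>b] by simp
  qed
  ultimately show ?thesis unfolding is_weak_deriv_iff[OF \<Omega>s] by simp
qed

lemma is_weak_deriv_y:
  fixes f g :: "real \<times> real \<Rightarrow> real"
  assumes \<Omega>: "\<Omega> = {a1<..<b1} \<times> {a2<..<b2}" and ab: "a1 < b1" "a2 < b2"
    and f: "set_integrable lborel \<Omega> f" and g: "set_integrable lborel \<Omega> g"
    and cont: "\<And>x. x \<in> {a1<..<b1} \<Longrightarrow> continuous_on {a2..b2} (\<lambda>y. f (x, y))"
    and S: "finite S"
    and deriv: "\<And>x y. (x, y) \<in> \<Omega> \<Longrightarrow> y \<notin> S \<Longrightarrow> ((\<lambda>y. f (x, y)) has_real_derivative g (x, y)) (at y)"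
  shows "is_weak_deriv \<Omega> 0 1 f g"
proof -
  have \<Omega>b: "\<Omega> \<in> sets borel" unfolding \<Omega> by (simp add: borel_open open_Times)
  then have \<Omega>s: "\<Omega> \<in> sets lebesgue" by simp
  have "locally_integrable \<Omega> f" "locally_integrable \<Omega> g"
    using integrable_lebesgue_on_borel(1)[OF \<Omega>b] f g by (auto intro: locally_integrableI[OF _ \<Omega>s])
  moreover have "(LINT z|lebesgue. f z * dy UNIV \<phi> z) = - (LINT z|lebesgue. g z * \<phi> z)"
    if t: "test_function \<Omega> \<phi>" for \<phi>
  proof -
    note t' = test_function_deriv(2)[OF t]
    define H where "H z = f z * dy UNIV \<phi> z + g z * \<phi> z" for z
    have H: "integrable lborel H" unfolding H_def
      using set_integrable_test(1)[OF f t' \<Omega>b] set_integrable_test(1)[OF g t \<Omega>b] by (rule Bochner_Integration.integrable_add)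
    have "AE x in lborel. (LINT y|lborel. H (x, y)) = 0"
      using lborel_fubini(5)[OF H]
    proof eventually_elim
      case (elim x)
      show ?case
      proof (cases "x \<in> {a1<..<b1}")
        case False
        then have "(x, y) \<notin> \<Omega>" for y unfolding \<Omega> by auto
        then have "H (x, y) = 0" for y
          using test_function_zero[OF t, of "(x, y)"] test_function_zero[OF t', of "(x, y)"] unfolding H_def by simp
        then show ?thesis by simp
      next
        case y: True
        have Hz: "H (x, y) = 0" if "y \<notin> {a2..b2}" for y
          using that test_function_zero[OF t, of "(x, y)"] test_function_zero[OF t', of "(x, y)"] unfolding H_def \<Omega> by auto
        have d\<phi>: "((\<lambda>y. \<phi> (x, y)) has_real_derivative dy UNIV \<phi> (x, y)) (at y)" for y
        proof -
          have "((\<lambda>y. (x, y)) has_derivative (\<lambda>h. (0, h))) (at y)"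
            by (intro derivative_intros)
          from has_derivative_compose[OF this test_function_has_derivative[OF t]]
          moreover have "(\<lambda>h. fst (0, h) * dx UNIV \<phi> (x, y) + snd (0, h) * dy UNIV \<phi> (x, y)) = (*) (dy UNIV \<phi> (x, y))"
            by (auto simp: fun_eq_iff)
          ultimately show ?thesis unfolding has_field_derivative_def by simp
        qed
        have "((\<lambda>y. H (x, y)) has_integral (f (x, b2) * \<phi> (x, b2) - f (x, a2) * \<phi> (x, a2))) {a2..b2}"
        proof (rule fundamental_theorem_of_calculus_interior_strong[OF S])
          show "a2 \<le> b2" using ab by simp
          show "((\<lambda>y. f (x, y) * \<phi> (x, y)) has_vector_derivative H (x, y)) (at y)" if "y \<in> {a2<..<b2} - S" for y
            unfolding has_real_derivative_iff_has_vector_derivative[symmetric] H_def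
            using DERIV_mult[OF deriv[of x y] d\<phi>] that y by (simp add: \<Omega> algebra_simps)
          have "continuous_on {a2..b2} (\<lambda>y. \<phi> (x, y))"
            by (rule DERIV_continuous_on) (rule has_field_derivative_at_within[OF d\<phi>])
          then show "continuous_on {a2..b2} (\<lambda>y. f (x, y) * \<phi> (x, y))"
            by (rule continuous_on_mult[OF cont[OF y]])
        qed
        moreover have "(f (x, b2) * \<phi> (x, b2) - f (x, a2) * \<phi> (x, a2)) = 0"
          using test_function_zero[OF t] by (simp add: \<Omega>)
        ultimately have "((\<lambda>y. H (x, y)) has_integral 0) UNIV"
          using has_integral_on_superset[of "\<lambda>y. H (x, y)" 0 "{a2..b2}" UNIV] Hz by simp
        moreover have "((\<lambda>y. H (x, y)) has_integral (LINT y|lborel. H (x, y))) UNIV"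
          by (rule has_integral_integral_lborel[OF elim])
        ultimately show ?thesis by (rule has_integral_unique[rotated])
      qed
    qed
    then have "(LINT x|lborel. LINT y|lborel. H (x, y)) = 0"
      by (rule integral_eq_zero_AE)
    then have "(LINT z|lborel. H z) = 0" using lborel_fubini(4)[OF H] by simp
    then show ?thesis unfolding H_def
      using set_integrable_test[OF f t' \<Omega>b] set_integrable_test[OF g t \<Omega>b] by simp
  qed
  ultimately show ?thesis unfolding is_weak_deriv_iff[OF \<Omega>s] by simp
qed

section \<open>Continuity of dilations in the mean\<close>

lemma nn_integral_lborel_affine:
  fixes f :: "'a::euclidean_space \<Rightarrow> ennreal"
  assumes "f \<in> borel_measurable borel" "c \<noteq> 0"
  shows "(\<integral>\<^sup>+x. f x \<partial>lborel) = ennreal (\<bar>c\<bar> ^ DIM('a)) * (\<integral>\<^sup>+x. f (t + c *\<^sub>R x) \<partial>lborel)"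
  using assms by (subst lborel_affine[OF assms(2), of t])
    (simp add: nn_integral_density nn_integral_distr nn_integral_cmult)

lemma integrable_lborel_affine:
  fixes f :: "'a::euclidean_space \<Rightarrow> real"
  assumes f: "integrable lborel f" and c: "c \<noteq> 0"
  shows "integrable lborel (\<lambda>x. f (t + c *\<^sub>R x))"
    and "(LINT x|lborel. f (t + c *\<^sub>R x)) = (LINT x|lborel. f x) / \<bar>c\<bar> ^ DIM('a)"
proof -
  have m[measurable]: "f \<in> borel_measurable borel" using f by (auto dest: borel_measurable_integrable)
  have "(\<integral>\<^sup>+x. norm (f x) \<partial>lborel) < \<infinity>" using f by (simp add: integrable_iff_bounded)
  then have "ennreal (\<bar>c\<bar> ^ DIM('a)) * (\<integral>\<^sup>+x. norm (f (t + c *\<^sub>R x)) \<partial>lborel) < \<infinity>"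
    using nn_integral_lborel_affine[of "\<lambda>x. norm (f x)" c t] c by simp
  then have "(\<integral>\<^sup>+x. norm (f (t + c *\<^sub>R x)) \<partial>lborel) < \<infinity>"
    using c by (auto simp: ennreal_mult_less_top)
  then show i: "integrable lborel (\<lambda>x. f (t + c *\<^sub>R x))"
    by (simp add: integrable_iff_bounded)
  have "(LINT x|lborel. f x) = (LINT x|density (distr lborel borel (\<lambda>x. t + c *\<^sub>R x)) (\<lambda>_. \<bar>c\<bar> ^ DIM('a)). f x)"
    using lborel_affine[OF c, of t] by simp
  also have "\<dots> = \<bar>c\<bar> ^ DIM('a) * (LINT x|lborel. f (t + c *\<^sub>R x))"
    by (subst integral_density) (auto simp: integral_distr)
  finally show "(LINT x|lborel. f (t + c *\<^sub>R x)) = (LINT x|lborel. f x) / \<bar>c\<bar> ^ DIM('a)"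
    using c by (simp add: field_simps)
qed

text \<open>The bound away from zero on the factors \<open>l n\<close> keeps the substitution \<open>z \<mapsto> t + l z\<close> uniformly bounded.\<close>

definition affine_cont :: "('a::euclidean_space \<Rightarrow> real) \<Rightarrow> bool" where
  "affine_cont f \<longleftrightarrow> (\<forall>l t. (\<forall>n. l n \<in> {1/2..1}) \<and> l \<longlonglongrightarrow> (1::real) \<and> t \<longlonglongrightarrow> 0 \<longrightarrow>
     (\<lambda>n. LINT z|lborel. \<bar>f (t n + l n *\<^sub>R z) - f z\<bar>) \<longlonglongrightarrow> 0)"

text \<open>The property is closed under L_1 limits, because the substitutions have factors at least
  1/2 and thus enlarge L_1 norms at most by 2 to the power of the dimension.\<close>

lemma affine_cont_approx:
  fixes f :: "'a::euclidean_space \<Rightarrow> real"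
  assumes f: "integrable lborel f"
    and g: "\<And>e. e > 0 \<Longrightarrow> \<exists>g. integrable lborel g \<and> affine_cont g \<and> (LINT z|lborel. \<bar>f z - g z\<bar>) < e"
  shows "affine_cont f"
  unfolding affine_cont_def
proof (intro allI impI)
  fix l :: "nat \<Rightarrow> real" and t :: "nat \<Rightarrow> 'a"
  assume lt: "(\<forall>n. l n \<in> {1/2..1}) \<and> l \<longlonglongrightarrow> 1 \<and> t \<longlonglongrightarrow> 0"
  have l0: "l n \<noteq> 0" for n using lt by (metis atLeastAtMost_iff less_le_not_le zero_less_divide_1_iff zero_less_numeral)
  let ?A = "\<lambda>n z. t n + l n *\<^sub>R z" and ?D = "DIM('a)"
  show "(\<lambda>n. LINT z|lborel. \<bar>f (?A n z) - f z\<bar>) \<longlonglongrightarrow> 0"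
  proof (rule LIMSEQ_I)
    fix e :: real assume e: "e > 0"
    \<comment> \<open>The three parts of the triangle inequality contribute
      \<open>2 ^ ?D * d\<close>, \<open>d\<close> and \<open>d\<close>.\<close>
    define d where "d = e / (2 ^ ?D + 2)"
    have p: "(0::real) < 2 ^ ?D + 2" by (simp add: add_pos_pos)
    then have d: "d > 0" using e unfolding d_def by simp
    obtain g where g: "integrable lborel g" "affine_cont g" "(LINT z|lborel. \<bar>f z - g z\<bar>) < d"
      using assms(2)[OF d] by blast
    have "(\<lambda>n. LINT z|lborel. \<bar>g (?A n z) - g z\<bar>) \<longlonglongrightarrow> 0" using g(2) lt unfolding affine_cont_def by blast
    then obtain N where N: "\<And>n. n \<ge> N \<Longrightarrow> norm ((LINT z|lborel. \<bar>g (?A n z) - g z\<bar>) - 0) < d"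
      using LIMSEQ_D d by blast
    have "norm ((LINT z|lborel. \<bar>f (?A n z) - f z\<bar>) - 0) < e" if n: "n \<ge> N" for n
    proof -
      note fA = integrable_lborel_affine(1)[OF f l0[of n], of "t n"]
      note gA = integrable_lborel_affine(1)[OF g(1) l0[of n], of "t n"]
      have fg: "integrable lborel (\<lambda>z. \<bar>f z - g z\<bar>)" using f g(1) by simp
      have "(LINT z|lborel. \<bar>f (?A n z) - f z\<bar>)
          \<le> (LINT z|lborel. \<bar>f (?A n z) - g (?A n z)\<bar> + \<bar>g (?A n z) - g z\<bar> + \<bar>f z - g z\<bar>)"
        using fA gA f g(1) by (intro integral_mono) auto
      also have "\<dots> = (LINT z|lborel. \<bar>f (?A n z) - g (?A n z)\<bar>) + (LINT z|lborel. \<bar>g (?A n z) - g z\<bar>) + (LINT z|lborel. \<bar>f z - g z\<bar>)"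
        using fA gA f g(1) by simp
      also have "(LINT z|lborel. \<bar>f (?A n z) - g (?A n z)\<bar>) = (LINT z|lborel. \<bar>f z - g z\<bar>) / \<bar>l n\<bar> ^ ?D"
        using integrable_lborel_affine(2)[OF fg l0] .
      also have "\<dots> \<le> 2 ^ ?D * (LINT z|lborel. \<bar>f z - g z\<bar>)"
      proof -
        have "(1/2) ^ ?D \<le> \<bar>l n\<bar> ^ ?D" using lt by (intro power_mono) (auto simp: abs_if dest: spec[of _ n])
        then have "1 / \<bar>l n\<bar> ^ ?D \<le> 2 ^ ?D" using l0[of n] by (simp add: field_simps power_divide)
        then show ?thesis
          using mult_right_mono[of "1 / \<bar>l n\<bar> ^ ?D" "2 ^ ?D" "LINT z|lborel. \<bar>f z - g z\<bar>"] by simp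
      qed
      finally have "(LINT z|lborel. \<bar>f (?A n z) - f z\<bar>) \<le>
         2 ^ ?D * (LINT z|lborel. \<bar>f z - g z\<bar>) + (LINT z|lborel. \<bar>g (?A n z) - g z\<bar>) + (LINT z|lborel. \<bar>f z - g z\<bar>)" by simp
      also have "\<dots> < 2 ^ ?D * d + d + d"
        using N[OF n] g(3) by (intro add_le_less_mono add_strict_mono mult_left_mono) (auto simp: mult_left_mono)
      also have "\<dots> = (2 ^ ?D + 2) * d" by (simp add: algebra_simps)
      also have "\<dots> = e" using p unfolding d_def by simp
      finally show ?thesis by (simp add: integral_nonneg_AE)
    qed
    then show "\<exists>N. \<forall>n\<ge>N. norm ((LINT z|lborel. \<bar>f (?A n z) - f z\<bar>) - 0) < e" by blast
  qed
qed

text \<open>Scheffe's argument. At a point of \<open>U\<close> the transformed points eventually lie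
  in \<open>U\<close>, so the positive part of f minus the transformed f tends to zero; at other
  points it is zero. The two integrals approach each other by the change of variables, and the
  absolute difference equals twice the positive part minus the difference. The boundary of
  \<open>U\<close> may have positive measure.\<close>

lemma affine_cont_open:
  assumes "open U" "emeasure lborel U < \<infinity>"
  shows "affine_cont (indicator U :: 'a::euclidean_space \<Rightarrow> real)"
  unfolding affine_cont_def
proof (intro allI impI)
  fix l :: "nat \<Rightarrow> real" and t :: "nat \<Rightarrow> 'a"
  assume lt: "(\<forall>n. l n \<in> {1/2..1}) \<and> l \<longlonglongrightarrow> 1 \<and> t \<longlonglongrightarrow> 0"
  have l0: "l n \<noteq> 0" for n using lt by (metis atLeastAtMost_iff less_le_not_le zero_less_divide_1_iff zero_less_numeral)
  let ?A = "\<lambda>n z. t n + l n *\<^sub>R z" and ?D = "DIM('a)" and ?f = "indicator U :: 'a \<Rightarrow> real"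
  have [measurable]: "U \<in> sets borel" using assms(1) by simp
  have f: "integrable lborel ?f" using assms by (simp add: integrable_indicator_iff)
  note fA = integrable_lborel_affine[OF f l0]
  have pos: "(\<lambda>n. LINT z|lborel. max 0 (?f z - ?f (?A n z))) \<longlonglongrightarrow> (LINT z|(lborel::'a measure). (0::real))"
  proof (rule integral_dominated_convergence[where w="indicator U"])
    show "(\<lambda>z. max 0 (?f z - ?f (?A n z))) \<in> borel_measurable lborel" for n by measurable
    show "AE z in lborel. norm (max 0 (?f z - ?f (?A n z))) \<le> ?f z" for n
      by (auto simp: indicator_def)
    have "(\<lambda>n. max 0 (?f z - ?f (?A n z))) \<longlonglongrightarrow> 0" for z
    proof (cases "z \<in> U")
      case True
      have "(\<lambda>n. ?A n z) \<longlonglongrightarrow> 0 + 1 *\<^sub>R z" using lt by (intro tendsto_intros) auto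
      then have "eventually (\<lambda>n. ?A n z \<in> U) sequentially"
        using assms(1) True topological_tendstoD by fastforce
      then have "eventually (\<lambda>n. max 0 (?f z - ?f (?A n z)) = 0) sequentially"
        by eventually_elim simp
      then show ?thesis by (rule tendsto_eventually)
    qed (simp add: indicator_def)
    then show "AE z in lborel. (\<lambda>n. max 0 (?f z - ?f (?A n z))) \<longlonglongrightarrow> 0" by blast
  qed (use f in auto)
  have "(\<lambda>n. (LINT z|lborel. ?f z) - (LINT z|lborel. ?f z) / \<bar>l n\<bar> ^ ?D) \<longlonglongrightarrow>
      (LINT z|lborel. ?f z) - (LINT z|lborel. ?f z) / \<bar>1\<bar> ^ ?D"
    using lt by (intro tendsto_intros) auto
  then have "(\<lambda>n. 2 * (LINT z|lborel. max 0 (?f z - ?f (?A n z))) - ((LINT z|lborel. ?f z) - (LINT z|lborel. ?f z) / \<bar>l n\<bar> ^ ?D)) \<longlonglongrightarrow> 2 * 0 - 0"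
    using pos by (intro tendsto_intros) auto
  moreover have "(LINT z|lborel. \<bar>?f (?A n z) - ?f z\<bar>) =
     2 * (LINT z|lborel. max 0 (?f z - ?f (?A n z))) - ((LINT z|lborel. ?f z) - (LINT z|lborel. ?f z) / \<bar>l n\<bar> ^ ?D)" for n
  proof -
    have "(LINT z|lborel. \<bar>?f (?A n z) - ?f z\<bar>) = (LINT z|lborel. 2 * max 0 (?f z - ?f (?A n z)) - (?f z - ?f (?A n z)))"
      by (rule Bochner_Integration.integral_cong) (auto simp: max_def)
    also have "\<dots> = 2 * (LINT z|lborel. max 0 (?f z - ?f (?A n z))) - ((LINT z|lborel. ?f z) - (LINT z|lborel. ?f (?A n z)))"
      using f fA(1) by simp
    finally show ?thesis using fA(2) by simp
  qed
  ultimately show "(\<lambda>n. LINT z|lborel. \<bar>?f (?A n z) - ?f z\<bar>) \<longlonglongrightarrow> 0" by simp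
qed

lemma affine_cont_add:
  fixes f g :: "'a::euclidean_space \<Rightarrow> real"
  assumes f: "integrable lborel f" "affine_cont f" and g: "integrable lborel g" "affine_cont g"
  shows "affine_cont (\<lambda>z. f z + g z)"
  unfolding affine_cont_def
proof (intro allI impI)
  fix l :: "nat \<Rightarrow> real" and t :: "nat \<Rightarrow> 'a"
  assume lt: "(\<forall>n. l n \<in> {1/2..1}) \<and> l \<longlonglongrightarrow> 1 \<and> t \<longlonglongrightarrow> 0"
  have l0: "l n \<noteq> 0" for n using lt by (metis atLeastAtMost_iff less_le_not_le zero_less_divide_1_iff zero_less_numeral)
  let ?A = "\<lambda>n z. t n + l n *\<^sub>R z"
  note fA = integrable_lborel_affine(1)[OF f(1) l0] and gA = integrable_lborel_affine(1)[OF g(1) l0]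
  have lim: "(\<lambda>n. (LINT z|lborel. \<bar>f (?A n z) - f z\<bar>) + (LINT z|lborel. \<bar>g (?A n z) - g z\<bar>)) \<longlonglongrightarrow> 0"
    using f(2) g(2) lt unfolding affine_cont_def by (intro tendsto_add_zero) blast+
  show "(\<lambda>n. LINT z|lborel. \<bar>(f (?A n z) + g (?A n z)) - (f z + g z)\<bar>) \<longlonglongrightarrow> 0"
  proof (rule tendsto_sandwich[OF _ _ tendsto_const lim]; intro always_eventually allI)
    fix n
    have "(LINT z|lborel. \<bar>(f (?A n z) + g (?A n z)) - (f z + g z)\<bar>)
        \<le> (LINT z|lborel. \<bar>f (?A n z) - f z\<bar> + \<bar>g (?A n z) - g z\<bar>)"
      using fA gA f g by (intro integral_mono) auto
    also have "\<dots> = (LINT z|lborel. \<bar>f (?A n z) - f z\<bar>) + (LINT z|lborel. \<bar>g (?A n z) - g z\<bar>)"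
      using fA gA f g by simp
    finally show "(LINT z|lborel. \<bar>(f (?A n z) + g (?A n z)) - (f z + g z)\<bar>) \<le> \<dots>" .
  qed (simp add: integral_nonneg_AE)
qed

lemma affine_cont_cmult:
  fixes f :: "'a::euclidean_space \<Rightarrow> real"
  assumes "affine_cont f" shows "affine_cont (\<lambda>z. c * f z)"
proof -
  have "(LINT z|lborel. \<bar>c * f (A z) - c * f z\<bar>) = \<bar>c\<bar> * (LINT z|lborel. \<bar>f (A z) - f z\<bar>)" for A
    by (simp flip: right_diff_distrib add: abs_mult)
  then show ?thesis using assms unfolding affine_cont_def by (auto intro: tendsto_mult_right_zero)
qed

text \<open>Induction over integrable functions: outer regularity reduces an indicator to that of an
  open set, and sums and dominated limits preserve the property.\<close>

lemma affine_cont_integrable: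
  fixes f :: "'a::euclidean_space \<Rightarrow> real"
  assumes "integrable lborel f" shows "affine_cont f"
  using assms
proof induction
  case (base A c)
  have A: "A \<in> sets borel" using base by simp
  have iA: "integrable lborel (indicator A :: 'a \<Rightarrow> real)" using base by (simp add: integrable_indicator_iff)
  have "affine_cont (indicator A :: 'a \<Rightarrow> real)"
  proof (rule affine_cont_approx[OF iA])
    fix e :: real assume e: "e > 0"
    obtain U where U: "open U" "A \<subseteq> U" "emeasure lborel (U - A) < ennreal e"
      using outer_regular_lborel[OF A e] by blast
    have "emeasure lborel U = emeasure lborel (U - A) + emeasure lborel A"
      using U A by (subst plus_emeasure) (auto intro!: arg_cong[where f="emeasure lborel"])
    also have "\<dots> < \<infinity>" using U(3) base by (auto simp: ennreal_add_less_top less_top[symmetric] intro: order.strict_trans[OF _ ennreal_less_top])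
    finally have Uf: "emeasure lborel U < \<infinity>" .
    have iU: "integrable lborel (indicator U :: 'a \<Rightarrow> real)" using U Uf by (simp add: integrable_indicator_iff)
    have "(LINT z|lborel. \<bar>indicator A z - indicator U z\<bar> :: real) = (LINT z|lborel. indicator (U - A) z)"
      using U(2) by (intro Bochner_Integration.integral_cong) (auto simp: indicator_def)
    also have "\<dots> = measure lborel (U - A)" using U A by simp
    also have "\<dots> < e" unfolding measure_def
      using U(3) e enn2real_less_iff[of "emeasure lborel (U - A)" e] order.strict_trans[OF U(3) ennreal_less_top] by simp
    finally show "\<exists>g. integrable lborel g \<and> affine_cont g \<and> (LINT z|lborel. \<bar>indicator A z - g z\<bar>) < e"
      using iU affine_cont_open[OF U(1) Uf] by blast
  qed
  from affine_cont_cmult[OF this, of c] show ?case by (simp add: mult.commute)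
next
  case (add f g)
  then show ?case by (intro affine_cont_add)
next
  case (lim f s)
  have f: "integrable lborel f" by fact
  show ?case
  proof (rule affine_cont_approx[OF f])
    fix e :: real assume e: "e > 0"
    have "(\<lambda>i. LINT z|lborel. \<bar>f z - s i z\<bar>) \<longlonglongrightarrow> (LINT z|(lborel::'a measure). (0::real))"
    proof (rule integral_dominated_convergence[where w="\<lambda>z. 3 * \<bar>f z\<bar>"])
      show "integrable lborel (\<lambda>z. 3 * \<bar>f z\<bar>)" using f by simp
      show "(\<lambda>z. \<bar>f z - s i z\<bar>) \<in> borel_measurable lborel" for i using f lim(1) by measurable
      show "AE z in lborel. norm \<bar>f z - s i z\<bar> \<le> 3 * \<bar>f z\<bar>" for i
      proof (intro AE_I2)
        fix z :: 'a
        show "norm \<bar>f z - s i z\<bar> \<le> 3 * \<bar>f z\<bar>" using lim(3)[of z i] by simp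
      qed
      have "(\<lambda>i. \<bar>f z - s i z\<bar>) \<longlonglongrightarrow> \<bar>f z - f z\<bar>" for z using lim(2)[of z] by (intro tendsto_intros) auto
      then show "AE z in lborel. (\<lambda>i. \<bar>f z - s i z\<bar>) \<longlonglongrightarrow> 0" by simp
    qed simp
    then obtain i where "norm ((LINT z|lborel. \<bar>f z - s i z\<bar>) - 0) < e"
      using LIMSEQ_D[OF _ e] by fastforce
    then show "\<exists>g. integrable lborel g \<and> affine_cont g \<and> (LINT z|lborel. \<bar>f z - g z\<bar>) < e"
      using lim by (intro exI[of _ "s i"]) auto
  qed
qed

section \<open>Mollification\<close>

text \<open>\<open>D i j\<close> stands for the derivative of order \<open>i\<close> in the first and \<open>j\<close> in the second variable of \<open>D 0 0\<close>.\<close>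

definition smooth2 :: "(nat \<Rightarrow> nat \<Rightarrow> real \<times> real \<Rightarrow> real) \<Rightarrow> bool" where
  "smooth2 D \<longleftrightarrow> (\<forall>i j z. (D i j has_derivative (\<lambda>h. fst h * D (Suc i) j z + snd h * D i (Suc j) z)) (at z))"

definition csupp :: "(real \<Rightarrow> real) \<Rightarrow> bool" where
  "csupp a \<longleftrightarrow> smooth a \<and> (\<exists>l u. \<forall>t. t \<notin> {l..u} \<longrightarrow> a t = 0)"

lemma deriv_zero_outside:
  assumes "smooth a" "\<And>t. t \<notin> {l..u::real} \<Longrightarrow> a t = 0" "t \<notin> {l..u}"
  shows "deriv a t = 0"
proof -
  have "((\<lambda>_. 0) has_real_derivative 0) (at t)" by simp
  then have "(a has_real_derivative 0) (at t)"
    by (rule has_field_derivative_transform_within_open[of _ _ _ "- {l..u}"])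
      (use assms in auto)
  then show ?thesis by (rule DERIV_imp_deriv)
qed

lemma deriv_iter_zero_outside:
  assumes "smooth a" "\<And>t. t \<notin> {l..u::real} \<Longrightarrow> a t = 0" "t \<notin> {l..u}"
  shows "(deriv ^^ k) a t = 0"
  using assms(3)
proof (induction k arbitrary: t)
  case (Suc k)
  then show ?case using deriv_zero_outside[OF smooth_deriv_iter[OF assms(1)], of l u k t] by simp
qed (use assms in simp)

lemma csupp_deriv: "csupp a \<Longrightarrow> csupp (deriv a)"
  unfolding csupp_def by (meson deriv_zero_outside smooth_deriv)

lemma csupp_bounded: assumes "csupp a" obtains B where "B > 0" "\<And>t. \<bar>a t\<bar> \<le> B"
proof -
  obtain l u where lu: "\<And>t. t \<notin> {l..u} \<Longrightarrow> a t = 0" using assms csupp_def by blast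
  have "compact (a ` {l..u})" using assms smooth_continuous
    by (intro compact_continuous_image compact_Icc) (auto simp: csupp_def)
  then obtain B where B: "B > 0" "\<forall>x\<in>a ` {l..u}. norm x \<le> B"
    by (meson bounded_pos compact_imp_bounded)
  have "\<bar>a t\<bar> \<le> B" for t using B lu by (cases "t \<in> {l..u}") auto
  then show ?thesis using that B(1) by blast
qed

text \<open>The mean value inequality yields the Lipschitz bound and, applied to the remainder as a
  function of the increment, the Taylor bound. One constant, the maximum of the bounds for the
  function and two derivatives, serves all purposes.\<close>

lemma csupp_taylor:
  assumes "csupp a"
  obtains B where "B > 0" "\<And>t. \<bar>a t\<bar> \<le> B" "\<And>t. \<bar>deriv a t\<bar> \<le> B"
    "\<And>t s. \<bar>a (t + s) - a t\<bar> \<le> B * \<bar>s\<bar>" "\<And>t s. \<bar>a (t + s) - a t - s * deriv a t\<bar> \<le> B * s\<^sup>2"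
proof -
  have sm: "smooth a" "smooth (deriv a)" using assms csupp_deriv csupp_def by blast+
  obtain B0 where B0: "B0 > 0" "\<And>t. \<bar>a t\<bar> \<le> B0" using csupp_bounded[OF assms] by metis
  obtain B1 where B1: "B1 > 0" "\<And>t. \<bar>deriv a t\<bar> \<le> B1" using csupp_bounded[OF csupp_deriv[OF assms]] by metis
  obtain B2 where B2: "B2 > 0" "\<And>t. \<bar>deriv (deriv a) t\<bar> \<le> B2"
    using csupp_bounded[OF csupp_deriv[OF csupp_deriv[OF assms]]] by metis
  have lip: "\<bar>f (t + s) - f t\<bar> \<le> B * \<bar>s\<bar>" if "smooth f" "\<And>t. \<bar>deriv f t\<bar> \<le> B" for f B t s
    using field_differentiable_bound[of UNIV f "deriv f" B "t + s" t] smooth_has_deriv[OF that(1)] that(2)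
    by (simp add: has_field_derivative_at_within)
  have ta: "\<bar>a (t + s) - a t - s * deriv a t\<bar> \<le> B2 * s\<^sup>2" for t s
  proof -
    let ?S = "{- \<bar>s\<bar>..\<bar>s\<bar>}"
    let ?f = "\<lambda>r. a (t + r) - r * deriv a t"
    have "norm (?f s - ?f 0) \<le> (B2 * \<bar>s\<bar>) * norm (s - 0)"
    proof (rule field_differentiable_bound[of ?S])
      show "(?f has_field_derivative deriv a (t + r) - deriv a t) (at r within ?S)" for r
      proof -
        have "((\<lambda>r. a (t + r)) has_real_derivative deriv a (t + r) * 1) (at r)"
          by (rule DERIV_chain2[OF smooth_has_deriv[OF sm(1)]]) (auto intro!: derivative_eq_intros)
        then have "(?f has_real_derivative deriv a (t + r) * 1 - 1 * deriv a t) (at r)"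
          by (intro DERIV_diff DERIV_cmult_right DERIV_ident)
        from has_field_derivative_at_within[OF this] show ?thesis by simp
      qed
      show "norm (deriv a (t + r) - deriv a t) \<le> B2 * \<bar>s\<bar>" if "r \<in> ?S" for r
      proof -
        have "\<bar>deriv a (t + r) - deriv a t\<bar> \<le> B2 * \<bar>r\<bar>" by (rule lip[OF sm(2) B2(2)])
        also have "\<dots> \<le> B2 * \<bar>s\<bar>" using that B2(1) by (intro mult_left_mono) auto
        finally show ?thesis by simp
      qed
    qed auto
    then show ?thesis by (simp add: power2_eq_square mult.assoc algebra_simps)
  qed
  define B where "B = max B0 (max B1 B2)"
  show ?thesis
  proof (rule that[of B])
    show "B > 0" using B0 unfolding B_def by simp
    show "\<bar>a t\<bar> \<le> B" "\<bar>deriv a t\<bar> \<le> B" for t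
      using B0(2)[of t] B1(2)[of t] unfolding B_def by linarith+
    show "\<bar>a (t + s) - a t\<bar> \<le> B * \<bar>s\<bar>" for t s
      using lip[OF sm(1) B1(2), of t s] mult_right_mono[of B1 B "\<bar>s\<bar>"] unfolding B_def by linarith
    show "\<bar>a (t + s) - a t - s * deriv a t\<bar> \<le> B * s\<^sup>2" for t s
      using ta[of t s] mult_right_mono[of B2 B "s\<^sup>2"] unfolding B_def by (smt (verit) max.cobounded2 max.coboundedI2 zero_le_power2)
  qed
qed

text \<open>Replaces limit arguments by one inequality, both for differentiation under the integral
  sign and for the truncated square of the splines.\<close>

lemma has_derivative_quadratic_boundI:
  fixes f :: "'a::real_normed_vector \<Rightarrow> 'b::real_normed_vector"
  assumes L: "bounded_linear L" and b: "\<And>h. norm (f (z + h) - f z - L h) \<le> B * (norm h)\<^sup>2"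
  shows "(f has_derivative L) (at z)"
  unfolding has_derivative_at
proof (intro conjI L)
  have l: "((\<lambda>h. B * norm h) \<longlongrightarrow> B * 0) (at (0::'a))"
    by (intro tendsto_intros tendsto_norm_zero)
  have b': "norm (f (z + h) - f z - L h) / norm h \<le> B * norm h" for h
    using b[of h] by (cases "h = 0") (simp_all add: field_simps power2_eq_square)
  show "(\<lambda>h. norm (f (z + h) - f z - L h) / norm h) \<midarrow>0\<rightarrow> 0"
    by (rule tendsto_sandwich[OF _ _ tendsto_const l[simplified]]) (auto intro: always_eventually b')
qed

text \<open>The remainder of the product telescopes into a Taylor remainder of \<open>a\<close>, an
  increment of \<open>b\<close> weighted with the derivative of \<open>a\<close>, and a Taylor
  remainder of \<open>b\<close>. Uniformity in the base point is what allows integration against a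
  function in L_1.\<close>

lemma tensor_taylor:
  assumes "csupp a" "csupp b"
  obtains B where "B > 0" "\<And>t s. \<bar>a t * b s\<bar> \<le> B"
    "\<And>t s x y. \<bar>a (t + x) * b (s + y) - a t * b s - (x * (deriv a t * b s) + y * (a t * deriv b s))\<bar> \<le> B * (x\<^sup>2 + y\<^sup>2)"
proof -
  obtain A where A: "A > 0" "\<And>t. \<bar>a t\<bar> \<le> A" "\<And>t. \<bar>deriv a t\<bar> \<le> A"
    "\<And>t s. \<bar>a (t + s) - a t\<bar> \<le> A * \<bar>s\<bar>" "\<And>t s. \<bar>a (t + s) - a t - s * deriv a t\<bar> \<le> A * s\<^sup>2"
    using csupp_taylor[OF assms(1)] by metis
  obtain B where B: "B > 0" "\<And>t. \<bar>b t\<bar> \<le> B" "\<And>t. \<bar>deriv b t\<bar> \<le> B"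
    "\<And>t s. \<bar>b (t + s) - b t\<bar> \<le> B * \<bar>s\<bar>" "\<And>t s. \<bar>b (t + s) - b t - s * deriv b t\<bar> \<le> B * s\<^sup>2"
    using csupp_taylor[OF assms(2)] by metis
  show ?thesis
  proof (rule that[of "2 * (A * B)"])
    show "2 * (A * B) > 0" using A(1) B(1) by simp
    show "\<bar>a t * b s\<bar> \<le> 2 * (A * B)" for t s
      using mult_mono[OF A(2)[of t] B(2)[of s]] A(1) B(1) mult_pos_pos[OF A(1) B(1)] unfolding abs_mult by linarith
    fix t s x y
    have 1: "\<bar>(a (t + x) - a t - x * deriv a t) * b (s + y)\<bar> \<le> A * x\<^sup>2 * B"
      unfolding abs_mult using A B by (intro mult_mono) auto
    have 2: "\<bar>x * (deriv a t * (b (s + y) - b s))\<bar> \<le> \<bar>x\<bar> * (A * (B * \<bar>y\<bar>))"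
      unfolding abs_mult using A B by (intro mult_mono) auto
    have 3: "\<bar>a t * (b (s + y) - b s - y * deriv b s)\<bar> \<le> A * (B * y\<^sup>2)"
      unfolding abs_mult using A B by (intro mult_mono) auto
    have 4: "\<bar>x\<bar> * (A * (B * \<bar>y\<bar>)) \<le> A * B * (x\<^sup>2 + y\<^sup>2)"
    proof -
      have "\<bar>x\<bar> * \<bar>y\<bar> \<le> x\<^sup>2 + y\<^sup>2"
        using sum_squares_bound[of "\<bar>x\<bar>" "\<bar>y\<bar>"] mult_nonneg_nonneg[OF abs_ge_zero[of x] abs_ge_zero[of y]]
        unfolding mult.assoc power2_abs by linarith
      then show ?thesis using A(1) B(1) by (simp add: mult.left_commute[of "\<bar>x\<bar>"] mult.assoc)
    qed
    have "a (t + x) * b (s + y) - a t * b s - (x * (deriv a t * b s) + y * (a t * deriv b s)) =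
       (a (t + x) - a t - x * deriv a t) * b (s + y) + x * (deriv a t * (b (s + y) - b s)) + a t * (b (s + y) - b s - y * deriv b s)"
      by (simp add: algebra_simps)
    then have "\<bar>a (t + x) * b (s + y) - a t * b s - (x * (deriv a t * b s) + y * (a t * deriv b s))\<bar> \<le>
       A * x\<^sup>2 * B + A * B * (x\<^sup>2 + y\<^sup>2) + A * (B * y\<^sup>2)" using 1 2 3 4 by linarith
    also have "\<dots> = 2 * (A * B) * (x\<^sup>2 + y\<^sup>2)" by (simp add: algebra_simps)
    finally show "\<bar>a (t + x) * b (s + y) - a t * b s - (x * (deriv a t * b s) + y * (a t * deriv b s))\<bar> \<le> 2 * (A * B) * (x\<^sup>2 + y\<^sup>2)" .
  qed
qed

text \<open>A convolution after affine changes of both variables. With \<alpha> = l/\<delta>,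
  \<gamma> = 1/\<delta> and \<beta> = s/\<delta> it is, up to normalization, the mollification of
  \<open>g\<close> at scale \<delta>, evaluated at s + l z.\<close>

definition kernel_int :: "(real \<times> real \<Rightarrow> real) \<Rightarrow> real \<Rightarrow> real \<Rightarrow> real \<times> real \<Rightarrow> (real \<Rightarrow> real) \<Rightarrow> (real \<Rightarrow> real) \<Rightarrow> real \<times> real \<Rightarrow> real" where
  "kernel_int g \<alpha> \<gamma> \<beta> a b z = (LINT w|lborel. g w * (a (\<alpha> * fst z + fst \<beta> - \<gamma> * fst w) * b (\<alpha> * snd z + snd \<beta> - \<gamma> * snd w)))"

lemma kernel_integrable:
  assumes g: "integrable lborel g" and ab: "csupp a" "csupp b"
  shows "integrable lborel (\<lambda>w. g w * (a (p - \<gamma> * fst w) * b (q - \<gamma> * snd w)))"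
proof -
  obtain B where B: "B > 0" "\<And>t s. \<bar>a t * b s\<bar> \<le> B" using tensor_taylor[OF ab] by metis
  have ca: "continuous_on UNIV a" "continuous_on UNIV b" using ab smooth_continuous csupp_def by blast+
  have "continuous_on UNIV (\<lambda>w::real\<times>real. a (p - \<gamma> * fst w))"
    by (rule continuous_on_compose2[OF ca(1)]) (auto intro!: continuous_intros)
  moreover have "continuous_on UNIV (\<lambda>w::real\<times>real. b (q - \<gamma> * snd w))"
    by (rule continuous_on_compose2[OF ca(2)]) (auto intro!: continuous_intros)
  ultimately have [measurable]: "(\<lambda>w. a (p - \<gamma> * fst w) * b (q - \<gamma> * snd w)) \<in> borel_measurable borel"
    by (intro borel_measurable_continuous_onI continuous_on_mult)
  have [measurable]: "g \<in> borel_measurable borel" using borel_measurable_integrable[OF g] by simp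
  show ?thesis
  proof (rule Bochner_Integration.integrable_bound[of lborel "\<lambda>w. B * g w"])
    show "integrable lborel (\<lambda>w. B * g w)" using g by simp
    show "AE w in lborel. norm (g w * (a (p - \<gamma> * fst w) * b (q - \<gamma> * snd w))) \<le> norm (B * g w)"
    proof (intro AE_I2)
      fix w
      show "norm (g w * (a (p - \<gamma> * fst w) * b (q - \<gamma> * snd w))) \<le> norm (B * g w)"
        using mult_left_mono[OF B(2)[of "p - \<gamma> * fst w" "q - \<gamma> * snd w"], of "\<bar>g w\<bar>"] B(1)
        by (simp add: abs_mult mult.commute)
    qed
  qed measurable
qed

text \<open>Differentiation under the integral sign: the quadratic Taylor bound of the kernel is
  uniform in \<open>w\<close> and is integrated against the absolute value of
  \<open>g\<close>.\<close>

lemma kernel_int_has_derivative: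
  assumes g: "integrable lborel g" and ab: "csupp a" "csupp b"
  shows "(kernel_int g \<alpha> \<gamma> \<beta> a b has_derivative
     (\<lambda>h. fst h * (\<alpha> * kernel_int g \<alpha> \<gamma> \<beta> (deriv a) b z) + snd h * (\<alpha> * kernel_int g \<alpha> \<gamma> \<beta> a (deriv b) z))) (at z)"
proof -
  note ab' = csupp_deriv[OF ab(1)] csupp_deriv[OF ab(2)]
  obtain B where B: "B > 0"
    "\<And>t s x y. \<bar>a (t + x) * b (s + y) - a t * b s - (x * (deriv a t * b s) + y * (a t * deriv b s))\<bar> \<le> B * (x\<^sup>2 + y\<^sup>2)"
    using tensor_taylor[OF ab] by metis
  let ?t = "\<lambda>z w. \<alpha> * fst z + fst \<beta> - \<gamma> * fst w" and ?s = "\<lambda>z w. \<alpha> * snd z + snd \<beta> - \<gamma> * snd w"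
  let ?L = "\<lambda>h. fst h * (\<alpha> * kernel_int g \<alpha> \<gamma> \<beta> (deriv a) b z) + snd h * (\<alpha> * kernel_int g \<alpha> \<gamma> \<beta> a (deriv b) z)"
  show ?thesis
  proof (rule has_derivative_quadratic_boundI[where B = "B * \<alpha>\<^sup>2 * (LINT w|lborel. \<bar>g w\<bar>)"])
    show "bounded_linear ?L"
      by (intro bounded_linear_intros)
    fix h :: "real \<times> real"
    define E where "E w = a (?t (z + h) w) * b (?s (z + h) w) - a (?t z w) * b (?s z w) - ((\<alpha> * fst h) * (deriv a (?t z w) * b (?s z w)) + (\<alpha> * snd h) * (a (?t z w) * deriv b (?s z w)))" for w
    have E_le: "\<bar>E w\<bar> \<le> B * \<alpha>\<^sup>2 * (norm h)\<^sup>2" for w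
    proof -
      have "?t (z + h) w = ?t z w + \<alpha> * fst h" "?s (z + h) w = ?s z w + \<alpha> * snd h"
        by (simp_all add: algebra_simps)
      then have "\<bar>E w\<bar> \<le> B * ((\<alpha> * fst h)\<^sup>2 + (\<alpha> * snd h)\<^sup>2)"
        unfolding E_def using B(2)[of "?t z w" "\<alpha> * fst h" "?s z w" "\<alpha> * snd h"] by presburger
      also have "\<dots> = B * \<alpha>\<^sup>2 * (norm h)\<^sup>2"
        by (simp add: norm_prod_def power_mult_distrib algebra_simps)
      finally show ?thesis .
    qed
    have "kernel_int g \<alpha> \<gamma> \<beta> a b (z + h) - kernel_int g \<alpha> \<gamma> \<beta> a b z - ?L h = (LINT w|lborel.
         g w * (a (?t (z + h) w) * b (?s (z + h) w)) - g w * (a (?t z w) * b (?s z w)) - ((\<alpha> * fst h) * (g w * (deriv a (?t z w) * b (?s z w))) + (\<alpha> * snd h) * (g w * (a (?t z w) * deriv b (?s z w)))))"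
      unfolding kernel_int_def using kernel_integrable[OF g] ab ab' by simp
    also have "\<dots> = (LINT w|lborel. g w * E w)"
      by (rule Bochner_Integration.integral_cong) (simp_all only: E_def right_diff_distrib distrib_left mult.left_commute)
    finally have eq: "kernel_int g \<alpha> \<gamma> \<beta> a b (z + h) - kernel_int g \<alpha> \<gamma> \<beta> a b z - ?L h = (LINT w|lborel. g w * E w)" .
      have iE: "integrable lborel (\<lambda>w. g w * E w)"
      proof -
        have "integrable lborel (\<lambda>w. g w * (a (?t (z + h) w) * b (?s (z + h) w)) - g w * (a (?t z w) * b (?s z w)) - ((\<alpha> * fst h) * (g w * (deriv a (?t z w) * b (?s z w))) + (\<alpha> * snd h) * (g w * (a (?t z w) * deriv b (?s z w)))))"
          using kernel_integrable[OF g] ab ab' by simp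
        then show ?thesis by (rule back_subst[of "integrable lborel"]) (simp only: E_def right_diff_distrib distrib_left mult.left_commute)
      qed
    have n: "norm (g w * E w) \<le> (B * \<alpha>\<^sup>2 * (norm h)\<^sup>2) * \<bar>g w\<bar>" for w
      unfolding real_norm_def[of "g w * E w"] abs_mult[of "g w"] mult.commute[of "\<bar>g w\<bar>"]
      by (rule mult_right_mono[OF E_le abs_ge_zero])
    have i2: "integrable lborel (\<lambda>w. (B * \<alpha>\<^sup>2 * (norm h)\<^sup>2) * \<bar>g w\<bar>)" using g by simp
    have le1: "norm (LINT w|lborel. g w * E w) \<le> (LINT w|lborel. norm (g w * E w))"
      by (rule integral_norm_bound)
    have le2: "(LINT w|lborel. norm (g w * E w)) \<le> (LINT w|lborel. (B * \<alpha>\<^sup>2 * (norm h)\<^sup>2) * \<bar>g w\<bar>)"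
      by (intro integral_mono integrable_norm iE i2 n)
    have "(LINT w|lborel. (B * \<alpha>\<^sup>2 * (norm h)\<^sup>2) * \<bar>g w\<bar>) = B * \<alpha>\<^sup>2 * (LINT w|lborel. \<bar>g w\<bar>) * (norm h)\<^sup>2"
      by simp
    then show "norm (kernel_int g \<alpha> \<gamma> \<beta> a b (z + h) - kernel_int g \<alpha> \<gamma> \<beta> a b z - ?L h) \<le> B * \<alpha>\<^sup>2 * (LINT w|lborel. \<bar>g w\<bar>) * (norm h)\<^sup>2"
      unfolding eq using le1 le2 by linarith
  qed
qed

lemma deriv_iter_affine:
  assumes "smooth f"
  shows "(deriv ^^ k) (\<lambda>t. f (c * t + d)) = (\<lambda>t. c ^ k * (deriv ^^ k) f (c * t + d))"
proof (induction k)
  case (Suc k)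
  have "((\<lambda>t. c ^ k * (deriv ^^ k) f (c * t + d)) has_real_derivative c ^ Suc k * (deriv ^^ Suc k) f (c * t + d)) (at t)" for t
  proof -
    have "((\<lambda>t. (deriv ^^ k) f (c * t + d)) has_real_derivative deriv ((deriv ^^ k) f) (c * t + d) * c) (at t)"
      by (rule DERIV_chain2[OF smooth_has_deriv[OF smooth_deriv_iter[OF assms]]]) (auto intro!: derivative_eq_intros)
    from DERIV_cmult[OF this, of "c ^ k"] show ?thesis by (simp add: mult_ac)
  qed
  then have "deriv (\<lambda>t. c ^ k * (deriv ^^ k) f (c * t + d)) = (\<lambda>t. c ^ Suc k * (deriv ^^ Suc k) f (c * t + d))"
    by (intro ext DERIV_imp_deriv)
  then show ?case by (simp only: funpow.simps comp_apply Suc)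
qed simp

definition bump1 :: "real \<Rightarrow> real" where "bump1 = cutoff 0 (- 1) 1"

definition bump2 :: "real \<times> real \<Rightarrow> real" where "bump2 z = bump1 (fst z) * bump1 (snd z)"

lemma csupp_bump1_iter: "csupp ((deriv ^^ k) bump1)"
  unfolding csupp_def
proof (intro conjI exI allI impI)
  show "smooth ((deriv ^^ k) bump1)" unfolding bump1_def by (intro smooth_deriv_iter smooth_cutoff)
  show "(deriv ^^ k) bump1 t = 0" if "t \<notin> {-1..1}" for t
    by (rule deriv_iter_zero_outside[OF _ _ that]) (auto simp: bump1_def smooth_cutoff intro: cutoff_zero)
qed

lemma csupp_bump1: "csupp bump1" using csupp_bump1_iter[of 0] by simp

lemma bump2_range: "0 \<le> bump2 z" "bump2 z \<le> 1"
  unfolding bump2_def bump1_def using cutoff_range by (auto intro: mult_le_one)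

lemma bump2_borel[measurable]: "bump2 \<in> borel_measurable borel"
proof -
  have c: "continuous_on UNIV bump1" using csupp_bump1 smooth_continuous csupp_def by blast
  have "continuous_on UNIV (\<lambda>w::real\<times>real. bump1 (fst w))"
    by (rule continuous_on_compose2[OF c]) (auto intro!: continuous_intros)
  moreover have "continuous_on UNIV (\<lambda>w::real\<times>real. bump1 (snd w))"
    by (rule continuous_on_compose2[OF c]) (auto intro!: continuous_intros)
  ultimately show ?thesis unfolding bump2_def[abs_def]
    by (intro borel_measurable_continuous_onI continuous_on_mult)
qed

lemma bump2_integrable: "integrable lborel bump2"
proof (rule Bochner_Integration.integrable_bound[of lborel "indicator (cbox (-1, -1) (1, 1))"])
  show "integrable lborel (indicator (cbox (-1, -1) (1, 1)) :: real \<times> real \<Rightarrow> real)"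
    using emeasure_bounded_finite[OF bounded_cbox, of "(-1, -1)" "(1::real, 1::real)"]
    by (simp add: integrable_indicator_iff)
  have "bump2 z \<le> indicator (cbox (-1, -1) (1, 1)) z" for z
  proof (cases "z \<in> cbox (-1, -1) (1, 1)")
    case True then show ?thesis using bump2_range by simp
  next
    case False
    then have "bump2 z = 0" unfolding cbox_prod_real bump2_def bump1_def
      by (auto simp: mem_Times_iff intro!: cutoff_zero)
    then show ?thesis by simp
  qed
  then show "AE z in lborel. norm (bump2 z) \<le> norm (indicator (cbox (-1, -1) (1, 1)) z :: real)"
    using bump2_range by (intro AE_I2) (simp add: abs_of_nonneg)
qed simp

text \<open>The kernel is not normalized; its integral is divided out when mollifying.\<close>

definition bump_mass :: real where "bump_mass = (LINT z|lborel. bump2 z)"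

lemma bump_mass_pos: "bump_mass > 0"
proof -
  have "bump_mass \<ge> 0" unfolding bump_mass_def using bump2_range by (intro integral_nonneg_AE) auto
  moreover have "bump_mass \<noteq> 0"
  proof
    assume "bump_mass = 0"
    then have ae: "AE z in lborel. bump2 z = 0"
      unfolding bump_mass_def using integral_nonneg_eq_0_iff_AE[OF bump2_integrable] bump2_range by auto
    have pos: "bump2 z > 0" if "z \<in> box (-1, -1) (1::real, 1::real)" for z
      using that unfolding bump2_def bump1_def box_prod_real
      by (intro mult_pos_pos) (auto simp: cutoff_pos_iff)
    from ae have "AE z in lborel. z \<notin> box (-1, -1) (1::real, 1::real)"
      by eventually_elim (use pos in force)
    then have "emeasure lborel (box (-1, -1) (1::real, 1::real)) = 0"
      by (subst (asm) AE_iff_measurable[of "box (-1, -1) (1::real, 1::real)"]) auto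
    then show False by (simp add: emeasure_lborel_box_eq Basis_prod_def)
  qed
  ultimately show ?thesis by simp
qed

text \<open>Substituting s + l z - \<delta> w for the variable of integration moves the scale from
  the kernel to \<open>f\<close>; the Jacobian is \<delta> squared. The mollification thus becomes
  an average of affine transforms of \<open>f\<close>.\<close>

lemma kernel_int_substitute:
  assumes f: "integrable lborel f" and d: "\<delta> > 0"
  shows "kernel_int f (l / \<delta>) (1 / \<delta>) (s1 / \<delta>, s2 / \<delta>) bump1 bump1 z / \<delta>\<^sup>2 =
    (LINT w|lborel. f ((s1, s2) + l *\<^sub>R z - \<delta> *\<^sub>R w) * bump2 w)"
    and "integrable lborel (\<lambda>w. f ((s1, s2) + l *\<^sub>R z - \<delta> *\<^sub>R w) * bump2 w)"
proof -
  let ?F = "\<lambda>w. f w * (bump1 (l / \<delta> * fst z + s1 / \<delta> - 1 / \<delta> * fst w) * bump1 (l / \<delta> * snd z + s2 / \<delta> - 1 / \<delta> * snd w))"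
  have F: "integrable lborel ?F"
    using kernel_integrable[OF f csupp_bump1 csupp_bump1, of "l / \<delta> * fst z + s1 / \<delta>" "1 / \<delta>" "l / \<delta> * snd z + s2 / \<delta>"] .
  have eq: "?F (((s1, s2) + l *\<^sub>R z) + (- \<delta>) *\<^sub>R w) = f ((s1, s2) + l *\<^sub>R z - \<delta> *\<^sub>R w) * bump2 w" for w
  proof -
    have "l / \<delta> * fst z + s1 / \<delta> - 1 / \<delta> * fst (((s1, s2) + l *\<^sub>R z) + (- \<delta>) *\<^sub>R w) = fst w"
      "l / \<delta> * snd z + s2 / \<delta> - 1 / \<delta> * snd (((s1, s2) + l *\<^sub>R z) + (- \<delta>) *\<^sub>R w) = snd w"
      using d by (simp_all add: field_simps)
    then show ?thesis by (simp add: bump2_def)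
  qed
  have "- \<delta> \<noteq> 0" using d by simp
  note A = integrable_lborel_affine[OF F this, of "(s1, s2) + l *\<^sub>R z", unfolded eq]
  show "integrable lborel (\<lambda>w. f ((s1, s2) + l *\<^sub>R z - \<delta> *\<^sub>R w) * bump2 w)" using A(1) .
  show "kernel_int f (l / \<delta>) (1 / \<delta>) (s1 / \<delta>, s2 / \<delta>) bump1 bump1 z / \<delta>\<^sup>2 =
    (LINT w|lborel. f ((s1, s2) + l *\<^sub>R z - \<delta> *\<^sub>R w) * bump2 w)"
    using A(2) d by (simp add: kernel_int_def power2_eq_square)
qed

text \<open>By Tonelli the L_1 error is at most the average, weighted with the kernel, of the L_1
  distances \<open>I n w\<close> between \<open>f\<close> and its affine transforms. These tend to
  zero for each \<open>w\<close> by \<open>affine_cont_integrable\<close> and are uniformly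
  bounded.\<close>

lemma kernel_int_tendsto:
  assumes f: "integrable lborel f" and d: "\<And>n. \<delta> n > 0" "\<delta> \<longlonglongrightarrow> 0"
    and l: "\<And>n. l n \<in> {1/2..1}" "l \<longlonglongrightarrow> 1" and s: "s1 \<longlonglongrightarrow> 0" "s2 \<longlonglongrightarrow> 0"
  shows "(\<lambda>n. \<integral>\<^sup>+z. ennreal \<bar>kernel_int f (l n / \<delta> n) (1 / \<delta> n) (s1 n / \<delta> n, s2 n / \<delta> n) bump1 bump1 z / (\<delta> n)\<^sup>2 / bump_mass - f z\<bar> \<partial>lborel) \<longlonglongrightarrow> 0"
proof -
  have [measurable]: "f \<in> borel_measurable borel" using borel_measurable_integrable[OF f] by simp
  define T where "T n z w = (s1 n, s2 n) + l n *\<^sub>R z - \<delta> n *\<^sub>R w" for n and z w :: "real \<times> real"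
  define I where "I n w = (LINT z|lborel. \<bar>f (T n z w) - f z\<bar>)" for n w
  let ?N = "LINT z|lborel. \<bar>f z\<bar>"
  have l0: "l n \<noteq> 0" for n using l(1)[of n] by auto
  have Teq: "T n z w = ((s1 n, s2 n) - \<delta> n *\<^sub>R w) + l n *\<^sub>R z" for n z w unfolding T_def by simp
  have fT: "integrable lborel (\<lambda>z. f (T n z w))" for n w
    unfolding Teq by (rule integrable_lborel_affine(1)[OF f l0])
  have [measurable]: "(\<lambda>(z, w). T n z w) \<in> borel_measurable (borel \<Otimes>\<^sub>M borel)" for n
    unfolding T_def by measurable
  have I0: "I n w \<ge> 0" for n w unfolding I_def by (intro integral_nonneg_AE) auto
  \<comment> \<open>The transformed function has norm at most \<open>4 * ?N\<close>, since
    \<open>l n\<close> is at least 1/2; \<open>f\<close> itself adds one more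
    \<open>?N\<close>.\<close>
  have Ibound: "I n w \<le> 5 * ?N" for n w
  proof -
    have "I n w \<le> (LINT z|lborel. \<bar>f (T n z w)\<bar> + \<bar>f z\<bar>)"
      unfolding I_def using fT f by (intro integral_mono) auto
    also have "\<dots> = (LINT z|lborel. \<bar>f (T n z w)\<bar>) + ?N" using fT f by simp
    also have "(LINT z|lborel. \<bar>f (T n z w)\<bar>) = ?N / \<bar>l n\<bar> ^ 2"
      using integrable_lborel_affine(2)[of "\<lambda>z. \<bar>f z\<bar>" "l n" "(s1 n, s2 n) - \<delta> n *\<^sub>R w"] f l0 unfolding Teq by (simp add: power2_eq_square)
    also have "\<dots> \<le> 4 * ?N"
    proof -
      have "(1/2)\<^sup>2 \<le> \<bar>l n\<bar>\<^sup>2" using l(1)[of n] by (intro power_mono) auto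
      then have "1 / \<bar>l n\<bar>\<^sup>2 \<le> 4" using l0[of n] by (simp add: field_simps)
      moreover have "?N \<ge> 0" by (intro integral_nonneg_AE) auto
      ultimately show ?thesis using mult_right_mono[of "1 / \<bar>l n\<bar>\<^sup>2" 4 ?N] by simp
    qed
    finally show ?thesis by simp
  qed
  have Ilim: "(\<lambda>n. I n w) \<longlonglongrightarrow> 0" for w
  proof -
    have "(\<lambda>n. (s1 n, s2 n) - \<delta> n *\<^sub>R w) \<longlonglongrightarrow> (0, 0) - 0 *\<^sub>R w" using s d(2) by (intro tendsto_intros)
    then show ?thesis
      using affine_cont_integrable[OF f] l unfolding affine_cont_def I_def Teq by (simp add: zero_prod_def)
  qed
  have Imeas[measurable]: "(\<lambda>w. I n w) \<in> borel_measurable borel" for n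
    unfolding I_def by measurable
  let ?U = "\<lambda>n. \<integral>\<^sup>+w. ennreal (bump2 w * I n w) \<partial>lborel"
  have "?U \<longlonglongrightarrow> (\<integral>\<^sup>+w. 0 \<partial>(lborel :: (real\<times>real) measure))"
  proof (rule nn_integral_dominated_convergence[where w="\<lambda>w. ennreal (bump2 w * (5 * ?N))"])
    show "(\<integral>\<^sup>+w. ennreal (bump2 w * (5 * ?N)) \<partial>lborel) < \<infinity>"
      using bump2_integrable bump2_range
      by (subst nn_integral_eq_integral) (auto intro!: AE_I2 mult_nonneg_nonneg integral_nonneg_AE)
    show "AE w in lborel. ennreal (bump2 w * I n w) \<le> ennreal (bump2 w * (5 * ?N))" for n
      using Ibound bump2_range by (intro AE_I2 ennreal_leI mult_left_mono) auto
    have "(\<lambda>n. ennreal (bump2 w * I n w)) \<longlonglongrightarrow> ennreal (bump2 w * 0)" for w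
      by (intro tendsto_ennrealI tendsto_mult tendsto_const Ilim)
    then show "AE w in lborel. (\<lambda>n. ennreal (bump2 w * I n w)) \<longlonglongrightarrow> 0" by simp
  qed measurable
  then have "(\<lambda>n. ennreal (1 / bump_mass) * ?U n) \<longlonglongrightarrow> ennreal (1 / bump_mass) * 0"
    by (intro ennreal_tendsto_cmult) auto
  then have lim: "(\<lambda>n. ennreal (1 / bump_mass) * ?U n) \<longlonglongrightarrow> 0" by simp
  show ?thesis
  proof (rule tendsto_sandwich[OF _ _ tendsto_const lim]; intro always_eventually allI)
    fix n
    let ?K = "\<lambda>z. kernel_int f (l n / \<delta> n) (1 / \<delta> n) (s1 n / \<delta> n, s2 n / \<delta> n) bump1 bump1 z / (\<delta> n)\<^sup>2 / bump_mass"
    have pt: "ennreal \<bar>?K z - f z\<bar> \<le> ennreal (1 / bump_mass) * (\<integral>\<^sup>+w. ennreal (bump2 w * \<bar>f (T n z w) - f z\<bar>) \<partial>lborel)" for z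
    proof -
      note K = kernel_int_substitute[OF f d(1), where l = "l n" and n1 = n and ?s1.0 = "s1 n" and ?s2.0 = "s2 n" and z = z, folded T_def]
      have i: "integrable lborel (\<lambda>w. f (T n z w) * bump2 w - f z * bump2 w)" using K(2) bump2_integrable by simp
      have "?K z - f z = (1 / bump_mass) * ((LINT w|lborel. f (T n z w) * bump2 w) - f z * bump_mass)"
        using bump_mass_pos by (simp add: K(1) field_simps)
      also have "(LINT w|lborel. f (T n z w) * bump2 w) - f z * bump_mass = (LINT w|lborel. f (T n z w) * bump2 w - f z * bump2 w)"
        using K(2) bump2_integrable by (simp add: bump_mass_def)
      finally have "\<bar>?K z - f z\<bar> = 1 / bump_mass * norm (LINT w|lborel. f (T n z w) * bump2 w - f z * bump2 w)"
        using bump_mass_pos by (simp only: abs_mult real_norm_def abs_divide abs_one abs_of_pos)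
      then have "ennreal \<bar>?K z - f z\<bar> = ennreal (1 / bump_mass) * ennreal (norm (LINT w|lborel. f (T n z w) * bump2 w - f z * bump2 w))"
        using bump_mass_pos by (simp only: ennreal_mult norm_ge_zero divide_nonneg_pos zero_le_one)
      also have "\<dots> \<le> ennreal (1 / bump_mass) * (\<integral>\<^sup>+w. norm (f (T n z w) * bump2 w - f z * bump2 w) \<partial>lborel)"
        by (intro mult_left_mono integral_norm_bound_ennreal i) auto
      also have "(\<lambda>w. norm (f (T n z w) * bump2 w - f z * bump2 w)) = (\<lambda>w. bump2 w * \<bar>f (T n z w) - f z\<bar>)"
        using bump2_range(1) by (simp only: fun_eq_iff abs_mult mult.commute[of "bump2 _"] real_norm_def abs_of_nonneg flip: left_diff_distrib) simp
      finally show ?thesis .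
    qed
    have "(\<integral>\<^sup>+z. ennreal \<bar>?K z - f z\<bar> \<partial>lborel) \<le> (\<integral>\<^sup>+z. ennreal (1 / bump_mass) * (\<integral>\<^sup>+w. ennreal (bump2 w * \<bar>f (T n z w) - f z\<bar>) \<partial>lborel) \<partial>lborel)"
      by (intro nn_integral_mono pt)
    also have "\<dots> = ennreal (1 / bump_mass) * (\<integral>\<^sup>+z. \<integral>\<^sup>+w. ennreal (bump2 w * \<bar>f (T n z w) - f z\<bar>) \<partial>lborel \<partial>lborel)"
      by (rule nn_integral_cmult) measurable
    also have "(\<integral>\<^sup>+z. \<integral>\<^sup>+w. ennreal (bump2 w * \<bar>f (T n z w) - f z\<bar>) \<partial>lborel \<partial>lborel) = (\<integral>\<^sup>+w. \<integral>\<^sup>+z. ennreal (bump2 w * \<bar>f (T n z w) - f z\<bar>) \<partial>lborel \<partial>lborel)"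
      by (rule lborel_pair.Fubini'[symmetric]) measurable
    also have "\<dots> = ?U n"
    proof (rule nn_integral_cong)
      fix w :: "real \<times> real"
      have "(\<integral>\<^sup>+z. ennreal (bump2 w * \<bar>f (T n z w) - f z\<bar>) \<partial>lborel) = ennreal (LINT z|lborel. bump2 w * \<bar>f (T n z w) - f z\<bar>)"
        using fT f bump2_range by (intro nn_integral_eq_integral) auto
      also have "(LINT z|lborel. bump2 w * \<bar>f (T n z w) - f z\<bar>) = bump2 w * I n w"
        unfolding I_def by simp
      finally show "(\<integral>\<^sup>+z. ennreal (bump2 w * \<bar>f (T n z w) - f z\<bar>) \<partial>lborel) = ennreal (bump2 w * I n w)" .
    qed
    finally show "(\<integral>\<^sup>+z. ennreal \<bar>?K z - f z\<bar> \<partial>lborel) \<le> ennreal (1 / bump_mass) * ?U n" .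
  qed simp
qed


text \<open>As a function of \<open>w\<close> the kernel is a test function, provided that its
  support lies in \<Omega>. The sign from integration by parts cancels against the inner derivative
  -\<gamma>.\<close>

lemma kernel_int_weak_deriv:
  assumes w: "is_weak_deriv \<Omega> i j u g" and u: "integrable lborel u" and g: "integrable lborel g"
    and \<Omega>: "\<Omega> \<in> sets borel" and \<gamma>: "\<gamma> > 0"
    and sub: "{(p - 1) / \<gamma>..(p + 1) / \<gamma>} \<times> {(q - 1) / \<gamma>..(q + 1) / \<gamma>} \<subseteq> \<Omega>"
  shows "\<gamma> ^ (i + j) * (LINT w|lborel. u w * ((deriv ^^ i) bump1 (p - \<gamma> * fst w) * (deriv ^^ j) bump1 (q - \<gamma> * snd w)))
     = (LINT w|lborel. g w * (bump1 (p - \<gamma> * fst w) * bump1 (q - \<gamma> * snd w)))"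
proof -
  let ?a = "\<lambda>t. bump1 (- \<gamma> * t + p)" and ?b = "\<lambda>t. bump1 (- \<gamma> * t + q)"
  let ?\<phi> = "\<lambda>z. ?a (fst z) * ?b (snd z)"
  have sm: "smooth bump1" using csupp_bump1 csupp_def by blast
  have smab: "smooth ?a" "smooth ?b" by (intro smooth_affine sm)+
  have z: "bump1 (- \<gamma> * t + r) = 0" if "t \<notin> {(r - 1) / \<gamma>..(r + 1) / \<gamma>}" for t r
    using that \<gamma> unfolding bump1_def by (intro cutoff_zero) (auto simp: field_simps)
  have test: "test_function \<Omega> ?\<phi>"
    by (rule test_function_tensor[OF smab z z sub])
  have D: "((dx UNIV ^^ i) ((dy UNIV ^^ j) ?\<phi>)) z =
     (- \<gamma>) ^ (i + j) * ((deriv ^^ i) bump1 (p - \<gamma> * fst z) * (deriv ^^ j) bump1 (q - \<gamma> * snd z))" for z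
    unfolding iter_tensor[OF smab] deriv_iter_affine[OF sm] by (simp add: power_add)
  have \<Omega>s: "\<Omega> \<in> sets lebesgue" using \<Omega> by simp
  note ker = kernel_integrable[OF _ csupp_bump1_iter csupp_bump1_iter, of _ _ p \<gamma> _ q]
  have "(LINT z|lebesgue. u z * ((dx UNIV ^^ i) ((dy UNIV ^^ j) ?\<phi>)) z) = (-1) ^ (i + j) * (LINT z|lebesgue. g z * ?\<phi> z)"
    using w test unfolding is_weak_deriv_iff[OF \<Omega>s] by blast
  moreover have "(LINT z|lebesgue. g z * ?\<phi> z) = (LINT w|lborel. g w * (bump1 (p - \<gamma> * fst w) * bump1 (q - \<gamma> * snd w)))"
    using ker[OF g, of 0 0] by (subst integral_completion) (auto dest: borel_measurable_integrable)
  moreover have "(LINT z|lebesgue. u z * ((dx UNIV ^^ i) ((dy UNIV ^^ j) ?\<phi>)) z) =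
     (LINT z|lborel. (- \<gamma>) ^ (i + j) * (u z * ((deriv ^^ i) bump1 (p - \<gamma> * fst z) * (deriv ^^ j) bump1 (q - \<gamma> * snd z))))"
  proof -
    have "(\<lambda>z. u z * ((dx UNIV ^^ i) ((dy UNIV ^^ j) ?\<phi>)) z) =
       (\<lambda>z. (- \<gamma>) ^ (i + j) * (u z * ((deriv ^^ i) bump1 (p - \<gamma> * fst z) * (deriv ^^ j) bump1 (q - \<gamma> * snd z))))"
      unfolding D by (simp add: mult_ac)
    then show ?thesis
      using borel_measurable_integrable[OF integrable_mult_right[OF ker[OF u, of i j], of "(- \<gamma>) ^ (i + j)"]]
      by (simp only: integral_completion)
  qed
  moreover have "\<dots> = (- 1) ^ (i + j) * (\<gamma> ^ (i + j) * (LINT z|lborel. u z * ((deriv ^^ i) bump1 (p - \<gamma> * fst z) * (deriv ^^ j) bump1 (q - \<gamma> * snd z))))"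
    unfolding integral_mult_right_zero power_minus[of \<gamma>] by (rule mult.assoc)
  ultimately have "(- 1) ^ (i + j) * (\<gamma> ^ (i + j) * (LINT z|lborel. u z * ((deriv ^^ i) bump1 (p - \<gamma> * fst z) * (deriv ^^ j) bump1 (q - \<gamma> * snd z))))
    = (- 1) ^ (i + j) * (LINT w|lborel. g w * (bump1 (p - \<gamma> * fst w) * bump1 (q - \<gamma> * snd w)))" by (simp only:)
  then show ?thesis by simp
qed

lemma smooth2_kernel:
  assumes g: "integrable lborel g"
  shows "smooth2 (\<lambda>i j z. c * \<alpha> ^ (i + j) * kernel_int g \<alpha> \<gamma> \<beta> ((deriv ^^ i) bump1) ((deriv ^^ j) bump1) z)"
  unfolding smooth2_def
proof (intro allI)
  fix i j z
  let ?K = "\<lambda>i j. kernel_int g \<alpha> \<gamma> \<beta> ((deriv ^^ i) bump1) ((deriv ^^ j) bump1)"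
  have "(?K i j has_derivative (\<lambda>h. fst h * (\<alpha> * ?K (Suc i) j z) + snd h * (\<alpha> * ?K i (Suc j) z))) (at z)"
    using kernel_int_has_derivative[OF g csupp_bump1_iter csupp_bump1_iter] by simp
  from has_derivative_mult_right[OF this, of "c * \<alpha> ^ (i + j)"]
  show "((\<lambda>z. c * \<alpha> ^ (i + j) * ?K i j z) has_derivative
     (\<lambda>h. fst h * (c * \<alpha> ^ (Suc i + j) * ?K (Suc i) j z) + snd h * (c * \<alpha> ^ (i + Suc j) * ?K i (Suc j) z))) (at z)"
    by (simp add: algebra_simps)
qed

lemma smooth2_has_derivative:
  "smooth2 D \<Longrightarrow> (D i j has_derivative (\<lambda>h. fst h * D (Suc i) j z + snd h * D i (Suc j) z)) (at z)"
  unfolding smooth2_def by (drule spec, drule spec, drule spec)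

lemma smooth2_continuous: assumes "smooth2 D" shows "continuous_on S (D i j)"
  using has_derivative_continuous[OF smooth2_has_derivative[OF assms, of i j]]
  by (simp add: continuous_at_imp_continuous_on)

text \<open>Functions are dilated about the centre of the rectangle before they are mollified, so that the
  mollification is defined up to the boundary.\<close>

theorem smooth_approximation:
  fixes g :: "nat \<Rightarrow> nat \<Rightarrow> real \<times> real \<Rightarrow> real"
  assumes ab: "a1 < b1" "a2 < b2"
    and g: "\<And>i j. i + j \<le> k \<Longrightarrow> integrable lborel (g i j)"
    and w: "\<And>i j. i + j \<le> k \<Longrightarrow> is_weak_deriv ({a1<..<b1} \<times> {a2<..<b2}) i j (g 0 0) (g i j)"
  shows "\<exists>D :: nat \<Rightarrow> nat \<Rightarrow> nat \<Rightarrow> real \<times> real \<Rightarrow> real. (\<forall>n. smooth2 (D n)) \<and>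
    (\<forall>i j. i + j \<le> k \<longrightarrow> (\<lambda>n. LINT z:{a1..b1} \<times> {a2..b2}|lborel. \<bar>D n i j z - g i j z\<bar>) \<longlonglongrightarrow> 0)"
proof -
  let ?R = "{a1..b1} \<times> {a2..b2}" and ?\<Omega> = "{a1<..<b1} \<times> {a2<..<b2}"
  define r where "r = min (b1 - a1) (b2 - a2) / 2"
  have r: "r > 0" "r \<le> (b1 - a1) / 2" "r \<le> (b2 - a2) / 2" using ab unfolding r_def by auto
  define \<kappa> where "\<kappa> n = 1 / (real n + 2)" for n
  have \<kappa>: "\<kappa> n > 0" "\<kappa> n \<le> 1/2" for n unfolding \<kappa>_def by (auto simp: field_simps)
  have \<kappa>lim: "\<kappa> \<longlonglongrightarrow> 0"
  proof -
    have "(\<lambda>n. inverse (real (Suc (Suc n)))) \<longlonglongrightarrow> 0" by (rule LIMSEQ_Suc[OF LIMSEQ_inverse_real_of_nat])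
    then show ?thesis unfolding \<kappa>_def by (simp add: inverse_eq_divide add.commute)
  qed
  define l where "l n = 1 - \<kappa> n" for n
  have l: "l n \<in> {1/2..1}" for n using \<kappa>[of n] unfolding l_def by auto
  have llim: "l \<longlonglongrightarrow> 1" unfolding l_def using tendsto_diff[OF tendsto_const \<kappa>lim, of 1] by simp
  \<comment> \<open>The dilation by 1 - \<kappa> about the centre keeps the image of the rectangle
    at distance at least \<kappa> r from its boundary. Kernels of radius \<kappa> r / 2 then stay
    inside even at boundary points.\<close>
  define \<delta> where "\<delta> n = \<kappa> n * r / 2" for n
  have \<delta>: "\<delta> n > 0" for n using \<kappa> r unfolding \<delta>_def by simp
  have \<delta>lim: "\<delta> \<longlonglongrightarrow> 0" unfolding \<delta>_def using tendsto_mult_left_zero[OF \<kappa>lim, of "r / 2"] by simp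
  define s1 where "s1 n = \<kappa> n * ((a1 + b1) / 2)" for n
  define s2 where "s2 n = \<kappa> n * ((a2 + b2) / 2)" for n
  have slim: "s1 \<longlonglongrightarrow> 0" "s2 \<longlonglongrightarrow> 0" unfolding s1_def s2_def by (intro tendsto_mult_left_zero \<kappa>lim)+
  define K where "K n f z = kernel_int f (l n / \<delta> n) (1 / \<delta> n) (s1 n / \<delta> n, s2 n / \<delta> n) bump1 bump1 z / (\<delta> n)\<^sup>2 / bump_mass" for n f z
  define D where "D n i j z = 1 / (\<delta> n)\<^sup>2 / bump_mass * (l n / \<delta> n) ^ (i + j) *
     kernel_int (g 0 0) (l n / \<delta> n) (1 / \<delta> n) (s1 n / \<delta> n, s2 n / \<delta> n) ((deriv ^^ i) bump1) ((deriv ^^ j) bump1) z" for n i j z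
  have sm: "smooth2 (D n)" for n
    unfolding D_def[abs_def] by (rule smooth2_kernel) (use g[of 0 0] in simp)
  have inside: "{(l n / \<delta> n * x + \<kappa> n * ((a + b) / 2) / \<delta> n - 1) / (1 / \<delta> n)..(l n / \<delta> n * x + \<kappa> n * ((a + b) / 2) / \<delta> n + 1) / (1 / \<delta> n)} \<subseteq> {a<..<b}"
    if "x \<in> {a..b}" "r \<le> (b - a) / 2" for n x a b
  proof -
    have 1: "(l n / \<delta> n * x + \<kappa> n * ((a + b) / 2) / \<delta> n - 1) / (1 / \<delta> n) = l n * x + \<kappa> n * ((a + b) / 2) - \<delta> n"
      "(l n / \<delta> n * x + \<kappa> n * ((a + b) / 2) / \<delta> n + 1) / (1 / \<delta> n) = l n * x + \<kappa> n * ((a + b) / 2) + \<delta> n"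
      using \<delta>[of n] by (simp_all add: field_simps)
    have "l n * a \<le> l n * x" "l n * x \<le> l n * b" using that(1) l[of n] by (auto intro: mult_left_mono)
    moreover have "\<kappa> n * r \<le> \<kappa> n * ((b - a) / 2)" "\<kappa> n * r > 0" using that(2) \<kappa>[of n] r by (auto intro: mult_left_mono)
    ultimately have "a < l n * x + \<kappa> n * ((a + b) / 2) - \<delta> n" "l n * x + \<kappa> n * ((a + b) / 2) + \<delta> n < b"
      unfolding l_def \<delta>_def by (simp_all add: algebra_simps diff_divide_distrib add_divide_distrib)
    then show ?thesis unfolding 1 by auto
  qed
  \<comment> \<open>On the closed rectangle the derivatives of the mollified dilation are the
    mollifications of the weak derivatives, up to the power of \<open>l n\<close> due to the
    dilation, which tends to one.\<close>
  have Deq: "D n i j z = l n ^ (i + j) * K n (g i j) z" if ij: "i + j \<le> k" and z: "z \<in> ?R" for n i j z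
  proof -
    have g0: "integrable lborel (g 0 0)" using g[of 0 0] by simp
    have "(1 / \<delta> n) ^ (i + j) * kernel_int (g 0 0) (l n / \<delta> n) (1 / \<delta> n) (s1 n / \<delta> n, s2 n / \<delta> n) ((deriv ^^ i) bump1) ((deriv ^^ j) bump1) z
      = kernel_int (g i j) (l n / \<delta> n) (1 / \<delta> n) (s1 n / \<delta> n, s2 n / \<delta> n) bump1 bump1 z"
      unfolding kernel_int_def
    proof (rule kernel_int_weak_deriv[OF w[OF ij] g0 g[OF ij]])
      show "?\<Omega> \<in> sets borel" by (simp add: borel_open open_Times)
      show "1 / \<delta> n > 0" using \<delta> by simp
      show "{(l n / \<delta> n * fst z + fst (s1 n / \<delta> n, s2 n / \<delta> n) - 1) / (1 / \<delta> n)..(l n / \<delta> n * fst z + fst (s1 n / \<delta> n, s2 n / \<delta> n) + 1) / (1 / \<delta> n)} \<times>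
         {(l n / \<delta> n * snd z + snd (s1 n / \<delta> n, s2 n / \<delta> n) - 1) / (1 / \<delta> n)..(l n / \<delta> n * snd z + snd (s1 n / \<delta> n, s2 n / \<delta> n) + 1) / (1 / \<delta> n)} \<subseteq> ?\<Omega>"
        unfolding s1_def s2_def fst_conv snd_conv using z r by (intro Sigma_mono inside) (auto simp: mem_Times_iff)
    qed
    then have "K n (g i j) z = (1 / \<delta> n) ^ (i + j) * kernel_int (g 0 0) (l n / \<delta> n) (1 / \<delta> n) (s1 n / \<delta> n, s2 n / \<delta> n) ((deriv ^^ i) bump1) ((deriv ^^ j) bump1) z / (\<delta> n)\<^sup>2 / bump_mass"
      unfolding K_def by (simp only:)
    then show ?thesis unfolding D_def power_divide[of "l n"] by (simp add: power_one_over)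
  qed
  have lim: "(\<lambda>n. LINT z:?R|lborel. \<bar>D n i j z - g i j z\<bar>) \<longlonglongrightarrow> 0" if ij: "i + j \<le> k" for i j
  proof -
    let ?g = "g i j"
    note gi = g[OF ij]
    have [measurable]: "?R \<in> sets borel" "?g \<in> borel_measurable borel" using borel_measurable_integrable[OF gi] by (simp_all add: borel_closed closed_Times)
    have [measurable]: "K n ?g \<in> borel_measurable borel" for n
    proof -
      have "continuous_on UNIV (kernel_int ?g (l n / \<delta> n) (1 / \<delta> n) (s1 n / \<delta> n, s2 n / \<delta> n) bump1 bump1)"
        using has_derivative_continuous[OF kernel_int_has_derivative[OF gi csupp_bump1 csupp_bump1]]
        by (simp add: continuous_at_imp_continuous_on)
      then show ?thesis unfolding K_def[abs_def] by (intro borel_measurable_divide borel_measurable_const borel_measurable_continuous_onI)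
    qed
    have nn: "(\<lambda>n. \<integral>\<^sup>+z. ennreal \<bar>K n ?g z - ?g z\<bar> \<partial>lborel) \<longlonglongrightarrow> 0"
      unfolding K_def by (rule kernel_int_tendsto[OF gi \<delta> \<delta>lim l llim slim])
    define N where "N = (LINT z|lborel. \<bar>?g z\<bar>)"
    have N: "(\<integral>\<^sup>+z. ennreal \<bar>?g z\<bar> \<partial>lborel) = ennreal N" "N \<ge> 0"
      unfolding N_def using gi by (auto intro!: nn_integral_eq_integral integral_nonneg_AE)
    have "(\<lambda>n. ennreal ((1 - l n ^ (i + j)) * N)) \<longlonglongrightarrow> ennreal ((1 - 1 ^ (i + j)) * N)"
      by (intro tendsto_ennrealI tendsto_intros llim)
    then have lk: "(\<lambda>n. ennreal (1 - l n ^ (i + j)) * (\<integral>\<^sup>+z. ennreal \<bar>?g z\<bar> \<partial>lborel)) \<longlonglongrightarrow> 0"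
      unfolding N(1) by (simp add: ennreal_mult'' N(2))
    have up: "(\<lambda>n. (\<integral>\<^sup>+z. ennreal \<bar>K n ?g z - ?g z\<bar> \<partial>lborel) + ennreal (1 - l n ^ (i + j)) * (\<integral>\<^sup>+z. ennreal \<bar>?g z\<bar> \<partial>lborel)) \<longlonglongrightarrow> 0"
      using tendsto_add[OF nn lk] by simp
    have "(\<lambda>n. \<integral>\<^sup>+z. ennreal (indicator ?R z * \<bar>D n i j z - ?g z\<bar>) \<partial>lborel) \<longlonglongrightarrow> 0"
    proof (rule tendsto_sandwich[OF _ _ tendsto_const up]; intro always_eventually allI)
      fix n
      have ln: "0 \<le> l n ^ (i + j)" "l n ^ (i + j) \<le> 1" using l[of n] by (auto intro: power_le_one)
      have "(\<integral>\<^sup>+z. ennreal (indicator ?R z * \<bar>D n i j z - ?g z\<bar>) \<partial>lborel) \<le>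
         (\<integral>\<^sup>+z. ennreal \<bar>K n ?g z - ?g z\<bar> + ennreal (1 - l n ^ (i + j)) * ennreal \<bar>?g z\<bar> \<partial>lborel)"
      proof (rule nn_integral_mono)
        fix z
        show "ennreal (indicator ?R z * \<bar>D n i j z - ?g z\<bar>) \<le> ennreal \<bar>K n ?g z - ?g z\<bar> + ennreal (1 - l n ^ (i + j)) * ennreal \<bar>?g z\<bar>"
        proof (cases "z \<in> ?R")
          case True
          have "D n i j z - ?g z = l n ^ (i + j) * (K n ?g z - ?g z) - (1 - l n ^ (i + j)) * ?g z"
            unfolding Deq[OF ij True] by (simp add: algebra_simps)
          then have "\<bar>D n i j z - ?g z\<bar> \<le> \<bar>l n ^ (i + j) * (K n ?g z - ?g z)\<bar> + \<bar>(1 - l n ^ (i + j)) * ?g z\<bar>" by linarith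
          also have "\<dots> \<le> \<bar>K n ?g z - ?g z\<bar> + (1 - l n ^ (i + j)) * \<bar>?g z\<bar>"
            using ln by (simp add: abs_mult mult_left_le_one_le)
          finally show ?thesis using True ln by (simp flip: ennreal_mult ennreal_plus)
        qed simp
      qed
      also have "\<dots> = (\<integral>\<^sup>+z. ennreal \<bar>K n ?g z - ?g z\<bar> \<partial>lborel) + ennreal (1 - l n ^ (i + j)) * (\<integral>\<^sup>+z. ennreal \<bar>?g z\<bar> \<partial>lborel)"
        by (subst nn_integral_add) (auto simp: nn_integral_cmult)
      finally show "(\<integral>\<^sup>+z. ennreal (indicator ?R z * \<bar>D n i j z - ?g z\<bar>) \<partial>lborel) \<le> \<dots>" .
    qed simp
    then have "(\<lambda>n. enn2real (\<integral>\<^sup>+z. ennreal (indicator ?R z * \<bar>D n i j z - ?g z\<bar>) \<partial>lborel)) \<longlonglongrightarrow> enn2real 0"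
      by (intro tendsto_enn2real) auto
    moreover have "(LINT z:?R|lborel. \<bar>D n i j z - ?g z\<bar>) = enn2real (\<integral>\<^sup>+z. ennreal (indicator ?R z * \<bar>D n i j z - ?g z\<bar>) \<partial>lborel)" for n
    proof -
      have [measurable]: "D n i j \<in> borel_measurable borel"
        by (intro borel_measurable_continuous_onI smooth2_continuous sm)
      show ?thesis unfolding set_lebesgue_integral_def real_scaleR_def
        by (rule integral_eq_nn_integral) auto
    qed
    ultimately show ?thesis by simp
  qed
  show ?thesis using sm lim by blast
qed

section \<open>Traces and Poincare inequalities on rectangles\<close>

lemma abs_integral_le:
  fixes f g :: "'a::euclidean_space \<Rightarrow> real"
  assumes "f integrable_on S" "g integrable_on S" "\<And>x. x \<in> S \<Longrightarrow> \<bar>f x\<bar> \<le> g x"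
  shows "\<bar>integral S f\<bar> \<le> integral S g"
  using Henstock_Kurzweil_Integration.integral_norm_bound_integral[OF assms(1,2)] assms(3) by simp

text \<open>Integrating the derivative against this kernel recovers the difference between the value at \<open>s\<close>
  and the mean value.\<close>

definition eval_kernel :: "real \<Rightarrow> real \<Rightarrow> real \<Rightarrow> real \<Rightarrow> real" where
  "eval_kernel a b s t = (if t < s then t - a else t - b) / (b - a)"

lemma eval_kernel_bound: "a < b \<Longrightarrow> s \<in> {a..b} \<Longrightarrow> t \<in> {a..b} \<Longrightarrow> \<bar>eval_kernel a b s t\<bar> \<le> 1"
  by (auto simp: eval_kernel_def abs_if field_simps)

lemma eval_kernel_borel[measurable]: "eval_kernel a b s \<in> borel_measurable borel"
  unfolding eval_kernel_def[abs_def] by measurable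

text \<open>Integrating the derivatives of (t - a) g over [a, s] and of (t - b) g over [s, b] gives
  (s - a) g(s) and (b - s) g(s), which add up to (b - a) g(s).\<close>

lemma point_evaluation:
  fixes g g' :: "real \<Rightarrow> real"
  assumes ab: "a < b" and s: "s \<in> {a..b}"
    and g: "\<And>t. t \<in> {a..b} \<Longrightarrow> (g has_real_derivative g' t) (at t within {a..b})"
  shows "((\<lambda>t. g t / (b - a) + eval_kernel a b s t * g' t) has_integral g s) {a..b}"
proof -
  have der: "((\<lambda>t. (t - c) * g t) has_vector_derivative g t + (t - c) * g' t) (at t within {l..u})"
    if "t \<in> {l..u}" "{l..u} \<subseteq> {a..b}" for l u t c
    unfolding has_real_derivative_iff_has_vector_derivative[symmetric]
    using that DERIV_subset[OF g that(2), of t]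
    by (auto intro!: derivative_eq_intros)
  have 1: "((\<lambda>t. g t + (t - a) * g' t) has_integral (s - a) * g s - (a - a) * g a) {a..s}"
    using s by (intro fundamental_theorem_of_calculus der) auto
  have 2: "((\<lambda>t. g t + (t - b) * g' t) has_integral (b - b) * g b - (s - b) * g s) {s..b}"
    using s by (intro fundamental_theorem_of_calculus der) auto
  have c1: "((\<lambda>t. (b - a) * (g t / (b - a) + eval_kernel a b s t * g' t)) has_integral (s - a) * g s - (a - a) * g a) {a..s}"
    by (rule has_integral_spike[OF negligible_sing[of s] _ 1]) (use ab in \<open>auto simp: eval_kernel_def distrib_left\<close>)
  have c2: "((\<lambda>t. (b - a) * (g t / (b - a) + eval_kernel a b s t * g' t)) has_integral (b - b) * g b - (s - b) * g s) {s..b}"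
    by (rule has_integral_spike[OF negligible_sing[of s] _ 2]) (use ab in \<open>auto simp: eval_kernel_def distrib_left\<close>)
  have "((\<lambda>t. (b - a) * (g t / (b - a) + eval_kernel a b s t * g' t)) has_integral (b - a) * g s) {a..b}"
    using has_integral_combine[OF _ _ c1 c2] s by (simp add: left_diff_distrib)
  from has_integral_mult_right[OF this, of "1 / (b - a)"] show ?thesis using ab by simp
qed

lemma
  fixes g g' :: "real \<Rightarrow> real"
  assumes ab: "a < b" and s: "s \<in> {a..b}"
    and g: "\<And>t. t \<in> {a..b} \<Longrightarrow> (g has_real_derivative g' t) (at t within {a..b})"
    and g': "continuous_on {a..b} g'"
  shows point_value_le: "\<bar>g s\<bar> \<le> integral {a..b} (\<lambda>t. \<bar>g t\<bar>) / (b - a) + integral {a..b} (\<lambda>t. \<bar>g' t\<bar>)"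
    and point_value_mean_le: "\<bar>g s - integral {a..b} g / (b - a)\<bar> \<le> integral {a..b} (\<lambda>t. \<bar>g' t\<bar>)"
proof -
  have P: "((\<lambda>t. g t / (b - a) + eval_kernel a b s t * g' t) has_integral g s) {a..b}"
    by (rule point_evaluation[OF ab s g])
  have cg: "continuous_on {a..b} g" using g by (rule DERIV_continuous_on)
  have ig: "(\<lambda>t. g t / (b - a)) integrable_on {a..b}" "(\<lambda>t. \<bar>g t\<bar> / (b - a)) integrable_on {a..b}" "(\<lambda>t. \<bar>g' t\<bar>) integrable_on {a..b}"
    using ab by (auto intro!: integrable_continuous_interval continuous_intros cg g')
  have "\<bar>integral {a..b} (\<lambda>t. g t / (b - a) + eval_kernel a b s t * g' t)\<bar> \<le> integral {a..b} (\<lambda>t. \<bar>g t\<bar> / (b - a) + \<bar>g' t\<bar>)"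
  proof (rule abs_integral_le)
    show "(\<lambda>t. g t / (b - a) + eval_kernel a b s t * g' t) integrable_on {a..b}" using P by blast
    show "(\<lambda>t. \<bar>g t\<bar> / (b - a) + \<bar>g' t\<bar>) integrable_on {a..b}" using ig by (intro integrable_add)
    show "\<bar>g t / (b - a) + eval_kernel a b s t * g' t\<bar> \<le> \<bar>g t\<bar> / (b - a) + \<bar>g' t\<bar>" if "t \<in> {a..b}" for t
    proof -
      have "\<bar>eval_kernel a b s t * g' t\<bar> \<le> \<bar>g' t\<bar>"
        using eval_kernel_bound[OF ab s that] by (simp add: abs_mult mult_left_le_one_le)
      moreover have "\<bar>g t / (b - a)\<bar> = \<bar>g t\<bar> / (b - a)" using ab by simp
      ultimately show ?thesis by linarith
    qed
  qed
  then show "\<bar>g s\<bar> \<le> integral {a..b} (\<lambda>t. \<bar>g t\<bar>) / (b - a) + integral {a..b} (\<lambda>t. \<bar>g' t\<bar>)"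
    unfolding integral_unique[OF P] using ig by (simp add: integral_add)
  have ki: "(\<lambda>t. eval_kernel a b s t * g' t) integrable_on {a..b}"
    using integrable_diff[OF has_integral_integrable[OF P] ig(1)] by simp
  have "\<bar>integral {a..b} (\<lambda>t. eval_kernel a b s t * g' t)\<bar> \<le> integral {a..b} (\<lambda>t. \<bar>g' t\<bar>)"
  proof (rule abs_integral_le[OF ki ig(3)])
    show "\<bar>eval_kernel a b s t * g' t\<bar> \<le> \<bar>g' t\<bar>" if "t \<in> {a..b}" for t
      using eval_kernel_bound[OF ab s that] by (simp add: abs_mult mult_left_le_one_le)
  qed
  moreover have "g s = integral {a..b} (\<lambda>t. g t / (b - a)) + integral {a..b} (\<lambda>t. eval_kernel a b s t * g' t)"
    using integral_unique[OF P] integral_add[OF ig(1) ki] by simp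
  ultimately show "\<bar>g s - integral {a..b} g / (b - a)\<bar> \<le> integral {a..b} (\<lambda>t. \<bar>g' t\<bar>)" by simp
qed

lemma
  fixes f :: "real \<times> real \<Rightarrow> real"
  assumes f: "continuous_on (cbox (a1, a2) (b1, b2)) f"
  shows integral_box_xy: "integral (cbox (a1, a2) (b1, b2)) f = integral {a1..b1} (\<lambda>x. integral {a2..b2} (\<lambda>y. f (x, y)))"
    and integral_box_yx: "integral (cbox (a1, a2) (b1, b2)) f = integral {a2..b2} (\<lambda>y. integral {a1..b1} (\<lambda>x. f (x, y)))"
    and continuous_box_slice_x: "y \<in> {a2..b2} \<Longrightarrow> continuous_on {a1..b1} (\<lambda>x. f (x, y))"
    and continuous_box_slice_y: "x \<in> {a1..b1} \<Longrightarrow> continuous_on {a2..b2} (\<lambda>y. f (x, y))"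
    and continuous_box_integral_y: "continuous_on {a1..b1} (\<lambda>x. integral {a2..b2} (\<lambda>y. f (x, y)))"
    and continuous_box_integral_x: "continuous_on {a2..b2} (\<lambda>y. integral {a1..b1} (\<lambda>x. f (x, y)))"
proof -
  show xy: "integral (cbox (a1, a2) (b1, b2)) f = integral {a1..b1} (\<lambda>x. integral {a2..b2} (\<lambda>y. f (x, y)))"
    using integral_prod_continuous[OF f] by simp
  show "integral (cbox (a1, a2) (b1, b2)) f = integral {a2..b2} (\<lambda>y. integral {a1..b1} (\<lambda>x. f (x, y)))"
    unfolding xy using integral_swap_continuous[of a1 a2 b1 b2 "\<lambda>x y. f (x, y)"] f by simp
  have f': "continuous_on ({a1..b1} \<times> {a2..b2}) f" using f by (simp add: cbox_Pair_eq)
  show "y \<in> {a2..b2} \<Longrightarrow> continuous_on {a1..b1} (\<lambda>x. f (x, y))"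
    by (rule continuous_on_compose2[OF f']) (auto intro!: continuous_intros)
  show "x \<in> {a1..b1} \<Longrightarrow> continuous_on {a2..b2} (\<lambda>y. f (x, y))"
    by (rule continuous_on_compose2[OF f']) (auto intro!: continuous_intros)
  show "continuous_on {a1..b1} (\<lambda>x. integral {a2..b2} (\<lambda>y. f (x, y)))"
    using integral_continuous_on_param[of "{a1..b1}" a2 b2 "\<lambda>x y. f (x, y)"] f' by simp
  have "continuous_on ({a2..b2} \<times> {a1..b1}) (\<lambda>p. f (snd p, fst p))"
    by (rule continuous_on_compose2[OF f']) (auto intro!: continuous_intros)
  then show "continuous_on {a2..b2} (\<lambda>y. integral {a1..b1} (\<lambda>x. f (x, y)))"
    using integral_continuous_on_param[of "{a2..b2}" a1 b1 "\<lambda>y x. f (x, y)"] by (simp add: case_prod_unfold)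
qed

text \<open>Derivatives are recorded only along axis-parallel lines inside the closed rectangle. The
  representation formulas work line by line, and both the families of \<open>smooth2\<close> and
  functions with \<open>cont_diff 1\<close> fit in.\<close>

locale C1_box =
  fixes a1 b1 a2 b2 :: real and f fx fy :: "real \<times> real \<Rightarrow> real"
  assumes a1b1: "a1 < b1" and a2b2: "a2 < b2"
    and cfx: "continuous_on (cbox (a1, a2) (b1, b2)) fx" and cfy: "continuous_on (cbox (a1, a2) (b1, b2)) fy"
    and cf: "continuous_on (cbox (a1, a2) (b1, b2)) f"
    and dfx: "x \<in> {a1..b1} \<Longrightarrow> y \<in> {a2..b2} \<Longrightarrow> ((\<lambda>x. f (x, y)) has_real_derivative fx (x, y)) (at x within {a1..b1})"
    and dfy: "x \<in> {a1..b1} \<Longrightarrow> y \<in> {a2..b2} \<Longrightarrow> ((\<lambda>y. f (x, y)) has_real_derivative fy (x, y)) (at y within {a2..b2})"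
begin

abbreviation "R \<equiv> cbox (a1, a2) (b1, b2)"

lemmas cabs = continuous_on_rabs[OF cf] continuous_on_rabs[OF cfx] continuous_on_rabs[OF cfy]

text \<open>The one-dimensional evaluation bound is applied across the line and integrated along it,
  so only the transversal derivative occurs.\<close>

lemma horizontal_trace_le:
  assumes "y \<in> {a2..b2}"
  shows "integral {a1..b1} (\<lambda>x. \<bar>f (x, y)\<bar>) \<le> integral R (\<lambda>z. \<bar>f z\<bar>) / (b2 - a2) + integral R (\<lambda>z. \<bar>fy z\<bar>)"
proof -
  have "integral {a1..b1} (\<lambda>x. \<bar>f (x, y)\<bar>) \<le> integral {a1..b1} (\<lambda>x. integral {a2..b2} (\<lambda>y. \<bar>f (x, y)\<bar>) / (b2 - a2) + integral {a2..b2} (\<lambda>y. \<bar>fy (x, y)\<bar>))"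
  proof (rule integral_le)
    show "\<bar>f (x, y)\<bar> \<le> integral {a2..b2} (\<lambda>y. \<bar>f (x, y)\<bar>) / (b2 - a2) + integral {a2..b2} (\<lambda>y. \<bar>fy (x, y)\<bar>)" if "x \<in> {a1..b1}" for x
      by (rule point_value_le[OF a2b2 assms dfy[OF that] continuous_box_slice_y[OF cfy that]])
  qed (use a2b2 in \<open>auto intro!: integrable_continuous_interval continuous_intros continuous_box_slice_x[OF cf assms] continuous_box_integral_y[OF cabs(1)] continuous_box_integral_y[OF cabs(3)]\<close>)
  also have "\<dots> = integral R (\<lambda>z. \<bar>f z\<bar>) / (b2 - a2) + integral R (\<lambda>z. \<bar>fy z\<bar>)"
    unfolding integral_box_xy[OF cabs(1)] integral_box_xy[OF cabs(3)] using a2b2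
    by (subst integral_add) (auto intro!: integrable_continuous_interval continuous_intros continuous_box_integral_y[OF cabs(1)] continuous_box_integral_y[OF cabs(3)])
  finally show ?thesis .
qed

lemma vertical_trace_le:
  assumes "x \<in> {a1..b1}"
  shows "integral {a2..b2} (\<lambda>y. \<bar>f (x, y)\<bar>) \<le> integral R (\<lambda>z. \<bar>f z\<bar>) / (b1 - a1) + integral R (\<lambda>z. \<bar>fx z\<bar>)"
proof -
  have "integral {a2..b2} (\<lambda>y. \<bar>f (x, y)\<bar>) \<le> integral {a2..b2} (\<lambda>y. integral {a1..b1} (\<lambda>x. \<bar>f (x, y)\<bar>) / (b1 - a1) + integral {a1..b1} (\<lambda>x. \<bar>fx (x, y)\<bar>))"
  proof (rule integral_le)
    show "\<bar>f (x, y)\<bar> \<le> integral {a1..b1} (\<lambda>x. \<bar>f (x, y)\<bar>) / (b1 - a1) + integral {a1..b1} (\<lambda>x. \<bar>fx (x, y)\<bar>)" if "y \<in> {a2..b2}" for y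
      by (rule point_value_le[OF a1b1 assms dfx[OF _ that] continuous_box_slice_x[OF cfx that]])
  qed (use a1b1 in \<open>auto intro!: integrable_continuous_interval continuous_intros continuous_box_slice_y[OF cf assms] continuous_box_integral_x[OF cabs(1)] continuous_box_integral_x[OF cabs(2)]\<close>)
  also have "\<dots> = integral R (\<lambda>z. \<bar>f z\<bar>) / (b1 - a1) + integral R (\<lambda>z. \<bar>fx z\<bar>)"
    unfolding integral_box_yx[OF cabs(1)] integral_box_yx[OF cabs(2)] using a1b1
    by (subst integral_add) (auto intro!: integrable_continuous_interval continuous_intros continuous_box_integral_x[OF cabs(1)] continuous_box_integral_x[OF cabs(2)])
  finally show ?thesis .
qed

abbreviation "mean \<equiv> integral R f / ((b1 - a1) * (b2 - a2))"

text \<open>The value is compared with the mean over the horizontal line through the point, and this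
  mean with the mean over the rectangle. The first comparison is the origin of the line integral in
  the final pointwise bound.\<close>

lemma pointwise_poincare:
  assumes x: "x \<in> {a1..b1}" and y: "y \<in> {a2..b2}"
  shows "\<bar>f (x, y) - mean\<bar> \<le> integral {a1..b1} (\<lambda>x. \<bar>fx (x, y)\<bar>) + integral R (\<lambda>z. \<bar>fy z\<bar>) / (b1 - a1)"
proof -
  let ?m = "\<lambda>y. integral {a1..b1} (\<lambda>x. f (x, y)) / (b1 - a1)"
  have 1: "\<bar>f (x, y) - ?m y\<bar> \<le> integral {a1..b1} (\<lambda>x. \<bar>fx (x, y)\<bar>)"
    by (rule point_value_mean_le[OF a1b1 x dfx[OF _ y] continuous_box_slice_x[OF cfx y]])
  let ?d = "\<lambda>x. f (x, y) - integral {a2..b2} (\<lambda>y. f (x, y)) / (b2 - a2)"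
  have "integral {a1..b1} ?d = integral {a1..b1} (\<lambda>x. f (x, y)) - integral R f / (b2 - a2)"
    unfolding integral_box_xy[OF cf] using a2b2
    by (subst integral_diff) (auto intro!: integrable_continuous_interval continuous_intros continuous_box_slice_x[OF cf y] continuous_box_integral_y[OF cf])
  then have eq: "?m y - mean = integral {a1..b1} ?d / (b1 - a1)"
    using a1b1 a2b2 by (simp add: diff_divide_distrib mult.commute)
  have "\<bar>integral {a1..b1} ?d\<bar> \<le> integral {a1..b1} (\<lambda>x. integral {a2..b2} (\<lambda>y. \<bar>fy (x, y)\<bar>))"
  proof (rule abs_integral_le)
    show "\<bar>?d x\<bar> \<le> integral {a2..b2} (\<lambda>y. \<bar>fy (x, y)\<bar>)" if "x \<in> {a1..b1}" for x
      by (rule point_value_mean_le[OF a2b2 y dfy[OF that] continuous_box_slice_y[OF cfy that]])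
  qed (use a2b2 in \<open>auto intro!: integrable_continuous_interval continuous_intros continuous_box_slice_x[OF cf y] continuous_box_integral_y[OF cf] continuous_box_integral_y[OF cabs(3)]\<close>)
  also have "\<dots> = integral R (\<lambda>z. \<bar>fy z\<bar>)" by (rule integral_box_xy[OF cabs(3), symmetric])
  finally have "\<bar>?m y - mean\<bar> \<le> integral R (\<lambda>z. \<bar>fy z\<bar>) / (b1 - a1)"
    unfolding eq using a1b1 by (simp add: divide_right_mono)
  with 1 show ?thesis by linarith
qed

text \<open>The pointwise version integrated over the rectangle: the line integrals become area
  integrals, and each side length appears with constant one.\<close>

lemma L1_poincare:
  "integral R (\<lambda>z. \<bar>f z - mean\<bar>) \<le> (b1 - a1) * integral R (\<lambda>z. \<bar>fx z\<bar>) + (b2 - a2) * integral R (\<lambda>z. \<bar>fy z\<bar>)"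
proof -
  have c: "continuous_on R (\<lambda>z. \<bar>f z - mean\<bar>)" by (intro continuous_intros cf)
  let ?u = "\<lambda>y. integral {a1..b1} (\<lambda>x. \<bar>fx (x, y)\<bar>)" and ?B = "integral R (\<lambda>z. \<bar>fy z\<bar>) / (b1 - a1)"
  have "integral R (\<lambda>z. \<bar>f z - mean\<bar>) = integral {a2..b2} (\<lambda>y. integral {a1..b1} (\<lambda>x. \<bar>f (x, y) - mean\<bar>))"
    by (rule integral_box_yx[OF c])
  also have "\<dots> \<le> integral {a2..b2} (\<lambda>y. (b1 - a1) * ?u y + (b1 - a1) * ?B)"
  proof (rule integral_le)
    fix y assume y: "y \<in> {a2..b2}"
    have "integral {a1..b1} (\<lambda>x. \<bar>f (x, y) - mean\<bar>) \<le> integral {a1..b1} (\<lambda>x. ?u y + ?B)"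
      by (rule integral_le) (use pointwise_poincare[OF _ y] in \<open>auto intro!: integrable_continuous_interval continuous_box_slice_x[OF c y]\<close>)
    also have "\<dots> = (b1 - a1) * ?u y + (b1 - a1) * ?B" using a1b1 by (simp add: distrib_left)
    finally show "integral {a1..b1} (\<lambda>x. \<bar>f (x, y) - mean\<bar>) \<le> (b1 - a1) * ?u y + (b1 - a1) * ?B" .
  qed (auto intro!: integrable_continuous_interval continuous_intros continuous_box_integral_x[OF c] continuous_box_integral_x[OF cabs(2)])
  also have "\<dots> = (b1 - a1) * integral R (\<lambda>z. \<bar>fx z\<bar>) + (b2 - a2) * integral R (\<lambda>z. \<bar>fy z\<bar>)"
    unfolding integral_box_yx[OF cabs(2)] using a1b1 a2b2
    by (subst integral_add) (auto intro!: integrable_continuous_interval continuous_intros continuous_box_integral_x[OF cabs(2)])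
  finally show ?thesis .
qed

text \<open>Evaluation in one variable after the other. Among the second derivatives only the mixed
  one enters, which gives the embedding of W_{2,1} into the continuous functions in an explicit
  form.\<close>

lemma sup_le:
  assumes fxy: "continuous_on R fxy"
    and dfxy: "\<And>x y. x \<in> {a1..b1} \<Longrightarrow> y \<in> {a2..b2} \<Longrightarrow> ((\<lambda>y. fx (x, y)) has_real_derivative fxy (x, y)) (at y within {a2..b2})"
    and x: "x \<in> {a1..b1}" and y: "y \<in> {a2..b2}"
  shows "\<bar>f (x, y)\<bar> \<le> integral R (\<lambda>z. \<bar>f z\<bar>) / ((b1 - a1) * (b2 - a2)) + integral R (\<lambda>z. \<bar>fx z\<bar>) / (b2 - a2)
     + integral R (\<lambda>z. \<bar>fy z\<bar>) / (b1 - a1) + integral R (\<lambda>z. \<bar>fxy z\<bar>)"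
proof -
  note cfxy = continuous_on_rabs[OF fxy]
  have fx_le: "integral {a1..b1} (\<lambda>x. \<bar>fx (x, y)\<bar>) \<le> integral R (\<lambda>z. \<bar>fx z\<bar>) / (b2 - a2) + integral R (\<lambda>z. \<bar>fxy z\<bar>)"
  proof -
    have "integral {a1..b1} (\<lambda>x. \<bar>fx (x, y)\<bar>) \<le> integral {a1..b1} (\<lambda>x. integral {a2..b2} (\<lambda>y. \<bar>fx (x, y)\<bar>) / (b2 - a2) + integral {a2..b2} (\<lambda>y. \<bar>fxy (x, y)\<bar>))"
    proof (rule integral_le)
      show "\<bar>fx (x, y)\<bar> \<le> integral {a2..b2} (\<lambda>y. \<bar>fx (x, y)\<bar>) / (b2 - a2) + integral {a2..b2} (\<lambda>y. \<bar>fxy (x, y)\<bar>)" if "x \<in> {a1..b1}" for x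
        by (rule point_value_le[OF a2b2 y dfxy[OF that] continuous_box_slice_y[OF fxy that]])
    qed (use a2b2 in \<open>auto intro!: integrable_continuous_interval continuous_intros continuous_box_slice_x[OF cfx y] continuous_box_integral_y[OF cabs(2)] continuous_box_integral_y[OF cfxy]\<close>)
    also have "\<dots> = integral R (\<lambda>z. \<bar>fx z\<bar>) / (b2 - a2) + integral R (\<lambda>z. \<bar>fxy z\<bar>)"
      unfolding integral_box_xy[OF cabs(2)] integral_box_xy[OF cfxy] using a2b2
      by (subst integral_add) (auto intro!: integrable_continuous_interval continuous_intros continuous_box_integral_y[OF cabs(2)] continuous_box_integral_y[OF cfxy])
    finally show ?thesis .
  qed
  have "\<bar>f (x, y)\<bar> \<le> integral {a1..b1} (\<lambda>x. \<bar>f (x, y)\<bar>) / (b1 - a1) + integral {a1..b1} (\<lambda>x. \<bar>fx (x, y)\<bar>)"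
    by (rule point_value_le[OF a1b1 x dfx[OF _ y] continuous_box_slice_x[OF cfx y]])
  also have "integral {a1..b1} (\<lambda>x. \<bar>f (x, y)\<bar>) / (b1 - a1) \<le> (integral R (\<lambda>z. \<bar>f z\<bar>) / (b2 - a2) + integral R (\<lambda>z. \<bar>fy z\<bar>)) / (b1 - a1)"
    using a1b1 by (intro divide_right_mono horizontal_trace_le[OF y]) auto
  finally show ?thesis using fx_le by (simp add: add_divide_distrib mult.commute)
qed

end

section \<open>Hermite splines and dual functions\<close>

text \<open>The index \<open>i\<close> is the order of the derivative; orders above two are not used. At the break point
  \<open>a + r\<close> the second derivative has an arbitrary value.\<close>

definition quad_spline :: "real \<Rightarrow> real \<Rightarrow> real \<Rightarrow> real \<Rightarrow> real \<Rightarrow> real \<Rightarrow> nat \<Rightarrow> real \<Rightarrow> real" where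
  "quad_spline a r c0 c1 c2 c3 i t =
    (if i = 0 then c0 + c1 * (t - a) + c2 * (t - a)\<^sup>2 + c3 * (max 0 (t - (a + r)))\<^sup>2
     else if i = 1 then c1 + 2 * c2 * (t - a) + 2 * c3 * max 0 (t - (a + r))
     else 2 * c2 + (if t > a + r then 2 * c3 else 0))"

text \<open>The remainder is at most h^2 wherever t and t + h lie relative to m, which settles the
  kink without one-sided limits.\<close>

lemma truncated_square_has_derivative:
  "((\<lambda>t. (max 0 (t - m))\<^sup>2) has_real_derivative 2 * max 0 (t - m)) (at (t::real))"
proof -
  have "\<bar>(max 0 (t + h - m))\<^sup>2 - (max 0 (t - m))\<^sup>2 - 2 * max 0 (t - m) * h\<bar> \<le> 1 * (norm h)\<^sup>2" for h
  proof -
    consider "t - m \<ge> 0" "t + h - m \<ge> 0" | "t - m < 0" "t + h - m < 0" | "t - m \<ge> 0" "t + h - m < 0" | "t - m < 0" "t + h - m \<ge> 0"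
      by linarith
    then show ?thesis
    proof cases
      case 1 then show ?thesis by (simp add: power2_eq_square algebra_simps)
    next
      case 2 then show ?thesis by simp
    next
      case 3
      have "0 \<le> (t - m) * - (t - m + 2 * h)" using 3 by (intro mult_nonneg_nonneg) linarith+
      moreover have "(t - m) * - (t - m + 2 * h) = h\<^sup>2 - (t - m + h)\<^sup>2" by (simp add: power2_eq_square algebra_simps)
      moreover have "(max 0 (t + h - m))\<^sup>2 - (max 0 (t - m))\<^sup>2 - 2 * max 0 (t - m) * h = (t - m) * - (t - m + 2 * h)"
        using 3 by (simp add: power2_eq_square algebra_simps)
      ultimately show ?thesis by simp
    next
      case 4
      then have "(t + h - m)\<^sup>2 \<le> h\<^sup>2" by (intro power_mono) auto
      moreover have "max 0 (t + h - m) = t + h - m" "max 0 (t - m) = 0" using 4 by auto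
      ultimately show ?thesis by simp
    qed
  qed
  then have "((\<lambda>t. (max 0 (t - m))\<^sup>2) has_derivative (\<lambda>h. 2 * max 0 (t - m) * h)) (at t)"
    by (intro has_derivative_quadratic_boundI[where B=1]) (auto intro: bounded_linear_mult_right)
  then show ?thesis by (simp add: has_field_derivative_def)
qed

lemma quad_spline_deriv0:
  "(quad_spline a r c0 c1 c2 c3 0 has_real_derivative quad_spline a r c0 c1 c2 c3 1 t) (at t)"
proof -
  have "((\<lambda>t. c0 + c1 * (t - a) + c2 * (t - a)\<^sup>2 + c3 * (max 0 (t - (a + r)))\<^sup>2) has_real_derivative
     c1 + 2 * c2 * (t - a) + c3 * (2 * max 0 (t - (a + r)))) (at t)"
    by (rule DERIV_add) (auto intro!: derivative_eq_intros DERIV_cmult truncated_square_has_derivative simp del: max_less_iff_conj)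
  then show ?thesis unfolding quad_spline_def by (simp add: mult_ac)
qed

lemma quad_spline_deriv1:
  assumes "t \<noteq> a + r"
  shows "(quad_spline a r c0 c1 c2 c3 1 has_real_derivative quad_spline a r c0 c1 c2 c3 2 t) (at t)"
proof (cases "t > a + r")
  case True
  have "((\<lambda>t. c1 + 2 * c2 * (t - a) + 2 * c3 * (t - (a + r))) has_real_derivative quad_spline a r c0 c1 c2 c3 2 t) (at t)"
    using True by (auto intro!: derivative_eq_intros simp: quad_spline_def)
  then show ?thesis
    by (rule has_field_derivative_transform_within_open[of _ _ _ "{a + r<..}"]) (use True in \<open>auto simp: quad_spline_def\<close>)
next
  case False
  have "((\<lambda>t. c1 + 2 * c2 * (t - a)) has_real_derivative quad_spline a r c0 c1 c2 c3 2 t) (at t)"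
    using False by (auto intro!: derivative_eq_intros simp: quad_spline_def)
  then show ?thesis
    by (rule has_field_derivative_transform_within_open[of _ _ _ "{..<a + r}"]) (use False assms in \<open>auto simp: quad_spline_def\<close>)
qed

lemma quad_spline_continuous: "i \<le> 1 \<Longrightarrow> continuous_on S (quad_spline a r c0 c1 c2 c3 i)"
  unfolding quad_spline_def[abs_def] by (auto simp: le_Suc_eq intro!: continuous_intros)

lemma quad_spline_borel[measurable]: "quad_spline a r c0 c1 c2 c3 i \<in> borel_measurable borel"
  unfolding quad_spline_def[abs_def] by measurable

text \<open>The Hermite conditions solved explicitly in powers of t - a and the truncated square at
  the midpoint. In contrast to \<open>phi\<close>, nothing is cut off outside [a, b], and the order
  of the derivative is an argument. Every \<open>e\<close> other than \<open>a\<close> is treated as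
  \<open>b\<close>.\<close>

definition hphi :: "real \<Rightarrow> real \<Rightarrow> real \<Rightarrow> nat \<Rightarrow> real \<Rightarrow> real" where
  "hphi a b e = (let r = (b - a) / 2 in if e = a then quad_spline a r 1 0 (- 1 / (2 * r\<^sup>2)) (1 / r\<^sup>2)
     else quad_spline a r 0 0 (1 / (2 * r\<^sup>2)) (- 1 / r\<^sup>2))"

definition hpsi :: "real \<Rightarrow> real \<Rightarrow> real \<Rightarrow> nat \<Rightarrow> real \<Rightarrow> real" where
  "hpsi a b e = (let r = (b - a) / 2 in if e = a then quad_spline a r 0 1 (- 3 / (4 * r)) (1 / r)
     else quad_spline a r 0 0 (- 1 / (4 * r)) (1 / r))"

lemma half_length: assumes "a < (b::real)" obtains r where "b = a + 2 * r" "r > 0"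
  by (rule that[of "(b - a) / 2"]) (use assms in \<open>simp_all add: field_simps\<close>)

text \<open>This and the next two identities express that Hermite interpolation reproduces 1, t and
  t^2 together with two derivatives; the coefficients on the left are the Hermite data of these
  monomials.\<close>

lemma hphi_partition:
  assumes "a < b" "i \<le> 2"
  shows "hphi a b a i t + hphi a b b i t = of_bool (i = 0)"
  using assms by (auto simp: hphi_def Let_def quad_spline_def)

lemma hermite_linear:
  assumes "a < b" "i \<le> 2"
  shows "a * hphi a b a i t + b * hphi a b b i t + hpsi a b a i t + hpsi a b b i t = (if i = 0 then t else of_bool (i = 1))"
proof -
  obtain r where r: "b = a + 2 * r" "r > 0" using half_length[OF assms(1)] by blast
  show ?thesis using r(2) unfolding r(1) hphi_def hpsi_def Let_def quad_spline_def
    by (auto simp: divide_simps power2_eq_square) (simp_all add: algebra_simps)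
qed

lemma hermite_quadratic:
  assumes "a < b" "i \<le> 2"
  shows "a\<^sup>2 * hphi a b a i t + b\<^sup>2 * hphi a b b i t + 2 * a * hpsi a b a i t + 2 * b * hpsi a b b i t
    = (if i = 0 then t\<^sup>2 else if i = 1 then 2 * t else 2)"
proof -
  obtain r where r: "b = a + 2 * r" "r > 0" using half_length[OF assms(1)] by blast
  show ?thesis using r(2) unfolding r(1) hphi_def hpsi_def Let_def quad_spline_def
    by (auto simp: divide_simps power2_eq_square) (simp_all add: algebra_simps)
qed

lemma abs_sum4: "\<bar>x1 + x2 + x3 + x4 :: real\<bar> \<le> \<bar>x1\<bar> + \<bar>x2\<bar> + \<bar>x3\<bar> + \<bar>x4\<bar>"
  by arith

text \<open>The weights of the coefficients make the bound scale like r to the power -i. The factor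
  4 comes from the square of t - a, which is at most 2 r.\<close>

lemma quad_spline_bound:
  assumes r: "r > 0" and t: "t \<in> {a..a + 2 * r}" and i: "i \<le> 2"
  shows "\<bar>quad_spline a r c0 c1 c2 c3 i t\<bar> \<le> 4 * (\<bar>c0\<bar> + r * \<bar>c1\<bar> + r\<^sup>2 * \<bar>c2\<bar> + r\<^sup>2 * \<bar>c3\<bar>) / r ^ i"
proof -
  define s where "s = t - a"
  define q where "q = max 0 (t - (a + r))"
  have s: "0 \<le> s" "s \<le> 2 * r" and q: "0 \<le> q" "q \<le> r" using t r unfolding s_def q_def by auto
  have s2: "s\<^sup>2 \<le> 4 * r\<^sup>2" using power_mono[OF s(2) s(1), of 2] by (simp add: power_mult_distrib)
  have q2: "q\<^sup>2 \<le> r\<^sup>2" using power_mono[OF q(2) q(1), of 2] .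
  have nn: "\<bar>c1\<bar> * r \<ge> 0" "\<bar>c2\<bar> * r\<^sup>2 \<ge> 0" "\<bar>c3\<bar> * r\<^sup>2 \<ge> 0" "\<bar>c2\<bar> * r \<ge> 0" "\<bar>c3\<bar> * r \<ge> 0" using r by auto
  consider "i = 0" | "i = 1" | "i = 2" using i by linarith
  then show ?thesis
  proof cases
    case 1
    have "\<bar>c0 + c1 * s + c2 * s\<^sup>2 + c3 * q\<^sup>2\<bar> \<le> \<bar>c0\<bar> + \<bar>c1\<bar> * s + \<bar>c2\<bar> * s\<^sup>2 + \<bar>c3\<bar> * q\<^sup>2"
      using abs_sum4[of c0 "c1 * s" "c2 * s\<^sup>2" "c3 * q\<^sup>2"] unfolding abs_mult abs_of_nonneg[OF s(1)] abs_power2 .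
    also have "\<dots> \<le> \<bar>c0\<bar> + \<bar>c1\<bar> * (2 * r) + \<bar>c2\<bar> * (4 * r\<^sup>2) + \<bar>c3\<bar> * r\<^sup>2"
      by (intro add_mono mult_left_mono s q s2 q2) auto
    also have "\<dots> \<le> 4 * (\<bar>c0\<bar> + r * \<bar>c1\<bar> + r\<^sup>2 * \<bar>c2\<bar> + r\<^sup>2 * \<bar>c3\<bar>)"
      using nn abs_ge_zero[of c0] by (simp only: distrib_left mult.commute mult.left_commute)
    finally show ?thesis unfolding 1 quad_spline_def s_def[symmetric] q_def[symmetric] by simp
  next
    case 2
    have "\<bar>c1 + 2 * c2 * s + 2 * c3 * q\<bar> \<le> \<bar>c1\<bar> + 2 * \<bar>c2\<bar> * s + 2 * \<bar>c3\<bar> * q"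
      using abs_sum4[of c1 "2 * c2 * s" "2 * c3 * q" 0] unfolding abs_mult abs_of_nonneg[OF s(1)] abs_of_nonneg[OF q(1)] by simp
    also have "\<dots> \<le> \<bar>c1\<bar> + 2 * \<bar>c2\<bar> * (2 * r) + 2 * \<bar>c3\<bar> * r"
      by (intro add_mono mult_left_mono s q) auto
    also have "\<dots> \<le> 4 * (\<bar>c0\<bar> + r * \<bar>c1\<bar> + r\<^sup>2 * \<bar>c2\<bar> + r\<^sup>2 * \<bar>c3\<bar>) / r"
      using nn r by (simp add: pos_le_divide_eq algebra_simps power2_eq_square)
    finally show ?thesis unfolding 2 quad_spline_def s_def[symmetric] q_def[symmetric] by simp
  next
    case 3
    have "\<bar>2 * c2 + (if t > a + r then 2 * c3 else 0)\<bar> \<le> 2 * \<bar>c2\<bar> + 2 * \<bar>c3\<bar>" by auto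
    also have "\<dots> \<le> 4 * (\<bar>c0\<bar> + r * \<bar>c1\<bar> + r\<^sup>2 * \<bar>c2\<bar> + r\<^sup>2 * \<bar>c3\<bar>) / r\<^sup>2"
      using nn r by (simp add: pos_le_divide_eq algebra_simps)
    finally show ?thesis unfolding 3 quad_spline_def by simp
  qed
qed

lemma power_half_bound: "i \<le> 2 \<Longrightarrow> 0 < h \<Longrightarrow> 1 / (h / 2) ^ i \<le> 4 / (h::real) ^ i"
  by (auto simp: le_Suc_eq numeral_2_eq_2 power_divide field_simps)

text \<open>The coefficients give 4 (1 + 1/2 + 1) = 10 here and 4 r (1 + 3/4 + 1) = 11 r for
  \<open>hpsi\<close>. Passing from r to b - a costs at most another factor 4 for i up to 2; the
  value 44 serves both families.\<close>

lemma hphi_bound: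
  assumes ab: "a < b" and i: "i \<le> 2" and t: "t \<in> {a..b}"
  shows "\<bar>hphi a b e i t\<bar> \<le> 44 / (b - a) ^ i"
proof -
  define r where "r = (b - a) / 2"
  have "a + 2 * r = b" unfolding r_def by (simp add: field_simps)
  then have r: "r > 0" "t \<in> {a..a + 2 * r}" using ab t unfolding r_def by auto
  have "\<bar>hphi a b e i t\<bar> \<le> 10 / r ^ i"
    using quad_spline_bound[OF r i, of 1 0 "- 1 / (2 * r\<^sup>2)" "1 / r\<^sup>2"] quad_spline_bound[OF r i, of 0 0 "1 / (2 * r\<^sup>2)" "- 1 / r\<^sup>2"]
      divide_right_mono[of 6 10 "r ^ i"] r(1)
    unfolding hphi_def Let_def r_def[symmetric] by (cases "e = a") (simp_all add: abs_mult)
  also have "\<dots> \<le> 10 * (4 / (b - a) ^ i)"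
    using mult_left_mono[OF power_half_bound[OF i, of "b - a"], of 10] ab unfolding r_def by simp
  also have "\<dots> \<le> 44 / (b - a) ^ i" using divide_right_mono[of 40 44 "(b - a) ^ i"] ab by simp
  finally show ?thesis .
qed

lemma hpsi_bound:
  assumes ab: "a < b" and i: "i \<le> 2" and t: "t \<in> {a..b}"
  shows "\<bar>hpsi a b e i t\<bar> \<le> 44 * (b - a) / (b - a) ^ i"
proof -
  define r where "r = (b - a) / 2"
  have "a + 2 * r = b" unfolding r_def by (simp add: field_simps)
  then have r: "r > 0" "t \<in> {a..a + 2 * r}" using ab t unfolding r_def by auto
  have "\<bar>hpsi a b e i t\<bar> \<le> 11 * r / r ^ i"
    using quad_spline_bound[OF r i, of 0 1 "- 3 / (4 * r)" "1 / r"] quad_spline_bound[OF r i, of 0 0 "- 1 / (4 * r)" "1 / r"]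
      divide_right_mono[of "5 * r" "11 * r" "r ^ i"] r(1)
    unfolding hpsi_def Let_def r_def[symmetric] by (cases "e = a") (simp_all add: abs_mult power2_eq_square)
  also have "\<dots> \<le> 11 * r * (4 / (b - a) ^ i)"
    using mult_left_mono[OF power_half_bound[OF i, of "b - a"], of "11 * r"] ab r(1) unfolding r_def by simp
  also have "\<dots> \<le> 44 * (b - a) / (b - a) ^ i" using divide_right_mono[of "44 * r" "44 * (b - a)" "(b - a) ^ i"] ab unfolding r_def by simp
  finally show ?thesis .
qed

section \<open>Unique solvability of the Hermite conditions\<close>

lemma poly_degree_2:
  fixes q :: "real poly"
  assumes "degree q \<le> 2"
  shows "poly q t = poly q c + poly (pderiv q) c * (t - c) + coeff q 2 * (t - c)\<^sup>2"
proof -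
  have "q = [:coeff q 0, coeff q 1, coeff q 2:]"
    using assms by (intro poly_eqI) (auto simp: coeff_pCons coeff_eq_0 numeral_2_eq_2 split: nat.split)
  then obtain c0 c1 c2 where "q = [:c0, c1, c2:]" by blast
  then show ?thesis by (simp add: pderiv_pCons power2_eq_square algebra_simps numeral_2_eq_2)
qed

text \<open>The Taylor expansions at the two end points leave one unknown curvature per half. The
  last property of the conclusion is continuity of the derivative at the midpoint; continuity of the
  value follows by comparing the two expansions there.\<close>

lemma C1_quadratic_spline_shape:
  assumes s: "C1_quadratic_spline a b f" and ab: "a < b"
  defines "m \<equiv> (a + b) / 2" and "r \<equiv> (b - a) / 2"
  obtains u v where "\<And>t. t \<in> {a..m} \<Longrightarrow> f t = f a + deriv_on a b f a * (t - a) + u * (t - a)\<^sup>2"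
    "\<And>t. t \<in> {m..b} \<Longrightarrow> f t = f b + deriv_on a b f b * (t - b) + v * (t - b)\<^sup>2"
    "deriv_on a b f a + 2 * u * r = deriv_on a b f b - 2 * v * r"
proof -
  have m: "a < m" "m < b" "m - a = r" "b - m = r" using ab unfolding m_def r_def by (auto simp: field_simps)
  have diff: "(f has_vector_derivative deriv_on a b f t) (at t within {a..b})" if "t \<in> {a..b}" for t
    using s that unfolding C1_quadratic_spline_def differentiable_on_def by (simp add: vector_derivative_works)
  have "\<exists>q::real poly. degree q \<le> 2 \<and> (\<forall>t\<in>{a..m}. f t = poly q t)"
    using s unfolding C1_quadratic_spline_def m_def by (elim conjE)
  moreover have "\<exists>q::real poly. degree q \<le> 2 \<and> (\<forall>t\<in>{m..b}. f t = poly q t)"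
    using s unfolding C1_quadratic_spline_def m_def by (elim conjE)
  ultimately obtain q1 q2 :: "real poly" where "degree q1 \<le> 2 \<and> (\<forall>t\<in>{a..m}. f t = poly q1 t)"
    "degree q2 \<le> 2 \<and> (\<forall>t\<in>{m..b}. f t = poly q2 t)" by (elim exE)
  then have q: "degree q1 \<le> 2" "\<And>t. t \<in> {a..m} \<Longrightarrow> f t = poly q1 t"
     "degree q2 \<le> 2" "\<And>t. t \<in> {m..b} \<Longrightarrow> f t = poly q2 t" by simp_all
  have dq: "deriv_on a b f t = poly (pderiv q) t" if "t \<in> {l..v}" "l < v" "{l..v} \<subseteq> {a..b}" "\<And>t. t \<in> {l..v} \<Longrightarrow> f t = poly q t" for t l v q
  proof (rule vector_derivative_unique_within_closed_interval[of l v t f])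
    show "(f has_vector_derivative deriv_on a b f t) (at t within cbox l v)"
      using has_vector_derivative_within_subset[OF diff that(3)] that by auto
    have "(poly q has_vector_derivative poly (pderiv q) t) (at t within {l..v})"
      unfolding has_real_derivative_iff_has_vector_derivative[symmetric] by (rule has_field_derivative_at_within[OF poly_DERIV])
    then show "(f has_vector_derivative poly (pderiv q) t) (at t within cbox l v)"
      using has_vector_derivative_transform[of t "{l..v}" f "poly q"] that by auto
  qed (use that in auto)
  have sub: "{a..m} \<subseteq> {a..b}" "{m..b} \<subseteq> {a..b}" using m by auto
  have d1: "deriv_on a b f t = poly (pderiv q1) t" if "t \<in> {a..m}" for t
    by (rule dq[OF that m(1) sub(1) q(2)])
  have d2: "deriv_on a b f t = poly (pderiv q2) t" if "t \<in> {m..b}" for t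
    by (rule dq[OF that m(2) sub(2) q(4)])
  have mem: "a \<in> {a..m}" "m \<in> {a..m}" "m \<in> {m..b}" "b \<in> {m..b}" using m(1,2) by auto
  have 1: "f t = f a + deriv_on a b f a * (t - a) + coeff q1 2 * (t - a)\<^sup>2" if "t \<in> {a..m}" for t
    unfolding q(2)[OF that] q(2)[OF mem(1)] d1[OF mem(1)] by (rule poly_degree_2[OF q(1)])
  have 2: "f t = f b + deriv_on a b f b * (t - b) + coeff q2 2 * (t - b)\<^sup>2" if "t \<in> {m..b}" for t
    unfolding q(4)[OF that] q(4)[OF mem(4)] d2[OF mem(4)] by (rule poly_degree_2[OF q(3)])
  have pd: "poly (pderiv q) t = poly (pderiv q) c + 2 * coeff q 2 * (t - c)" if "degree q \<le> 2" for q :: "real poly" and t c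
  proof -
    have "q = [:coeff q 0, coeff q 1, coeff q 2:]"
      using that by (intro poly_eqI) (auto simp: coeff_pCons coeff_eq_0 numeral_2_eq_2 split: nat.split)
    then obtain c0 c1 c2 where "q = [:c0, c1, c2:]" by blast
    then show ?thesis by (simp add: pderiv_pCons algebra_simps numeral_2_eq_2)
  qed
  have "poly (pderiv q1) m = poly (pderiv q2) m" unfolding d1[OF mem(2), symmetric] by (rule d2[OF mem(3)])
  then have "deriv_on a b f a + 2 * coeff q1 2 * r = deriv_on a b f b - 2 * coeff q2 2 * r"
    unfolding d1[OF mem(1)] d2[OF mem(4)] using pd[OF q(1), of m a] pd[OF q(3), of m b] m(3,4)
    by (simp add: algebra_simps)
  with 1 2 show ?thesis by (rule that)
qed

text \<open>At the midpoint, continuity of the value fixes the difference of the two curvatures and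
  continuity of the derivative fixes their sum.\<close>

lemma C1_quadratic_spline_unique:
  assumes f: "C1_quadratic_spline a b f" and g: "C1_quadratic_spline a b g" and ab: "a < b"
    and eq: "f a = g a" "f b = g b" "deriv_on a b f a = deriv_on a b g a" "deriv_on a b f b = deriv_on a b g b"
  shows "f = g"
proof -
  let ?m = "(a + b) / 2" and ?r = "(b - a) / 2"
  obtain u v where 1: "\<And>t. t \<in> {a..?m} \<Longrightarrow> f t = f a + deriv_on a b f a * (t - a) + u * (t - a)\<^sup>2"
    "\<And>t. t \<in> {?m..b} \<Longrightarrow> f t = f b + deriv_on a b f b * (t - b) + v * (t - b)\<^sup>2"
    "deriv_on a b f a + 2 * u * ?r = deriv_on a b f b - 2 * v * ?r"
    using C1_quadratic_spline_shape[OF f ab] by metis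
  obtain u' v' where 2: "\<And>t. t \<in> {a..?m} \<Longrightarrow> g t = g a + deriv_on a b g a * (t - a) + u' * (t - a)\<^sup>2"
    "\<And>t. t \<in> {?m..b} \<Longrightarrow> g t = g b + deriv_on a b g b * (t - b) + v' * (t - b)\<^sup>2"
    "deriv_on a b g a + 2 * u' * ?r = deriv_on a b g b - 2 * v' * ?r"
    using C1_quadratic_spline_shape[OF g ab] by metis
  have r: "?r > 0" "?m - a = ?r" "?m - b = - ?r" "?m \<in> {a..?m}" "?m \<in> {?m..b}" using ab by (auto simp: field_simps)
  have "u * ?r\<^sup>2 - v * ?r\<^sup>2 = u' * ?r\<^sup>2 - v' * ?r\<^sup>2"
    using 1(1)[OF r(4)] 1(2)[OF r(5)] 2(1)[OF r(4)] 2(2)[OF r(5)] eq unfolding r(2,3) by simp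
  then have "?r\<^sup>2 * (u - v) = ?r\<^sup>2 * (u' - v')" unfolding right_diff_distrib mult.commute[of "?r\<^sup>2"] .
  then have e1: "u - v = u' - v'" using r(1) by simp
  have "?r * (2 * (u + v)) = ?r * (2 * (u' + v'))" using 1(3) 2(3) eq by (simp add: algebra_simps)
  then have e2: "u + v = u' + v'" using r(1) by simp
  note f1 = 1(1) and f2 = 1(2) and g1 = 2(1) and g2 = 2(2)
  from e1 e2 have uv: "u = u'" "v = v'" by linarith+
  show ?thesis
  proof
    fix t
    consider "t \<in> {a..?m}" | "t \<in> {?m..b}" | "t \<notin> {a..b}" using r by fastforce
    then show "f t = g t"
    proof cases
      case 3 then show ?thesis using f g unfolding C1_quadratic_spline_def by simp
    next
      case 1 show ?thesis unfolding f1[OF 1] g1[OF 1] eq uv ..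
    next
      case 2 show ?thesis unfolding f2[OF 2] g2[OF 2] eq uv ..
    qed
  qed
qed

lemma C1_quadratic_splineI:
  fixes a b c0 c1 c2 c3 :: real
  assumes ab: "a < b"
  defines "s \<equiv> quad_spline a ((b - a) / 2) c0 c1 c2 c3"
  defines "f \<equiv> (\<lambda>t. if t \<in> {a..b} then s 0 t else 0)"
  shows "C1_quadratic_spline a b f" "\<And>t. t \<in> {a..b} \<Longrightarrow> deriv_on a b f t = s 1 t"
proof -
  have d: "(f has_vector_derivative s 1 t) (at t within {a..b})" if "t \<in> {a..b}" for t
  proof -
    have "(s 0 has_vector_derivative s 1 t) (at t within {a..b})"
      unfolding has_real_derivative_iff_has_vector_derivative[symmetric] s_def by (rule has_field_derivative_at_within[OF quad_spline_deriv0])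
    then show ?thesis using has_vector_derivative_transform[of t "{a..b}" f "s 0"] that by (auto simp: f_def)
  qed
  show dd: "deriv_on a b f t = s 1 t" if "t \<in> {a..b}" for t
    using vector_derivative_within_cbox[OF ab] d[OF that] that by auto
  have m: "a + (b - a) / 2 = (a + b) / 2" by (simp add: field_simps)
  show "C1_quadratic_spline a b f"
    unfolding C1_quadratic_spline_def
  proof (intro conjI allI impI)
    show "f differentiable_on {a..b}" unfolding differentiable_on_def using d differentiableI_vector by blast
    have "continuous_on {a..b} (s 1)" unfolding s_def by (rule quad_spline_continuous) simp
    then show "continuous_on {a..b} (deriv_on a b f)" by (rule continuous_on_eq) (simp add: dd)
    have dg: "degree [:x, y, z:] \<le> 2" for x y z :: real
      using degree_pCons_le[of x "[:y, z:]"] degree_pCons_le[of y "[:z:]"] by simp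
    let ?q = "[:c0 - c1 * a + c2 * a\<^sup>2, c1 - 2 * c2 * a, c2:]"
    have q: "poly ?q t = c0 + c1 * (t - a) + c2 * (t - a)\<^sup>2" for t by (simp add: power2_eq_square algebra_simps)
    show "\<exists>q::real poly. degree q \<le> 2 \<and> (\<forall>t\<in>{a..(a + b) / 2}. f t = poly q t)"
    proof (intro exI[of _ ?q] conjI ballI dg)
      fix t assume t: "t \<in> {a..(a + b) / 2}"
      then have "max 0 (t - (a + (b - a) / 2)) = 0" "t \<in> {a..b}" using ab unfolding m by auto
      then show "f t = poly ?q t" unfolding q f_def s_def quad_spline_def by simp
    qed
    let ?n = "(a + b) / 2"
    let ?q' = "[:c0 - c1 * a + c2 * a\<^sup>2 + c3 * ?n\<^sup>2, c1 - 2 * c2 * a - 2 * c3 * ?n, c2 + c3:]"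
    have q': "poly ?q' t = c0 + c1 * (t - a) + c2 * (t - a)\<^sup>2 + c3 * (t - ?n)\<^sup>2" for t by (simp add: power2_eq_square algebra_simps)
    show "\<exists>q::real poly. degree q \<le> 2 \<and> (\<forall>t\<in>{(a + b) / 2..b}. f t = poly q t)"
    proof (intro exI[of _ ?q'] conjI ballI dg)
      fix t assume t: "t \<in> {(a + b) / 2..b}"
      then have "max 0 (t - (a + (b - a) / 2)) = t - ?n" "t \<in> {a..b}" using ab unfolding m by auto
      then show "f t = poly ?q' t" unfolding q' f_def s_def quad_spline_def by simp
    qed
  qed (simp add: f_def del: atLeastAtMost_iff)
qed

lemma hphi_eq_quad_spline:
  obtains c0 c1 c2 c3 where "hphi a b e = quad_spline a ((b - a) / 2) c0 c1 c2 c3"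
  unfolding hphi_def Let_def by (cases "e = a") auto

lemma hpsi_eq_quad_spline:
  obtains c0 c1 c2 c3 where "hpsi a b e = quad_spline a ((b - a) / 2) c0 c1 c2 c3"
  unfolding hpsi_def Let_def by (cases "e = a") auto

lemma hphi_endpoints:
  assumes "a < b" "e \<in> {a, b}" "k \<in> {a, b}"
  shows "hphi a b e 0 k = of_bool (e = k)" "hphi a b e 1 k = 0"
    and "hpsi a b e 0 k = 0" "hpsi a b e 1 k = of_bool (e = k)"
proof -
  obtain r where r: "b = a + 2 * r" "r > 0" using half_length[OF assms(1)] by blast
  show "hphi a b e 0 k = of_bool (e = k)" "hphi a b e 1 k = 0" "hpsi a b e 0 k = 0" "hpsi a b e 1 k = of_bool (e = k)"
    using assms(2,3) r(2) unfolding r(1) hphi_def hpsi_def Let_def quad_spline_def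
    by (auto simp: field_simps power2_eq_square)
qed

lemma phi_eq_hphi:
  assumes ab: "a < b" and e: "e \<in> {a, b}"
  shows "phi a b e = (\<lambda>t. if t \<in> {a..b} then hphi a b e 0 t else 0)"
  unfolding phi_def
proof (rule the_equality)
  obtain c0 c1 c2 c3 where c: "hphi a b e = quad_spline a ((b - a) / 2) c0 c1 c2 c3" by (rule hphi_eq_quad_spline)
  let ?f = "\<lambda>t. if t \<in> {a..b} then hphi a b e 0 t else 0"
  note S = C1_quadratic_splineI[OF ab, where ?c0.0 = c0 and ?c1.0 = c1 and ?c2.0 = c2 and ?c3.0 = c3, folded c]
  have d: "deriv_on a b ?f k = 0" if "k \<in> {a, b}" for k
  proof -
    have "k \<in> {a..b}" using that ab by auto
    from S(2)[OF this] show ?thesis unfolding hphi_endpoints(2)[OF ab e that] .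
  qed
  have v: "?f k = of_bool (e = k)" if "k \<in> {a, b}" for k
    using hphi_endpoints(1)[OF ab e that] that ab by auto
  show P: "C1_quadratic_spline a b ?f \<and> (\<forall>k\<in>{a, b}. ?f k = of_bool (e = k) \<and> deriv_on a b ?f k = 0)"
    using S(1) d v by blast
  show "g = ?f" if "C1_quadratic_spline a b g \<and> (\<forall>k\<in>{a, b}. g k = of_bool (e = k) \<and> deriv_on a b g k = 0)" for g
  proof (rule C1_quadratic_spline_unique[OF _ S(1) ab])
    show "g a = ?f a" "g b = ?f b" "deriv_on a b g a = deriv_on a b ?f a" "deriv_on a b g b = deriv_on a b ?f b"
      using that v[of a] v[of b] d[of a] d[of b] by (metis insertCI)+
  qed (use that in blast)
qed

lemma psi_eq_hpsi:
  assumes ab: "a < b" and e: "e \<in> {a, b}"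
  shows "psi a b e = (\<lambda>t. if t \<in> {a..b} then hpsi a b e 0 t else 0)"
    and "t \<in> {a..b} \<Longrightarrow> deriv_on a b (psi a b e) t = hpsi a b e 1 t"
proof -
  obtain c0 c1 c2 c3 where c: "hpsi a b e = quad_spline a ((b - a) / 2) c0 c1 c2 c3" by (rule hpsi_eq_quad_spline)
  let ?f = "\<lambda>t. if t \<in> {a..b} then hpsi a b e 0 t else 0"
  note S = C1_quadratic_splineI[OF ab, where ?c0.0 = c0 and ?c1.0 = c1 and ?c2.0 = c2 and ?c3.0 = c3, folded c]
  have d: "deriv_on a b ?f k = of_bool (e = k)" if "k \<in> {a, b}" for k
  proof -
    have "k \<in> {a..b}" using that ab by auto
    from S(2)[OF this] show ?thesis unfolding hphi_endpoints(4)[OF ab e that] .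
  qed
  have v: "?f k = 0" if "k \<in> {a, b}" for k
    using hphi_endpoints(3)[OF ab e that] by simp
  show eq: "psi a b e = ?f" unfolding psi_def
  proof (rule the_equality)
    show P: "C1_quadratic_spline a b ?f \<and> (\<forall>k\<in>{a, b}. ?f k = 0 \<and> deriv_on a b ?f k = of_bool (e = k))"
      using S(1) d v by blast
    show "g = ?f" if "C1_quadratic_spline a b g \<and> (\<forall>k\<in>{a, b}. g k = 0 \<and> deriv_on a b g k = of_bool (e = k))" for g
    proof (rule C1_quadratic_spline_unique[OF _ S(1) ab])
      show "g a = ?f a" "g b = ?f b" "deriv_on a b g a = deriv_on a b ?f a" "deriv_on a b g b = deriv_on a b ?f b"
        using that v[of a] v[of b] d[of a] d[of b] by (metis insertCI)+
    qed (use that in blast)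
  qed
  show "t \<in> {a..b} \<Longrightarrow> deriv_on a b (psi a b e) t = hpsi a b e 1 t" unfolding eq by (rule S(2))
qed

section \<open>The dual functions in closed form\<close>

lemma cubic_has_integral:
  fixes c r k0 k1 k2 k3 :: real
  assumes "r > 0"
  shows "((\<lambda>t. k0 + k1 * (t - c) + k2 * (t - c)\<^sup>2 + k3 * (t - c) ^ 3) has_integral
     (k0 * r + k1 * r\<^sup>2 / 2 + k2 * r ^ 3 / 3 + k3 * r ^ 4 / 4)) {c..c + r}"
proof -
  let ?F = "\<lambda>t. k0 * (t - c) + k1 * (t - c)\<^sup>2 / 2 + k2 * (t - c) ^ 3 / 3 + k3 * (t - c) ^ 4 / 4"
  have "((\<lambda>t. k0 + k1 * (t - c) + k2 * (t - c)\<^sup>2 + k3 * (t - c) ^ 3) has_integral (?F (c + r) - ?F c)) {c..c + r}"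
  proof (rule fundamental_theorem_of_calculus)
    show "(?F has_vector_derivative (k0 + k1 * (t - c) + k2 * (t - c)\<^sup>2 + k3 * (t - c) ^ 3)) (at t within {c..c + r})" for t
      unfolding has_real_derivative_iff_has_vector_derivative[symmetric]
      by (auto intro!: derivative_eq_intros)
  qed (use assms in simp)
  then show ?thesis by simp
qed

text \<open>All integrands in the dual pairings are products of a piecewise linear and a piecewise
  quadratic function. The local variable starts at \<open>a\<close> on the left half and at the
  midpoint on the right half.\<close>

lemma piecewise_cubic_has_integral:
  fixes a r :: real
  assumes r: "r > 0"
    and left: "\<And>s. 0 \<le> s \<Longrightarrow> s \<le> r \<Longrightarrow> f (a + s) = k0 + k1 * s + k2 * s\<^sup>2 + k3 * s ^ 3"
    and right: "\<And>s. 0 \<le> s \<Longrightarrow> s \<le> r \<Longrightarrow> f (a + r + s) = l0 + l1 * s + l2 * s\<^sup>2 + l3 * s ^ 3"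
    and I: "I = (k0 * r + k1 * r\<^sup>2 / 2 + k2 * r ^ 3 / 3 + k3 * r ^ 4 / 4) + (l0 * r + l1 * r\<^sup>2 / 2 + l2 * r ^ 3 / 3 + l3 * r ^ 4 / 4)"
  shows "(f has_integral I) {a..a + 2 * r}"
proof -
  have 1: "(f has_integral (k0 * r + k1 * r\<^sup>2 / 2 + k2 * r ^ 3 / 3 + k3 * r ^ 4 / 4)) {a..a + r}"
    by (rule has_integral_eq[OF _ cubic_has_integral[OF r, of k0 k1 a k2 k3]]) (use left[of "_ - a"] in auto)
  have 2: "(f has_integral (l0 * r + l1 * r\<^sup>2 / 2 + l2 * r ^ 3 / 3 + l3 * r ^ 4 / 4)) {a + r..a + r + r}"
    by (rule has_integral_eq[OF _ cubic_has_integral[OF r, of l0 l1 "a + r" l2 l3]]) (use right[of "_ - (a + r)"] in auto)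
  have e: "a + r + r = a + 2 * r" by simp
  show ?thesis unfolding I by (rule has_integral_combine[OF _ _ 1 2[unfolded e]]) (use r in auto)
qed

lemma half_values:
  assumes r: "r > 0" and s: "0 \<le> s" "s \<le> r"
  shows "hpsi a (a + 2 * r) a 0 (a + s) + hpsi a (a + 2 * r) (a + 2 * r) 0 (a + s) = s - s\<^sup>2 / r"
    "hpsi a (a + 2 * r) a 0 (a + r + s) + hpsi a (a + 2 * r) (a + 2 * r) 0 (a + r + s) = s\<^sup>2 / r - s"
    "hpsi a (a + 2 * r) a 1 (a + s) = 1 - 3 * s / (2 * r)"
    "hpsi a (a + 2 * r) a 1 (a + r + s) = s / (2 * r) - 1 / 2"
    "hpsi a (a + 2 * r) (a + 2 * r) 1 (a + s) = - s / (2 * r)"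
    "hpsi a (a + 2 * r) (a + 2 * r) 1 (a + r + s) = 3 * s / (2 * r) - 1 / 2"
    "theta a (a + 2 * r) (a + s) = 5 / 6 - 2 * s / r + s\<^sup>2 / r\<^sup>2"
    "theta a (a + 2 * r) (a + r + s) = s\<^sup>2 / r\<^sup>2 - 1 / 6"
proof -
  have m: "max 0 (a + s - (a + r)) = 0" "max 0 (a + r + s - (a + r)) = s" using s by auto
  note d = hpsi_def Let_def quad_spline_def m theta_def
  show "hpsi a (a + 2 * r) a 0 (a + s) + hpsi a (a + 2 * r) (a + 2 * r) 0 (a + s) = s - s\<^sup>2 / r"
    "hpsi a (a + 2 * r) a 0 (a + r + s) + hpsi a (a + 2 * r) (a + 2 * r) 0 (a + r + s) = s\<^sup>2 / r - s"
    "hpsi a (a + 2 * r) a 1 (a + s) = 1 - 3 * s / (2 * r)"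
    "hpsi a (a + 2 * r) a 1 (a + r + s) = s / (2 * r) - 1 / 2"
    "hpsi a (a + 2 * r) (a + 2 * r) 1 (a + s) = - s / (2 * r)"
    "hpsi a (a + 2 * r) (a + 2 * r) 1 (a + r + s) = 3 * s / (2 * r) - 1 / 2"
    "theta a (a + 2 * r) (a + s) = 5 / 6 - 2 * s / r + s\<^sup>2 / r\<^sup>2"
    "theta a (a + 2 * r) (a + r + s) = s\<^sup>2 / r\<^sup>2 - 1 / 6"
    using r s by (simp_all add: d) (simp_all add: field_simps power2_eq_square)
qed

text \<open>The signs reflect symmetry about the midpoint: the sum of the two \<open>hpsi\<close> is
  odd, \<open>theta\<close> is even, and reflection exchanges the derivatives of the two
  \<open>hpsi\<close>. Hence the pairings with the odd function are opposite and those with the even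
  one are equal.\<close>

lemma dual_pairings:
  assumes r: "r > 0" and b: "b = a + 2 * r"
  shows "((\<lambda>t. hpsi a b a 1 t * (hpsi a b a 0 t + hpsi a b b 0 t)) has_integral r\<^sup>2 / 12) {a..b}"
    and "((\<lambda>t. hpsi a b b 1 t * (hpsi a b a 0 t + hpsi a b b 0 t)) has_integral - r\<^sup>2 / 12) {a..b}"
    and "((\<lambda>t. hpsi a b a 1 t * theta a b t) has_integral r / 6) {a..b}"
    and "((\<lambda>t. hpsi a b b 1 t * theta a b t) has_integral r / 6) {a..b}"
    and "((\<lambda>t. hpsi a b a 0 t + hpsi a b b 0 t) has_integral 0) {a..b}"
    and "(theta a b has_integral r / 3) {a..b}"
  unfolding b
proof -
  note H = half_values[OF r]
  show "((\<lambda>t. hpsi a (a + 2 * r) a 1 t * (hpsi a (a + 2 * r) a 0 t + hpsi a (a + 2 * r) (a + 2 * r) 0 t)) has_integral r\<^sup>2 / 12) {a..a + 2 * r}"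
    by (rule piecewise_cubic_has_integral[OF r, of _ _ 0 1 "- 5 / (2 * r)" "3 / (2 * r\<^sup>2)" 0 "1 / 2" "- 1 / r" "1 / (2 * r\<^sup>2)"];
        (simp only: H)?) (use r in \<open>simp_all add: field_simps power2_eq_square power3_eq_cube power4_eq_xxxx\<close>)
  show "((\<lambda>t. hpsi a (a + 2 * r) (a + 2 * r) 1 t * (hpsi a (a + 2 * r) a 0 t + hpsi a (a + 2 * r) (a + 2 * r) 0 t)) has_integral - r\<^sup>2 / 12) {a..a + 2 * r}"
    by (rule piecewise_cubic_has_integral[OF r, of _ _ 0 0 "- 1 / (2 * r)" "1 / (2 * r\<^sup>2)" 0 "1 / 2" "- 2 / r" "3 / (2 * r\<^sup>2)"];
        (simp only: H)?) (use r in \<open>simp_all add: field_simps power2_eq_square power3_eq_cube power4_eq_xxxx\<close>)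
  show "((\<lambda>t. hpsi a (a + 2 * r) a 1 t * theta a (a + 2 * r) t) has_integral r / 6) {a..a + 2 * r}"
    by (rule piecewise_cubic_has_integral[OF r, of _ _ "5 / 6" "- 13 / (4 * r)" "4 / r\<^sup>2" "- 3 / (2 * r ^ 3)" "1 / 12" "- 1 / (12 * r)" "- 1 / (2 * r\<^sup>2)" "1 / (2 * r ^ 3)"];
        (simp only: H)?) (use r in \<open>simp_all add: field_simps power2_eq_square power3_eq_cube power4_eq_xxxx\<close>)
  show "((\<lambda>t. hpsi a (a + 2 * r) (a + 2 * r) 1 t * theta a (a + 2 * r) t) has_integral r / 6) {a..a + 2 * r}"
    by (rule piecewise_cubic_has_integral[OF r, of _ _ 0 "- 5 / (12 * r)" "1 / r\<^sup>2" "- 1 / (2 * r ^ 3)" "1 / 12" "- 1 / (4 * r)" "- 1 / (2 * r\<^sup>2)" "3 / (2 * r ^ 3)"];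
        (simp only: H)?) (use r in \<open>simp_all add: field_simps power2_eq_square power3_eq_cube power4_eq_xxxx\<close>)
  show "((\<lambda>t. hpsi a (a + 2 * r) a 0 t + hpsi a (a + 2 * r) (a + 2 * r) 0 t) has_integral 0) {a..a + 2 * r}"
    by (rule piecewise_cubic_has_integral[OF r, of _ _ 0 1 "- 1 / r" 0 0 "-1" "1 / r" 0];
        (simp only: H)?) (use r in \<open>simp_all add: field_simps power2_eq_square power3_eq_cube power4_eq_xxxx\<close>)
  show "(theta a (a + 2 * r) has_integral r / 3) {a..a + 2 * r}"
    by (rule piecewise_cubic_has_integral[OF r, of _ _ "5 / 6" "- 2 / r" "1 / r\<^sup>2" 0 "- 1 / 6" 0 "1 / r\<^sup>2" 0];
        (simp only: H)?) (use r in \<open>simp_all add: field_simps power2_eq_square power3_eq_cube power4_eq_xxxx\<close>)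
qed

lemma set_lebesgue_integral_eq_has_integral:
  fixes f :: "real \<Rightarrow> real"
  assumes "continuous_on {a..b} f" "(f has_integral I) {a..b}"
  shows "(LINT t|lebesgue_on {a..b}. f t) = I"
proof -
  have "integrable (lebesgue_on {a..b}) f"
    using integrable_continuous_interval assms(1) absolutely_integrable_continuous_real[OF assms(1)]
    by (simp add: set_integrable_def integrable_lebesgue_on_iff)
  then show ?thesis using lebesgue_integral_eq_integral[of "{a..b}" f] assms(2) by (simp add: integral_unique)
qed

lemma hpsi_continuous: "i \<le> 1 \<Longrightarrow> continuous_on S (hpsi a b e i)"
  using hpsi_eq_quad_spline[of a b e] quad_spline_continuous by metis

lemma theta_continuous: "continuous_on S (theta a b)"
  unfolding theta_def[abs_def] divide_inverse by (intro continuous_intros)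

text \<open>Duality is a system of two equations for the coefficients; adding and subtracting the
  equations decouples it because of the symmetry of the pairings.\<close>

lemma dual_eq:
  assumes ab: "a < b" and e: "e \<in> {a, b}"
  defines "r \<equiv> (b - a) / 2"
  shows "dual a b e = (\<lambda>t. (if e = a then 6 / r\<^sup>2 else - 6 / r\<^sup>2) * (psi a b a t + psi a b b t) + 3 / r * theta a b t)"
proof -
  have r: "r > 0" "b = a + 2 * r" using ab unfolding r_def by (simp_all add: field_simps)
  note P = dual_pairings[OF r]
  let ?d = "\<lambda>\<alpha> \<beta> t. \<alpha> * (psi a b a t + psi a b b t) + \<beta> * theta a b t"
  have val: "(LINT t|lebesgue_on {a..b}. deriv_on a b (psi a b k) t * ?d \<alpha> \<beta> t) = \<alpha> * (if k = a then r\<^sup>2 / 12 else - r\<^sup>2 / 12) + \<beta> * (r / 6)"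
    if k: "k \<in> {a, b}" for k \<alpha> \<beta>
  proof -
    let ?f = "\<lambda>t. \<alpha> * (hpsi a b k 1 t * (hpsi a b a 0 t + hpsi a b b 0 t)) + \<beta> * (hpsi a b k 1 t * theta a b t)"
    have "(LINT t|lebesgue_on {a..b}. deriv_on a b (psi a b k) t * ?d \<alpha> \<beta> t) = (LINT t|lebesgue_on {a..b}. ?f t)"
    proof (rule Bochner_Integration.integral_cong)
      fix t assume "t \<in> space (lebesgue_on {a..b})"
      then have t: "t \<in> {a..b}" by simp
      show "deriv_on a b (psi a b k) t * ?d \<alpha> \<beta> t = ?f t"
        unfolding psi_eq_hpsi(2)[OF ab k t] using t by (simp add: psi_eq_hpsi(1)[OF ab] algebra_simps)
    qed simp
    also have "\<dots> = \<alpha> * (if k = a then r\<^sup>2 / 12 else - r\<^sup>2 / 12) + \<beta> * (r / 6)"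
    proof (rule set_lebesgue_integral_eq_has_integral)
      show "continuous_on {a..b} ?f" by (intro continuous_intros hpsi_continuous theta_continuous) auto
      show "(?f has_integral \<alpha> * (if k = a then r\<^sup>2 / 12 else - r\<^sup>2 / 12) + \<beta> * (r / 6)) {a..b}"
      proof (cases "k = a")
        case True
        then show ?thesis
          using has_integral_add[OF has_integral_mult_right[OF P(1), of \<alpha>] has_integral_mult_right[OF P(3), of \<beta>]] by simp
      next
        case False
        then have "k = b" using k by simp
        then show ?thesis
          using has_integral_add[OF has_integral_mult_right[OF P(2), of \<alpha>] has_integral_mult_right[OF P(4), of \<beta>]] False by simp
      qed
    qed
    finally show ?thesis .
  qed
  let ?\<alpha> = "if e = a then 6 / r\<^sup>2 else - 6 / r\<^sup>2"
  show ?thesis unfolding dual_def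
  proof (rule the_equality)
    have "?d ?\<alpha> (3 / r) \<in> V_space a b" unfolding V_space_def by blast
    moreover have "(LINT t|lebesgue_on {a..b}. deriv_on a b (psi a b k) t * ?d ?\<alpha> (3 / r) t) = of_bool (k = e)" if "k \<in> {a, b}" for k
      unfolding val[OF that] using that e ab r(1) by (auto simp: field_simps)
    ultimately show "?d ?\<alpha> (3 / r) \<in> V_space a b \<and> (\<forall>k\<in>{a, b}. (LINT t|lebesgue_on {a..b}. deriv_on a b (psi a b k) t * ?d ?\<alpha> (3 / r) t) = of_bool (k = e))"
      by blast
    fix d assume d: "d \<in> V_space a b \<and> (\<forall>k\<in>{a, b}. (LINT t|lebesgue_on {a..b}. deriv_on a b (psi a b k) t * d t) = of_bool (k = e))"
    then obtain \<alpha> \<beta> where \<alpha>\<beta>: "d = ?d \<alpha> \<beta>" unfolding V_space_def by blast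
    have "(LINT t|lebesgue_on {a..b}. deriv_on a b (psi a b a) t * ?d \<alpha> \<beta> t) = of_bool (a = e)"
      "(LINT t|lebesgue_on {a..b}. deriv_on a b (psi a b b) t * ?d \<alpha> \<beta> t) = of_bool (b = e)"
      using d unfolding \<alpha>\<beta> by blast+
    then have "\<alpha> * (r\<^sup>2 / 12) + \<beta> * (r / 6) = of_bool (a = e)" "\<alpha> * (- r\<^sup>2 / 12) + \<beta> * (r / 6) = of_bool (b = e)"
      using ab unfolding val[of a, simplified] val[of b, simplified] by auto
    \<comment> \<open>The sum of the two equations determines \<beta>, their difference determines
      \<alpha>.\<close>
    then have "\<beta> * (r / 3) = 1" "\<alpha> * (r\<^sup>2 / 6) = (if e = a then 1 else -1)" using e ab by auto
    then have "\<beta> = 3 / r" "\<alpha> = ?\<alpha>" using r(1) by (auto simp: field_simps)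
    then show "d = ?d ?\<alpha> (3 / r)" unfolding \<alpha>\<beta> by simp
  qed
qed

text \<open>The odd component of the dual function has mean zero, and the even component is the same
  for both end points, so both dual functions have integral one. An average against them therefore
  preserves constants.\<close>

lemma
  assumes ab: "a < b" and e: "e \<in> {a, b}"
  shows dual_bound: "t \<in> {a..b} \<Longrightarrow> \<bar>dual a b e t\<bar> \<le> 2200 / (b - a)"
    and dual_continuous: "continuous_on {a..b} (dual a b e)"
    and dual_has_integral: "(dual a b e has_integral 1) {a..b}"
proof -
  define r where "r = (b - a) / 2"
  have r: "r > 0" "b = a + 2 * r" using ab unfolding r_def by (simp_all add: field_simps)
  note P = dual_pairings[OF r]
  define \<alpha> where "\<alpha> = (if e = a then 6 / r\<^sup>2 else - 6 / r\<^sup>2)"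
  let ?g = "\<lambda>t. \<alpha> * (hpsi a b a 0 t + hpsi a b b 0 t) + 3 / r * theta a b t"
  have eq: "?g t = dual a b e t" if "t \<in> {a..b}" for t
    using that unfolding dual_eq[OF ab e] r_def[symmetric] \<alpha>_def[symmetric] by (simp add: psi_eq_hpsi(1)[OF ab])
  have "(?g has_integral \<alpha> * 0 + 3 / r * (r / 3)) {a..b}"
    by (intro has_integral_add has_integral_mult_right P)
  then have "(?g has_integral 1) {a..b}" using r(1) by simp
  with eq show "(dual a b e has_integral 1) {a..b}" by (rule has_integral_eq)
  have "continuous_on {a..b} ?g" by (intro continuous_intros hpsi_continuous theta_continuous) auto
  then show "continuous_on {a..b} (dual a b e)" by (rule continuous_on_eq) (rule eq)
  show "\<bar>dual a b e t\<bar> \<le> 2200 / (b - a)" if t: "t \<in> {a..b}"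
  proof -
    have p: "\<bar>hpsi a b k 0 t\<bar> \<le> 88 * r" for k using hpsi_bound[OF ab _ t, of 0 k] by (simp add: r_def)
    have "\<bar>\<alpha> * (hpsi a b a 0 t + hpsi a b b 0 t)\<bar> \<le> 6 / r\<^sup>2 * (176 * r)"
      unfolding abs_mult
    proof (rule mult_mono)
      show "\<bar>\<alpha>\<bar> \<le> 6 / r\<^sup>2" unfolding \<alpha>_def by simp
      show "\<bar>hpsi a b a 0 t + hpsi a b b 0 t\<bar> \<le> 176 * r" using p[of a] p[of b] by linarith
    qed (use r in auto)
    also have "\<dots> = 1056 / r" using r(1) by (simp add: power2_eq_square)
    finally have 1: "\<bar>\<alpha> * (hpsi a b a 0 t + hpsi a b b 0 t)\<bar> \<le> 1056 / r" .
    have "\<bar>(t - (a + b) / 2) / ((b - a) / 2)\<bar> \<le> 1" using t ab by (auto simp: abs_le_iff field_simps)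
    then have "((t - (a + b) / 2) / ((b - a) / 2))\<^sup>2 \<le> 1" by (simp add: abs_square_le_1)
    then have "\<bar>theta a b t\<bar> \<le> 1" unfolding theta_def using zero_le_power2[of "(t - (a + b) / 2) / ((b - a) / 2)"] by linarith
    then have 2: "\<bar>3 / r * theta a b t\<bar> \<le> 3 / r" using r(1) mult_left_mono[of "\<bar>theta a b t\<bar>" 1 "3 / r"] by (simp add: abs_mult)
    \<comment> \<open>Since b - a = 2 r, the sum 1059 / r equals 2118 / (b - a), which is rounded up
      to 2200 / (b - a).\<close>
    have "\<bar>dual a b e t\<bar> \<le> 1056 / r + 3 / r" unfolding eq[OF t, symmetric] using 1 2 by linarith
    also have "\<dots> \<le> 2200 / (b - a)" using r(1) unfolding r(2) by (simp add: field_simps)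
    finally show ?thesis .
  qed
qed

section \<open>The estimate for smooth functions\<close>

lemma smooth2_partials:
  assumes "smooth2 D"
  shows "((\<lambda>x. D i j (x, y)) has_real_derivative D (Suc i) j (x, y)) (at x within X)"
    and "((\<lambda>y. D i j (x, y)) has_real_derivative D i (Suc j) (x, y)) (at y within Y)"
proof -
  have "((\<lambda>x. (x, y)) has_derivative (\<lambda>h. (h, 0))) (at x within X)" by (intro derivative_intros)
  from has_derivative_compose[OF this smooth2_has_derivative[OF assms]]
  have "((\<lambda>x. D i j (x, y)) has_derivative (\<lambda>h. h * D (Suc i) j (x, y))) (at x within X)" by simp
  moreover have "(\<lambda>h. h * D (Suc i) j (x, y)) = (*) (D (Suc i) j (x, y))" by (simp add: fun_eq_iff)
  ultimately show "((\<lambda>x. D i j (x, y)) has_real_derivative D (Suc i) j (x, y)) (at x within X)"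
    by (simp add: has_field_derivative_def)
  have "((\<lambda>y. (x, y)) has_derivative (\<lambda>h. (0, h))) (at y within Y)" by (intro derivative_intros)
  from has_derivative_compose[OF this smooth2_has_derivative[OF assms]]
  have "((\<lambda>y. D i j (x, y)) has_derivative (\<lambda>h. h * D i (Suc j) (x, y))) (at y within Y)" by simp
  moreover have "(\<lambda>h. h * D i (Suc j) (x, y)) = (*) (D i (Suc j) (x, y))" by (simp add: fun_eq_iff)
  ultimately show "((\<lambda>y. D i j (x, y)) has_real_derivative D i (Suc j) (x, y)) (at y within Y)"
    by (simp add: has_field_derivative_def)
qed

lemma smooth2_C1_box:
  assumes "smooth2 D" "a1 < b1" "a2 < b2"
  shows "C1_box a1 b1 a2 b2 (D i j) (D (Suc i) j) (D i (Suc j))"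
  by unfold_locales (use assms in \<open>auto intro: smooth2_continuous smooth2_partials\<close>)

lemma smooth2_diff:
  assumes "smooth2 D" "smooth2 E" shows "smooth2 (\<lambda>i j z. D i j z - E i j z)"
  unfolding smooth2_def
proof (intro allI)
  fix i j z
  show "((\<lambda>z. D i j z - E i j z) has_derivative
     (\<lambda>h. fst h * (D (Suc i) j z - E (Suc i) j z) + snd h * (D i (Suc j) z - E i (Suc j) z))) (at z)"
    by (rule has_derivative_eq_rhs[OF has_derivative_diff[OF smooth2_has_derivative[OF assms(1)] smooth2_has_derivative[OF assms(2)]]])
      (simp add: fun_eq_iff algebra_simps)
qed

text \<open>The derivative table of the general quadratic polynomial, in the format of
  \<open>smooth2\<close>, so that it can be subtracted from a smooth family at all orders at
  once.\<close>

definition quad_poly :: "real \<Rightarrow> real \<Rightarrow> real \<Rightarrow> real \<Rightarrow> real \<Rightarrow> real \<Rightarrow> nat \<Rightarrow> nat \<Rightarrow> real \<times> real \<Rightarrow> real" where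
  "quad_poly k00 k10 k01 k20 k11 k02 i j z =
    (if i = 0 \<and> j = 0 then k00 + k10 * fst z + k01 * snd z + k20 * (fst z)\<^sup>2 + k11 * (fst z * snd z) + k02 * (snd z)\<^sup>2
     else if i = 1 \<and> j = 0 then k10 + 2 * k20 * fst z + k11 * snd z
     else if i = 0 \<and> j = 1 then k01 + k11 * fst z + 2 * k02 * snd z
     else if i = 2 \<and> j = 0 then 2 * k20
     else if i = 1 \<and> j = 1 then k11
     else if i = 0 \<and> j = 2 then 2 * k02 else 0)"

lemma smooth2_quad_poly: "smooth2 (quad_poly k00 k10 k01 k20 k11 k02)"
  unfolding smooth2_def
proof (intro allI)
  fix i j :: nat and z :: "real \<times> real"
  let ?Q = "quad_poly k00 k10 k01 k20 k11 k02"
  have fs: "(fst has_derivative fst) (at z)" "(snd has_derivative snd) (at z)"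
    by (auto intro: derivative_intros)
  consider "i = 0 \<and> j = 0" | "i = 1 \<and> j = 0" | "i = 0 \<and> j = 1" | "i + j \<ge> 2" by linarith
  then show "(?Q i j has_derivative (\<lambda>h. fst h * ?Q (Suc i) j z + snd h * ?Q i (Suc j) z)) (at z)"
  proof cases
    case 1
    have "((\<lambda>z. k00 + k10 * fst z + k01 * snd z + k20 * (fst z)\<^sup>2 + k11 * (fst z * snd z) + k02 * (snd z)\<^sup>2) has_derivative
      (\<lambda>h. fst h * ?Q (Suc i) j z + snd h * ?Q i (Suc j) z)) (at z)"
      by (rule has_derivative_eq_rhs) (auto intro!: derivative_eq_intros fs simp: 1 quad_poly_def fun_eq_iff algebra_simps)
    then show ?thesis using 1 by (simp add: quad_poly_def[abs_def])
  next
    case 2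
    have "((\<lambda>z. k10 + 2 * k20 * fst z + k11 * snd z) has_derivative
      (\<lambda>h. fst h * ?Q (Suc i) j z + snd h * ?Q i (Suc j) z)) (at z)"
      by (rule has_derivative_eq_rhs) (auto intro!: derivative_eq_intros fs simp: 2 quad_poly_def fun_eq_iff algebra_simps)
    then show ?thesis using 2 by (simp add: quad_poly_def[abs_def])
  next
    case 3
    have "((\<lambda>z. k01 + k11 * fst z + 2 * k02 * snd z) has_derivative
      (\<lambda>h. fst h * ?Q (Suc i) j z + snd h * ?Q i (Suc j) z)) (at z)"
      by (rule has_derivative_eq_rhs) (auto intro!: derivative_eq_intros fs simp: 3 quad_poly_def fun_eq_iff algebra_simps)
    then show ?thesis using 3 by (simp add: quad_poly_def[abs_def])
  next
    case 4
    then have 0: "?Q (Suc i) j z = 0" "?Q i (Suc j) z = 0" by (auto simp: quad_poly_def)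
    have "?Q i j = (\<lambda>_. ?Q i j (0, 0))" using 4 by (auto simp: quad_poly_def fun_eq_iff)
    then show ?thesis unfolding 0 by (metis (no_types, lifting) has_derivative_const mult_zero_right add_0 ext)
  qed
qed

text \<open>The arguments \<open>U\<close>, \<open>X\<close>, \<open>Y\<close>, \<open>W\<close> prescribe the values, the two first derivatives and the mixed
  derivative at the vertices, and \<open>i\<close>, \<open>j\<close> are the orders of differentiation.\<close>

definition hermite_interp :: "real \<Rightarrow> real \<Rightarrow> real \<Rightarrow> real \<Rightarrow> (real \<Rightarrow> real \<Rightarrow> real) \<Rightarrow> (real \<Rightarrow> real \<Rightarrow> real) \<Rightarrow>
    (real \<Rightarrow> real \<Rightarrow> real) \<Rightarrow> (real \<Rightarrow> real \<Rightarrow> real) \<Rightarrow> nat \<Rightarrow> nat \<Rightarrow> real \<times> real \<Rightarrow> real" where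
  "hermite_interp a b c d U X Y W i j z = (\<Sum>e\<in>{a, b}. \<Sum>f\<in>{c, d}.
     U e f * (hphi a b e i (fst z) * hphi c d f j (snd z)) + X e f * (hpsi a b e i (fst z) * hphi c d f j (snd z))
     + Y e f * (hphi a b e i (fst z) * hpsi c d f j (snd z)) + W e f * (hpsi a b e i (fst z) * hpsi c d f j (snd z)))"

lemma hermite_interp_diff:
  "hermite_interp a b c d (\<lambda>e f. U e f - U' e f) (\<lambda>e f. X e f - X' e f) (\<lambda>e f. Y e f - Y' e f) (\<lambda>e f. W e f - W' e f) i j z
    = hermite_interp a b c d U X Y W i j z - hermite_interp a b c d U' X' Y' W' i j z"
  unfolding hermite_interp_def sum_subtractf[symmetric]
  by (intro sum.cong refl) (simp add: algebra_simps)

text \<open>For each monomial the double sum over the vertices factorizes into two one-dimensional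
  reproduction identities. The mixed derivative of the polynomial is the constant
  \<open>k11\<close>, which is what any average with weight of integral one returns.\<close>

lemma hermite_interp_quad_poly:
  fixes k00 k10 k01 k20 k11 k02 :: real
  assumes ab: "a < b" "c < d" and ij: "i + j \<le> 2"
  defines "Q \<equiv> quad_poly k00 k10 k01 k20 k11 k02"
  shows "hermite_interp a b c d (\<lambda>e f. Q 0 0 (e, f)) (\<lambda>e f. Q 1 0 (e, f)) (\<lambda>e f. Q 0 1 (e, f)) (\<lambda>e f. k11) i j z = Q i j z"
proof -
  obtain s t where z: "z = (s, t)" by (cases z)
  let ?P0 = "of_bool (i = 0) :: real" and ?R0 = "of_bool (j = 0) :: real"
  let ?P1 = "if i = 0 then s else of_bool (i = 1)" and ?R1 = "if j = 0 then t else of_bool (j = 1)"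
  let ?P2 = "if i = 0 then s\<^sup>2 else if i = 1 then 2 * s else 2" and ?R2 = "if j = 0 then t\<^sup>2 else if j = 1 then 2 * t else 2"
  define pa pb qa qb where p: "pa = hphi a b a i s" "pb = hphi a b b i s" "qa = hpsi a b a i s" "qb = hpsi a b b i s"
  define ua ub va vb where u: "ua = hphi c d c j t" "ub = hphi c d d j t" "va = hpsi c d c j t" "vb = hpsi c d d j t"
  have I: "pa + pb = ?P0" "a * pa + b * pb + qa + qb = ?P1" "a\<^sup>2 * pa + b\<^sup>2 * pb + 2 * a * qa + 2 * b * qb = ?P2"
    unfolding p using hphi_partition hermite_linear hermite_quadratic ab ij by auto
  have J: "ua + ub = ?R0" "c * ua + d * ub + va + vb = ?R1" "c\<^sup>2 * ua + d\<^sup>2 * ub + 2 * c * va + 2 * d * vb = ?R2"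
    unfolding u using hphi_partition hermite_linear hermite_quadratic ab ij by auto
  have "hermite_interp a b c d (\<lambda>e f. Q 0 0 (e, f)) (\<lambda>e f. Q 1 0 (e, f)) (\<lambda>e f. Q 0 1 (e, f)) (\<lambda>e f. k11) i j z
    = k00 * ((pa + pb) * (ua + ub)) + k10 * ((a * pa + b * pb + qa + qb) * (ua + ub)) + k01 * ((pa + pb) * (c * ua + d * ub + va + vb))
    + k20 * ((a\<^sup>2 * pa + b\<^sup>2 * pb + 2 * a * qa + 2 * b * qb) * (ua + ub))
    + k11 * ((a * pa + b * pb + qa + qb) * (c * ua + d * ub + va + vb))
    + k02 * ((pa + pb) * (c\<^sup>2 * ua + d\<^sup>2 * ub + 2 * c * va + 2 * d * vb))"
    using ab unfolding hermite_interp_def z fst_conv snd_conv Q_def quad_poly_def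
    by (simp add: p[symmetric] u[symmetric] algebra_simps)
  also have "\<dots> = Q i j z"
  proof -
    consider "i = 0 \<and> j = 0" | "i = 1 \<and> j = 0" | "i = 0 \<and> j = 1" | "i = 2 \<and> j = 0" | "i = 1 \<and> j = 1" | "i = 0 \<and> j = 2"
      using ij by linarith
    then show ?thesis unfolding I J Q_def quad_poly_def z by cases auto
  qed
  finally show ?thesis .
qed

text \<open>If values are of size h, first derivatives of size 1 and mixed derivatives of size 1/h,
  all four kinds of terms have the same order. Each vertex contributes 44^2 = 1936, and the four
  vertices give 7744.\<close>

lemma hermite_interp_bound:
  assumes h: "h > 0" and b: "b = a + h" "d = c + h" and s: "fst z \<in> {a..b}" "snd z \<in> {c..d}" and ij: "i + j \<le> 2"
    and U: "\<And>e f. e \<in> {a, b} \<Longrightarrow> f \<in> {c, d} \<Longrightarrow> \<bar>U e f\<bar> \<le> h * A"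
    and X: "\<And>e f. e \<in> {a, b} \<Longrightarrow> f \<in> {c, d} \<Longrightarrow> \<bar>X e f\<bar> \<le> B"
    and Y: "\<And>e f. e \<in> {a, b} \<Longrightarrow> f \<in> {c, d} \<Longrightarrow> \<bar>Y e f\<bar> \<le> B"
    and W: "\<And>e f. e \<in> {a, b} \<Longrightarrow> f \<in> {c, d} \<Longrightarrow> \<bar>W e f\<bar> \<le> C / h"
  shows "\<bar>hermite_interp a b c d U X Y W i j z\<bar> \<le> 7744 * (A + 2 * B + C) * (h / h ^ (i + j))"
proof -
  have i: "i \<le> 2" "j \<le> 2" and ab: "a < b" "c < d" using ij h b by auto
  have pos: "h ^ i > 0" "h ^ j > 0" using h by auto
  have p: "\<bar>hphi a b e i (fst z)\<bar> \<le> 44 / h ^ i" "\<bar>hpsi a b e i (fst z)\<bar> \<le> 44 * h / h ^ i" for e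
    using hphi_bound[OF ab(1) i(1) s(1)] hpsi_bound[OF ab(1) i(1) s(1)] b by auto
  have q: "\<bar>hphi c d f j (snd z)\<bar> \<le> 44 / h ^ j" "\<bar>hpsi c d f j (snd z)\<bar> \<le> 44 * h / h ^ j" for f
    using hphi_bound[OF ab(2) i(2) s(2)] hpsi_bound[OF ab(2) i(2) s(2)] b by auto
  have prod: "\<bar>u * (x * y)\<bar> \<le> P * (Q * T)" if "\<bar>u\<bar> \<le> P" "\<bar>x\<bar> \<le> Q" "\<bar>y\<bar> \<le> T" for u x y P Q T :: real
    unfolding abs_mult using that abs_ge_zero order_trans by (intro mult_mono mult_nonneg_nonneg) (blast intro: order_trans[OF abs_ge_zero])+
  have tm: "\<bar>U e f * (hphi a b e i (fst z) * hphi c d f j (snd z)) + X e f * (hpsi a b e i (fst z) * hphi c d f j (snd z))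
     + Y e f * (hphi a b e i (fst z) * hpsi c d f j (snd z)) + W e f * (hpsi a b e i (fst z) * hpsi c d f j (snd z))\<bar>
     \<le> 1936 * (A + 2 * B + C) * (h / h ^ (i + j))" if e: "e \<in> {a, b}" and f: "f \<in> {c, d}" for e f
  proof -
    have 1: "\<bar>U e f * (hphi a b e i (fst z) * hphi c d f j (snd z))\<bar> \<le> h * A * (44 / h ^ i * (44 / h ^ j))"
      by (rule prod[OF U[OF e f] p(1) q(1)])
    have 2: "\<bar>X e f * (hpsi a b e i (fst z) * hphi c d f j (snd z))\<bar> \<le> B * (44 * h / h ^ i * (44 / h ^ j))"
      by (rule prod[OF X[OF e f] p(2) q(1)])
    have 3: "\<bar>Y e f * (hphi a b e i (fst z) * hpsi c d f j (snd z))\<bar> \<le> B * (44 / h ^ i * (44 * h / h ^ j))"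
      by (rule prod[OF Y[OF e f] p(1) q(2)])
    have 4: "\<bar>W e f * (hpsi a b e i (fst z) * hpsi c d f j (snd z))\<bar> \<le> C / h * (44 * h / h ^ i * (44 * h / h ^ j))"
      by (rule prod[OF W[OF e f] p(2) q(2)])
    have "h * A * (44 / h ^ i * (44 / h ^ j)) + B * (44 * h / h ^ i * (44 / h ^ j)) + B * (44 / h ^ i * (44 * h / h ^ j)) + C / h * (44 * h / h ^ i * (44 * h / h ^ j))
      = 1936 * (A + 2 * B + C) * (h / h ^ (i + j))"
      using h by (simp add: power_add field_simps)
    then show ?thesis
      using order_trans[OF abs_sum4 add_mono[OF add_mono[OF add_mono[OF 1 2] 3] 4]] by simp
  qed
  have ne: "a \<noteq> b" "c \<noteq> d" using ab by auto
  have "\<bar>hermite_interp a b c d U X Y W i j z\<bar> \<le> (\<Sum>e\<in>{a, b}. \<Sum>f\<in>{c, d}. 1936 * (A + 2 * B + C) * (h / h ^ (i + j)))"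
    unfolding hermite_interp_def
    by (intro order_trans[OF sum_abs] sum_mono) (use tm in \<open>blast intro: order_trans[OF sum_abs] sum_mono\<close>)
  also have "\<dots> = 7744 * (A + 2 * B + C) * (h / h ^ (i + j))" using ne by simp
  finally show ?thesis .
qed

text \<open>The single density by which all errors are measured. It is applied to smooth families
  and, after the limit, to the family of weak derivatives.\<close>

definition third :: "(nat \<Rightarrow> nat \<Rightarrow> real \<times> real \<Rightarrow> real) \<Rightarrow> real \<times> real \<Rightarrow> real" where
  "third D z = \<bar>D 3 0 z\<bar> + \<bar>D 2 1 z\<bar> + \<bar>D 1 2 z\<bar> + \<bar>D 0 3 z\<bar>"

text \<open>The subtracted quadratic polynomial is chosen such that the derivatives of the difference up to
  second order have mean zero.\<close>

lemma quadratic_approximation: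
  assumes D: "smooth2 D" and h: "h > 0"
    and R: "h \<le> b1 - a1" "b1 - a1 \<le> 3 * h" "h \<le> b2 - a2" "b2 - a2 \<le> 3 * h"
  defines "R \<equiv> cbox (a1, a2) (b1, b2)"
  defines "S \<equiv> integral R (third D)"
  obtains k00 k10 k01 k20 k11 k02 where
    "k11 = integral R (D 1 1) / ((b1 - a1) * (b2 - a2))"
    "\<And>z. z \<in> R \<Longrightarrow> \<bar>D 0 0 z - quad_poly k00 k10 k01 k20 k11 k02 0 0 z\<bar> \<le> 147 * h * S"
    "\<And>i j z. i + j = 1 \<Longrightarrow> z \<in> R \<Longrightarrow> \<bar>D i j z - quad_poly k00 k10 k01 k20 k11 k02 i j z\<bar> \<le> 25 * S"
    "\<And>i j x y. i + j = 2 \<Longrightarrow> x \<in> {a1..b1} \<Longrightarrow> y \<in> {a2..b2} \<Longrightarrow> \<bar>D i j (x, y) - quad_poly k00 k10 k01 k20 k11 k02 i j (x, y)\<bar>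
       \<le> integral {a1..b1} (\<lambda>x. third D (x, y)) + S / h"
    "S \<ge> 0" "integral R (\<lambda>z. \<bar>D 1 1 z - k11\<bar>) \<le> 3 * h * S"
proof -
  have ab: "a1 < b1" "a2 < b2" using h R by auto
  define m where "m f = integral R f / ((b1 - a1) * (b2 - a2))" for f :: "real \<times> real \<Rightarrow> real"
  have cD: "continuous_on R (D i j)" for i j by (rule smooth2_continuous[OF D])
  have cD': "continuous_on X (D i j)" for i j X by (rule smooth2_continuous[OF D])
  \<comment> \<open>The coefficients of highest order come first; each of the lower ones is the mean
    of what remains after the higher terms have been subtracted.\<close>
  define k20 where "k20 = m (D 2 0) / 2"
  define k11 where "k11 = m (D 1 1)"
  define k02 where "k02 = m (D 0 2) / 2"
  define k10 where "k10 = m (\<lambda>z. D 1 0 z - (2 * k20 * fst z + k11 * snd z))"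
  define k01 where "k01 = m (\<lambda>z. D 0 1 z - (k11 * fst z + 2 * k02 * snd z))"
  define k00 where "k00 = m (\<lambda>z. D 0 0 z - (k10 * fst z + k01 * snd z + k20 * (fst z)\<^sup>2 + k11 * (fst z * snd z) + k02 * (snd z)\<^sup>2))"
  define Q where "Q = quad_poly k00 k10 k01 k20 k11 k02"
  define E where "E i j z = D i j z - Q i j z" for i j z
  have E: "smooth2 E" unfolding E_def[abs_def] Q_def by (intro smooth2_diff D smooth2_quad_poly)
  have cE: "continuous_on R (E i j)" for i j by (rule smooth2_continuous[OF E])
  have aE: "(\<lambda>z. \<bar>E i j z\<bar>) integrable_on R" for i j unfolding R_def by (intro integrable_continuous continuous_on_rabs smooth2_continuous[OF E])
  have zero: "integral R (\<lambda>z. f z - m f) = 0" if "continuous_on R f" for f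
  proof -
    have "integral R (\<lambda>z. f z - m f) = integral R f - integral R (\<lambda>z. m f)"
      using that unfolding R_def by (intro integral_diff integrable_continuous) auto
    also have "integral R (\<lambda>z. m f) = (b1 - a1) * (b2 - a2) * m f"
      unfolding R_def using ab by (simp add: content_Pair)
    finally show ?thesis unfolding m_def using ab by simp
  qed
  have E0: "integral R (E i j) = 0" if ij: "i + j \<le> 2" for i j
  proof -
    consider "i = 0 \<and> j = 0" | "i = 1 \<and> j = 0" | "i = 0 \<and> j = 1" | "i = 2 \<and> j = 0" | "i = 1 \<and> j = 1" | "i = 0 \<and> j = 2"
      using ij by linarith
    then show ?thesis
    proof cases
      case 1
      have "E i j = (\<lambda>z. (D 0 0 z - (k10 * fst z + k01 * snd z + k20 * (fst z)\<^sup>2 + k11 * (fst z * snd z) + k02 * (snd z)\<^sup>2)) - k00)"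
        using 1 by (auto simp: E_def Q_def quad_poly_def fun_eq_iff)
      then show ?thesis unfolding k00_def by (simp only:) (intro zero continuous_intros cD')
    next
      case 2
      have "E i j = (\<lambda>z. (D 1 0 z - (2 * k20 * fst z + k11 * snd z)) - k10)"
        using 2 by (auto simp: E_def Q_def quad_poly_def fun_eq_iff)
      then show ?thesis unfolding k10_def by (simp only:) (intro zero continuous_intros cD')
    next
      case 3
      have "E i j = (\<lambda>z. (D 0 1 z - (k11 * fst z + 2 * k02 * snd z)) - k01)"
        using 3 by (auto simp: E_def Q_def quad_poly_def fun_eq_iff)
      then show ?thesis unfolding k01_def by (simp only:) (intro zero continuous_intros cD')
    next
      case 4
      have "E i j = (\<lambda>z. D 2 0 z - m (D 2 0))"
        using 4 by (auto simp: E_def Q_def quad_poly_def fun_eq_iff k20_def)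
      then show ?thesis using zero[OF cD] by simp
    next
      case 5
      have "E i j = (\<lambda>z. D 1 1 z - m (D 1 1))"
        using 5 by (auto simp: E_def Q_def quad_poly_def fun_eq_iff k11_def)
      then show ?thesis using zero[OF cD] by simp
    next
      case 6
      have "E i j = (\<lambda>z. D 0 2 z - m (D 0 2))"
        using 6 by (auto simp: E_def Q_def quad_poly_def fun_eq_iff k02_def)
      then show ?thesis using zero[OF cD] by simp
    qed
  qed
  have E3: "E i j = D i j" if "i + j = 3" for i j
    using that by (auto simp: E_def Q_def quad_poly_def fun_eq_iff)
  have cthird: "continuous_on X (third D)" for X unfolding third_def[abs_def] by (intro continuous_intros cD')
  have ithird: "third D integrable_on R" unfolding R_def by (intro integrable_continuous cthird)
  define N where "N i j = integral R (\<lambda>z. \<bar>E i j z\<bar>)" for i j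
  have N0: "N i j \<ge> 0" for i j unfolding N_def by (intro integral_nonneg aE) auto
  have S0: "S \<ge> 0" unfolding S_def by (intro integral_nonneg ithird) (auto simp: third_def)
  have le3: "\<bar>E i j z\<bar> \<le> third D z" if ij: "i + j = 3" for i j z
  proof -
    consider "i = 3 \<and> j = 0" | "i = 2 \<and> j = 1" | "i = 1 \<and> j = 2" | "i = 0 \<and> j = 3" using ij by linarith
    then show ?thesis unfolding E3[OF ij] third_def by cases auto
  qed
  have N3: "N i j \<le> S" if "i + j = 3" for i j
    unfolding N_def S_def by (intro integral_le aE ithird le3 that)
  \<comment> \<open>The two third derivatives are different summands of \<open>third\<close>, so
    their norms together, and not only each of them, stay below S.\<close>
  have N33: "N (Suc i) j + N i (Suc j) \<le> S" if ij: "i + j = 2" for i j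
  proof -
    have "N (Suc i) j + N i (Suc j) = integral R (\<lambda>z. \<bar>E (Suc i) j z\<bar> + \<bar>E i (Suc j) z\<bar>)"
      unfolding N_def by (rule integral_add[OF aE aE, symmetric])
    also have "\<dots> \<le> S" unfolding S_def
    proof (intro integral_le integrable_add aE ithird)
      fix z
      have E': "E (Suc i) j = D (Suc i) j" "E i (Suc j) = D i (Suc j)" using ij by (auto intro: E3)
      consider "i = 2 \<and> j = 0" | "i = 1 \<and> j = 1" | "i = 0 \<and> j = 2" using ij by linarith
      then show "\<bar>E (Suc i) j z\<bar> + \<bar>E i (Suc j) z\<bar> \<le> third D z"
        unfolding E' third_def by cases (auto simp: numeral_3_eq_3 numeral_2_eq_2)
    qed
    finally show ?thesis .
  qed
  have box: "C1_box a1 b1 a2 b2 (E i j) (E (Suc i) j) (E i (Suc j))" for i j by (rule smooth2_C1_box[OF E ab])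
  \<comment> \<open>Mean zero allows the Poincare inequality at every order up to two, with side
    lengths at most 3 h. Iteration yields 3 h S, 18 h^2 S and 108 h^3 S for the orders 2, 1 and
    0.\<close>
  have poin: "N i j \<le> 3 * h * (N (Suc i) j + N i (Suc j))" if "i + j \<le> 2" for i j
  proof -
    have "N i j \<le> (b1 - a1) * N (Suc i) j + (b2 - a2) * N i (Suc j)"
      using C1_box.L1_poincare[OF box, of i j] E0[OF that] unfolding N_def R_def by simp
    also have "\<dots> \<le> 3 * h * N (Suc i) j + 3 * h * N i (Suc j)"
      using R N0 by (intro add_mono mult_right_mono) auto
    finally show ?thesis by (simp add: distrib_left)
  qed
  have N2: "N i j \<le> 3 * h * S" if "i + j = 2" for i j
  proof -
    have "N i j \<le> 3 * h * (N (Suc i) j + N i (Suc j))" using that by (intro poin) simp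
    also have "\<dots> \<le> 3 * h * S" using N33[OF that] h by (intro mult_left_mono) auto
    finally show ?thesis .
  qed
  have N1: "N i j \<le> 18 * h\<^sup>2 * S" if "i + j = 1" for i j
  proof -
    have "N i j \<le> 3 * h * (N (Suc i) j + N i (Suc j))" using that by (intro poin) simp
    also have "\<dots> \<le> 3 * h * (3 * h * S + 3 * h * S)" using h that by (intro mult_left_mono add_mono N2) auto
    finally show ?thesis by (simp add: power2_eq_square algebra_simps)
  qed
  have N0': "N 0 0 \<le> 108 * h ^ 3 * S"
  proof -
    have "N 0 0 \<le> 3 * h * (N (Suc 0) 0 + N 0 (Suc 0))" by (intro poin) simp
    also have "\<dots> \<le> 3 * h * (18 * h\<^sup>2 * S + 18 * h\<^sup>2 * S)" using h by (intro mult_left_mono add_mono N1) auto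
    finally show ?thesis by (simp add: power2_eq_square power3_eq_cube algebra_simps)
  qed
  have div1: "x / (b1 - a1) \<le> x / h" "x / (b2 - a2) \<le> x / h" "x / ((b1 - a1) * (b2 - a2)) \<le> x / h\<^sup>2" if "x \<ge> 0" for x
    using that R h ab by (auto intro!: divide_left_mono mult_mono simp: power2_eq_square)
  have sup: "\<bar>E i j z\<bar> \<le> N i j / h\<^sup>2 + N (Suc i) j / h + N i (Suc j) / h + N (Suc i) (Suc j)" if "z \<in> R" for i j z
  proof -
    obtain x y where z: "z = (x, y)" by (cases z)
    have xy: "x \<in> {a1..b1}" "y \<in> {a2..b2}" using that unfolding z R_def by auto
    have "\<bar>E i j (x, y)\<bar> \<le> N i j / ((b1 - a1) * (b2 - a2)) + N (Suc i) j / (b2 - a2) + N i (Suc j) / (b1 - a1) + N (Suc i) (Suc j)"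
      unfolding N_def R_def using C1_box.sup_le[OF box smooth2_continuous[OF E] smooth2_partials(2)[OF E] xy] .
    then show ?thesis unfolding z using div1(3)[OF N0, of i j] div1(2)[OF N0, of "Suc i" j] div1(1)[OF N0, of i "Suc j"] by linarith
  qed
  \<comment> \<open>The supremum bound collects 18 + 3 + 3 + 1 = 25.\<close>
  have s1: "\<bar>E i j z\<bar> \<le> 25 * S" if ij: "i + j = 1" and z: "z \<in> R" for i j z
  proof -
    have "N i j / h\<^sup>2 \<le> 18 * h\<^sup>2 * S / h\<^sup>2" using N1[OF ij] h by (intro divide_right_mono) auto
    moreover have "N (Suc i) j / h \<le> 3 * h * S / h" "N i (Suc j) / h \<le> 3 * h * S / h"
      using h ij by (intro divide_right_mono N2; simp)+
    moreover have "N (Suc i) (Suc j) \<le> S" using ij by (intro N3) simp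
    ultimately show ?thesis using sup[OF z, of i j] h by simp
  qed
  \<comment> \<open>The supremum bound collects 108 + 18 + 18 + 3 = 147.\<close>
  have s0: "\<bar>E 0 0 z\<bar> \<le> 147 * h * S" if z: "z \<in> R" for z
  proof -
    have "N 0 0 / h\<^sup>2 \<le> 108 * h ^ 3 * S / h\<^sup>2" using N0' h by (intro divide_right_mono) auto
    moreover have "N (Suc 0) 0 / h \<le> 18 * h\<^sup>2 * S / h" "N 0 (Suc 0) / h \<le> 18 * h\<^sup>2 * S / h"
      using h by (intro divide_right_mono N1; simp)+
    moreover have "N (Suc 0) (Suc 0) \<le> 3 * h * S" by (intro N2) simp
    ultimately show ?thesis using sup[OF z, of 0 0] h by (simp add: power2_eq_square power3_eq_cube)
  qed
  \<comment> \<open>For second derivatives \<open>sup_le\<close> would involve fourth derivatives;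
    the pointwise Poincare inequality is used instead, at the price of a line integral.\<close>
  have s2: "\<bar>E i j (x, y)\<bar> \<le> integral {a1..b1} (\<lambda>x. third D (x, y)) + S / h"
    if ij: "i + j = 2" and x: "x \<in> {a1..b1}" and y: "y \<in> {a2..b2}" for i j x y
  proof -
    have "\<bar>E i j (x, y)\<bar> \<le> integral {a1..b1} (\<lambda>x. \<bar>E (Suc i) j (x, y)\<bar>) + N i (Suc j) / (b1 - a1)"
      using C1_box.pointwise_poincare[OF box x y, of i j] E0[of i j] ij unfolding N_def R_def by simp
    moreover have "integral {a1..b1} (\<lambda>x. \<bar>E (Suc i) j (x, y)\<bar>) \<le> integral {a1..b1} (\<lambda>x. third D (x, y))"
    proof (intro integral_le integrable_continuous_interval)
      show "continuous_on {a1..b1} (\<lambda>x. \<bar>E (Suc i) j (x, y)\<bar>)"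
        by (rule continuous_box_slice_x[OF continuous_on_rabs[OF smooth2_continuous[OF E]] y])
      show "continuous_on {a1..b1} (\<lambda>x. third D (x, y))" by (rule continuous_box_slice_x[OF cthird y])
    qed (use ij in \<open>auto intro: le3\<close>)
    moreover have "N i (Suc j) / (b1 - a1) \<le> S / h"
    proof -
      have "N i (Suc j) / (b1 - a1) \<le> N i (Suc j) / h" by (rule div1(1)[OF N0])
      also have "\<dots> \<le> S / h" using h ij by (intro divide_right_mono N3) auto
      finally show ?thesis .
    qed
    ultimately show ?thesis by linarith
  qed
  show ?thesis
  proof (rule that[of k11 k00 k10 k01 k20 k02])
    show "k11 = integral R (D 1 1) / ((b1 - a1) * (b2 - a2))" unfolding k11_def m_def ..
    have "E 1 1 = (\<lambda>z. D 1 1 z - k11)" by (auto simp: E_def Q_def quad_poly_def fun_eq_iff)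
    then show "integral R (\<lambda>z. \<bar>D 1 1 z - k11\<bar>) \<le> 3 * h * S" using N2[of 1 1] unfolding N_def by simp
  qed (use s0 s1 s2 S0 in \<open>auto simp: E_def Q_def\<close>)
qed

text \<open>The interpolant reproduces the approximating quadratic, so the error splits into the
  approximation error and the interpolant of that error. Of the mixed data \<open>W\<close> only
  closeness to the mean mixed derivative is required. In the constant, 197 = 147 + 2 * 25 and
  \<kappa> stem from the interpolated data, and the final 147 from the approximation error.\<close>

theorem smooth_estimate:
  assumes D: "smooth2 D" and h: "h > 0"
    and R: "h \<le> b1 - a1" "b1 - a1 \<le> 3 * h" "h \<le> b2 - a2" "b2 - a2 \<le> 3 * h"
    and M: "a1 \<le> s0" "s0 + h \<le> b1" "a2 \<le> t0" "t0 + h \<le> b2"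
    and W: "\<And>e f. e \<in> {s0, s0 + h} \<Longrightarrow> f \<in> {t0, t0 + h} \<Longrightarrow>
       \<bar>W e f - integral (cbox (a1, a2) (b1, b2)) (D 1 1) / ((b1 - a1) * (b2 - a2))\<bar> \<le> \<kappa> * integral (cbox (a1, a2) (b1, b2)) (third D) / h"
    and \<kappa>: "\<kappa> \<ge> 0" and s: "s \<in> {s0..s0 + h}" and t: "t \<in> {t0..t0 + h}" and ij: "i + j \<le> 2"
  shows "\<bar>D i j (s, t) - hermite_interp s0 (s0 + h) t0 (t0 + h) (\<lambda>e f. D 0 0 (e, f)) (\<lambda>e f. D 1 0 (e, f)) (\<lambda>e f. D 0 1 (e, f)) W i j (s, t)\<bar>
    \<le> (7744 * (197 + \<kappa>) + 147) * (h\<^sup>2 / h ^ (i + j)) * (integral {a1..b1} (\<lambda>r. third D (r, t)) + integral (cbox (a1, a2) (b1, b2)) (third D) / h)"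
proof -
  define Rb where "Rb = cbox (a1, a2) (b1, b2)"
  define S where "S = integral Rb (third D)"
  obtain k00 k10 k01 k20 k11 k02 where k11: "k11 = integral Rb (D 1 1) / ((b1 - a1) * (b2 - a2))"
    and e0: "\<And>z. z \<in> Rb \<Longrightarrow> \<bar>D 0 0 z - quad_poly k00 k10 k01 k20 k11 k02 0 0 z\<bar> \<le> 147 * h * S"
    and e1: "\<And>i j z. i + j = 1 \<Longrightarrow> z \<in> Rb \<Longrightarrow> \<bar>D i j z - quad_poly k00 k10 k01 k20 k11 k02 i j z\<bar> \<le> 25 * S"
    and e2: "\<And>i j x y. i + j = 2 \<Longrightarrow> x \<in> {a1..b1} \<Longrightarrow> y \<in> {a2..b2} \<Longrightarrow> \<bar>D i j (x, y) - quad_poly k00 k10 k01 k20 k11 k02 i j (x, y)\<bar>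
       \<le> integral {a1..b1} (\<lambda>x. third D (x, y)) + S / h"
    and S0: "S \<ge> 0"
    using quadratic_approximation[OF D h R] unfolding Rb_def S_def by metis
  let ?Q = "quad_poly k00 k10 k01 k20 k11 k02"
  have hh: "s0 < s0 + h" "t0 < t0 + h" using h by auto
  let ?I = "hermite_interp s0 (s0 + h) t0 (t0 + h)"
  have in_R: "(e, f) \<in> Rb" if "e \<in> {s0..s0 + h}" "f \<in> {t0..t0 + h}" for e f using that M unfolding Rb_def by auto
  have corner: "(e, f) \<in> Rb" if "e \<in> {s0, s0 + h}" "f \<in> {t0, t0 + h}" for e f using that h by (intro in_R) auto
  have st: "s \<in> {a1..b1}" "t \<in> {a2..b2}" using s t M by auto
  define A where "A = integral {a1..b1} (\<lambda>r. third D (r, t))"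
  have A0: "A \<ge> 0" unfolding A_def
    by (intro integral_nonneg integrable_continuous_interval continuous_box_slice_x[OF _ st(2)])
      (auto simp: third_def[abs_def] intro!: continuous_intros smooth2_continuous[OF D])
  have I: "\<bar>?I (\<lambda>e f. D 0 0 (e, f) - ?Q 0 0 (e, f)) (\<lambda>e f. D 1 0 (e, f) - ?Q 1 0 (e, f)) (\<lambda>e f. D 0 1 (e, f) - ?Q 0 1 (e, f)) (\<lambda>e f. W e f - k11) i j (s, t)\<bar>
     \<le> 7744 * (147 * S + 2 * (25 * S) + \<kappa> * S) * (h / h ^ (i + j))"
  proof (rule hermite_interp_bound[OF h refl refl _ _ ij])
    show "\<bar>D 0 0 (e, f) - ?Q 0 0 (e, f)\<bar> \<le> h * (147 * S)" if "e \<in> {s0, s0 + h}" "f \<in> {t0, t0 + h}" for e f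
      using e0[OF corner[OF that]] by (simp add: mult_ac)
    show "\<bar>D 1 0 (e, f) - ?Q 1 0 (e, f)\<bar> \<le> 25 * S" "\<bar>D 0 1 (e, f) - ?Q 0 1 (e, f)\<bar> \<le> 25 * S" if "e \<in> {s0, s0 + h}" "f \<in> {t0, t0 + h}" for e f
      using e1[OF _ corner[OF that]] by auto
    show "\<bar>W e f - k11\<bar> \<le> \<kappa> * S / h" if "e \<in> {s0, s0 + h}" "f \<in> {t0, t0 + h}" for e f
      using W[OF that] unfolding k11 S_def Rb_def .
  qed (use s t in auto)
  have E: "\<bar>D i j (s, t) - ?Q i j (s, t)\<bar> \<le> 147 * (h\<^sup>2 / h ^ (i + j)) * (A + S / h)"
  proof -
    have Sh: "S / h \<ge> 0" using S0 h by simp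
    consider "i + j = 0" | "i + j = 1" | "i + j = 2" using ij by linarith
    then show ?thesis
    proof cases
      case 1
      then have "i = 0" "j = 0" by auto
      have "147 * h * S = 147 * h\<^sup>2 * (S / h)" using h by (simp add: power2_eq_square)
      also have "\<dots> \<le> 147 * h\<^sup>2 * (A + S / h)" using A0 by (intro mult_left_mono) auto
      finally show ?thesis using e0[OF in_R[OF s t]] unfolding \<open>i = 0\<close> \<open>j = 0\<close> by simp
    next
      case 2
      have "25 * S = 25 * h * (S / h)" using h by simp
      also have "\<dots> \<le> 147 * h * (A + S / h)" using A0 Sh h by (intro mult_mono) auto
      finally show ?thesis using e1[OF 2 in_R[OF s t]] h unfolding 2 by (simp add: power2_eq_square)
    next
      case 3
      then show ?thesis using e2[OF 3 st] Sh A0 h unfolding A_def[symmetric] 3 by simp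
    qed
  qed
  have "D i j (s, t) - ?I (\<lambda>e f. D 0 0 (e, f)) (\<lambda>e f. D 1 0 (e, f)) (\<lambda>e f. D 0 1 (e, f)) W i j (s, t)
    = (D i j (s, t) - ?Q i j (s, t)) - ?I (\<lambda>e f. D 0 0 (e, f) - ?Q 0 0 (e, f)) (\<lambda>e f. D 1 0 (e, f) - ?Q 1 0 (e, f)) (\<lambda>e f. D 0 1 (e, f) - ?Q 0 1 (e, f)) (\<lambda>e f. W e f - k11) i j (s, t)"
    unfolding hermite_interp_diff hermite_interp_quad_poly[OF hh ij] by simp
  then have "\<bar>D i j (s, t) - ?I (\<lambda>e f. D 0 0 (e, f)) (\<lambda>e f. D 1 0 (e, f)) (\<lambda>e f. D 0 1 (e, f)) W i j (s, t)\<bar>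
     \<le> 147 * (h\<^sup>2 / h ^ (i + j)) * (A + S / h) + 7744 * (147 * S + 2 * (25 * S) + \<kappa> * S) * (h / h ^ (i + j))"
    using E I by linarith
  also have "\<dots> \<le> 147 * (h\<^sup>2 / h ^ (i + j)) * (A + S / h) + 7744 * (197 + \<kappa>) * (h\<^sup>2 / h ^ (i + j)) * (A + S / h)"
  proof (rule add_left_mono)
  have "7744 * (147 * S + 2 * (25 * S) + \<kappa> * S) * (h / h ^ (i + j)) = 7744 * (197 + \<kappa>) * (h\<^sup>2 / h ^ (i + j)) * (S / h)"
    using h by (simp add: power2_eq_square field_simps)
  also have "\<dots> \<le> 7744 * (197 + \<kappa>) * (h\<^sup>2 / h ^ (i + j)) * (A + S / h)"
    using A0 h \<kappa> by (intro mult_left_mono mult_nonneg_nonneg) auto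
  finally show "7744 * (147 * S + 2 * (25 * S) + \<kappa> * S) * (h / h ^ (i + j)) \<le> 7744 * (197 + \<kappa>) * (h\<^sup>2 / h ^ (i + j)) * (A + S / h)" .
  qed
  also have "147 * (h\<^sup>2 / h ^ (i + j)) * (A + S / h) + 7744 * (197 + \<kappa>) * (h\<^sup>2 / h ^ (i + j)) * (A + S / h)
     = (7744 * (197 + \<kappa>) + 147) * (h\<^sup>2 / h ^ (i + j)) * (A + S / h)"
    unfolding distrib_right[of "7744 * (197 + \<kappa>)" 147 "h\<^sup>2 / h ^ (i + j)"]
      distrib_right[of "7744 * (197 + \<kappa>) * (h\<^sup>2 / h ^ (i + j))" "147 * (h\<^sup>2 / h ^ (i + j))" "A + S / h"]
    by (rule add.commute)
  finally show ?thesis unfolding A_def S_def Rb_def .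
qed

section \<open>Averages over lines in Lebesgue spaces\<close>

text \<open>Convexity: the graph lies above its tangents. The point x = 0 is treated by hand because
  the tangent argument is carried out on the open half line.\<close>

lemma powr_tangent:
  fixes q x a :: real
  assumes q: "q \<ge> 1" and x: "x \<ge> 0" and a: "a > 0"
  shows "a powr q + q * a powr (q - 1) * (x - a) \<le> x powr q"
proof (cases "x = 0")
  case True
  have "a powr (q - 1) * a = a powr q" using a powr_add[of a "q - 1" 1] by simp
  then have "a powr q + q * a powr (q - 1) * (x - a) = (1 - q) * a powr q" using True by (simp add: algebra_simps)
  also have "\<dots> \<le> 0" using q by (intro mult_nonpos_nonneg) auto
  finally show ?thesis using True by simp
next
  case False
  then have x0: "x > 0" using x by simp
  have "((\<lambda>x. x powr q) has_real_derivative q * a powr (q - 1)) (at a within {0<..})"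
    using a by (auto intro!: derivative_eq_intros simp: powr_diff)
  then have "x powr q - a powr q \<ge> q * a powr (q - 1) * (x - a)"
    using a x0 by (intro convex_on_imp_above_tangent[of "{0<..}" _ a x] powr_convex[OF q]) (auto simp: interior_open)
  then show ?thesis by simp
qed

text \<open>The tangent inequality at the point a, the integral of f divided by \<mu>, is integrated
  over \<open>S\<close>. An upper bound \<mu> for the measure of \<open>S\<close> suffices, since (1
  - q) \<mu> is at most (1 - q) times that measure.\<close>

lemma jensen_powr:
  fixes f :: "'a \<Rightarrow> real"
  assumes f: "integrable M f" "\<And>z. f z \<ge> 0" "\<And>z. z \<notin> S \<Longrightarrow> f z = 0" and fq: "integrable M (\<lambda>z. f z powr q)"
    and S: "S \<in> sets M" "emeasure M S \<le> ennreal \<mu>" and \<mu>: "\<mu> > 0" and q: "q \<ge> 1"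
  shows "(integral\<^sup>L M f) powr q \<le> \<mu> powr (q - 1) * (LINT z|M. f z powr q)"
proof -
  define a where "a = integral\<^sup>L M f / \<mu>"
  have I0: "integral\<^sup>L M f \<ge> 0" using f(2) by (intro integral_nonneg_AE) auto
  have J0: "(LINT z|M. f z powr q) \<ge> 0" by (intro integral_nonneg_AE) auto
  show ?thesis
  proof (cases "integral\<^sup>L M f = 0")
    case True then show ?thesis using J0 q by simp
  next
    case False
    then have a: "a > 0" using I0 \<mu> unfolding a_def by simp
    have Sf: "emeasure M S < \<infinity>" using S(2) by (simp add: order_le_less_trans[OF _ ennreal_less_top])
    have iS: "integrable M (indicator S :: 'a \<Rightarrow> real)" using S(1) Sf by (simp add: integrable_indicator_iff)
    have mS: "measure M S \<le> \<mu>" unfolding measure_def using S(2) \<mu> by (intro enn2real_leI) auto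
    let ?g = "\<lambda>z. (a powr q - q * a powr (q - 1) * a) * indicator S z + q * a powr (q - 1) * f z"
    have "integral\<^sup>L M ?g \<le> (LINT z|M. f z powr q)"
    proof (rule integral_mono)
      show "integrable M ?g" using iS f(1) by simp
      show "?g z \<le> f z powr q" for z
      proof (cases "z \<in> S")
        case True then show ?thesis using powr_tangent[OF q f(2)[of z] a] by (simp add: algebra_simps)
      next
        case False then show ?thesis using f(3)[OF False] q by simp
      qed
    qed (rule fq)
    also have "integral\<^sup>L M ?g = (a powr q - q * a powr (q - 1) * a) * measure M S + q * a powr (q - 1) * (a * \<mu>)"
      using iS f(1) S(1) \<mu> by (simp add: a_def)
    also have "a powr (q - 1) * a = a powr q" using a powr_add[of a "q - 1" 1] by simp
    then have "(a powr q - q * a powr (q - 1) * a) * measure M S + q * a powr (q - 1) * (a * \<mu>) = a powr q * ((1 - q) * measure M S + q * \<mu>)"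
      by (simp add: algebra_simps)
    finally have 1: "a powr q * ((1 - q) * measure M S + q * \<mu>) \<le> (LINT z|M. f z powr q)" .
    have "(1 - q) * \<mu> \<le> (1 - q) * measure M S" using mS q by (intro mult_left_mono_neg) auto
    then have "\<mu> \<le> (1 - q) * measure M S + q * \<mu>" by (simp add: algebra_simps)
    then have "a powr q * \<mu> \<le> (LINT z|M. f z powr q)"
      using 1 mult_left_mono[of \<mu> "(1 - q) * measure M S + q * \<mu>" "a powr q"] by simp
    then have "\<mu> powr (q - 1) * (a powr q * \<mu>) \<le> \<mu> powr (q - 1) * (LINT z|M. f z powr q)" by (intro mult_left_mono) auto
    moreover have "\<mu> powr (q - 1) * (a powr q * \<mu>) = (integral\<^sup>L M f) powr q"
      using \<mu> I0 unfolding a_def by (simp add: powr_divide powr_diff)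
    ultimately show ?thesis by simp
  qed
qed

lemma AE_lborel_snd:
  fixes Q :: "real \<Rightarrow> bool"
  assumes "AE t in lborel. Q t" shows "AE z::real \<times> real in lborel. Q (snd z)"
proof -
  obtain N where N: "N \<in> null_sets lborel" "{t. \<not> Q t} \<subseteq> N" using assms by (auto simp: eventually_ae_filter)
  have "emeasure (lborel \<Otimes>\<^sub>M lborel) ((UNIV::real set) \<times> N) = emeasure lborel (UNIV::real set) * emeasure lborel N"
    by (rule lborel.emeasure_pair_measure_Times) (use N in auto)
  then have "emeasure (lborel :: (real\<times>real) measure) (UNIV \<times> N) = 0" using N by (simp add: lborel_prod null_sets_def)
  moreover have "UNIV \<times> N \<in> sets (lborel :: (real\<times>real) measure)"
  proof -
    have "UNIV \<times> N \<in> sets (lborel \<Otimes>\<^sub>M lborel :: (real\<times>real) measure)" using N by (intro pair_measureI) auto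
    then show ?thesis by (simp only: lborel_prod)
  qed
  ultimately have "UNIV \<times> N \<in> null_sets (lborel :: (real\<times>real) measure)" by (simp add: null_sets_def)
  then show ?thesis using N(2) by (intro AE_I'[of "UNIV \<times> N"]) auto
qed

text \<open>Tonelli for the indicator of the exceptional set: almost every horizontal slice of it is
  a null set.\<close>

lemma AE_lborel_slices:
  fixes P :: "real \<times> real \<Rightarrow> bool"
  assumes "AE z in lborel. P z" and [measurable]: "Measurable.pred borel P"
  shows "AE t in lborel. AE r in lborel. P (r, t)"
proof -
  let ?f = "\<lambda>z. indicator {z. \<not> P z} z :: ennreal"
  have [measurable]: "?f \<in> borel_measurable borel" by measurable
  have sl[measurable]: "(\<lambda>r. ?f (r, t)) \<in> borel_measurable borel" for t by measurable
  have "(\<integral>\<^sup>+z. ?f z \<partial>lborel) = 0"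
    using assms(1) by (subst nn_integral_0_iff_AE) (auto simp: indicator_def)
  then have "(\<integral>\<^sup>+t. \<integral>\<^sup>+r. ?f (r, t) \<partial>lborel \<partial>lborel) = 0" by (subst (asm) lborel_tonelli(1)) auto
  moreover have "(\<lambda>t. \<integral>\<^sup>+r. ?f (r, t) \<partial>lborel) \<in> borel_measurable lborel" by measurable
  ultimately have "AE t in lborel. (\<integral>\<^sup>+r. ?f (r, t) \<partial>lborel) = 0"
    by (subst (asm) nn_integral_0_iff_AE) auto
  then show ?thesis
  proof eventually_elim
    case (elim t)
    then have "AE r in lborel. ?f (r, t) = 0" by (subst (asm) nn_integral_0_iff_AE) auto
    then show ?case by eventually_elim (auto simp: indicator_def split: if_splits)
  qed
qed

lemma emeasure_box_le:
  assumes "0 \<le> b1 - a1" "b1 - a1 \<le> c" "0 \<le> b2 - a2" "b2 - a2 \<le> d" "0 \<le> c"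
  shows "emeasure lborel ({a1..b1::real} \<times> {a2..b2::real}) \<le> ennreal (c * d)"
proof -
  have "emeasure lborel ({a1..b1} \<times> {a2..b2}) = ennreal ((b1 - a1) * (b2 - a2))"
    unfolding cbox_prod_real[symmetric] using assms by (subst emeasure_lborel_cbox_eq) (auto simp: Basis_prod_def ennreal_mult mult.commute)
  also have "\<dots> \<le> ennreal (c * d)" using assms by (intro ennreal_leI mult_mono) auto
  finally show ?thesis .
qed

text \<open>Jensen is applied on almost every horizontal line, of length at most 3 h, and on the
  patch, of area at most 9 h^2. The line integral is constant along the first variable, so over the
  element its q-th power contributes at most a factor h times an integral over all lines. For
  infinite p the essential bound passes to almost every line.\<close>

lemma lp_norm_slice_bound:
  fixes G e :: "real \<times> real \<Rightarrow> real"
  assumes p: "1 \<le> p" and h: "h > 0"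
    and R: "0 \<le> b1 - a1" "b1 - a1 \<le> 3 * h" "0 \<le> b2 - a2" "b2 - a2 \<le> 3 * h"
    and G: "integrable lborel G" "\<And>z. G z \<ge> 0" "\<And>z. z \<notin> {a1..b1} \<times> {a2..b2} \<Longrightarrow> G z = 0"
    and e: "e \<in> borel_measurable (lebesgue_on ({s0<..<s0 + h} \<times> {t0<..<t0 + h}))"
    and c: "c \<ge> 0" and K: "K \<ge> 0"
    and ae: "AE z in lebesgue_on ({s0<..<s0 + h} \<times> {t0<..<t0 + h}). \<bar>e z\<bar> \<le> c * ((LINT r|lborel. G (r, snd z)) + (LINT z|lborel. G z) / h)"
    and Kinf: "p = \<infinity> \<Longrightarrow> AE z in lborel. G z \<le> K"
    and Kfin: "p \<noteq> \<infinity> \<Longrightarrow> integrable lborel (\<lambda>z. G z powr enn2real p) \<and> (LINT z|lborel. G z powr enn2real p) \<le> K powr enn2real p"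
  shows "lp_norm (lebesgue_on ({s0<..<s0 + h} \<times> {t0<..<t0 + h})) p e \<le> ennreal (36 * c * h * K)"
proof -
  let ?R = "{a1..b1} \<times> {a2..b2}" and ?M = "{s0<..<s0 + h} \<times> {t0<..<t0 + h}"
  have [measurable]: "G \<in> borel_measurable borel" using borel_measurable_integrable[OF G(1)] by simp
  have Rs: "?R \<in> sets lborel" by (simp add: borel_closed closed_Times)
  have Ms: "?M \<in> sets borel" by (simp add: borel_open open_Times)
  then have Ml: "?M \<in> sets lebesgue" by simp
  have Rm: "emeasure lborel ?R \<le> ennreal (9 * h\<^sup>2)"
    using emeasure_box_le[OF R(1,2) R(3,4)] h by (simp add: power2_eq_square)
  have Im: "emeasure lborel {a1..b1} \<le> ennreal (3 * h)" using R by (simp add: ennreal_leI)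
  have [measurable]: "(snd :: real \<times> real \<Rightarrow> real) \<in> borel_measurable borel"
    by (intro borel_measurable_continuous_onI continuous_intros)
  define A where "A t = (LINT r|lborel. G (r, t))" for t
  define B where "B = (LINT z|lborel. G z) / h"
  have A0: "A t \<ge> 0" for t unfolding A_def using G(2) by (intro integral_nonneg_AE) auto
  have B0: "B \<ge> 0" unfolding B_def using G(2) h by (intro divide_nonneg_pos integral_nonneg_AE) auto
  have [measurable]: "A \<in> borel_measurable borel" unfolding A_def[abs_def] by measurable
  have Gsl: "G (r, t) = 0" if "r \<notin> {a1..b1}" for r t using G(3) that by auto
  show ?thesis
  proof (cases "p = \<infinity>")
    case True
    have GK: "AE z in lborel. G z \<le> K" using Kinf True by blast
    have "AE t in lborel. AE r in lborel. G (r, t) \<le> K"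
      by (rule AE_lborel_slices[OF GK]) measurable
    moreover have "AE t in lborel. integrable lborel (\<lambda>r. G (r, t))" by (rule lborel_fubini(2)[OF G(1)])
    ultimately have "AE t in lborel. A t \<le> 3 * h * K"
    proof eventually_elim
      case (elim t)
      have "A t \<le> (LINT r|lborel. K * indicator {a1..b1} r)"
        unfolding A_def
      proof (rule integral_mono_AE[OF elim(2)])
        show "integrable lborel (\<lambda>r. K * indicator {a1..b1} r)" using R by (intro integrable_mult_right) (simp add: integrable_indicator_iff)
        show "AE r in lborel. G (r, t) \<le> K * indicator {a1..b1} r"
          using elim(1) by eventually_elim (use Gsl in \<open>auto simp: indicator_def\<close>)
      qed
      also have "\<dots> = K * (b1 - a1)" using R by simp
      also have "\<dots> \<le> K * (3 * h)" using R K by (intro mult_left_mono) auto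
      finally show ?case by (simp add: mult_ac)
    qed
    then have Aae: "AE z::real\<times>real in lborel. A (snd z) \<le> 3 * h * K" by (rule AE_lborel_snd)
    have "B \<le> 9 * h * K"
    proof -
      have "(LINT z|lborel. G z) \<le> (LINT z|lborel. K * indicator ?R z)"
      proof (rule integral_mono_AE[OF G(1)])
        show "integrable lborel (\<lambda>z. K * indicator ?R z)"
          using Rs Rm by (intro integrable_mult_right) (simp add: integrable_indicator_iff order_le_less_trans[OF _ ennreal_less_top])
        show "AE z in lborel. G z \<le> K * indicator ?R z"
          using GK by eventually_elim (use G(3) in \<open>auto simp: indicator_def\<close>)
      qed
      also have "\<dots> = K * measure lborel ?R" using Rs by simp
      also have "\<dots> \<le> K * (9 * h\<^sup>2)" using Rm K unfolding measure_def by (intro mult_left_mono enn2real_leI) auto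
      finally show ?thesis unfolding B_def using h by (simp add: pos_divide_le_eq power2_eq_square mult_ac)
    qed
    have Aae': "AE z in lebesgue_on ?M. A (snd z) \<le> 3 * h * K"
      using AE_completion[OF Aae] Ml by (subst AE_restrict_space_iff) auto
    have "AE z in lebesgue_on ?M. ennreal \<bar>e z\<bar> \<le> ennreal (36 * c * h * K)"
      using ae Aae'
    proof eventually_elim
      case (elim z)
      have "\<bar>e z\<bar> \<le> c * (A (snd z) + B)" using elim(1) unfolding A_def B_def .
      also have "\<dots> \<le> c * (36 * h * K)"
        using elim(2) \<open>B \<le> 9 * h * K\<close> c mult_nonneg_nonneg[OF less_imp_le[OF h] K] by (intro mult_left_mono) linarith+
      finally show ?case by (intro ennreal_leI) (simp add: mult_ac)
    qed
    then have "esssup (lebesgue_on ?M) (\<lambda>z. ennreal \<bar>e z\<bar>) \<le> ennreal (36 * c * h * K)"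
      using e by (intro esssup_I) auto
    then show ?thesis unfolding lp_norm_def using True by simp
  next
    case False
    define q where "q = enn2real p"
    have q: "q \<ge> 1"
      using p False enn2real_mono[of 1 p] unfolding q_def by (simp add: less_top)
    have q0: "q > 0" using q by simp
    define I where "I = (LINT z|lborel. G z powr q)"
    have Gq: "integrable lborel (\<lambda>z. G z powr q)" and IK: "I \<le> K powr q" using Kfin[OF False] unfolding q_def I_def by auto
    have I0: "I \<ge> 0" unfolding I_def by (intro integral_nonneg_AE) auto
    have Bq: "B powr q \<le> (9 * h) powr q * I / h\<^sup>2"
    proof -
      have "(LINT z|lborel. G z) powr q \<le> (9 * h\<^sup>2) powr (q - 1) * I"
        unfolding I_def by (rule jensen_powr[OF G Gq Rs Rm _ q]) (use h in auto)
      then have "B powr q \<le> (9 * h\<^sup>2) powr (q - 1) * I / h powr q"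
        unfolding B_def using h G(2) by (subst powr_divide) (auto intro!: divide_right_mono integral_nonneg_AE)
      also have "(9 * h\<^sup>2) powr (q - 1) = (9 * h) powr q * h powr q / (9 * h\<^sup>2)"
        using h by (simp add: powr_diff powr_mult[symmetric] power2_eq_square mult_ac)
      also have "(9 * h) powr q * h powr q / (9 * h\<^sup>2) * I / h powr q = (9 * h) powr q * I / h\<^sup>2 / 9"
        using h by (simp add: field_simps)
      also have "\<dots> \<le> (9 * h) powr q * I / h\<^sup>2"
      proof -
        have y: "y / 9 \<le> y" if "y \<ge> 0" for y :: real using that by simp
        show ?thesis by (rule y) (use I0 in simp)
      qed
      finally show ?thesis .
    qed
    have Aq: "AE t in lborel. A t powr q \<le> (3 * h) powr (q - 1) * (LINT r|lborel. G (r, t) powr q)"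
      using lborel_fubini(2)[OF G(1)] lborel_fubini(2)[OF Gq]
    proof eventually_elim
      case (elim t)
      show ?case unfolding A_def
        by (rule jensen_powr[OF elim(1) G(2) Gsl elim(2) _ Im _ q]) (use h in auto)
    qed
    have Anq: "(\<integral>\<^sup>+t. ennreal (A t powr q) \<partial>lborel) \<le> ennreal ((3 * h) powr (q - 1) * I)"
    proof -
      have i: "integrable lborel (\<lambda>t. (3 * h) powr (q - 1) * (LINT r|lborel. G (r, t) powr q))"
        using lborel_fubini(3)[OF Gq] by simp
      have "(\<integral>\<^sup>+t. ennreal (A t powr q) \<partial>lborel) \<le> (\<integral>\<^sup>+t. ennreal ((3 * h) powr (q - 1) * (LINT r|lborel. G (r, t) powr q)) \<partial>lborel)"
        using Aq by (intro nn_integral_mono_AE) (auto intro: ennreal_leI elim!: eventually_mono)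
      also have "\<dots> = ennreal (LINT t|lborel. (3 * h) powr (q - 1) * (LINT r|lborel. G (r, t) powr q))"
        by (intro nn_integral_eq_integral[OF i] AE_I2 mult_nonneg_nonneg integral_nonneg_AE) auto
      also have "(LINT t|lborel. (3 * h) powr (q - 1) * (LINT r|lborel. G (r, t) powr q)) = (3 * h) powr (q - 1) * I"
        unfolding I_def lborel_fubini(1)[OF Gq] by simp
      finally show ?thesis .
    qed
    have [measurable]: "(\<lambda>z::real\<times>real. ennreal (A (snd z) powr q) + ennreal (B powr q)) \<in> borel_measurable borel"
      by measurable
    have "(\<integral>\<^sup>+z. ennreal (\<bar>e z\<bar> powr q) \<partial>lebesgue_on ?M) \<le> (\<integral>\<^sup>+z. ennreal ((2 * c) powr q) * (ennreal (A (snd z) powr q) + ennreal (B powr q)) \<partial>lebesgue_on ?M)"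
    proof (rule nn_integral_mono_AE, use ae in eventually_elim)
      case (elim z)
      have "\<bar>e z\<bar> \<le> c * (A (snd z) + B)" using elim unfolding A_def B_def .
      \<comment> \<open>The power of a maximum is at most the sum of the powers; this splits the two
        contributions without a convexity constant depending on q.\<close>
      also have "\<dots> \<le> c * (2 * max (A (snd z)) B)" using c by (intro mult_left_mono) auto
      finally have "\<bar>e z\<bar> powr q \<le> (2 * c * max (A (snd z)) B) powr q" using q0 by (intro powr_mono2) (auto simp: mult_ac)
      also have "\<dots> = (2 * c) powr q * max (A (snd z)) B powr q" using c A0 B0 by (subst powr_mult) (auto simp: max_def)
      also have "\<dots> \<le> (2 * c) powr q * (A (snd z) powr q + B powr q)" by (intro mult_left_mono) (auto simp: max_def)
      finally have "ennreal (\<bar>e z\<bar> powr q) \<le> ennreal ((2 * c) powr q * (A (snd z) powr q + B powr q))" by (rule ennreal_leI)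
      then show ?case by (simp add: ennreal_mult)
    qed
    also have "\<dots> = (\<integral>\<^sup>+z. (ennreal ((2 * c) powr q) * (ennreal (A (snd z) powr q) + ennreal (B powr q))) * indicator ?M z \<partial>lborel)"
      using Ml by (subst nn_integral_restrict_space) (auto simp: nn_integral_completion)
    also have "\<dots> = ennreal ((2 * c) powr q) * (\<integral>\<^sup>+z. (ennreal (A (snd z) powr q) + ennreal (B powr q)) * indicator ?M z \<partial>lborel)"
      by (subst nn_integral_cmult[symmetric]) (use Ms in \<open>auto simp: mult.assoc intro!: borel_measurable_times_ennreal\<close>)
    also have "(\<integral>\<^sup>+z. (ennreal (A (snd z) powr q) + ennreal (B powr q)) * indicator ?M z \<partial>lborel)
       = (\<integral>\<^sup>+t. \<integral>\<^sup>+s. (ennreal (A t powr q) + ennreal (B powr q)) * indicator ?M (s, t) \<partial>lborel \<partial>lborel)"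
      by (subst lborel_tonelli(1)) (use Ms in auto)
    also have "\<dots> \<le> (\<integral>\<^sup>+t. ennreal h * (ennreal (A t powr q) + ennreal (B powr q) * indicator {t0<..<t0 + h} t) \<partial>lborel)"
    proof (rule nn_integral_mono)
      fix t :: real
      have "(\<integral>\<^sup>+s. (ennreal (A t powr q) + ennreal (B powr q)) * indicator ?M (s, t) \<partial>lborel)
        = (\<integral>\<^sup>+s. ((ennreal (A t powr q) + ennreal (B powr q)) * indicator {t0<..<t0 + h} t) * indicator {s0<..<s0 + h} s \<partial>lborel)"
        by (rule nn_integral_cong) (auto simp: indicator_def)
      also have "\<dots> = ((ennreal (A t powr q) + ennreal (B powr q)) * indicator {t0<..<t0 + h} t) * ennreal h"
        using h by (subst nn_integral_cmult_indicator) auto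
      also have "\<dots> \<le> ennreal h * (ennreal (A t powr q) + ennreal (B powr q) * indicator {t0<..<t0 + h} t)"
        by (auto simp: indicator_def mult.commute)
      finally show "(\<integral>\<^sup>+s. (ennreal (A t powr q) + ennreal (B powr q)) * indicator ?M (s, t) \<partial>lborel) \<le> \<dots>" .
    qed
    also have "\<dots> = ennreal h * ((\<integral>\<^sup>+t. ennreal (A t powr q) \<partial>lborel) + ennreal (B powr q) * ennreal h)"
      using h by (subst nn_integral_cmult) (auto simp: nn_integral_add nn_integral_cmult_indicator)
    also have "\<dots> \<le> ennreal h * (ennreal ((3 * h) powr (q - 1) * I) + ennreal ((9 * h) powr q * I / h\<^sup>2) * ennreal h)"
      using Bq by (intro mult_left_mono add_mono Anq mult_right_mono ennreal_leI) auto
    also have "\<dots> = ennreal (h * ((3 * h) powr (q - 1) * I + (9 * h) powr q * I / h\<^sup>2 * h))"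
    proof -
      have "ennreal ((9 * h) powr q * I / h\<^sup>2) * ennreal h = ennreal ((9 * h) powr q * I / h\<^sup>2 * h)"
        using h I0 by (intro ennreal_mult[symmetric]) auto
      then show ?thesis using h I0 by (simp only: ennreal_mult ennreal_plus add_nonneg_nonneg mult_nonneg_nonneg powr_ge_zero divide_nonneg_nonneg zero_le_power2 less_imp_le)
    qed
    also have "h * ((3 * h) powr (q - 1) * I + (9 * h) powr q * I / h\<^sup>2 * h) \<le> 2 * ((9 * h) powr q * I)"
    proof -
      have "h * (3 * h) powr (q - 1) = (3 * h) powr q / 3" using h by (simp add: powr_diff field_simps)
      also have "\<dots> \<le> (9 * h) powr q" using powr_mono2[of q "3 * h" "9 * h"] q0 h powr_ge_zero[of "3 * h" q] by linarith
      finally have "h * (3 * h) powr (q - 1) * I \<le> (9 * h) powr q * I" using I0 by (intro mult_right_mono)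
      then have "h * ((3 * h) powr (q - 1) * I) \<le> (9 * h) powr q * I" by (simp only: mult.assoc)
      moreover have "h * ((9 * h) powr q * I / h\<^sup>2 * h) = (9 * h) powr q * I" using h by (simp add: power2_eq_square)
      ultimately show ?thesis unfolding distrib_left mult_2 by (intro add_mono) (simp_all only: order_refl)
    qed
    finally have "(\<integral>\<^sup>+z. ennreal (\<bar>e z\<bar> powr q) \<partial>lebesgue_on ?M) \<le> ennreal ((2 * c) powr q) * ennreal (2 * ((9 * h) powr q * I))"
      by (simp add: mult_left_mono ennreal_leI)
    also have "\<dots> = ennreal ((2 * c) powr q * (2 * ((9 * h) powr q * I)))" using I0 by (simp add: ennreal_mult)
    \<comment> \<open>The leading 2 is at most \<open>2 powr q\<close>, so all factors merge into
      one power with base 2 * 2 * 9 * c * h * K. Hence the 36, independent of q.\<close>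
    also have "(2 * c) powr q * (2 * ((9 * h) powr q * I)) \<le> (36 * c * h * K) powr q"
    proof -
      have "2 \<le> 2 powr q" using powr_mono[OF q, of 2] by simp
      then have "(2 * c) powr q * (2 * ((9 * h) powr q * I)) \<le> (2 * c) powr q * (2 powr q * ((9 * h) powr q * K powr q))"
        using IK I0 h K by (intro mult_left_mono mult_mono) auto
      also have "\<dots> = (36 * c * h * K) powr q" using c h K by (simp add: powr_mult[symmetric] mult_ac)
      finally show ?thesis .
    qed
    finally have main: "(\<integral>\<^sup>+z. ennreal (\<bar>e z\<bar> powr q) \<partial>lebesgue_on ?M) \<le> ennreal ((36 * c * h * K) powr q)"
      by (simp add: ennreal_leI)
    have fin: "(\<integral>\<^sup>+z. ennreal (\<bar>e z\<bar> powr q) \<partial>lebesgue_on ?M) \<noteq> \<infinity>"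
      using order_le_less_trans[OF main ennreal_less_top] by simp
    have chK: "36 * c * h * K \<ge> 0" using c h K by simp
    have "enn2real (\<integral>\<^sup>+z. ennreal (\<bar>e z\<bar> powr q) \<partial>lebesgue_on ?M) powr (1 / q) \<le> ((36 * c * h * K) powr q) powr (1 / q)"
      using main q0 by (intro powr_mono2 enn2real_leI) auto
    also have "\<dots> = 36 * c * h * K" using chK q0 by (simp add: powr_powr)
    finally show ?thesis unfolding lp_norm_def using False fin by (simp add: Let_def q_def[symmetric] ennreal_leI)
  qed
qed

section \<open>Macro-element patches\<close>

lemma mesh_mono:
  assumes "strict_mono_on {..n} (x::nat \<Rightarrow> real)" "k \<le> n" "l \<le> n"
  shows "x k \<le> x l \<longleftrightarrow> k \<le> l" and "x k < x l \<longleftrightarrow> k < l" and "x k = x l \<longleftrightarrow> k = l"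
proof -
  have lt: "x k < x l" if "k < l" "l \<le> n" for k l
    using assms(1) that unfolding strict_mono_on_def monotone_on_def by auto
  show "x k \<le> x l \<longleftrightarrow> k \<le> l" "x k < x l \<longleftrightarrow> k < l" "x k = x l \<longleftrightarrow> k = l"
    using lt[of k l] lt[of l k] assms(2,3) by (cases k l rule: linorder_cases; fastforce)+
qed

lemma measure_box: "a \<le> b \<Longrightarrow> c \<le> d \<Longrightarrow> measure lborel ({a..b::real} \<times> {c..d::real}) = (b - a) * (d - c)"
  unfolding cbox_prod_real[symmetric] by (simp add: content_Pair)

text \<open>The incidence of vertex and edge is given by coordinates; strict monotonicity of the
  nodes turns it into the statement that the vertex is one of the two end points of its
  edge.\<close>

lemma edge_assignment_cases:
  assumes m: "mesh n m x y" and ea: "edge_assignment n m x y \<sigma>" and k: "k \<le> n" and l: "l \<le> m"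
  obtains k' where "\<sigma> k l = Horizontal k' l" "k' < n" "k = k' \<or> k = Suc k'"
    | l' where "\<sigma> k l = Vertical k l'" "l' < m" "l = l' \<or> l = Suc l'"
proof -
  have x: "strict_mono_on {..n} x" and y: "strict_mono_on {..m} y" using m by (auto simp: mesh_def)
  have e: "is_edge n m (\<sigma> k l)" "(x k, y l) \<in> edge_set x y (\<sigma> k l)" using ea k l by (auto simp: edge_assignment_def)
  show ?thesis
  proof (cases "\<sigma> k l")
    case (Horizontal k' l')
    then have "k' < n" "l' \<le> m" "y l = y l'" "x k' \<le> x k" "x k \<le> x (Suc k')" using e by auto
    then have "l = l'" "k' \<le> k" "k \<le> Suc k'"
      using mesh_mono[OF y l] mesh_mono[OF x] k l by auto
    then have "k = k' \<or> k = Suc k'" by linarith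
    then show ?thesis using that(1)[of k'] Horizontal \<open>k' < n\<close> \<open>l = l'\<close> by simp
  next
    case (Vertical k' l')
    then have "k' \<le> n" "l' < m" "x k = x k'" "y l' \<le> y l" "y l \<le> y (Suc l')" using e by auto
    then have "k = k'" "l' \<le> l" "l \<le> Suc l'"
      using mesh_mono[OF x k] mesh_mono[OF y] k l by auto
    then have "l = l' \<or> l = Suc l'" by linarith
    then show ?thesis using that(2)[of l'] Vertical \<open>l' < m\<close> \<open>k = k'\<close> by simp
  qed
qed

text \<open>A window of one further macro-element on each side, clipped to the mesh, contains all
  associated edges. Intersecting a minimizing patch with this window gives a competitor, which would
  have strictly smaller area if the minimizer reached beyond the window. So the patch is at most
  three macro-elements wide.\<close>

lemma macro_patch_props:
  assumes m: "mesh n m x y" and ea: "edge_assignment n m x y \<sigma>" and i: "i < n" and j: "j < m"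
  obtains p p' q q' where "macro_patch n m x y \<sigma> i j = {x p..x p'} \<times> {y q..y q'}"
    "p \<le> i" "Suc i \<le> p'" "p' \<le> n" "p' \<le> p + 3" "q \<le> j" "Suc j \<le> q'" "q' \<le> m" "q' \<le> q + 3"
    "\<And>k l. k \<in> {i, Suc i} \<Longrightarrow> l \<in> {j, Suc j} \<Longrightarrow> edge_set x y (\<sigma> k l) \<subseteq> {x p..x p'} \<times> {y q..y q'}"
proof -
  have x: "strict_mono_on {..n} x" and y: "strict_mono_on {..m} y" using m by (auto simp: mesh_def)
  note mx = mesh_mono[OF x] and my = mesh_mono[OF y]
  define U where "U = (\<Union>k\<in>{i, Suc i}. \<Union>l\<in>{j, Suc j}. edge_set x y (\<sigma> k l))"
  define P where "P \<omega> \<longleftrightarrow> \<omega> \<in> rect_patches n m x y \<and> convex hull U \<subseteq> \<omega>" for \<omega>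
  define \<omega> where "\<omega> = macro_patch n m x y \<sigma> i j"
  \<comment> \<open>Only finitely many rectangles compete, so a minimizer exists; this rewriting
    gives access to that fact.\<close>
  have \<omega>: "\<omega> = arg_min_on (measure lborel) {\<omega>. P \<omega>}"
    unfolding \<omega>_def macro_patch_def arg_min_on_def P_def U_def by simp
  have fin: "finite {\<omega>. P \<omega>}"
  proof (rule finite_subset)
    show "{\<omega>. P \<omega>} \<subseteq> (\<lambda>(a, b, c, d). {x a..x b} \<times> {y c..y d}) ` ({..n} \<times> {..n} \<times> {..m} \<times> {..m})"
      unfolding P_def rect_patches_def by force
  qed auto
  have box: "P ({x a..x b} \<times> {y c..y d})" if "a < b" "b \<le> n" "c < d" "d \<le> m" "U \<subseteq> {x a..x b} \<times> {y c..y d}" for a b c d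
  proof -
    have "convex hull U \<subseteq> {x a..x b} \<times> {y c..y d}"
      by (rule hull_minimal[OF that(5)]) (intro convex_Times convex_real_interval)
    then show ?thesis unfolding P_def rect_patches_def using that by blast
  qed
  \<comment> \<open>Natural subtraction clips the window at the index 0, just as \<open>min\<close>
    clips it at the other end.\<close>
  define a where "a = i - 1" define b where "b = min n (i + 2)"
  define c where "c = j - 1" define d where "d = min m (j + 2)"
  have ab: "a \<le> i" "Suc i \<le> b" "b \<le> n" "c \<le> j" "Suc j \<le> d" "d \<le> m" unfolding a_def b_def c_def d_def using i j by auto
  have Ub: "U \<subseteq> {x a..x b} \<times> {y c..y d}"
  proof -
    have "edge_set x y (\<sigma> k l) \<subseteq> {x a..x b} \<times> {y c..y d}" if k: "k \<in> {i, Suc i}" and l: "l \<in> {j, Suc j}" for k l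
    proof -
      have kl: "k \<le> n" "l \<le> m" using k l i j by auto
      show ?thesis
      proof (cases rule: edge_assignment_cases[OF m ea kl])
        case (1 k')
        then have "a \<le> k'" "Suc k' \<le> b" "c \<le> l" "l \<le> d" using k l ab i j unfolding a_def b_def by auto
        then have "x a \<le> x k'" "x (Suc k') \<le> x b" "y c \<le> y l" "y l \<le> y d"
          using mx(1)[of a k'] mx(1)[of "Suc k'" b] my(1)[of c l] my(1)[of l d] 1(2) ab(3,6) kl by simp_all
        then show ?thesis unfolding 1(1) edge_set.simps by (intro Sigma_mono) auto
      next
        case (2 l')
        then have "c \<le> l'" "Suc l' \<le> d" "a \<le> k" "k \<le> b" using k l ab i j unfolding c_def d_def by auto
        then have "y c \<le> y l'" "y (Suc l') \<le> y d" "x a \<le> x k" "x k \<le> x b"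
          using my(1)[of c l'] my(1)[of "Suc l'" d] mx(1)[of a k] mx(1)[of k b] 2(2) ab(3,6) kl by simp_all
        then show ?thesis unfolding 2(1) edge_set.simps by (intro Sigma_mono) auto
      qed
    qed
    then show ?thesis unfolding U_def by blast
  qed
  have ne: "{\<omega>. P \<omega>} \<noteq> {}" using box[OF _ _ _ _ Ub] ab by auto
  have P\<omega>: "P \<omega>" using arg_min_if_finite(1)[OF fin ne, of "measure lborel"] \<omega> by auto
  then obtain p p' q q' where pq: "\<omega> = {x p..x p'} \<times> {y q..y q'}" "p < p'" "p' \<le> n" "q < q'" "q' \<le> m"
    unfolding P_def rect_patches_def by blast
  have U\<omega>: "U \<subseteq> \<omega>" using P\<omega> hull_subset[of U convex] unfolding P_def by blast
  have vert: "(x k, y l) \<in> U" if "k \<in> {i, Suc i}" "l \<in> {j, Suc j}" for k l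
    using ea that i j unfolding U_def edge_assignment_def by fastforce
  have "(x i, y j) \<in> \<omega>" "(x (Suc i), y (Suc j)) \<in> \<omega>" using vert U\<omega> by auto
  then have in\<omega>: "p \<le> i" "Suc i \<le> p'" "q \<le> j" "Suc j \<le> q'"
    using mx(1)[of p i] mx(1)[of "Suc i" p'] my(1)[of q j] my(1)[of "Suc j" q'] pq i j by simp_all
  \<comment> \<open>The competitor: the intersection of the minimizer with the window, again a
    rectangle of the mesh.\<close>
  let ?p = "max p a" and ?p' = "min p' b" and ?q = "max q c" and ?q' = "min q' d"
  have lt: "?p < ?p'" "?p' \<le> n" "?q < ?q'" "?q' \<le> m" using in\<omega> ab pq by auto
  have xm: "x ?p = max (x p) (x a)" "x ?p' = min (x p') (x b)" "y ?q = max (y q) (y c)" "y ?q' = min (y q') (y d)"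
    using mx(1)[of p a] mx(1)[of p' b] my(1)[of q c] my(1)[of q' d] pq ab by (simp_all add: max_def min_def)
  have "{x ?p..x ?p'} \<times> {y ?q..y ?q'} = \<omega> \<inter> ({x a..x b} \<times> {y c..y d})"
    unfolding pq(1) xm by auto
  then have "U \<subseteq> {x ?p..x ?p'} \<times> {y ?q..y ?q'}" using U\<omega> Ub by blast
  then have "P ({x ?p..x ?p'} \<times> {y ?q..y ?q'})" using box lt by blast
  then have "\<not> measure lborel ({x ?p..x ?p'} \<times> {y ?q..y ?q'}) < measure lborel \<omega>"
    using arg_min_if_finite(2)[OF fin ne, of "measure lborel"] \<omega> by auto
  then have ge: "(x p' - x p) * (y q' - y q) \<le> (x ?p' - x ?p) * (y ?q' - y ?q)"
    unfolding pq(1) using mx[of ?p ?p'] my[of ?q ?q'] mx[of p p'] my[of q q'] lt pq by (subst (asm) (1 2) measure_box) auto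
  have pos: "0 < x ?p' - x ?p" "0 < y ?q' - y ?q" "0 < x p' - x p" "0 < y q' - y q"
    using mx[of ?p ?p'] my[of ?q ?q'] mx[of p p'] my[of q q'] lt pq by auto
  have le: "x ?p' - x ?p \<le> x p' - x p" "y ?q' - y ?q \<le> y q' - y q" unfolding xm by auto
  have "\<not> x ?p' - x ?p < x p' - x p"
  proof
    assume "x ?p' - x ?p < x p' - x p"
    then have "(x ?p' - x ?p) * (y ?q' - y ?q) < (x p' - x p) * (y q' - y q)" using pos le by (intro mult_less_le_imp_less) auto
    then show False using ge by simp
  qed
  then have "x p' \<le> x b" "x a \<le> x p" unfolding xm by auto
  then have 1: "p' \<le> b" "a \<le> p" using mx[of p' b] mx[of a p] pq ab by auto
  have "\<not> y ?q' - y ?q < y q' - y q"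
  proof
    assume "y ?q' - y ?q < y q' - y q"
    then have "(x ?p' - x ?p) * (y ?q' - y ?q) < (x p' - x p) * (y q' - y q)" using pos le by (intro mult_le_less_imp_less) auto
    then show False using ge by simp
  qed
  then have "y q' \<le> y d" "y c \<le> y q" unfolding xm by auto
  then have 2: "q' \<le> d" "c \<le> q" using my[of q' d] my[of c q] pq ab by auto
  show ?thesis
  proof (rule that[of p p' q q'])
    show "macro_patch n m x y \<sigma> i j = {x p..x p'} \<times> {y q..y q'}" using pq(1) unfolding \<omega>_def .
    show "p' \<le> p + 3" "q' \<le> q + 3" using 1 2 unfolding a_def b_def c_def d_def by auto
    show "edge_set x y (\<sigma> k l) \<subseteq> {x p..x p'} \<times> {y q..y q'}" if "k \<in> {i, Suc i}" "l \<in> {j, Suc j}" for k l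
      using U\<omega> that unfolding pq(1) U_def by blast
  qed (use in\<omega> pq in auto)
qed

lemma uniform_nodes:
  assumes "\<And>k. p \<le> k \<Longrightarrow> k < p' \<Longrightarrow> x (Suc k) - x k = (h::real)" "p \<le> k" "k \<le> p'"
  shows "x k = x p + real (k - p) * h"
  using assms(2,3)
proof (induction k rule: dec_induct)
  case (step k)
  then show ?case using assms(1)[of k] by (simp add: Suc_diff_le algebra_simps)
qed simp

text \<open>Keeps what the analysis uses of an associated edge: its length, its position inside the
  side [a, b] of the patch, and that the vertex is an end point. After this the mesh combinatorics
  can be forgotten.\<close>

definition horizontal_edge_in :: "(nat \<Rightarrow> real) \<Rightarrow> (nat \<Rightarrow> real) \<Rightarrow> real \<Rightarrow> real \<Rightarrow> real \<Rightarrow> nat \<Rightarrow> nat \<Rightarrow> edge \<Rightarrow> bool" where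
  "horizontal_edge_in x y a b h k l e \<longleftrightarrow> (\<exists>k'. e = Horizontal k' l \<and> x (Suc k') = x k' + h \<and> a \<le> x k' \<and> x k' + h \<le> b
     \<and> x k \<in> {x k', x (Suc k')})"

definition vertical_edge_in :: "(nat \<Rightarrow> real) \<Rightarrow> (nat \<Rightarrow> real) \<Rightarrow> real \<Rightarrow> real \<Rightarrow> real \<Rightarrow> nat \<Rightarrow> nat \<Rightarrow> edge \<Rightarrow> bool" where
  "vertical_edge_in x y a b h k l e \<longleftrightarrow> (\<exists>l'. e = Vertical k l' \<and> y (Suc l') = y l' + h \<and> a \<le> y l' \<and> y l' + h \<le> b
     \<and> y l \<in> {y l', y (Suc l')})"

lemma uniform_macro_patch:
  assumes m: "mesh n m x y" and ea: "edge_assignment n m x y \<sigma>" and i: "i < n" and j: "j < m"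
    and u: "uniform_on n m x y (macro_patch n m x y \<sigma> i j) h"
  obtains a1 b1 a2 b2 where "macro_patch n m x y \<sigma> i j = {a1..b1} \<times> {a2..b2}" "h > 0"
    "h \<le> b1 - a1" "b1 - a1 \<le> 3 * h" "h \<le> b2 - a2" "b2 - a2 \<le> 3 * h"
    "x (Suc i) = x i + h" "y (Suc j) = y j + h" "a1 \<le> x i" "x i + h \<le> b1" "a2 \<le> y j" "y j + h \<le> b2"
    "\<And>k l. k \<in> {i, Suc i} \<Longrightarrow> l \<in> {j, Suc j} \<Longrightarrow> horizontal_edge_in x y a1 b1 h k l (\<sigma> k l) \<or> vertical_edge_in x y a2 b2 h k l (\<sigma> k l)"
proof -
  have x: "strict_mono_on {..n} x" and y: "strict_mono_on {..m} y" using m by (auto simp: mesh_def)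
  note mx = mesh_mono[OF x] and my = mesh_mono[OF y]
  obtain p p' q q' where \<omega>: "macro_patch n m x y \<sigma> i j = {x p..x p'} \<times> {y q..y q'}"
    and p: "p \<le> i" "Suc i \<le> p'" "p' \<le> n" "p' \<le> p + 3" and q: "q \<le> j" "Suc j \<le> q'" "q' \<le> m" "q' \<le> q + 3"
    and es: "\<And>k l. k \<in> {i, Suc i} \<Longrightarrow> l \<in> {j, Suc j} \<Longrightarrow> edge_set x y (\<sigma> k l) \<subseteq> {x p..x p'} \<times> {y q..y q'}"
    by (rule macro_patch_props[OF m ea i j]) (rule that)
  have step: "x (Suc k) - x k = h \<and> y (Suc l) - y l = h" if "p \<le> k" "k < p'" "q \<le> l" "l < q'" for k l
  proof -
    have "elem x y k l \<subseteq> {x p..x p'} \<times> {y q..y q'}"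
    proof -
      have "x p \<le> x k" "x (Suc k) \<le> x p'" "y q \<le> y l" "y (Suc l) \<le> y q'"
        using mx(1)[of p k] mx(1)[of "Suc k" p'] my(1)[of q l] my(1)[of "Suc l" q'] that p(3) q(3) by simp_all
      then show ?thesis unfolding elem_def by (intro Sigma_mono) auto
    qed
    moreover have "k < n" "l < m" using that p(3) q(3) by linarith+
    ultimately show ?thesis using u unfolding uniform_on_def \<omega> by blast
  qed
  \<comment> \<open>Uniformity is formulated for macro-elements, so a column is tested through the
    lowest row of the patch; rows are tested through the first column.\<close>
  have sx: "x (Suc k) - x k = h" if "p \<le> k" "k < p'" for k using step[OF that, of q] q by auto
  have sy: "y (Suc l) - y l = h" if "q \<le> l" "l < q'" for l using step[of p l] that p by auto
  have h: "h > 0" using sx[of i] mx(2)[of i "Suc i"] p i by auto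
  have X: "x p' - x p = real (p' - p) * h" using uniform_nodes[of p p' x h p', OF sx] p by auto
  have Y: "y q' - y q = real (q' - q) * h" using uniform_nodes[of q q' y h q', OF sy] q by auto
  have 1: "1 \<le> real (p' - p)" "real (p' - p) \<le> 3" "1 \<le> real (q' - q)" "real (q' - q) \<le> 3" using p q by auto
  show ?thesis
  proof (rule that[OF \<omega> h])
    show "h \<le> x p' - x p" "x p' - x p \<le> 3 * h" "h \<le> y q' - y q" "y q' - y q \<le> 3 * h"
      unfolding X Y using 1 h by simp_all
    show "x (Suc i) = x i + h" "y (Suc j) = y j + h" using sx[of i] sy[of j] p q by auto
    then show "x p \<le> x i" "x i + h \<le> x p'" "y q \<le> y j" "y j + h \<le> y q'"
      using mx(1)[of p i] mx(1)[of "Suc i" p'] my(1)[of q j] my(1)[of "Suc j" q'] p q i j by simp_all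
    fix k l assume k: "k \<in> {i, Suc i}" and l: "l \<in> {j, Suc j}"
    have kl: "k \<le> n" "l \<le> m" using k l i j by auto
    show "horizontal_edge_in x y (x p) (x p') h k l (\<sigma> k l) \<or> vertical_edge_in x y (y q) (y q') h k l (\<sigma> k l)"
    proof (cases rule: edge_assignment_cases[OF m ea kl])
      case (1 k')
      have le: "x k' \<le> x (Suc k')" using mx(1)[of k' "Suc k'"] 1 by auto
      have "(x k', y l) \<in> {x p..x p'} \<times> {y q..y q'}" "(x (Suc k'), y l) \<in> {x p..x p'} \<times> {y q..y q'}"
        using le by (intro subsetD[OF es[OF k l, unfolded 1(1) edge_set.simps]]; simp)+
      then have xx: "x p \<le> x k'" "x (Suc k') \<le> x p'" by auto
      then have "p \<le> k'" "k' < p'" using mx(1)[of p k'] mx(1)[of "Suc k'" p'] p 1 by auto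
      then show ?thesis using sx[of k'] 1 xx unfolding horizontal_edge_in_def by auto
    next
      case (2 l')
      have le: "y l' \<le> y (Suc l')" using my(1)[of l' "Suc l'"] 2 by auto
      have "(x k, y l') \<in> {x p..x p'} \<times> {y q..y q'}" "(x k, y (Suc l')) \<in> {x p..x p'} \<times> {y q..y q'}"
        using le by (intro subsetD[OF es[OF k l, unfolded 2(1) edge_set.simps]]; simp)+
      then have yy: "y q \<le> y l'" "y (Suc l') \<le> y q'" by auto
      then have "q \<le> l'" "l' < q'" using my(1)[of q l'] my(1)[of "Suc l'" q'] q 2 by auto
      then show ?thesis using sy[of l'] 2 yy unfolding vertical_edge_in_def by auto
    qed
  qed
qed

section \<open>Sobolev seminorms\<close>

text \<open>Countably many compact boxes cover the open set, and measurability can be checked on the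
  members of a countable cover.\<close>

lemma locally_integrable_measurable:
  fixes f :: "real \<times> real \<Rightarrow> real"
  assumes "open \<Omega>" "locally_integrable \<Omega> f"
  shows "f \<in> borel_measurable (lebesgue_on \<Omega>)"
proof -
  obtain D where D: "countable D" "D \<subseteq> Pow \<Omega>" "\<And>X. X \<in> D \<Longrightarrow> \<exists>a b. X = cbox a b" "\<Union>D = \<Omega>"
    using open_countable_Union_open_cbox[OF \<open>open \<Omega>\<close>] by metis
  show ?thesis
  proof (rule measurable_piecewise_restrict[OF D(1)])
    fix X assume X: "X \<in> D"
    obtain a b where ab: "X = cbox a b" using D(3)[OF X] by blast
    have "compact X" "X \<subseteq> \<Omega>" using ab D(2) X by auto
    then have "integrable (lebesgue_on X) f" using assms(2) by (simp add: locally_integrable_def)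
    then show "f \<in> borel_measurable (restrict_space (lebesgue_on \<Omega>) X)"
      using \<open>X \<subseteq> \<Omega>\<close> assms(1) by (subst restrict_restrict_space) (auto simp: ab borel_open Int_absorb1 intro: borel_measurable_integrable)
    have "X \<inter> space (lebesgue_on \<Omega>) = X" using \<open>X \<subseteq> \<Omega>\<close> by auto
    moreover have "X \<in> sets (lebesgue_on \<Omega>)"
      using \<open>X \<subseteq> \<Omega>\<close> assms(1) unfolding ab by (intro sets_restrict_space_iff[THEN iffD2]) (auto simp: borel_open)
    ultimately show "X \<inter> space (lebesgue_on \<Omega>) \<in> sets (lebesgue_on \<Omega>)" by simp
  next
    show "space (lebesgue_on \<Omega>) \<subseteq> \<Union>D" using D(4) by simp
  qed
qed

lemma lp_norm_AE_cong:
  assumes "f \<in> borel_measurable M" "g \<in> borel_measurable M" "AE z in M. f z = g z"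
  shows "lp_norm M p f = lp_norm M p g"
proof -
  have "esssup M (\<lambda>z. ennreal \<bar>f z\<bar>) = esssup M (\<lambda>z. ennreal \<bar>g z\<bar>)"
    using assms by (intro esssup_AE_cong) (auto elim: eventually_mono)
  moreover have "(\<integral>\<^sup>+ z. ennreal (\<bar>f z\<bar> powr enn2real p) \<partial>M) = (\<integral>\<^sup>+ z. ennreal (\<bar>g z\<bar> powr enn2real p) \<partial>M)"
    using assms by (intro nn_integral_cong_AE) (auto elim: eventually_mono)
  ultimately show ?thesis unfolding lp_norm_def by simp
qed

lemma enn2real_ge_1: "1 \<le> p \<Longrightarrow> p \<noteq> \<infinity> \<Longrightarrow> 1 \<le> enn2real p"
  using enn2real_mono[of 1 p] by (simp add: less_top)

lemma lp_norm_finite_powr_integrable: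
  assumes f: "f \<in> borel_measurable M" and fin: "lp_norm M p f < \<infinity>" and p: "1 \<le> p" "p \<noteq> \<infinity>"
  shows "integrable M (\<lambda>z. \<bar>f z\<bar> powr enn2real p)"
    and "(LINT z|M. \<bar>f z\<bar> powr enn2real p) = enn2real (lp_norm M p f) powr enn2real p"
proof -
  let ?I = "\<integral>\<^sup>+ z. ennreal (\<bar>f z\<bar> powr enn2real p) \<partial>M"
  have I: "?I \<noteq> \<infinity>" using fin p unfolding lp_norm_def Let_def by (auto split: if_splits)
  then show i: "integrable M (\<lambda>z. \<bar>f z\<bar> powr enn2real p)"
    using f by (simp add: integrable_iff_bounded less_top)
  have q: "enn2real p \<ge> 1" by (rule enn2real_ge_1[OF p])
  have "lp_norm M p f = ennreal (enn2real ?I powr (1 / enn2real p))" using p I unfolding lp_norm_def by (simp add: Let_def)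
  then have "enn2real (lp_norm M p f) powr enn2real p = enn2real ?I" using q by (simp add: powr_powr)
  moreover have "(LINT z|M. \<bar>f z\<bar> powr enn2real p) = enn2real ?I"
    by (rule integral_eq_nn_integral) (use f in auto)
  ultimately show "(LINT z|M. \<bar>f z\<bar> powr enn2real p) = enn2real (lp_norm M p f) powr enn2real p" by simp
qed

lemma lp_norm_infinity_bound:
  assumes f: "f \<in> borel_measurable M" and fin: "lp_norm M \<infinity> f < \<infinity>"
  shows "AE z in M. \<bar>f z\<bar> \<le> enn2real (lp_norm M \<infinity> f)"
proof -
  have eq: "lp_norm M \<infinity> f = esssup M (\<lambda>z. ennreal \<bar>f z\<bar>)" unfolding lp_norm_def by simp
  have "AE z in M. ennreal \<bar>f z\<bar> \<le> lp_norm M \<infinity> f" unfolding eq by (rule esssup_AE)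
  then show ?thesis
  proof eventually_elim
    case (elim z)
    then show ?case using fin enn2real_mono[of "ennreal \<bar>f z\<bar>" "lp_norm M \<infinity> f"] by simp
  qed
qed

text \<open>Here the exponent is forgotten: on a bounded set every L_p function is in L_1, because
  its modulus is at most 1 plus its q-th power or essentially bounded.\<close>

lemma lp_norm_finite_integrable:
  assumes f: "f \<in> borel_measurable M" and fin: "lp_norm M p f < \<infinity>" and p: "1 \<le> p" and M: "finite_measure M"
  shows "integrable M f"
proof (cases "p = \<infinity>")
  case True
  show ?thesis
    using finite_measure.integrable_const_bound[OF M, of f "enn2real (lp_norm M \<infinity> f)"] lp_norm_infinity_bound[OF f] fin True f by simp
next
  case False
  have i: "integrable M (\<lambda>z. 1 + \<bar>f z\<bar> powr enn2real p)"
    using lp_norm_finite_powr_integrable(1)[OF f fin p False] finite_measure.integrable_const[OF M, of "1::real"] by simp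
  show ?thesis
  proof (rule Bochner_Integration.integrable_bound[OF i f])
    show "AE z in M. norm (f z) \<le> norm (1 + \<bar>f z\<bar> powr enn2real p)"
    proof (intro AE_I2)
      fix z
      have "\<bar>f z\<bar> \<le> 1 + \<bar>f z\<bar> powr enn2real p"
      proof (cases "\<bar>f z\<bar> \<le> 1")
        case False
        then have "\<bar>f z\<bar> powr 1 \<le> \<bar>f z\<bar> powr enn2real p" using enn2real_ge_1[OF p \<open>p \<noteq> \<infinity>\<close>] by (intro powr_mono) auto
        then show ?thesis using False by simp
      qed (simp add: add_increasing2)
      then show "norm (f z) \<le> norm (1 + \<bar>f z\<bar> powr enn2real p)" by simp
    qed
  qed
qed

lemma lp_norm_1:
  assumes "integrable M f" shows "lp_norm M 1 f = ennreal (LINT z|M. \<bar>f z\<bar>)"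
proof -
  have "(\<integral>\<^sup>+ z. ennreal \<bar>f z\<bar> \<partial>M) = ennreal (LINT z|M. \<bar>f z\<bar>)"
    using assms by (intro nn_integral_eq_integral) auto
  then show ?thesis unfolding lp_norm_def by (simp add: Let_def integral_nonneg_AE)
qed

lemma is_weak_deriv_measurable:
  "open \<Omega> \<Longrightarrow> is_weak_deriv \<Omega> i j u g \<Longrightarrow> g \<in> borel_measurable (lebesgue_on \<Omega>)"
  by (rule locally_integrable_measurable) (auto simp: is_weak_deriv_def)

text \<open>The choice hidden in \<open>weak_deriv\<close> is harmless: any two weak derivatives
  agree almost everywhere, so computations may use a convenient representative.\<close>

lemma weak_deriv_eq_AE:
  assumes "open \<Omega>" "is_weak_deriv \<Omega> i j u g"
  shows "is_weak_deriv \<Omega> i j u (weak_deriv \<Omega> i j u)" "AE z in lebesgue_on \<Omega>. weak_deriv \<Omega> i j u z = g z"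
    "lp_norm (lebesgue_on \<Omega>) p (weak_deriv \<Omega> i j u) = lp_norm (lebesgue_on \<Omega>) p g"
proof -
  show w: "is_weak_deriv \<Omega> i j u (weak_deriv \<Omega> i j u)" unfolding weak_deriv_def using assms(2) by (rule someI[of "is_weak_deriv \<Omega> i j u"])
  show ae: "AE z in lebesgue_on \<Omega>. weak_deriv \<Omega> i j u z = g z" by (rule is_weak_deriv_unique[OF assms(1) w assms(2)])
  show "lp_norm (lebesgue_on \<Omega>) p (weak_deriv \<Omega> i j u) = lp_norm (lebesgue_on \<Omega>) p g"
    by (rule lp_norm_AE_cong[OF is_weak_deriv_measurable[OF assms(1) w] is_weak_deriv_measurable[OF assms] ae])
qed

lemma sobolev_weak_deriv:
  assumes "open \<Omega>" "u \<in> sobolev k p \<Omega>" "i + j \<le> k"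
  shows "is_weak_deriv \<Omega> i j u (weak_deriv \<Omega> i j u)" "lp_norm (lebesgue_on \<Omega>) p (weak_deriv \<Omega> i j u) < \<infinity>"
proof -
  obtain g where g: "is_weak_deriv \<Omega> i j u g" "lp_norm (lebesgue_on \<Omega>) p g < \<infinity>"
    using assms(2,3) unfolding sobolev_def by blast
  show "is_weak_deriv \<Omega> i j u (weak_deriv \<Omega> i j u)" "lp_norm (lebesgue_on \<Omega>) p (weak_deriv \<Omega> i j u) < \<infinity>"
    using weak_deriv_eq_AE[OF assms(1) g(1)] g(2) by simp_all
qed

lemma is_weak_deriv_refl: "\<Omega> \<in> sets lebesgue \<Longrightarrow> locally_integrable \<Omega> f \<Longrightarrow> is_weak_deriv \<Omega> 0 0 f f"
  by (simp add: is_weak_deriv_iff)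

lemma sobolev_seminorm_1:
  assumes \<Omega>: "open \<Omega>" and e: "\<And>i j. i + j \<le> l \<Longrightarrow> is_weak_deriv \<Omega> i j f (e i j)"
    "\<And>i j. i + j \<le> l \<Longrightarrow> integrable (lebesgue_on \<Omega>) (e i j)"
  shows "sobolev_seminorm l 1 \<Omega> f = ennreal (\<Sum>i\<le>l. LINT z|lebesgue_on \<Omega>. \<bar>e i (l - i) z\<bar>)"
proof -
  have "lp_norm (lebesgue_on \<Omega>) 1 (e i j) < \<infinity>" if "i + j \<le> l" for i j
    using lp_norm_1[OF e(2)[OF that]] by simp
  then have "f \<in> sobolev l 1 \<Omega>" unfolding sobolev_def using e(1) by blast
  moreover have "enn2real (lp_norm (lebesgue_on \<Omega>) 1 (weak_deriv \<Omega> i (l - i) f)) = (LINT z|lebesgue_on \<Omega>. \<bar>e i (l - i) z\<bar>)" if "i \<le> l" for i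
    using weak_deriv_eq_AE(3)[OF \<Omega> e(1)[of i "l - i"], of 1] lp_norm_1[OF e(2)[of i "l - i"]] that by (simp add: integral_nonneg_AE)
  ultimately show ?thesis unfolding sobolev_seminorm_def
    by (simp add: Let_def sum_nonneg integral_nonneg_AE)
qed

text \<open>Provides a Borel function on the whole plane that vanishes off \<open>S\<close>, as
  needed for Fubini and for mollification.\<close>

lemma borel_representative:
  fixes f :: "'a::euclidean_space \<Rightarrow> real"
  assumes "integrable (lebesgue_on S) f" and S: "S \<in> sets borel"
  obtains g where "integrable lborel g" "\<And>z. z \<notin> S \<Longrightarrow> g z = 0" "AE z in lebesgue_on S. f z = g z"
proof -
  have S': "S \<in> sets lebesgue" using S by simp
  have i: "integrable lebesgue (\<lambda>z. indicator S z * f z)" using assms by (simp add: integrable_lebesgue_on_iff)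
  then obtain F where F: "F \<in> borel_measurable lborel" "AE z in lborel. indicator S z * f z = F z"
    using completion_ex_borel_measurable_real borel_measurable_integrable by blast
  define g where "g z = indicator S z * F z" for z
  have [measurable]: "g \<in> borel_measurable borel" using F(1) S unfolding g_def by measurable
  have "AE z in lborel. indicator S z * f z = g z" using F(2) by eventually_elim (auto simp: g_def indicator_def)
  then have ae: "AE z in lebesgue. indicator S z * f z = g z" by (rule AE_completion)
  have "integrable lebesgue g" by (rule integrable_cong_AE_imp[OF i _ ae]) (simp add: measurable_completion)
  then have "integrable lborel g" by (simp add: integrable_completion)
  moreover have "AE z in lebesgue_on S. f z = g z"
    using ae S' by (subst AE_restrict_space_iff) (auto elim!: eventually_mono simp: indicator_def)
  ultimately show ?thesis using that[of g] by (simp add: g_def)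
qed

section \<open>Weak derivatives of limits and of spline tensor products\<close>

text \<open>Test functions and their derivatives are bounded, so both sides of the defining identity
  are continuous with respect to L_1 convergence.\<close>

lemma is_weak_deriv_limit:
  assumes \<Omega>: "\<Omega> \<in> sets borel"
    and w: "\<And>n. is_weak_deriv \<Omega> i j (w n) (w' n)" "\<And>n. set_integrable lborel \<Omega> (w n)" "\<And>n. set_integrable lborel \<Omega> (w' n)"
    and f: "set_integrable lborel \<Omega> f" "set_integrable lborel \<Omega> f'"
    and lim: "(\<lambda>n. LINT z:\<Omega>|lborel. \<bar>w n z - f z\<bar>) \<longlonglongrightarrow> 0" "(\<lambda>n. LINT z:\<Omega>|lborel. \<bar>w' n z - f' z\<bar>) \<longlonglongrightarrow> 0"
  shows "is_weak_deriv \<Omega> i j f f'"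
proof -
  have \<Omega>s: "\<Omega> \<in> sets lebesgue" using \<Omega> by simp
  have tl: "(\<lambda>n. LINT z|lebesgue. v n z * \<phi> z) \<longlonglongrightarrow> (LINT z|lebesgue. F z * \<phi> z)"
    if v: "\<And>n. set_integrable lborel \<Omega> (v n)" and F: "set_integrable lborel \<Omega> F"
      and l: "(\<lambda>n. LINT z:\<Omega>|lborel. \<bar>v n z - F z\<bar>) \<longlonglongrightarrow> 0" and t: "test_function \<Omega> \<phi>" for v F \<phi>
  proof -
    obtain B where B: "\<And>z. \<bar>\<phi> z\<bar> \<le> B" "B > 0" using test_function_bounded[OF t] by blast
    have l': "(\<lambda>n. B * (LINT z:\<Omega>|lborel. \<bar>v n z - F z\<bar>)) \<longlonglongrightarrow> 0" using tendsto_mult_right_zero[OF l] .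
    have "(\<lambda>n. (LINT z|lborel. v n z * \<phi> z) - (LINT z|lborel. F z * \<phi> z)) \<longlonglongrightarrow> 0"
    proof (rule Lim_null_comparison[OF _ l'], intro always_eventually allI)
      fix n
      note iv = set_integrable_test(1)[OF v[of n] t \<Omega>] and iF = set_integrable_test(1)[OF F t \<Omega>]
      have d: "set_integrable lborel \<Omega> (\<lambda>z. \<bar>v n z - F z\<bar>)" using v[of n] F by (intro set_integrable_abs set_integral_diff(1))
      have "norm (LINT z|lborel. v n z * \<phi> z - F z * \<phi> z) \<le> (LINT z|lborel. B * (indicator \<Omega> z * \<bar>v n z - F z\<bar>))"
      proof (rule order_trans[OF integral_norm_bound], rule integral_mono)
        show "integrable lborel (\<lambda>z. norm (v n z * \<phi> z - F z * \<phi> z))" using iv iF by simp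
        show "integrable lborel (\<lambda>z. B * (indicator \<Omega> z * \<bar>v n z - F z\<bar>))" using d by (simp add: set_integrable_def)
        show "norm (v n z * \<phi> z - F z * \<phi> z) \<le> B * (indicator \<Omega> z * \<bar>v n z - F z\<bar>)" for z
        proof (cases "z \<in> \<Omega>")
          case True
          have "norm (v n z * \<phi> z - F z * \<phi> z) = \<bar>\<phi> z\<bar> * \<bar>v n z - F z\<bar>" by (simp flip: left_diff_distrib add: abs_mult)
          also have "\<dots> \<le> B * \<bar>v n z - F z\<bar>" by (intro mult_right_mono B) auto
          finally show ?thesis using True by simp
        next
          case False then show ?thesis using test_function_zero[OF t False] by simp
        qed
      qed
      then show "norm ((LINT z|lborel. v n z * \<phi> z) - (LINT z|lborel. F z * \<phi> z)) \<le> B * (LINT z:\<Omega>|lborel. \<bar>v n z - F z\<bar>)"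
        using iv iF by (simp add: set_lebesgue_integral_def)
    qed
    then show ?thesis using set_integrable_test(2)[OF v t \<Omega>] set_integrable_test(2)[OF F t \<Omega>] by (simp add: LIM_zero_iff)
  qed
  have "(LINT z|lebesgue. f z * (dx UNIV ^^ i) ((dy UNIV ^^ j) \<phi>) z) = (- 1) ^ (i + j) * (LINT z|lebesgue. f' z * \<phi> z)"
    if t: "test_function \<Omega> \<phi>" for \<phi>
  proof (rule LIMSEQ_unique)
    show "(\<lambda>n. LINT z|lebesgue. w n z * (dx UNIV ^^ i) ((dy UNIV ^^ j) \<phi>) z) \<longlonglongrightarrow> (LINT z|lebesgue. f z * (dx UNIV ^^ i) ((dy UNIV ^^ j) \<phi>) z)"
      by (rule tl[OF w(2) f(1) lim(1) test_function_iter[OF t]])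
    have "(\<lambda>n. (- 1) ^ (i + j) * (LINT z|lebesgue. w' n z * \<phi> z)) \<longlonglongrightarrow> (- 1) ^ (i + j) * (LINT z|lebesgue. f' z * \<phi> z)"
      by (intro tendsto_mult tendsto_const tl[OF w(3) f(2) lim(2) t])
    moreover have "(LINT z|lebesgue. w n z * (dx UNIV ^^ i) ((dy UNIV ^^ j) \<phi>) z) = (- 1) ^ (i + j) * (LINT z|lebesgue. w' n z * \<phi> z)" for n
      using w(1)[of n] t unfolding is_weak_deriv_iff[OF \<Omega>s] by blast
    ultimately show "(\<lambda>n. LINT z|lebesgue. w n z * (dx UNIV ^^ i) ((dy UNIV ^^ j) \<phi>) z) \<longlonglongrightarrow> (- 1) ^ (i + j) * (LINT z|lebesgue. f' z * \<phi> z)" by simp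
  qed
  moreover have "locally_integrable \<Omega> f" "locally_integrable \<Omega> f'"
    using integrable_lebesgue_on_borel(1)[OF \<Omega>] f by (auto intro: locally_integrableI[OF _ \<Omega>s])
  ultimately show ?thesis unfolding is_weak_deriv_iff[OF \<Omega>s] by blast
qed

lemma is_weak_deriv_cmult:
  assumes "\<Omega> \<in> sets lebesgue" "is_weak_deriv \<Omega> i j u g"
  shows "is_weak_deriv \<Omega> i j (\<lambda>z. c * u z) (\<lambda>z. c * g z)"
  using is_weak_deriv_lin[OF assms(1) assms(2) assms(2), of c 0] by simp

lemma is_weak_deriv_add:
  assumes "\<Omega> \<in> sets lebesgue" "is_weak_deriv \<Omega> i j u g" "is_weak_deriv \<Omega> i j u' g'"
  shows "is_weak_deriv \<Omega> i j (\<lambda>z. u z + u' z) (\<lambda>z. g z + g' z)"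
  using is_weak_deriv_lin[OF assms, of 1 1] by simp

lemma is_weak_deriv_sum:
  assumes "\<Omega> \<in> sets lebesgue" "finite I" "I \<noteq> {}" "\<And>e. e \<in> I \<Longrightarrow> is_weak_deriv \<Omega> i j (u e) (g e)"
  shows "is_weak_deriv \<Omega> i j (\<lambda>z. \<Sum>e\<in>I. u e z) (\<lambda>z. \<Sum>e\<in>I. g e z)"
  using assms(2-4)
proof (induction I rule: finite_ne_induct)
  case (insert x I)
  then show ?case using is_weak_deriv_add[OF assms(1), of i j "u x" "g x"] by simp
qed simp

text \<open>Single derivatives come from integration by parts with one exceptional line, and are
  then composed. The first derivative of a spline is still continuous, so the jump of the second
  derivative produces no singular part.\<close>

lemma is_weak_deriv_quad_spline_tensor:
  fixes a b c d p r k0 k1 k2 k3 q s l0 l1 l2 l3 :: real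
  assumes ab: "a < b" "c < d" and ij: "i \<le> 2" "j \<le> 2"
  defines "A \<equiv> quad_spline p r k0 k1 k2 k3" and "B \<equiv> quad_spline q s l0 l1 l2 l3"
  shows "is_weak_deriv ({a<..<b} \<times> {c<..<d}) i j (\<lambda>z. A 0 (fst z) * B 0 (snd z)) (\<lambda>z. A i (fst z) * B j (snd z))"
proof -
  let ?\<Omega> = "{a<..<b} \<times> {c<..<d}"
  have \<Omega>b: "?\<Omega> \<in> sets borel" by (simp add: borel_open open_Times)
  then have \<Omega>: "?\<Omega> \<in> sets lebesgue" by simp
  have [measurable]: "A i \<in> borel_measurable borel" "B i \<in> borel_measurable borel" for i
    unfolding A_def B_def by measurable
  have [measurable]: "(fst :: real \<times> real \<Rightarrow> real) \<in> borel_measurable borel" "(snd :: real \<times> real \<Rightarrow> real) \<in> borel_measurable borel"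
    by (intro borel_measurable_continuous_onI continuous_intros)+
  have bd: "\<exists>K. \<forall>t\<in>{u..v}. \<bar>quad_spline p r k0 k1 k2 k3 i t\<bar> \<le> K" for u v p r k0 k1 k2 k3 :: real and i
  proof -
    define F where "F t = (if i \<le> 1 then quad_spline p r k0 k1 k2 k3 i t else 0)" for t
    have "continuous_on {u..v} F" unfolding F_def by (cases "i \<le> 1") (auto intro: quad_spline_continuous)
    then have "bounded (F ` {u..v})" by (intro compact_imp_bounded compact_continuous_image compact_Icc)
    then obtain K where K: "\<forall>x\<in>F ` {u..v}. norm x \<le> K" by (auto simp: bounded_iff)
    have "\<bar>quad_spline p r k0 k1 k2 k3 i t\<bar> \<le> max K (2 * \<bar>k2\<bar> + 2 * \<bar>k3\<bar>)" if "t \<in> {u..v}" for t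
    proof (cases "i \<le> 1")
      case True
      then have "\<bar>quad_spline p r k0 k1 k2 k3 i t\<bar> \<le> K" using K that unfolding F_def by auto
      then show ?thesis by linarith
    next
      case False
      then have "\<bar>quad_spline p r k0 k1 k2 k3 i t\<bar> \<le> 2 * \<bar>k2\<bar> + 2 * \<bar>k3\<bar>" unfolding quad_spline_def by auto
      then show ?thesis by simp
    qed
    then show ?thesis by blast
  qed
  have int: "set_integrable lborel ?\<Omega> (\<lambda>z. A i (fst z) * B j (snd z))" for i j
  proof -
    obtain K where K: "\<And>t. t \<in> {a..b} \<Longrightarrow> \<bar>A i t\<bar> \<le> K" using bd[of a b] unfolding A_def by metis
    obtain L where L: "\<And>t. t \<in> {c..d} \<Longrightarrow> \<bar>B j t\<bar> \<le> L" using bd[of c d] unfolding B_def by metis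
    have fin: "emeasure lborel ?\<Omega> < \<infinity>"
      unfolding box_prod_real[symmetric] using emeasure_bounded_finite[OF bounded_box] by blast
    show ?thesis unfolding set_integrable_def
    proof (rule integrableI_bounded_set_indicator[where B="K * L"])
      show "AE z\<in>?\<Omega> in lborel. norm (A i (fst z) * B j (snd z)) \<le> K * L"
      proof (intro AE_I2 impI)
        fix z assume "z \<in> ?\<Omega>"
        then have "fst z \<in> {a..b}" "snd z \<in> {c..d}" by auto
        then show "norm (A i (fst z) * B j (snd z)) \<le> K * L"
          unfolding real_norm_def abs_mult using K L by (intro mult_mono) (auto intro: order_trans[OF abs_ge_zero])
      qed
    qed (use \<Omega>b fin in auto)
  qed
  have X: "is_weak_deriv ?\<Omega> 1 0 (\<lambda>z. A i (fst z) * B j (snd z)) (\<lambda>z. A (Suc i) (fst z) * B j (snd z))" if "i \<le> 1" for i j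
  proof (rule is_weak_deriv_x[OF refl ab int int, where S="{p + r}"])
    show "continuous_on {a..b} (\<lambda>x. A i (fst (x, y)) * B j (snd (x, y)))" for y
      using that unfolding A_def by (auto intro!: continuous_intros quad_spline_continuous)
    show "((\<lambda>x. A i (fst (x, y)) * B j (snd (x, y))) has_real_derivative A (Suc i) (fst (x, y)) * B j (snd (x, y))) (at x)"
      if "x \<notin> {p + r}" for x y
    proof -
      have "(A i has_real_derivative A (Suc i) x) (at x)"
        using \<open>i \<le> 1\<close> that quad_spline_deriv0 quad_spline_deriv1 unfolding A_def by (auto simp: le_Suc_eq numeral_2_eq_2)
      from DERIV_cmult_right[OF this] show ?thesis by simp
    qed
  qed auto
  have Y: "is_weak_deriv ?\<Omega> 0 1 (\<lambda>z. A i (fst z) * B j (snd z)) (\<lambda>z. A i (fst z) * B (Suc j) (snd z))" if "j \<le> 1" for i j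
  proof (rule is_weak_deriv_y[OF refl ab int int, where S="{q + s}"])
    show "continuous_on {c..d} (\<lambda>y. A i (fst (x, y)) * B j (snd (x, y)))" for x
      using that unfolding B_def by (auto intro!: continuous_intros quad_spline_continuous)
    show "((\<lambda>y. A i (fst (x, y)) * B j (snd (x, y))) has_real_derivative A i (fst (x, y)) * B (Suc j) (snd (x, y))) (at y)"
      if "y \<notin> {q + s}" for x y
    proof -
      have "(B j has_real_derivative B (Suc j) y) (at y)"
        using \<open>j \<le> 1\<close> that quad_spline_deriv0 quad_spline_deriv1 unfolding B_def by (auto simp: le_Suc_eq numeral_2_eq_2)
      from DERIV_cmult[OF this] show ?thesis by simp
    qed
  qed auto
  have rf: "is_weak_deriv ?\<Omega> 0 0 (\<lambda>z. A i (fst z) * B j (snd z)) (\<lambda>z. A i (fst z) * B j (snd z))" for i j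
    by (rule is_weak_deriv_refl[OF \<Omega> locally_integrableI[OF integrable_lebesgue_on_borel(1)[OF \<Omega>b int] \<Omega>]])
  have XX: "is_weak_deriv ?\<Omega> i 0 (\<lambda>z. A 0 (fst z) * B 0 (snd z)) (\<lambda>z. A i (fst z) * B 0 (snd z))" if "i \<le> 2" for i
    using that
  proof (induction i)
    case (Suc i)
    then show ?case by (intro is_weak_deriv_Suc_x[OF _ X \<Omega>]) auto
  qed (rule rf)
  have YY: "is_weak_deriv ?\<Omega> 0 j (\<lambda>z. A i (fst z) * B 0 (snd z)) (\<lambda>z. A i (fst z) * B j (snd z))" if "j \<le> 2" for i j
    using that
  proof (induction j)
    case (Suc j)
    then show ?case by (intro is_weak_deriv_Suc_y[OF _ Y \<Omega>]) auto
  qed (rule rf)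
  show ?thesis by (rule is_weak_deriv_comp[OF XX[OF ij(1)] YY[OF ij(2)] \<Omega>])
qed

lemma is_weak_deriv_hermite_interp:
  assumes ab: "a < b" "c < d" and ij: "i + j \<le> 2"
  shows "is_weak_deriv ({a<..<b} \<times> {c<..<d}) i j (hermite_interp a b c d U X Y W 0 0) (hermite_interp a b c d U X Y W i j)"
proof -
  have \<Omega>: "{a<..<b} \<times> {c<..<d} \<in> sets lebesgue" by (simp add: borel_open open_Times)
  have i: "i \<le> 2" "j \<le> 2" using ij by auto
  note T = is_weak_deriv_quad_spline_tensor[OF ab i]
  have P: "\<exists>p r k0 k1 k2 k3. hphi a b e = quad_spline p r k0 k1 k2 k3" "\<exists>p r k0 k1 k2 k3. hpsi a b e = quad_spline p r k0 k1 k2 k3" for a b e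
    by (meson hphi_eq_quad_spline, meson hpsi_eq_quad_spline)
  have TT: "is_weak_deriv ({a<..<b} \<times> {c<..<d}) i j (\<lambda>z. A 0 (fst z) * B 0 (snd z)) (\<lambda>z. A i (fst z) * B j (snd z))"
    if A: "\<exists>p r k0 k1 k2 k3. A = quad_spline p r k0 k1 k2 k3" and B: "\<exists>p r k0 k1 k2 k3. B = quad_spline p r k0 k1 k2 k3" for A B
  proof -
    obtain p r k0 k1 k2 k3 where A: "A = quad_spline p r k0 k1 k2 k3" using A by auto
    obtain q s l0 l1 l2 l3 where B: "B = quad_spline q s l0 l1 l2 l3" using B by auto
    show ?thesis unfolding A B by (rule T)
  qed
  show ?thesis unfolding hermite_interp_def[abs_def]
    by (intro is_weak_deriv_sum[OF \<Omega>] is_weak_deriv_add[OF \<Omega>] is_weak_deriv_cmult[OF \<Omega>] TT P) auto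
qed

text \<open>Passes from gauge integrals, used for the calculus with continuous functions, to
  Lebesgue integrals, in which the limits are taken.\<close>

lemma integral_box_eq_lborel:
  fixes f :: "real \<times> real \<Rightarrow> real"
  assumes "continuous_on (cbox (a1, a2) (b1, b2)) f"
  shows "set_integrable lborel ({a1..b1} \<times> {a2..b2}) f" "integral (cbox (a1, a2) (b1, b2)) f = (LINT z:{a1..b1} \<times> {a2..b2}|lborel. f z)"
proof -
  show i: "set_integrable lborel ({a1..b1} \<times> {a2..b2}) f"
    unfolding set_integrable_def cbox_prod_real[symmetric] by (rule borel_integrable_compact) (use assms in auto)
  show "integral (cbox (a1, a2) (b1, b2)) f = (LINT z:{a1..b1} \<times> {a2..b2}|lborel. f z)"
    using set_borel_integral_eq_integral(2)[OF i] by (simp add: cbox_prod_real)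
qed

section \<open>Approximation by smooth functions\<close>

text \<open>Approximation is claimed in L_1 only, whatever p is: for infinite p smooth functions are
  not dense. The representatives \<open>g i j\<close> vanish outside the open rectangle, which makes
  them globally integrable.\<close>

lemma sobolev_smooth_approximation:
  fixes a1 b1 a2 b2 :: real
  defines "\<Omega> \<equiv> {a1<..<b1} \<times> {a2<..<b2}"
  assumes ab: "a1 < b1" "a2 < b2" and p: "1 \<le> p" and u: "u \<in> sobolev k p \<Omega>"
  obtains g D where
    "\<And>i j. i + j \<le> k \<Longrightarrow> integrable lborel (g i j)"
    "\<And>i j z. i + j \<le> k \<Longrightarrow> z \<notin> \<Omega> \<Longrightarrow> g i j z = 0"
    "\<And>i j. i + j \<le> k \<Longrightarrow> AE z in lebesgue_on \<Omega>. weak_deriv \<Omega> i j u z = g i j z"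
    "\<And>i j. i + j \<le> k \<Longrightarrow> is_weak_deriv \<Omega> i j u (g i j)"
    "AE z in lebesgue_on \<Omega>. u z = g 0 0 z"
    "\<And>n. smooth2 (D n)"
    "\<And>i j. i + j \<le> k \<Longrightarrow> (\<lambda>n. LINT z:{a1..b1} \<times> {a2..b2}|lborel. \<bar>D n i j z - g i j z\<bar>) \<longlonglongrightarrow> 0"
proof -
  have op: "open \<Omega>" unfolding \<Omega>_def by (simp add: open_Times)
  then have \<Omega>b: "\<Omega> \<in> sets borel" and \<Omega>: "\<Omega> \<in> sets lebesgue" by (auto simp: borel_open)
  have lm: "\<Omega> \<in> lmeasurable" unfolding \<Omega>_def box_prod_real[symmetric] by simp
  note W = sobolev_weak_deriv[OF op u]
  have ex: "\<exists>g. integrable lborel g \<and> (\<forall>z. z \<notin> \<Omega> \<longrightarrow> g z = 0) \<and> (AE z in lebesgue_on \<Omega>. weak_deriv \<Omega> i j u z = g z)"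
    if ij: "i + j \<le> k" for i j
  proof -
    have "integrable (lebesgue_on \<Omega>) (weak_deriv \<Omega> i j u)"
      by (rule lp_norm_finite_integrable[OF is_weak_deriv_measurable[OF op W(1)[OF ij]] W(2)[OF ij] p finite_measure_lebesgue_on[OF lm]])
    from borel_representative[OF this \<Omega>b] show ?thesis by metis
  qed
  define g where "g i j = (SOME g. integrable lborel g \<and> (\<forall>z. z \<notin> \<Omega> \<longrightarrow> g z = 0) \<and> (AE z in lebesgue_on \<Omega>. weak_deriv \<Omega> i j u z = g z))" for i j
  have g: "integrable lborel (g i j)" "z \<notin> \<Omega> \<Longrightarrow> g i j z = 0" "AE z in lebesgue_on \<Omega>. weak_deriv \<Omega> i j u z = g i j z"
    if ij: "i + j \<le> k" for i j z
    using someI_ex[OF ex[OF ij]] unfolding g_def[symmetric] by blast+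
  have gw: "is_weak_deriv \<Omega> i j u (g i j)" if ij: "i + j \<le> k" for i j
    by (rule is_weak_deriv_AE_cong[OF W(1)[OF ij] _ g(3)[OF ij] \<Omega>]) simp
  have "locally_integrable \<Omega> u" using gw[of 0 0] by (simp add: is_weak_deriv_def)
  then have u0: "AE z in lebesgue_on \<Omega>. u z = g 0 0 z"
    using is_weak_deriv_unique[OF op is_weak_deriv_refl[OF \<Omega>] gw[of 0 0]] by simp
  have "is_weak_deriv \<Omega> i j (g 0 0) (g i j)" if ij: "i + j \<le> k" for i j
    by (rule is_weak_deriv_AE_cong[OF gw[OF ij] u0 _ \<Omega>]) simp
  from smooth_approximation[OF ab g(1) this[unfolded \<Omega>_def], of k]
  obtain D where "\<forall>n. smooth2 (D n)"
    "\<forall>i j. i + j \<le> k \<longrightarrow> (\<lambda>n. LINT z:{a1..b1} \<times> {a2..b2}|lborel. \<bar>D n i j z - g i j z\<bar>) \<longlonglongrightarrow> 0" by auto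
  with g gw u0 show ?thesis by (intro that[of g D]) auto
qed

section \<open>The limit and its continuously differentiable representative\<close>

text \<open>The interpolated function does not appear; what is used of it is a family of L_1 limits
  of the derivatives up to order three of a smooth sequence. The function enters later through
  equalities almost everywhere.\<close>

locale smooth_limit =
  fixes a1 b1 a2 b2 :: real and g :: "nat \<Rightarrow> nat \<Rightarrow> real \<times> real \<Rightarrow> real" and D :: "nat \<Rightarrow> nat \<Rightarrow> nat \<Rightarrow> real \<times> real \<Rightarrow> real"
  assumes a1b1: "a1 < b1" and a2b2: "a2 < b2"
    and g_int: "i + j \<le> 3 \<Longrightarrow> integrable lborel (g i j)"
    and D_smooth: "smooth2 (D n)"
    and D_lim: "i + j \<le> 3 \<Longrightarrow> (\<lambda>n. LINT z:{a1..b1} \<times> {a2..b2}|lborel. \<bar>D n i j z - g i j z\<bar>) \<longlonglongrightarrow> 0"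
begin

abbreviation "Q \<equiv> {a1..b1} \<times> {a2..b2}"

lemma Q_cbox: "Q = cbox (a1, a2) (b1, b2)" by (simp add: cbox_prod_real)

lemma Q_borel: "Q \<in> sets borel" unfolding Q_cbox by simp

lemma g_set_int: "i + j \<le> 3 \<Longrightarrow> S \<in> sets borel \<Longrightarrow> set_integrable lborel S (g i j)"
  unfolding set_integrable_def using integrable_mult_indicator[OF _ g_int] by simp

lemma continuous_set_int: "continuous_on Q f \<Longrightarrow> set_integrable lborel Q f" for f :: "real \<times> real \<Rightarrow> real"
  using integral_box_eq_lborel(1) by (simp add: cbox_prod_real)

lemma D_continuous: "continuous_on S (D n i j)" by (rule smooth2_continuous[OF D_smooth])

lemma D_set_int: "set_integrable lborel Q (D n i j)" by (rule continuous_set_int[OF D_continuous])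

lemma L1_triangle:
  assumes "set_integrable lborel Q f" "set_integrable lborel Q f'" "set_integrable lborel Q f''"
  shows "(LINT z:Q|lborel. \<bar>f z - f'' z\<bar>) \<le> (LINT z:Q|lborel. \<bar>f z - f' z\<bar>) + (LINT z:Q|lborel. \<bar>f' z - f'' z :: real\<bar>)"
proof -
  have "set_integrable lborel Q (\<lambda>z. \<bar>p z - q z :: real\<bar>)" if "set_integrable lborel Q p" "set_integrable lborel Q q" for p q
    using that by (intro set_integrable_abs set_integral_diff(1))
  then have i: "set_integrable lborel Q (\<lambda>z. \<bar>f z - f' z\<bar>)" "set_integrable lborel Q (\<lambda>z. \<bar>f' z - f'' z\<bar>)" "set_integrable lborel Q (\<lambda>z. \<bar>f z - f'' z\<bar>)"
    using assms by blast+
  have "(LINT z:Q|lborel. \<bar>f z - f'' z\<bar>) \<le> (LINT z:Q|lborel. \<bar>f z - f' z\<bar> + \<bar>f' z - f'' z\<bar>)"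
    by (intro set_integral_mono i set_integral_add) auto
  then show ?thesis by (simp add: set_integral_add(2)[OF i(1,2)])
qed

lemma D_L1_Cauchy:
  assumes "i + j \<le> 3" "e > 0"
  obtains N where "\<And>m n. m \<ge> N \<Longrightarrow> n \<ge> N \<Longrightarrow> integral (cbox (a1, a2) (b1, b2)) (\<lambda>z. \<bar>D m i j z - D n i j z\<bar>) < e"
proof -
  obtain N where N: "\<And>n. n \<ge> N \<Longrightarrow> (LINT z:Q|lborel. \<bar>D n i j z - g i j z\<bar>) < e / 2"
    using order_tendstoD(2)[OF D_lim[OF assms(1)], of "e / 2"] assms(2) by (auto simp: eventually_sequentially)
  have "integral (cbox (a1, a2) (b1, b2)) (\<lambda>z. \<bar>D m i j z - D n i j z\<bar>) < e" if mn: "m \<ge> N" "n \<ge> N" for m n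
  proof -
    have c: "continuous_on (cbox (a1, a2) (b1, b2)) (\<lambda>z. \<bar>D m i j z - D n i j z\<bar>)" by (intro continuous_intros D_continuous)
    have "(LINT z:Q|lborel. \<bar>D m i j z - D n i j z\<bar>) \<le> (LINT z:Q|lborel. \<bar>D m i j z - g i j z\<bar>) + (LINT z:Q|lborel. \<bar>g i j z - D n i j z\<bar>)"
      by (rule L1_triangle[OF D_set_int g_set_int[OF assms(1) Q_borel] D_set_int])
    also have "\<dots> < e" using N[OF mn(1)] N[OF mn(2)] by (simp add: abs_minus_commute)
    finally show ?thesis using integral_box_eq_lborel(2)[OF c] by simp
  qed
  then show ?thesis using that by blast
qed

text \<open>The embedding of W_{3,1} into the continuously differentiable functions: for order at
  most one, \<open>sup_le\<close> involves only derivatives of order at most three, whose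
  differences are small in L_1.\<close>

lemma D_uniform_Cauchy:
  assumes ij: "i + j \<le> 1"
  shows "uniformly_Cauchy_on Q (\<lambda>n. D n i j)"
proof (rule uniformly_Cauchy_onI')
  fix e :: real assume e: "e > 0"
  define A where "A = (b1 - a1) * (b2 - a2)"
  define B where "B = b2 - a2"
  define C where "C = b1 - a1"
  have pos: "A > 0" "B > 0" "C > 0" using a1b1 a2b2 by (auto simp: A_def B_def C_def)
  let ?I = "\<lambda>i j m n. integral (cbox (a1, a2) (b1, b2)) (\<lambda>z. \<bar>D m i j z - D n i j z\<bar>)"
  obtain N1 where N1: "\<And>m n. m \<ge> N1 \<Longrightarrow> n \<ge> N1 \<Longrightarrow> ?I i j m n < A * (e / 4)"
    using D_L1_Cauchy[of i j "A * (e / 4)"] ij e pos by auto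
  obtain N2 where N2: "\<And>m n. m \<ge> N2 \<Longrightarrow> n \<ge> N2 \<Longrightarrow> ?I (Suc i) j m n < B * (e / 4)"
    using D_L1_Cauchy[of "Suc i" j "B * (e / 4)"] ij e pos by auto
  obtain N3 where N3: "\<And>m n. m \<ge> N3 \<Longrightarrow> n \<ge> N3 \<Longrightarrow> ?I i (Suc j) m n < C * (e / 4)"
    using D_L1_Cauchy[of i "Suc j" "C * (e / 4)"] ij e pos by auto
  obtain N4 where N4: "\<And>m n. m \<ge> N4 \<Longrightarrow> n \<ge> N4 \<Longrightarrow> ?I (Suc i) (Suc j) m n < e / 4"
    using D_L1_Cauchy[of "Suc i" "Suc j" "e / 4"] ij e pos by auto
  define N where "N = max (max N1 N2) (max N3 N4)"
  have "dist (D m i j z) (D n i j z) < e" if z: "z \<in> Q" and mn: "m \<ge> N" "n > m" for z m n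
  proof -
    note sd = smooth2_diff[OF D_smooth[of m] D_smooth[of n]]
    interpret X: C1_box a1 b1 a2 b2 "\<lambda>z. D m i j z - D n i j z" "\<lambda>z. D m (Suc i) j z - D n (Suc i) j z" "\<lambda>z. D m i (Suc j) z - D n i (Suc j) z"
      using smooth2_C1_box[OF sd a1b1 a2b2, of i j] .
    obtain x y where z': "z = (x, y)" "x \<in> {a1..b1}" "y \<in> {a2..b2}" using z by auto
    have "\<bar>D m i j z - D n i j z\<bar> \<le> ?I i j m n / A + ?I (Suc i) j m n / B + ?I i (Suc j) m n / C + ?I (Suc i) (Suc j) m n"
      unfolding z'(1) A_def B_def C_def
      by (rule X.sup_le[OF smooth2_continuous[OF sd] smooth2_partials(2)[OF sd] z'(2,3)])
    moreover have "?I i j m n / A < e / 4" "?I (Suc i) j m n / B < e / 4" "?I i (Suc j) m n / C < e / 4" "?I (Suc i) (Suc j) m n < e / 4"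
      using N1[of m n] N2[of m n] N3[of m n] N4[of m n] mn pos by (auto simp: N_def pos_divide_less_eq mult.commute)
    ultimately show ?thesis unfolding dist_real_def by linarith
  qed
  then show "\<exists>M. \<forall>x\<in>Q. \<forall>m\<ge>M. \<forall>n>m. dist (D m i j x) (D n i j x) < e" by blast
qed

text \<open>\<open>V 0 0\<close> is the continuously differentiable representative on the closed
  rectangle, and \<open>V 1 0\<close>, \<open>V 0 1\<close> are its partial derivatives. Existence
  of the limit is established for i + j at most 1 and points of \<open>Q\<close>.\<close>

definition "V i j z = lim (\<lambda>n. D n i j z)"

lemma D_uniform_limit: "i + j \<le> 1 \<Longrightarrow> uniform_limit Q (\<lambda>n. D n i j) (V i j) sequentially"
  using Cauchy_uniformly_convergent[OF D_uniform_Cauchy]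
  unfolding uniformly_convergent_uniform_limit_iff V_def[abs_def] by blast

lemma D_uniform_limitD: "i + j \<le> 1 \<Longrightarrow> r > 0 \<Longrightarrow> \<forall>\<^sub>F n in sequentially. \<forall>x\<in>Q. dist (D n i j x) (V i j x) < r"
  using D_uniform_limit unfolding uniform_limit_iff by blast

lemma D_pointwise: "i + j \<le> 1 \<Longrightarrow> z \<in> Q \<Longrightarrow> (\<lambda>n. D n i j z) \<longlonglongrightarrow> V i j z"
  by (rule tendsto_uniform_limitI[OF D_uniform_limit])

lemma V_continuous: "i + j \<le> 1 \<Longrightarrow> continuous_on Q (V i j)"
  by (rule uniform_limit_theorem[OF _ D_uniform_limit]) (auto intro!: always_eventually D_continuous)

text \<open>Uniform convergence of the gradients on a convex set permits the exchange of limit and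
  derivative, up to the boundary.\<close>

lemma V_has_derivative:
  assumes z: "z \<in> Q"
  shows "(V 0 0 has_derivative (\<lambda>h. fst h * V 1 0 z + snd h * V 0 1 z)) (at z within Q)"
proof -
  have cv: "convex Q" unfolding Q_cbox by simp
  have "\<exists>f. \<forall>x\<in>Q. (\<lambda>n. D n 0 0 x) \<longlonglongrightarrow> f x \<and> (f has_derivative (\<lambda>h. fst h * V 1 0 x + snd h * V 0 1 x)) (at x within Q)"
  proof (rule has_derivative_sequence[where S=Q and ?x0.0=z and f="\<lambda>n. D n 0 0" and f'="\<lambda>n x h. fst h * D n 1 0 x + snd h * D n 0 1 x" and l="V 0 0 z"])
    show "(D n 0 0 has_derivative (\<lambda>h. fst h * D n 1 0 x + snd h * D n 0 1 x)) (at x within Q)" for n x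
      using has_derivative_at_withinI[OF smooth2_has_derivative[OF D_smooth, of n 0 0 x], of Q] by simp
    fix e :: real assume "e > 0"
    then have "\<forall>\<^sub>F n in sequentially. \<forall>x\<in>Q. dist (D n 1 0 x) (V 1 0 x) < e / 2" "\<forall>\<^sub>F n in sequentially. \<forall>x\<in>Q. dist (D n 0 1 x) (V 0 1 x) < e / 2"
      using D_uniform_limitD[of 1 0 "e / 2"] D_uniform_limitD[of 0 1 "e / 2"] by simp_all
    then show "\<forall>\<^sub>F n in sequentially. \<forall>x\<in>Q. \<forall>h. norm (fst h * D n 1 0 x + snd h * D n 0 1 x - (fst h * V 1 0 x + snd h * V 0 1 x)) \<le> e * norm h"
    proof eventually_elim
      case (elim n)
      show ?case
      proof (intro ballI allI)
        fix x and h :: "real \<times> real" assume x: "x \<in> Q"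
        have n: "\<bar>fst h\<bar> \<le> norm h" "\<bar>snd h\<bar> \<le> norm h"
          using norm_fst_le[of "fst h" "snd h"] norm_snd_le[of "snd h" "fst h"] by auto
        have "norm (fst h * D n 1 0 x + snd h * D n 0 1 x - (fst h * V 1 0 x + snd h * V 0 1 x))
          = \<bar>fst h * (D n 1 0 x - V 1 0 x) + snd h * (D n 0 1 x - V 0 1 x)\<bar>" by (simp add: algebra_simps)
        also have "\<dots> \<le> \<bar>fst h\<bar> * \<bar>D n 1 0 x - V 1 0 x\<bar> + \<bar>snd h\<bar> * \<bar>D n 0 1 x - V 0 1 x\<bar>"
          unfolding abs_mult[symmetric] by (rule abs_triangle_ineq)
        also have "\<dots> \<le> norm h * (e / 2) + norm h * (e / 2)"
          using elim x n by (intro add_mono mult_mono) (auto simp: dist_real_def less_imp_le)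
        finally show "norm (fst h * D n 1 0 x + snd h * D n 0 1 x - (fst h * V 1 0 x + snd h * V 0 1 x)) \<le> e * norm h"
          by (simp add: field_simps)
      qed
    qed
  qed (use cv z D_pointwise[of 0 0 z] in auto)
  then obtain f where f: "\<And>x. x \<in> Q \<Longrightarrow> (\<lambda>n. D n 0 0 x) \<longlonglongrightarrow> f x"
    "(f has_derivative (\<lambda>h. fst h * V 1 0 z + snd h * V 0 1 z)) (at z within Q)" using z by blast
  have eq: "V 0 0 x = f x" if "x \<in> Q" for x using LIMSEQ_unique[OF D_pointwise[OF _ that] f(1)[OF that]] by simp
  show ?thesis by (rule has_derivative_transform[OF z eq f(2)])
qed

text \<open>On a bounded set uniform convergence implies L_1 convergence, so the two limits of the
  same sequence have L_1 distance zero.\<close>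

lemma V_AE:
  "AE z in lebesgue_on Q. V 0 0 z = g 0 0 z"
proof -
  have i: "set_integrable lborel Q (V 0 0)" by (rule continuous_set_int[OF V_continuous]) simp
  note gi = g_set_int[of 0 0, OF _ Q_borel, simplified]
  have d: "set_integrable lborel Q (\<lambda>z. \<bar>V 0 0 z - g 0 0 z\<bar>)" by (intro set_integrable_abs set_integral_diff(1) i gi)
  have m: "emeasure lborel Q < \<infinity>" unfolding Q_cbox by (simp add: emeasure_lborel_cbox_eq)
  have "(\<lambda>n. LINT z:Q|lborel. \<bar>V 0 0 z - D n 0 0 z\<bar>) \<longlonglongrightarrow> 0"
  proof (rule LIMSEQ_I)
    fix r :: real assume r: "r > 0"
    define c where "c = measure lborel Q + 1"
    have c: "c > 0" "measure lborel Q < c" by (auto simp: c_def add_nonneg_pos)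
    have "\<forall>\<^sub>F n in sequentially. \<forall>x\<in>Q. dist (D n 0 0 x) (V 0 0 x) < r / c"
      using D_uniform_limitD[of 0 0 "r / c"] r c by simp
    then obtain N where N: "\<And>n x. n \<ge> N \<Longrightarrow> x \<in> Q \<Longrightarrow> dist (D n 0 0 x) (V 0 0 x) < r / c" unfolding eventually_sequentially by blast
    have "norm ((LINT z:Q|lborel. \<bar>V 0 0 z - D n 0 0 z\<bar>) - 0) < r" if n: "n \<ge> N" for n
    proof -
      have "(LINT z:Q|lborel. \<bar>V 0 0 z - D n 0 0 z\<bar>) \<le> (LINT z:Q|lborel. r / c)"
        using m Q_borel by (intro set_integral_mono set_integrable_abs set_integral_diff(1) i D_set_int continuous_set_int[OF continuous_on_const])
          (auto simp: dist_real_def abs_minus_commute intro!: less_imp_le[OF N[OF n, unfolded dist_real_def abs_minus_commute]])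
      also have "\<dots> = measure lborel Q * (r / c)" using m Q_borel by (simp add: set_lebesgue_integral_def)
      also have "\<dots> < c * (r / c)" using c r by (intro mult_strict_right_mono) auto
      finally have "(LINT z:Q|lborel. \<bar>V 0 0 z - D n 0 0 z\<bar>) < r" using c by simp
      moreover have "(LINT z:Q|lborel. \<bar>V 0 0 z - D n 0 0 z\<bar>) \<ge> 0" by (simp add: set_lebesgue_integral_def integral_nonneg_AE)
      ultimately show ?thesis by simp
    qed
    then show "\<exists>no. \<forall>n\<ge>no. norm ((LINT z:Q|lborel. \<bar>V 0 0 z - D n 0 0 z\<bar>) - 0) < r" by blast
  qed
  from tendsto_add[OF this D_lim[of 0 0]]
  have "(\<lambda>n. (LINT z:Q|lborel. \<bar>V 0 0 z - D n 0 0 z\<bar>) + (LINT z:Q|lborel. \<bar>D n 0 0 z - g 0 0 z\<bar>)) \<longlonglongrightarrow> 0" by simp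
  from LIMSEQ_le_const[OF this] have "(LINT z:Q|lborel. \<bar>V 0 0 z - g 0 0 z\<bar>) \<le> 0"
    using L1_triangle[OF i D_set_int gi] by blast
  moreover have "(LINT z:Q|lborel. \<bar>V 0 0 z - g 0 0 z\<bar>) \<ge> 0" by (simp add: set_lebesgue_integral_def integral_nonneg_AE)
  ultimately have "(LINT z:Q|lborel. \<bar>V 0 0 z - g 0 0 z\<bar>) = 0" by (rule antisym)
  then have "(LINT z|lborel. indicator Q z * \<bar>V 0 0 z - g 0 0 z\<bar>) = 0" by (simp add: set_lebesgue_integral_def)
  then have "AE z in lborel. indicator Q z * \<bar>V 0 0 z - g 0 0 z\<bar> = 0"
    using integral_nonneg_eq_0_iff_AE[of lborel "\<lambda>z. indicator Q z * \<bar>V 0 0 z - g 0 0 z\<bar>"] d by (simp add: set_integrable_def)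
  then have "AE z in lebesgue. indicator Q z * \<bar>V 0 0 z - g 0 0 z\<bar> = 0" by (rule AE_completion)
  then show ?thesis using Q_borel by (subst AE_restrict_space_iff) (auto elim!: eventually_mono simp: indicator_def)
qed

text \<open>Continuous functions that agree almost everywhere on an open rectangle agree on its
  closure. So on the closed element, vertices included, \<open>u\<close> is the representative
  \<open>V 0 0\<close>, and its one-sided derivatives are those of \<open>V 0 0\<close>. This is the
  point where classical smoothness of \<open>u\<close> on the element enters.\<close>

lemma point_values:
  assumes M: "s0 < s1" "t0 < t1" "a1 \<le> s0" "s1 \<le> b1" "a2 \<le> t0" "t1 \<le> b2"
    and u: "cont_diff 1 ({s0..s1} \<times> {t0..t1}) u"
    and ae: "AE z in lebesgue_on ({a1<..<b1} \<times> {a2<..<b2}). u z = g 0 0 z"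
    and z: "z \<in> {s0..s1} \<times> {t0..t1}"
  shows "(\<lambda>n. D n 0 0 z) \<longlonglongrightarrow> u z" "(\<lambda>n. D n 1 0 z) \<longlonglongrightarrow> dx ({s0..s1} \<times> {t0..t1}) u z"
    "(\<lambda>n. D n 0 1 z) \<longlonglongrightarrow> dy ({s0..s1} \<times> {t0..t1}) u z"
proof -
  define M where "M = {s0..s1} \<times> {t0..t1}"
  define M0 where "M0 = {s0<..<s1} \<times> {t0<..<t1}"
  have MQ: "M \<subseteq> Q" using M by (auto simp: M_def)
  have op: "open M0" by (simp add: M0_def open_Times)
  have cl: "closure M0 = M" unfolding M0_def M_def using M(1,2) by (simp add: closure_Times)
  have cu: "continuous_on M u" using u differentiable_imp_continuous_on unfolding M_def by auto
  have "AE z in lebesgue. z \<in> M0 \<longrightarrow> V 0 0 z = u z"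
  proof -
    have "{a1<..<b1} \<times> {a2<..<b2} \<in> sets lebesgue" by (simp add: borel_open open_Times)
    then have "AE z in lebesgue. z \<in> {a1<..<b1} \<times> {a2<..<b2} \<longrightarrow> u z = g 0 0 z" using ae by (simp add: AE_restrict_space_iff)
    moreover have "AE z in lebesgue. z \<in> Q \<longrightarrow> V 0 0 z = g 0 0 z" using V_AE Q_borel by (simp add: AE_restrict_space_iff)
    ultimately show ?thesis by eventually_elim (use M in \<open>auto simp: M0_def\<close>)
  qed
  then have ae0: "AE z\<in>M0 in lebesgue. z \<in> {z \<in> M. V 0 0 z - u z = 0}"
    by eventually_elim (use closure_subset[of M0] in \<open>auto simp: cl\<close>)
  have cd: "continuous_on M (\<lambda>z. V 0 0 z - u z)" by (intro continuous_intros cu continuous_on_subset[OF V_continuous MQ]) simp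
  have "closed M" unfolding cl[symmetric] by simp
  from continuous_closed_preimage[OF cd this closed_singleton[of 0]]
  have "closed {z \<in> M. V 0 0 z - u z = 0}" by (simp add: vimage_def Int_def)
  from mem_closed_if_AE_lebesgue_open[OF op this ae0] have "V 0 0 z - u z = 0" if "z \<in> M0" for z using that by blast
  then have eq: "V 0 0 z = u z" if "z \<in> M" for z
    using continuous_constant_on_closure[of M0 "\<lambda>z. V 0 0 z - u z" 0 z] that cd by (simp add: cl)
  have zM: "z \<in> M" using z by (simp add: M_def)
  then have zQ: "z \<in> Q" using MQ by auto
  show "(\<lambda>n. D n 0 0 z) \<longlonglongrightarrow> u z" using D_pointwise[OF _ zQ, of 0 0] eq[OF zM] by simp
  note dV = has_derivative_subset[OF V_has_derivative[OF zQ] MQ]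
  have du: "(u has_derivative (\<lambda>h. fst h * V 1 0 z + snd h * V 0 1 z)) (at z within M)"
    by (rule has_derivative_transform[OF zM _ dV]) (simp add: eq)
  have Mc: "M = cbox (s0, t0) (s1, t1)" by (simp add: M_def cbox_prod_real)
  have "(s0, t0) \<bullet> b < (s1, t1) \<bullet> b" if "b \<in> Basis" for b :: "real \<times> real"
    using that M(1,2) by (auto simp: Basis_prod_def)
  from frechet_derivative_within_cbox[OF this zM[unfolded Mc] du[unfolded Mc]]
  have "frechet_derivative u (at z within M) = (\<lambda>h. fst h * V 1 0 z + snd h * V 0 1 z)" unfolding Mc by simp
  then have "dx M u z = V 1 0 z" "dy M u z = V 0 1 z" by (simp_all add: dx_def dy_def)
  then show "(\<lambda>n. D n 1 0 z) \<longlonglongrightarrow> dx ({s0..s1} \<times> {t0..t1}) u z" "(\<lambda>n. D n 0 1 z) \<longlonglongrightarrow> dy ({s0..s1} \<times> {t0..t1}) u z"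
    using D_pointwise[OF _ zQ, of 1 0] D_pointwise[OF _ zQ, of 0 1] unfolding M_def by simp_all
qed

end

section \<open>Traces of the mixed derivative\<close>

lemma open_box_integral:
  fixes f :: "real \<times> real \<Rightarrow> real"
  assumes f: "set_integrable lborel ({a1..b1} \<times> {a2..b2}) f"
  shows "set_integrable lborel ({a1<..<b1} \<times> {a2<..<b2}) f"
    "(LINT z:{a1<..<b1} \<times> {a2<..<b2}|lborel. f z) = (LINT z:{a1..b1} \<times> {a2..b2}|lborel. f z)"
proof -
  let ?Q = "{a1..b1} \<times> {a2..b2}" and ?\<Omega> = "{a1<..<b1} \<times> {a2<..<b2}"
  show i: "set_integrable lborel ?\<Omega> f"
    by (rule set_integrable_subset[OF f]) (auto simp: borel_open open_Times)
  have "negligible (cbox (a1, a2) (b1, b2) - box (a1, a2) (b1, b2))" by (rule negligible_frontier_interval)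
  then have "cbox (a1, a2) (b1, b2) - box (a1, a2) (b1, b2) \<in> null_sets lborel"
    by (simp add: negligible_iff_null_sets null_sets_completion_iff)
  from AE_not_in[OF this] have "AE z in lborel. indicator ?\<Omega> z *\<^sub>R f z = indicator ?Q z *\<^sub>R f z"
    by eventually_elim (auto simp: indicator_def cbox_prod_real box_prod_real)
  then show "(LINT z:?\<Omega>|lborel. f z) = (LINT z:?Q|lborel. f z)"
    unfolding set_lebesgue_integral_def
    by (intro integral_cong_AE) (use i f in \<open>auto simp: set_integrable_def\<close>)
qed

lemma C1_box_cont_diff:
  assumes ab: "a1 < b1" "a2 < b2" and w: "cont_diff 1 ({a1..b1} \<times> {a2..b2}) w"
  shows "C1_box a1 b1 a2 b2 w (dx ({a1..b1} \<times> {a2..b2}) w) (dy ({a1..b1} \<times> {a2..b2}) w)"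
proof
  let ?Q = "{a1..b1} \<times> {a2..b2}"
  have d: "w differentiable_on ?Q" and cx: "continuous_on ?Q (dx ?Q w)" and cy: "continuous_on ?Q (dy ?Q w)" using w by auto
  show "continuous_on (cbox (a1, a2) (b1, b2)) (dx ?Q w)" "continuous_on (cbox (a1, a2) (b1, b2)) (dy ?Q w)"
    "continuous_on (cbox (a1, a2) (b1, b2)) w"
    using cx cy differentiable_imp_continuous_on[OF d] by (simp_all add: cbox_prod_real)
  fix x y assume xy: "x \<in> {a1..b1}" "y \<in> {a2..b2}"
  define F where "F = frechet_derivative w (at (x, y) within ?Q)"
  have dF: "(w has_derivative F) (at (x, y) within ?Q)"
    using d xy unfolding F_def differentiable_on_def by (auto simp flip: frechet_derivative_works)
  interpret F: linear F by (rule has_derivative_linear[OF dF])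
  have 1: "((\<lambda>x. w (x, y)) has_derivative (\<lambda>h. F (h, 0))) (at x within {a1..b1})"
  proof (rule has_derivative_in_compose[where f="\<lambda>x. (x, y)" and g=w])
    show "((\<lambda>x. (x, y)) has_derivative (\<lambda>h. (h, 0))) (at x within {a1..b1})" by (auto intro!: derivative_eq_intros)
    show "(w has_derivative F) (at (x, y) within (\<lambda>x. (x, y)) ` {a1..b1})" by (rule has_derivative_subset[OF dF]) (use xy in auto)
  qed
  have "F (h, 0) = dx ?Q w (x, y) * h" for h using F.scale[of h "(1, 0)"] by (simp add: dx_def F_def)
  with 1 show "((\<lambda>x. w (x, y)) has_real_derivative dx ?Q w (x, y)) (at x within {a1..b1})"
    by (simp add: has_field_derivative_def)
  have 2: "((\<lambda>y. w (x, y)) has_derivative (\<lambda>h. F (0, h))) (at y within {a2..b2})"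
  proof (rule has_derivative_in_compose[where f="\<lambda>y. (x, y)" and g=w])
    show "((\<lambda>y. (x, y)) has_derivative (\<lambda>h. (0, h))) (at y within {a2..b2})" by (auto intro!: derivative_eq_intros)
    show "(w has_derivative F) (at (x, y) within (\<lambda>y. (x, y)) ` {a2..b2})" by (rule has_derivative_subset[OF dF]) (use xy in auto)
  qed
  have "F (0, h) = dy ?Q w (x, y) * h" for h using F.scale[of h "(0, 1)"] by (simp add: dy_def F_def)
  with 2 show "((\<lambda>y. w (x, y)) has_real_derivative dy ?Q w (x, y)) (at y within {a2..b2})"
    by (simp add: has_field_derivative_def)
qed (use ab in auto)

lemma smooth2_cont_diff:
  assumes D: "smooth2 D" and ab: "a1 < b1" "a2 < b2"
  shows "cont_diff 1 ({a1..b1} \<times> {a2..b2}) (D i j)"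
proof -
  let ?Q = "{a1..b1} \<times> {a2..b2}"
  have d: "(D i j has_derivative (\<lambda>h. fst h * D (Suc i) j z + snd h * D i (Suc j) z)) (at z within ?Q)" for z
    by (rule has_derivative_at_withinI[OF smooth2_has_derivative[OF D]])
  have B: "(a1, a2) \<bullet> b < (b1, b2) \<bullet> b" if "b \<in> Basis" for b :: "real \<times> real"
    using that ab by (auto simp: Basis_prod_def)
  have "frechet_derivative (D i j) (at z within ?Q) = (\<lambda>h. fst h * D (Suc i) j z + snd h * D i (Suc j) z)" if "z \<in> ?Q" for z
    using frechet_derivative_within_cbox[OF B _ d[unfolded cbox_prod_real[symmetric]]] that by (simp add: cbox_prod_real)
  then have "dx ?Q (D i j) z = D (Suc i) j z" "dy ?Q (D i j) z = D i (Suc j) z" if "z \<in> ?Q" for z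
    using that by (simp_all add: dx_def dy_def)
  then have "continuous_on ?Q (dx ?Q (D i j))" "continuous_on ?Q (dy ?Q (D i j))"
    using continuous_on_cong[OF refl, of ?Q "dx ?Q (D i j)" "D (Suc i) j"] continuous_on_cong[OF refl, of ?Q "dy ?Q (D i j)" "D i (Suc j)"]
      smooth2_continuous[OF D] by blast+
  moreover have "D i j differentiable_on ?Q" unfolding differentiable_on_def differentiable_def using d by blast
  ultimately show ?thesis by simp
qed

context C1_box begin

lemma closed_box_integrable:
  "set_integrable lborel ({a1..b1} \<times> {a2..b2}) f" "set_integrable lborel ({a1..b1} \<times> {a2..b2}) fx"
  "set_integrable lborel ({a1..b1} \<times> {a2..b2}) fy"
  using integral_box_eq_lborel(1)[OF cf] integral_box_eq_lborel(1)[OF cfx] integral_box_eq_lborel(1)[OF cfy] by auto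

lemma box_integrable:
  "set_integrable lborel ({a1<..<b1} \<times> {a2<..<b2}) f" "set_integrable lborel ({a1<..<b1} \<times> {a2<..<b2}) fx"
  "set_integrable lborel ({a1<..<b1} \<times> {a2<..<b2}) fy"
  by (intro open_box_integral(1) closed_box_integrable)+

lemma weak_deriv_partials:
  "is_weak_deriv ({a1<..<b1} \<times> {a2<..<b2}) 1 0 f fx" "is_weak_deriv ({a1<..<b1} \<times> {a2<..<b2}) 0 1 f fy"
proof -
  show "is_weak_deriv ({a1<..<b1} \<times> {a2<..<b2}) 1 0 f fx"
  proof (rule is_weak_deriv_x[OF refl a1b1 a2b2 box_integrable(1,2) _ finite.emptyI])
    show "continuous_on {a1..b1} (\<lambda>x. f (x, y))" if "y \<in> {a2<..<b2}" for y
      by (rule DERIV_continuous_on[OF dfx]) (use that in auto)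
    show "((\<lambda>x. f (x, y)) has_real_derivative fx (x, y)) (at x)" if "(x, y) \<in> {a1<..<b1} \<times> {a2<..<b2}" for x y
      using dfx[of x y] that by (simp add: at_within_Icc_at)
  qed
  show "is_weak_deriv ({a1<..<b1} \<times> {a2<..<b2}) 0 1 f fy"
  proof (rule is_weak_deriv_y[OF refl a1b1 a2b2 box_integrable(1,3) _ finite.emptyI])
    show "continuous_on {a2..b2} (\<lambda>y. f (x, y))" if "x \<in> {a1<..<b1}" for x
      by (rule DERIV_continuous_on[OF dfy]) (use that in auto)
    show "((\<lambda>y. f (x, y)) has_real_derivative fy (x, y)) (at y)" if "(x, y) \<in> {a1<..<b1} \<times> {a2<..<b2}" for x y
      using dfy[of x y] that by (simp add: at_within_Icc_at)
  qed
qed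

end

lemma C1_box_diff:
  assumes "C1_box a1 b1 a2 b2 f fx fy" "C1_box a1 b1 a2 b2 g gx gy"
  shows "C1_box a1 b1 a2 b2 (\<lambda>z. f z - g z) (\<lambda>z. fx z - gx z) (\<lambda>z. fy z - gy z)"
proof -
  interpret f: C1_box a1 b1 a2 b2 f fx fy by fact
  interpret g: C1_box a1 b1 a2 b2 g gx gy by fact
  show ?thesis
    by unfold_locales (auto intro!: continuous_intros DERIV_diff f.cf f.cfx f.cfy g.cf g.cfx g.cfy f.dfx f.dfy g.dfx g.dfy f.a1b1 f.a2b2)
qed

lemma C1_box_const: "a1 < b1 \<Longrightarrow> a2 < b2 \<Longrightarrow> C1_box a1 b1 a2 b2 (\<lambda>z. c) (\<lambda>z. 0) (\<lambda>z. 0)"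
  by unfold_locales auto

text \<open>Treats horizontal and vertical segments alike; \<open>L\<close> is the width of the rectangle across the segment.\<close>

definition bounded_trace :: "real \<Rightarrow> real \<Rightarrow> real \<Rightarrow> real \<Rightarrow> (real \<Rightarrow> real \<times> real) \<Rightarrow> real \<Rightarrow> real \<Rightarrow> real \<Rightarrow> bool" where
  "bounded_trace a1 b1 a2 b2 \<gamma> c d L \<longleftrightarrow> L > 0 \<and> (\<forall>w wx wy. C1_box a1 b1 a2 b2 w wx wy \<longrightarrow>
     continuous_on {c..d} (\<lambda>r. w (\<gamma> r)) \<and>
     (LINT r|lebesgue_on {c..d}. \<bar>w (\<gamma> r)\<bar>) \<le> (LINT z:{a1..b1} \<times> {a2..b2}|lborel. \<bar>w z\<bar>) / L
       + (LINT z:{a1..b1} \<times> {a2..b2}|lborel. \<bar>wx z\<bar>) + (LINT z:{a1..b1} \<times> {a2..b2}|lborel. \<bar>wy z\<bar>))"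

lemma lebesgue_on_interval_le:
  fixes f :: "real \<Rightarrow> real"
  assumes f: "continuous_on {a..b} f" and cd: "a \<le> c" "d \<le> b" and nn: "\<And>t. f t \<ge> 0"
  shows "continuous_on {c..d} f" "(LINT t|lebesgue_on {c..d}. f t) \<le> integral {a..b} f"
proof -
  show c: "continuous_on {c..d} f" by (rule continuous_on_subset[OF f]) (use cd in auto)
  have "(LINT t|lebesgue_on {c..d}. f t) = integral {c..d} f"
    by (rule set_lebesgue_integral_eq_has_integral[OF c integrable_integral[OF integrable_continuous_real[OF c]]])
  also have "\<dots> \<le> integral {a..b} f"
    by (rule integral_subset_le[OF _ integrable_continuous_real[OF c] integrable_continuous_real[OF f]]) (use cd nn in auto)
  finally show "(LINT t|lebesgue_on {c..d}. f t) \<le> integral {a..b} f" .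
qed

lemma bounded_trace_horizontal:
  assumes ab: "a1 < b1" "a2 < b2" and y: "y \<in> {a2..b2}" and cd: "a1 \<le> c" "d \<le> b1"
  shows "bounded_trace a1 b1 a2 b2 (\<lambda>r. (r, y)) c d (b2 - a2)"
  unfolding bounded_trace_def
proof (intro conjI allI impI)
  fix w wx wy assume "C1_box a1 b1 a2 b2 w wx wy"
  then interpret w: C1_box a1 b1 a2 b2 w wx wy .
  have c: "continuous_on {a1..b1} (\<lambda>r. w (r, y))" by (rule continuous_box_slice_x[OF w.cf y])
  show "continuous_on {c..d} (\<lambda>r. w (r, y))" by (rule continuous_on_subset[OF c]) (use cd in auto)
  have "(LINT r|lebesgue_on {c..d}. \<bar>w (r, y)\<bar>) \<le> integral {a1..b1} (\<lambda>r. \<bar>w (r, y)\<bar>)"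
    by (rule lebesgue_on_interval_le(2)[OF continuous_on_rabs[OF c] cd]) simp
  also have "\<dots> \<le> integral w.R (\<lambda>z. \<bar>w z\<bar>) / (b2 - a2) + integral w.R (\<lambda>z. \<bar>wy z\<bar>)" by (rule w.horizontal_trace_le[OF y])
  also have "\<dots> = (LINT z:{a1..b1} \<times> {a2..b2}|lborel. \<bar>w z\<bar>) / (b2 - a2) + (LINT z:{a1..b1} \<times> {a2..b2}|lborel. \<bar>wy z\<bar>)"
    using integral_box_eq_lborel(2)[OF w.cabs(1)] integral_box_eq_lborel(2)[OF w.cabs(3)] by simp
  moreover have "(LINT z:{a1..b1} \<times> {a2..b2}|lborel. \<bar>wx z\<bar>) \<ge> 0" by (simp add: set_lebesgue_integral_def integral_nonneg_AE)
  ultimately show "(LINT r|lebesgue_on {c..d}. \<bar>w (r, y)\<bar>) \<le> (LINT z:{a1..b1} \<times> {a2..b2}|lborel. \<bar>w z\<bar>) / (b2 - a2)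
     + (LINT z:{a1..b1} \<times> {a2..b2}|lborel. \<bar>wx z\<bar>) + (LINT z:{a1..b1} \<times> {a2..b2}|lborel. \<bar>wy z\<bar>)" by linarith
qed (use ab in auto)

lemma bounded_trace_vertical:
  assumes ab: "a1 < b1" "a2 < b2" and x: "x \<in> {a1..b1}" and cd: "a2 \<le> c" "d \<le> b2"
  shows "bounded_trace a1 b1 a2 b2 (\<lambda>r. (x, r)) c d (b1 - a1)"
  unfolding bounded_trace_def
proof (intro conjI allI impI)
  fix w wx wy assume "C1_box a1 b1 a2 b2 w wx wy"
  then interpret w: C1_box a1 b1 a2 b2 w wx wy .
  have c: "continuous_on {a2..b2} (\<lambda>r. w (x, r))" by (rule continuous_box_slice_y[OF w.cf x])
  show "continuous_on {c..d} (\<lambda>r. w (x, r))" by (rule continuous_on_subset[OF c]) (use cd in auto)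
  have "(LINT r|lebesgue_on {c..d}. \<bar>w (x, r)\<bar>) \<le> integral {a2..b2} (\<lambda>r. \<bar>w (x, r)\<bar>)"
    by (rule lebesgue_on_interval_le(2)[OF continuous_on_rabs[OF c] cd]) simp
  also have "\<dots> \<le> integral w.R (\<lambda>z. \<bar>w z\<bar>) / (b1 - a1) + integral w.R (\<lambda>z. \<bar>wx z\<bar>)" by (rule w.vertical_trace_le[OF x])
  also have "\<dots> = (LINT z:{a1..b1} \<times> {a2..b2}|lborel. \<bar>w z\<bar>) / (b1 - a1) + (LINT z:{a1..b1} \<times> {a2..b2}|lborel. \<bar>wx z\<bar>)"
    using integral_box_eq_lborel(2)[OF w.cabs(1)] integral_box_eq_lborel(2)[OF w.cabs(2)] by simp
  moreover have "(LINT z:{a1..b1} \<times> {a2..b2}|lborel. \<bar>wy z\<bar>) \<ge> 0" by (simp add: set_lebesgue_integral_def integral_nonneg_AE)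
  ultimately show "(LINT r|lebesgue_on {c..d}. \<bar>w (x, r)\<bar>) \<le> (LINT z:{a1..b1} \<times> {a2..b2}|lborel. \<bar>w z\<bar>) / (b1 - a1)
     + (LINT z:{a1..b1} \<times> {a2..b2}|lborel. \<bar>wx z\<bar>) + (LINT z:{a1..b1} \<times> {a2..b2}|lborel. \<bar>wy z\<bar>)" by linarith
qed (use ab in auto)

context smooth_limit begin

abbreviation "\<Omega> \<equiv> {a1<..<b1} \<times> {a2<..<b2}"

lemma open_\<Omega>: "open \<Omega>" by (simp add: open_Times)

lemma \<Omega>_borel: "\<Omega> \<in> sets borel" by (simp add: open_Times borel_open)

lemma \<Omega>_lebesgue: "\<Omega> \<in> sets lebesgue" using \<Omega>_borel by simp

lemma D_C1_box: "C1_box a1 b1 a2 b2 (D n i j) (D n (Suc i) j) (D n i (Suc j))"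
  by (rule smooth2_C1_box[OF D_smooth a1b1 a2b2])

lemma D_lim_open:
  assumes "i + j \<le> 3" shows "(\<lambda>n. LINT z:\<Omega>|lborel. \<bar>D n i j z - g i j z\<bar>) \<longlonglongrightarrow> 0"
proof -
  have "set_integrable lborel Q (\<lambda>z. \<bar>D n i j z - g i j z\<bar>)" for n
    by (intro set_integrable_abs set_integral_diff(1) D_set_int g_set_int assms Q_borel)
  from open_box_integral(2)[OF this] show ?thesis using D_lim[OF assms] by simp
qed

lemma g_weak_deriv:
  assumes ij: "i + j \<le> 2"
  shows "is_weak_deriv \<Omega> 1 0 (g i j) (g (Suc i) j)" "is_weak_deriv \<Omega> 0 1 (g i j) (g i (Suc j))"
proof -
  have s: "i + j \<le> 3" "Suc i + j \<le> 3" "i + Suc j \<le> 3" using ij by auto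
  note b = C1_box.box_integrable[OF D_C1_box] and w = C1_box.weak_deriv_partials[OF D_C1_box]
  show "is_weak_deriv \<Omega> 1 0 (g i j) (g (Suc i) j)"
    by (rule is_weak_deriv_limit[OF \<Omega>_borel w(1) b(1,2) g_set_int[OF s(1) \<Omega>_borel] g_set_int[OF s(2) \<Omega>_borel] D_lim_open[OF s(1)] D_lim_open[OF s(2)]])
  show "is_weak_deriv \<Omega> 0 1 (g i j) (g i (Suc j))"
    by (rule is_weak_deriv_limit[OF \<Omega>_borel w(2) b(1,3) g_set_int[OF s(1) \<Omega>_borel] g_set_int[OF s(3) \<Omega>_borel] D_lim_open[OF s(1)] D_lim_open[OF s(3)]])
qed

text \<open>Translates the seminorms in the definition of a trace, which refer to chosen weak
  derivatives, into L_1 norms of known functions.\<close>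

lemma seminorm_diff_C1:
  assumes v: "AE z in lebesgue_on \<Omega>. v z = g 1 1 z" and w: "C1_box a1 b1 a2 b2 w wx wy"
  shows "sobolev_seminorm 0 1 \<Omega> (\<lambda>z. v z - w z) = ennreal (LINT z:Q|lborel. \<bar>g 1 1 z - w z\<bar>)"
    "sobolev_seminorm 1 1 \<Omega> (\<lambda>z. v z - w z) = ennreal ((LINT z:Q|lborel. \<bar>g 1 2 z - wy z\<bar>) + (LINT z:Q|lborel. \<bar>g 2 1 z - wx z\<bar>))"
proof -
  interpret w: C1_box a1 b1 a2 b2 w wx wy by fact
  define e where "e i j z = (if i = 1 then g 2 1 z - wx z else if j = 1 then g 1 2 z - wy z else g 1 1 z - w z)" for i j :: nat and z
  have gw: "is_weak_deriv \<Omega> 1 0 (g 1 1) (g 2 1)" "is_weak_deriv \<Omega> 0 1 (g 1 1) (g 1 2)"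
    using g_weak_deriv[of 1 1] by (simp_all add: numeral_2_eq_2)
  have rf: "is_weak_deriv \<Omega> 0 0 f f" if "is_weak_deriv \<Omega> i j f h" for i j f h
    using that by (intro is_weak_deriv_refl[OF \<Omega>_lebesgue]) (simp add: is_weak_deriv_def)
  have E: "is_weak_deriv \<Omega> i j (\<lambda>z. g 1 1 z - w z) (e i j)" if ij: "i + j \<le> 1" for i j
  proof -
    consider "i = 0" "j = 0" | "i = 1" "j = 0" | "i = 0" "j = 1" using ij by linarith
    then show ?thesis unfolding e_def
    proof cases
      case 1 then show "is_weak_deriv \<Omega> i j (\<lambda>z. g 1 1 z - w z) (\<lambda>z. if i = 1 then g 2 1 z - wx z else if j = 1 then g 1 2 z - wy z else g 1 1 z - w z)"
        using is_weak_deriv_diff[OF \<Omega>_lebesgue rf[OF gw(1)] rf[OF w.weak_deriv_partials(1)]] by simp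
    next
      case 2 then show "is_weak_deriv \<Omega> i j (\<lambda>z. g 1 1 z - w z) (\<lambda>z. if i = 1 then g 2 1 z - wx z else if j = 1 then g 1 2 z - wy z else g 1 1 z - w z)"
        using is_weak_deriv_diff[OF \<Omega>_lebesgue gw(1) w.weak_deriv_partials(1)] by simp
    next
      case 3 then show "is_weak_deriv \<Omega> i j (\<lambda>z. g 1 1 z - w z) (\<lambda>z. if i = 1 then g 2 1 z - wx z else if j = 1 then g 1 2 z - wy z else g 1 1 z - w z)"
        using is_weak_deriv_diff[OF \<Omega>_lebesgue gw(2) w.weak_deriv_partials(2)] by simp
    qed
  qed
  have E': "is_weak_deriv \<Omega> i j (\<lambda>z. v z - w z) (e i j)" if "i + j \<le> 1" for i j
    by (rule is_weak_deriv_AE_cong[OF E[OF that] _ _ \<Omega>_lebesgue]) (use v in \<open>auto elim: eventually_mono\<close>)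
  have iQ: "set_integrable lborel Q (e i j)" for i j
    unfolding e_def by (cases "i = 1"; cases "j = 1")
      (simp_all add: set_integral_diff(1) g_set_int Q_borel w.closed_box_integrable)
  have I: "integrable (lebesgue_on \<Omega>) (e i j)" "(LINT z|lebesgue_on \<Omega>. \<bar>e i j z\<bar>) = (LINT z:Q|lborel. \<bar>e i j z\<bar>)" for i j
    using integrable_lebesgue_on_borel(1)[OF \<Omega>_borel open_box_integral(1)[OF iQ]]
      integrable_lebesgue_on_borel(2)[OF \<Omega>_borel open_box_integral(1)[OF set_integrable_abs[OF iQ]]]
      open_box_integral(2)[OF set_integrable_abs[OF iQ]] by auto
  show "sobolev_seminorm 0 1 \<Omega> (\<lambda>z. v z - w z) = ennreal (LINT z:Q|lborel. \<bar>g 1 1 z - w z\<bar>)"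
    using sobolev_seminorm_1[OF open_\<Omega> E' I(1), of 0] by (simp add: I(2)) (simp add: e_def)
  show "sobolev_seminorm 1 1 \<Omega> (\<lambda>z. v z - w z) = ennreal ((LINT z:Q|lborel. \<bar>g 1 2 z - wy z\<bar>) + (LINT z:Q|lborel. \<bar>g 2 1 z - wx z\<bar>))"
    using sobolev_seminorm_1[OF open_\<Omega> E' I(1), of 1] by (simp add: I(2)) (simp add: e_def)
qed

lemma interior_Q: "interior Q = \<Omega>" by (simp add: interior_Times)

text \<open>A trace comes with an approximating sequence of its own. The trace inequality applied to
  the difference of that sequence and \<open>D n 1 1\<close> shows that both have the same limit on
  the segment, whichever trace was chosen.\<close>

lemma trace_limit:
  assumes v: "AE z in lebesgue_on \<Omega>. v z = g 1 1 z" and \<gamma>: "bounded_trace a1 b1 a2 b2 \<gamma> c d L"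
    and t: "is_trace Q v \<gamma> {c..d} t"
  shows "(\<lambda>n. LINT r|lebesgue_on {c..d}. \<bar>D n 1 1 (\<gamma> r) - t r\<bar>) \<longlonglongrightarrow> 0"
proof -
  obtain w where ti: "integrable (lebesgue_on {c..d}) t" and w: "\<And>n. cont_diff 1 Q (w n)"
    and l: "\<And>l. l \<le> 1 \<Longrightarrow> (\<lambda>n. sobolev_seminorm l 1 \<Omega> (\<lambda>z. v z - w n z)) \<longlonglongrightarrow> 0"
    and lt: "(\<lambda>n. lp_norm (lebesgue_on {c..d}) 1 (\<lambda>r. w n (\<gamma> r) - t r)) \<longlonglongrightarrow> 0"
    using t unfolding is_trace_def interior_Q by blast
  define wx wy where "wx n = dx Q (w n)" and "wy n = dy Q (w n)" for n
  have C: "C1_box a1 b1 a2 b2 (w n) (wx n) (wy n)" for n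
    unfolding wx_def wy_def by (rule C1_box_cont_diff[OF a1b1 a2b2 w])
  have wi: "set_integrable lborel Q (w n)" "set_integrable lborel Q (wx n)" "set_integrable lborel Q (wy n)" for n
    using C1_box.closed_box_integrable[OF C[of n]] by auto
  have nn: "(LINT z:Q|lborel. \<bar>f z\<bar>) \<ge> 0" for f :: "real \<times> real \<Rightarrow> real" by (simp add: set_lebesgue_integral_def integral_nonneg_AE)
  have s0: "(\<lambda>n. LINT z:Q|lborel. \<bar>g 1 1 z - w n z\<bar>) \<longlonglongrightarrow> 0"
    using l[of 0] unfolding seminorm_diff_C1(1)[OF v C] by (intro tendsto_ennrealD[where x=0]) (simp_all add: nn)
  have s1: "(\<lambda>n. (LINT z:Q|lborel. \<bar>g 1 2 z - wy n z\<bar>) + (LINT z:Q|lborel. \<bar>g 2 1 z - wx n z\<bar>)) \<longlonglongrightarrow> 0"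
    using l[of 1] unfolding seminorm_diff_C1(2)[OF v C] by (intro tendsto_ennrealD[where x=0]) (simp_all add: nn)
  have ci: "continuous_on {c..d} (\<lambda>r. w n (\<gamma> r))" "continuous_on {c..d} (\<lambda>r. D n 1 1 (\<gamma> r))" for n
    using \<gamma> C[of n] D_C1_box[of n 1 1] unfolding bounded_trace_def by blast+
  have ii: "integrable (lebesgue_on {c..d}) (\<lambda>r. w n (\<gamma> r))" "integrable (lebesgue_on {c..d}) (\<lambda>r. D n 1 1 (\<gamma> r))" for n
    using ci by (auto intro: continuous_imp_integrable_real)
  have s2: "(\<lambda>n. LINT r|lebesgue_on {c..d}. \<bar>w n (\<gamma> r) - t r\<bar>) \<longlonglongrightarrow> 0"
    using lt ii(1) ti by (intro tendsto_ennrealD[where x=0]) (simp_all add: lp_norm_1)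
  \<comment> \<open>The norms of D n - w n in the trace inequality, each split at \<open>g\<close>,
    plus the distance of \<open>w n\<close> to the trace.\<close>
  let ?B = "\<lambda>n. ((LINT z:Q|lborel. \<bar>D n 1 1 z - g 1 1 z\<bar>) + (LINT z:Q|lborel. \<bar>g 1 1 z - w n z\<bar>)) / L
    + ((LINT z:Q|lborel. \<bar>D n 2 1 z - g 2 1 z\<bar>) + (LINT z:Q|lborel. \<bar>D n 1 2 z - g 1 2 z\<bar>)
      + ((LINT z:Q|lborel. \<bar>g 1 2 z - wy n z\<bar>) + (LINT z:Q|lborel. \<bar>g 2 1 z - wx n z\<bar>))) + (LINT r|lebesgue_on {c..d}. \<bar>w n (\<gamma> r) - t r\<bar>)"
  have lim: "?B \<longlonglongrightarrow> (0 + 0) / L + (0 + 0 + 0) + 0"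
    by (intro tendsto_add tendsto_divide tendsto_const D_lim s0 s1 s2) (use \<gamma> in \<open>auto simp: bounded_trace_def\<close>)
  then have lim: "?B \<longlonglongrightarrow> 0" by simp
  show ?thesis
  proof (rule tendsto_sandwich[OF _ _ tendsto_const lim])
    show "\<forall>\<^sub>F n in sequentially. 0 \<le> (LINT r|lebesgue_on {c..d}. \<bar>D n 1 1 (\<gamma> r) - t r\<bar>)" by simp
    have "(LINT r|lebesgue_on {c..d}. \<bar>D n 1 1 (\<gamma> r) - t r\<bar>) \<le> ?B n" for n
    proof -
      have "(LINT r|lebesgue_on {c..d}. \<bar>D n 1 1 (\<gamma> r) - t r\<bar>)
        \<le> (LINT r|lebesgue_on {c..d}. \<bar>D n 1 1 (\<gamma> r) - w n (\<gamma> r)\<bar> + \<bar>w n (\<gamma> r) - t r\<bar>)"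
        using ii[of n] ti by (intro integral_mono) auto
      also have "\<dots> = (LINT r|lebesgue_on {c..d}. \<bar>D n 1 1 (\<gamma> r) - w n (\<gamma> r)\<bar>) + (LINT r|lebesgue_on {c..d}. \<bar>w n (\<gamma> r) - t r\<bar>)"
        using ii[of n] ti by (intro Bochner_Integration.integral_add) auto
      also have "(LINT r|lebesgue_on {c..d}. \<bar>D n 1 1 (\<gamma> r) - w n (\<gamma> r)\<bar>)
        \<le> (LINT z:Q|lborel. \<bar>D n 1 1 z - w n z\<bar>) / L + (LINT z:Q|lborel. \<bar>D n (Suc 1) 1 z - wx n z\<bar>) + (LINT z:Q|lborel. \<bar>D n 1 (Suc 1) z - wy n z\<bar>)"
        using \<gamma> C1_box_diff[OF D_C1_box[of n 1 1] C[of n]] unfolding bounded_trace_def by blast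
      also have "\<dots> \<le> ((LINT z:Q|lborel. \<bar>D n 1 1 z - g 1 1 z\<bar>) + (LINT z:Q|lborel. \<bar>g 1 1 z - w n z\<bar>)) / L
        + ((LINT z:Q|lborel. \<bar>D n 2 1 z - g 2 1 z\<bar>) + (LINT z:Q|lborel. \<bar>g 2 1 z - wx n z\<bar>))
        + ((LINT z:Q|lborel. \<bar>D n 1 2 z - g 1 2 z\<bar>) + (LINT z:Q|lborel. \<bar>g 1 2 z - wy n z\<bar>))"
        unfolding Suc_1 using \<gamma> by (intro add_mono divide_right_mono L1_triangle D_set_int g_set_int Q_borel wi) (auto simp: bounded_trace_def)
      finally show ?thesis by simp
    qed
    then show "\<forall>\<^sub>F n in sequentially. (LINT r|lebesgue_on {c..d}. \<bar>D n 1 1 (\<gamma> r) - t r\<bar>) \<le> ?B n" by simp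
  qed
qed

text \<open>The mixed derivatives of the smooth sequence are themselves an admissible sequence in
  the definition of a trace.\<close>

lemma is_traceI:
  assumes v: "AE z in lebesgue_on \<Omega>. v z = g 1 1 z" and \<gamma>: "bounded_trace a1 b1 a2 b2 \<gamma> c d L"
    and ti: "integrable (lebesgue_on {c..d}) t"
    and t: "(\<lambda>n. LINT r|lebesgue_on {c..d}. \<bar>D n 1 1 (\<gamma> r) - t r\<bar>) \<longlonglongrightarrow> 0"
  shows "is_trace Q v \<gamma> {c..d} t"
  unfolding is_trace_def interior_Q
proof (intro conjI exI[of _ "\<lambda>n. D n 1 1"] allI impI ti)
  show "cont_diff 1 Q (D n 1 1)" for n by (rule smooth2_cont_diff[OF D_smooth a1b1 a2b2])
  have "continuous_on {c..d} (\<lambda>r. D n 1 1 (\<gamma> r))" for n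
    using \<gamma> D_C1_box[of n 1 1] unfolding bounded_trace_def by blast
  from continuous_imp_integrable_real[OF this]
  have "lp_norm (lebesgue_on {c..d}) 1 (\<lambda>r. D n 1 1 (\<gamma> r) - t r) = ennreal (LINT r|lebesgue_on {c..d}. \<bar>D n 1 1 (\<gamma> r) - t r\<bar>)" for n
    using ti by (intro lp_norm_1 Bochner_Integration.integrable_diff)
  then show "(\<lambda>n. lp_norm (lebesgue_on {c..d}) 1 (\<lambda>r. D n 1 1 (\<gamma> r) - t r)) \<longlonglongrightarrow> 0"
    using tendsto_ennrealI[OF t] by simp
  fix l :: nat assume "l \<le> 1"
  then consider "l = 0" | "l = 1" by linarith
  then show "(\<lambda>n. sobolev_seminorm l 1 \<Omega> (\<lambda>z. v z - D n 1 1 z)) \<longlonglongrightarrow> 0"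
  proof cases
    case 1
    show ?thesis unfolding 1 seminorm_diff_C1(1)[OF v D_C1_box]
      using tendsto_ennrealI[OF D_lim[of 1 1]] by (simp add: abs_minus_commute)
  next
    case 2
    show ?thesis unfolding 2 seminorm_diff_C1(2)[OF v D_C1_box]
      using tendsto_ennrealI[OF tendsto_add[OF D_lim[of 1 2] D_lim[of 2 1]]] by (simp add: abs_minus_commute numeral_2_eq_2)
  qed
qed

end

text \<open>Integrating out one variable is a contraction of L_1.\<close>

lemma slice_L1:
  fixes F G :: "real \<times> real \<Rightarrow> real"
  assumes F: "integrable lborel F" and G: "integrable lborel G"
  shows "(LINT r|lborel. \<bar>(LINT t|lborel. F (r, t)) - (LINT t|lborel. G (r, t))\<bar>) \<le> (LINT z|lborel. \<bar>F z - G z\<bar>)"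
    "(LINT r|lborel. \<bar>(LINT t|lborel. F (t, r)) - (LINT t|lborel. G (t, r))\<bar>) \<le> (LINT z|lborel. \<bar>F z - G z\<bar>)"
proof -
  have H: "integrable lborel (\<lambda>z. \<bar>F z - G z\<bar>)" using F G by simp
  have le: "\<bar>(LINT t|lborel. f t) - (LINT t|lborel. f' t)\<bar> \<le> (LINT t|lborel. \<bar>f t - f' t\<bar>)"
    if "integrable lborel f" "integrable lborel f'" for f f' :: "real \<Rightarrow> real"
    using integral_norm_bound[of lborel "\<lambda>t. f t - f' t"] that by simp
  show "(LINT r|lborel. \<bar>(LINT t|lborel. F (r, t)) - (LINT t|lborel. G (r, t))\<bar>) \<le> (LINT z|lborel. \<bar>F z - G z\<bar>)"
    unfolding lborel_fubini(4)[OF H]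
  proof (rule integral_mono_AE)
    show "AE r in lborel. \<bar>(LINT t|lborel. F (r, t)) - (LINT t|lborel. G (r, t))\<bar> \<le> (LINT t|lborel. \<bar>F (r, t) - G (r, t)\<bar>)"
      using lborel_fubini(5)[OF F] lborel_fubini(5)[OF G] by eventually_elim (rule le)
  qed (use lborel_fubini(6)[OF F] lborel_fubini(6)[OF G] lborel_fubini(6)[OF H] in auto)
  show "(LINT r|lborel. \<bar>(LINT t|lborel. F (t, r)) - (LINT t|lborel. G (t, r))\<bar>) \<le> (LINT z|lborel. \<bar>F z - G z\<bar>)"
    unfolding lborel_fubini(1)[OF H]
  proof (rule integral_mono_AE)
    show "AE r in lborel. \<bar>(LINT t|lborel. F (t, r)) - (LINT t|lborel. G (t, r))\<bar> \<le> (LINT t|lborel. \<bar>F (t, r) - G (t, r)\<bar>)"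
      using lborel_fubini(2)[OF F] lborel_fubini(2)[OF G] by eventually_elim (rule le)
  qed (use lborel_fubini(3)[OF F] lborel_fubini(3)[OF G] lborel_fubini(3)[OF H] in auto)
qed

context smooth_limit begin

text \<open>Integrating this function across a segment gives the trace of \<open>f\<close> if \<open>k\<close> is the evaluation kernel and
  \<open>f'\<close> the transversal derivative.\<close>

definition "weighted L k f f' z = indicator Q z * (f z / L + k z * f' z)" for L :: real and k f f' :: "real \<times> real \<Rightarrow> real"

lemma weighted_integrable:
  assumes f: "set_integrable lborel Q f" "set_integrable lborel Q f'" and k: "k \<in> borel_measurable borel" "\<And>z. z \<in> Q \<Longrightarrow> \<bar>k z\<bar> \<le> 1"
  shows "integrable lborel (weighted L k f f')"
proof -
  have "integrable lborel (\<lambda>z. k z * (indicator Q z * f' z))"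
  proof (rule Bochner_Integration.integrable_bound[of lborel "\<lambda>z. indicator Q z * f' z"])
    show "integrable lborel (\<lambda>z. indicator Q z * f' z)" using f(2) by (simp add: set_integrable_def)
    then show "(\<lambda>z. k z * (indicator Q z * f' z)) \<in> borel_measurable lborel" using k(1) by simp
    show "AE z in lborel. norm (k z * (indicator Q z * f' z)) \<le> norm (indicator Q z * f' z)"
      using k(2) by (intro AE_I2) (auto simp: indicator_def abs_mult intro: mult_left_le_one_le)
  qed
  moreover have "integrable lborel (\<lambda>z. (indicator Q z * f z) / L)" using f(1) by (simp add: set_integrable_def)
  ultimately have "integrable lborel (\<lambda>z. (indicator Q z * f z) / L + k z * (indicator Q z * f' z))" by (rule Bochner_Integration.integrable_add[rotated])
  then show ?thesis unfolding weighted_def[abs_def] by (simp add: algebra_simps)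
qed

lemma weighted_diff_le:
  assumes f: "set_integrable lborel Q f" "set_integrable lborel Q f'" "set_integrable lborel Q p" "set_integrable lborel Q p'"
    and k: "k \<in> borel_measurable borel" "\<And>z. z \<in> Q \<Longrightarrow> \<bar>k z\<bar> \<le> 1" and L: "L > 0"
  shows "(LINT z|lborel. \<bar>weighted L k f f' z - weighted L k p p' z\<bar>) \<le> (LINT z:Q|lborel. \<bar>f z - p z\<bar>) / L + (LINT z:Q|lborel. \<bar>f' z - p' z\<bar>)"
proof -
  have i: "integrable lborel (\<lambda>z. indicator Q z * \<bar>f z - p z\<bar>)" "integrable lborel (\<lambda>z. indicator Q z * \<bar>f' z - p' z\<bar>)"
    using set_integrable_abs[OF set_integral_diff(1)[OF f(1,3)]] set_integrable_abs[OF set_integral_diff(1)[OF f(2,4)]]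
    by (simp_all add: set_integrable_def)
  have "(LINT z|lborel. \<bar>weighted L k f f' z - weighted L k p p' z\<bar>)
    \<le> (LINT z|lborel. (indicator Q z * \<bar>f z - p z\<bar>) / L + indicator Q z * \<bar>f' z - p' z\<bar>)"
  proof (rule integral_mono)
    show "\<bar>weighted L k f f' z - weighted L k p p' z\<bar> \<le> (indicator Q z * \<bar>f z - p z\<bar>) / L + indicator Q z * \<bar>f' z - p' z\<bar>" for z
    proof (cases "z \<in> Q")
      case True
      have "\<bar>(f z / L + k z * f' z) - (p z / L + k z * p' z)\<bar> = \<bar>(f z - p z) / L + k z * (f' z - p' z)\<bar>"
        by (simp add: algebra_simps diff_divide_distrib)
      also have "\<dots> \<le> \<bar>f z - p z\<bar> / L + \<bar>k z\<bar> * \<bar>f' z - p' z\<bar>"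
        using L by (intro order_trans[OF abs_triangle_ineq]) (simp add: abs_mult)
      also have "\<dots> \<le> \<bar>f z - p z\<bar> / L + \<bar>f' z - p' z\<bar>" using k(2)[OF True] by (simp add: mult_left_le_one_le)
      finally show ?thesis using True by (simp add: weighted_def)
    qed (simp add: weighted_def)
  qed (use i weighted_integrable[OF f(1,2) k] weighted_integrable[OF f(3,4) k] in auto)
  also have "\<dots> = (LINT z:Q|lborel. \<bar>f z - p z\<bar>) / L + (LINT z:Q|lborel. \<bar>f' z - p' z\<bar>)"
    using i by (simp add: set_lebesgue_integral_def)
  finally show ?thesis .
qed

text \<open>The common part of both directions: \<tau> is the candidate for the trace, and
  \<open>\<tau>n\<close> are the functions obtained in the same way from the smooth sequence, for
  which the representation formula gives the actual restriction.\<close>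

lemma trace_converges:
  fixes \<tau> :: "real \<Rightarrow> real" and \<tau>n :: "nat \<Rightarrow> real \<Rightarrow> real"
  assumes \<gamma>: "bounded_trace a1 b1 a2 b2 \<gamma> c d L" and \<tau>: "integrable lborel \<tau>" "\<And>n. integrable lborel (\<tau>n n)"
    and le: "\<And>n. (LINT r|lborel. \<bar>\<tau>n n r - \<tau> r\<bar>) \<le> B n" and B: "B \<longlonglongrightarrow> 0"
    and eq: "\<And>n. AE r in lborel. r \<in> {c..d} \<longrightarrow> \<tau>n n r = D n 1 1 (\<gamma> r)"
  shows "integrable (lebesgue_on {c..d}) \<tau>" "(\<lambda>n. LINT r|lebesgue_on {c..d}. \<bar>D n 1 1 (\<gamma> r) - \<tau> r\<bar>) \<longlonglongrightarrow> 0"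
proof -
  have s\<tau>: "set_integrable lborel {c..d} \<tau>"
    unfolding set_integrable_def using \<tau>(1) by (intro integrable_mult_indicator) auto
  show "integrable (lebesgue_on {c..d}) \<tau>" by (rule integrable_lebesgue_on_borel(1)[OF _ s\<tau>]) simp
  have sD: "set_integrable lborel {c..d} (\<lambda>r. D n 1 1 (\<gamma> r))" for n
    using \<gamma> D_C1_box[of n 1 1] unfolding bounded_trace_def set_integrable_def
    by (intro borel_integrable_compact) auto
  have s: "set_integrable lborel {c..d} (\<lambda>r. \<bar>D n 1 1 (\<gamma> r) - \<tau> r\<bar>)" for n by (intro set_integrable_abs set_integral_diff(1) sD s\<tau>)
  have "(LINT r|lebesgue_on {c..d}. \<bar>D n 1 1 (\<gamma> r) - \<tau> r\<bar>) \<le> B n" for n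
  proof -
    have "(LINT r|lebesgue_on {c..d}. \<bar>D n 1 1 (\<gamma> r) - \<tau> r\<bar>) = (LINT r|lborel. indicator {c..d} r *\<^sub>R \<bar>D n 1 1 (\<gamma> r) - \<tau> r\<bar>)"
      using integrable_lebesgue_on_borel(2)[OF _ s] by (simp add: set_lebesgue_integral_def)
    also have "\<dots> \<le> (LINT r|lborel. \<bar>\<tau>n n r - \<tau> r\<bar>)"
    proof (rule integral_mono_AE)
      show "AE r in lborel. indicator {c..d} r *\<^sub>R \<bar>D n 1 1 (\<gamma> r) - \<tau> r\<bar> \<le> \<bar>\<tau>n n r - \<tau> r\<bar>"
        using eq[of n] by eventually_elim (auto simp: indicator_def)
    qed (use s[of n] \<tau> in \<open>auto simp: set_integrable_def\<close>)
    also have "\<dots> \<le> B n" by (rule le)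
    finally show ?thesis .
  qed
  then show "(\<lambda>n. LINT r|lebesgue_on {c..d}. \<bar>D n 1 1 (\<gamma> r) - \<tau> r\<bar>) \<longlonglongrightarrow> 0"
    by (intro tendsto_sandwich[OF _ _ tendsto_const B]) auto
qed

lemma point_evaluation_lborel:
  fixes f f' F :: "real \<Rightarrow> real"
  assumes ab: "a < b" "s \<in> {a..b}" and f: "\<And>t. t \<in> {a..b} \<Longrightarrow> (f has_real_derivative f' t) (at t within {a..b})"
    and F: "integrable lborel F" "\<And>t. F t = indicator {a..b} t * (f t / (b - a) + eval_kernel a b s t * f' t)"
  shows "(LINT t|lborel. F t) = f s"
proof -
  have F': "F = (\<lambda>t. indicator {a..b} t *\<^sub>R (f t / (b - a) + eval_kernel a b s t * f' t))" using F(2) by auto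
  have "(LINT t:{a..b}|lborel. f t / (b - a) + eval_kernel a b s t * f' t) = integral {a..b} (\<lambda>t. f t / (b - a) + eval_kernel a b s t * f' t)"
    by (rule set_borel_integral_eq_integral(2)) (use F(1) in \<open>simp add: set_integrable_def F'\<close>)
  also have "\<dots> = f s" by (rule integral_unique[OF point_evaluation[OF ab f]])
  finally show ?thesis by (simp add: F' set_lebesgue_integral_def)
qed

text \<open>The trace is written down explicitly: the representation formula across the segment is
  applied to \<open>g 1 1\<close> and its transversal derivative \<open>g 1 2\<close>. For smooth
  functions this is evaluation, and the formula is continuous in L_1, so no abstract completion is
  needed.\<close>

lemma is_trace_horizontal:
  assumes v: "AE z in lebesgue_on \<Omega>. v z = g 1 1 z" and y: "y \<in> {a2..b2}" and cd: "a1 \<le> c" "d \<le> b1"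
  shows "\<exists>t. is_trace Q v (\<lambda>r. (r, y)) {c..d} t"
proof -
  define k where "k z = eval_kernel a2 b2 y (snd z)" for z :: "real \<times> real"
  have [measurable]: "(snd :: real \<times> real \<Rightarrow> real) \<in> borel_measurable borel" by (intro borel_measurable_continuous_onI continuous_intros)
  have k: "k \<in> borel_measurable borel" "\<And>z. z \<in> Q \<Longrightarrow> \<bar>k z\<bar> \<le> 1"
    unfolding k_def[abs_def] using eval_kernel_bound[OF a2b2 y] by (measurable, auto)
  let ?F = "weighted (b2 - a2) k (g 1 1) (g 1 2)" and ?Fn = "\<lambda>n. weighted (b2 - a2) k (D n 1 1) (D n 1 2)"
  have gi: "set_integrable lborel Q (g 1 1)" "set_integrable lborel Q (g 1 2)" by (auto intro!: g_set_int Q_borel)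
  have i: "integrable lborel ?F" "integrable lborel (?Fn n)" for n by (intro weighted_integrable gi D_set_int k; assumption)+
  have \<gamma>: "bounded_trace a1 b1 a2 b2 (\<lambda>r. (r, y)) c d (b2 - a2)" by (rule bounded_trace_horizontal[OF a1b1 a2b2 y cd])
  have le: "(LINT r|lborel. \<bar>(LINT t|lborel. ?Fn n (r, t)) - (LINT t|lborel. ?F (r, t))\<bar>)
     \<le> (LINT z:Q|lborel. \<bar>D n 1 1 z - g 1 1 z\<bar>) / (b2 - a2) + (LINT z:Q|lborel. \<bar>D n 1 2 z - g 1 2 z\<bar>)" for n
    by (rule order_trans[OF slice_L1(1)[OF i(2,1)] weighted_diff_le[OF D_set_int D_set_int gi k]]) (use a2b2 in auto)
  have B: "(\<lambda>n. (LINT z:Q|lborel. \<bar>D n 1 1 z - g 1 1 z\<bar>) / (b2 - a2) + (LINT z:Q|lborel. \<bar>D n 1 2 z - g 1 2 z\<bar>)) \<longlonglongrightarrow> 0"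
    using tendsto_add[OF tendsto_divide[OF D_lim[of 1 1] tendsto_const[of "b2 - a2"]] D_lim[of 1 2]] a2b2 by simp
  have eq: "AE r in lborel. r \<in> {c..d} \<longrightarrow> (LINT t|lborel. ?Fn n (r, t)) = D n 1 1 (r, y)" for n
    using lborel_fubini(5)[OF i(2)[of n]]
  proof eventually_elim
    case (elim r)
    show ?case
    proof
      assume r: "r \<in> {c..d}"
      show "(LINT t|lborel. ?Fn n (r, t)) = D n 1 1 (r, y)"
      proof (rule point_evaluation_lborel[OF a2b2 y _ elim])
        show "((\<lambda>t. D n 1 1 (r, t)) has_real_derivative D n 1 2 (r, t)) (at t within {a2..b2})" for t
          using smooth2_partials(2)[OF D_smooth, of n 1 1 r t] by (simp add: numeral_2_eq_2)
        show "?Fn n (r, t) = indicator {a2..b2} t * (D n 1 1 (r, t) / (b2 - a2) + eval_kernel a2 b2 y t * D n 1 2 (r, t))" for t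
          using r cd by (auto simp: weighted_def k_def indicator_def)
      qed
    qed
  qed
  note T = trace_converges[OF \<gamma> lborel_fubini(6)[OF i(1)] lborel_fubini(6)[OF i(2)] le B eq]
  show ?thesis using is_traceI[OF v \<gamma> T] by - (rule exI)
qed

lemma is_trace_vertical:
  assumes v: "AE z in lebesgue_on \<Omega>. v z = g 1 1 z" and x: "x \<in> {a1..b1}" and cd: "a2 \<le> c" "d \<le> b2"
  shows "\<exists>t. is_trace Q v (\<lambda>r. (x, r)) {c..d} t"
proof -
  define k where "k z = eval_kernel a1 b1 x (fst z)" for z :: "real \<times> real"
  have [measurable]: "(fst :: real \<times> real \<Rightarrow> real) \<in> borel_measurable borel" by (intro borel_measurable_continuous_onI continuous_intros)
  have k: "k \<in> borel_measurable borel" "\<And>z. z \<in> Q \<Longrightarrow> \<bar>k z\<bar> \<le> 1"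
    unfolding k_def[abs_def] using eval_kernel_bound[OF a1b1 x] by (measurable, auto)
  let ?F = "weighted (b1 - a1) k (g 1 1) (g 2 1)" and ?Fn = "\<lambda>n. weighted (b1 - a1) k (D n 1 1) (D n 2 1)"
  have gi: "set_integrable lborel Q (g 1 1)" "set_integrable lborel Q (g 2 1)" by (auto intro!: g_set_int Q_borel)
  have i: "integrable lborel ?F" "integrable lborel (?Fn n)" for n by (intro weighted_integrable gi D_set_int k; assumption)+
  have \<gamma>: "bounded_trace a1 b1 a2 b2 (\<lambda>r. (x, r)) c d (b1 - a1)" by (rule bounded_trace_vertical[OF a1b1 a2b2 x cd])
  have le: "(LINT r|lborel. \<bar>(LINT t|lborel. ?Fn n (t, r)) - (LINT t|lborel. ?F (t, r))\<bar>)
     \<le> (LINT z:Q|lborel. \<bar>D n 1 1 z - g 1 1 z\<bar>) / (b1 - a1) + (LINT z:Q|lborel. \<bar>D n 2 1 z - g 2 1 z\<bar>)" for n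
    by (rule order_trans[OF slice_L1(2)[OF i(2,1)] weighted_diff_le[OF D_set_int D_set_int gi k]]) (use a1b1 in auto)
  have B: "(\<lambda>n. (LINT z:Q|lborel. \<bar>D n 1 1 z - g 1 1 z\<bar>) / (b1 - a1) + (LINT z:Q|lborel. \<bar>D n 2 1 z - g 2 1 z\<bar>)) \<longlonglongrightarrow> 0"
    using tendsto_add[OF tendsto_divide[OF D_lim[of 1 1] tendsto_const[of "b1 - a1"]] D_lim[of 2 1]] a1b1 by simp
  have eq: "AE r in lborel. r \<in> {c..d} \<longrightarrow> (LINT t|lborel. ?Fn n (t, r)) = D n 1 1 (x, r)" for n
    using lborel_fubini(2)[OF i(2)[of n]]
  proof eventually_elim
    case (elim r)
    show ?case
    proof
      assume r: "r \<in> {c..d}"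
      show "(LINT t|lborel. ?Fn n (t, r)) = D n 1 1 (x, r)"
      proof (rule point_evaluation_lborel[OF a1b1 x _ elim])
        show "((\<lambda>t. D n 1 1 (t, r)) has_real_derivative D n 2 1 (t, r)) (at t within {a1..b1})" for t
          using smooth2_partials(1)[OF D_smooth, of n 1 1 r t] by (simp add: numeral_2_eq_2)
        show "?Fn n (t, r) = indicator {a1..b1} t * (D n 1 1 (t, r) / (b1 - a1) + eval_kernel a1 b1 x t * D n 2 1 (t, r))" for t
          using r cd by (auto simp: weighted_def k_def indicator_def)
      qed
    qed
  qed
  note T = trace_converges[OF \<gamma> lborel_fubini(3)[OF i(1)] lborel_fubini(3)[OF i(2)] le B eq]
  show ?thesis using is_traceI[OF v \<gamma> T] by - (rule exI)
qed

text \<open>The weight is bounded, so L_1 convergence to the chosen trace, which holds for every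
  possible choice, carries over to the averages.\<close>

lemma average_limit:
  assumes v: "AE z in lebesgue_on \<Omega>. v z = g 1 1 z" and \<gamma>: "bounded_trace a1 b1 a2 b2 \<gamma> c d L" and ex: "\<exists>t. is_trace Q v \<gamma> {c..d} t"
    and q: "continuous_on {c..d} q" "\<And>r. r \<in> {c..d} \<Longrightarrow> \<bar>q r\<bar> \<le> B"
  shows "(\<lambda>n. LINT r|lebesgue_on {c..d}. D n 1 1 (\<gamma> r) * q r) \<longlonglongrightarrow> (LINT r|lebesgue_on {c..d}. edge_trace Q v \<gamma> {c..d} r * q r)"
proof -
  define t where "t = edge_trace Q v \<gamma> {c..d}"
  have t: "is_trace Q v \<gamma> {c..d} t" unfolding t_def edge_trace_def using someI_ex[OF ex] .
  then have ti: "integrable (lebesgue_on {c..d}) t" by (simp add: is_trace_def)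
  have [measurable]: "q \<in> borel_measurable (lebesgue_on {c..d})" by (rule borel_measurable_integrable[OF continuous_imp_integrable_real[OF q(1)]])
  have iq: "integrable (lebesgue_on {c..d}) (\<lambda>r. f r * q r)" if f: "integrable (lebesgue_on {c..d}) f" for f
  proof (rule Bochner_Integration.integrable_bound[of _ "\<lambda>r. B * f r"])
    show "AE r in lebesgue_on {c..d}. norm (f r * q r) \<le> norm (B * f r)"
    proof (intro AE_I2)
      fix r assume "r \<in> space (lebesgue_on {c..d})"
      then have "\<bar>q r\<bar> \<le> \<bar>B\<bar>" using q(2)[of r] by auto
      then show "norm (f r * q r) \<le> norm (B * f r)" by (simp add: abs_mult mult.commute[of "\<bar>B\<bar>"] mult_left_mono)
    qed
  qed (use f in auto)
  have iD: "integrable (lebesgue_on {c..d}) (\<lambda>r. D n 1 1 (\<gamma> r))" for n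
    using \<gamma> D_C1_box[of n 1 1] unfolding bounded_trace_def by (intro continuous_imp_integrable_real) blast
  have "(\<lambda>n. (LINT r|lebesgue_on {c..d}. D n 1 1 (\<gamma> r) * q r) - (LINT r|lebesgue_on {c..d}. t r * q r)) \<longlonglongrightarrow> 0"
  proof (rule Lim_null_comparison[OF _ tendsto_mult_right_zero[OF trace_limit[OF v \<gamma> t], of "\<bar>B\<bar>"]], intro always_eventually allI)
    fix n
    have "norm (LINT r|lebesgue_on {c..d}. D n 1 1 (\<gamma> r) * q r - t r * q r) \<le> (LINT r|lebesgue_on {c..d}. \<bar>B\<bar> * \<bar>D n 1 1 (\<gamma> r) - t r\<bar>)"
    proof (rule order_trans[OF integral_norm_bound], rule integral_mono)
      fix r assume "r \<in> space (lebesgue_on {c..d})"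
      then have "\<bar>q r\<bar> \<le> \<bar>B\<bar>" using q(2)[of r] by auto
      then show "norm (D n 1 1 (\<gamma> r) * q r - t r * q r) \<le> \<bar>B\<bar> * \<bar>D n 1 1 (\<gamma> r) - t r\<bar>"
        by (simp flip: left_diff_distrib add: abs_mult mult.commute[of "\<bar>B\<bar>"] mult_left_mono)
    qed (use iq[OF iD] iq[OF ti] iD ti in auto)
    then show "norm ((LINT r|lebesgue_on {c..d}. D n 1 1 (\<gamma> r) * q r) - (LINT r|lebesgue_on {c..d}. t r * q r)) \<le> \<bar>B\<bar> * (LINT r|lebesgue_on {c..d}. \<bar>D n 1 1 (\<gamma> r) - t r\<bar>)"
      using iq[OF iD] iq[OF ti] by simp
  qed
  then show ?thesis unfolding t_def by (simp add: LIM_zero_iff)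
qed

end

text \<open>A weight of integral one reproduces the mean of the mixed derivative, so only the
  deviation from it has to be averaged. On the segment the trace inequality bounds the deviation by
  3 S, from the Poincare inequality, plus S from its derivatives; hence the factor 4.\<close>

lemma average_bound:
  assumes D: "smooth2 D" and h: "h > 0"
    and R: "h \<le> b1 - a1" "b1 - a1 \<le> 3 * h" "h \<le> b2 - a2" "b2 - a2 \<le> 3 * h"
    and \<gamma>: "bounded_trace a1 b1 a2 b2 \<gamma> c d L" and L: "h \<le> L"
    and q: "continuous_on {c..d} q" "\<And>r. r \<in> {c..d} \<Longrightarrow> \<bar>q r\<bar> \<le> B / h" "(LINT r|lebesgue_on {c..d}. q r) = 1" and B: "B \<ge> 0"
  shows "\<bar>(LINT r|lebesgue_on {c..d}. D 1 1 (\<gamma> r) * q r) - integral (cbox (a1, a2) (b1, b2)) (D 1 1) / ((b1 - a1) * (b2 - a2))\<bar>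
     \<le> 4 * B * integral (cbox (a1, a2) (b1, b2)) (third D) / h"
proof -
  let ?R = "cbox (a1, a2) (b1, b2)"
  let ?S = "integral ?R (third D)"
  have ab: "a1 < b1" "a2 < b2" using h R by auto
  obtain k11 where k: "k11 = integral ?R (D 1 1) / ((b1 - a1) * (b2 - a2))" "?S \<ge> 0" "integral ?R (\<lambda>z. \<bar>D 1 1 z - k11\<bar>) \<le> 3 * h * ?S"
    using quadratic_approximation[OF D h R] by metis
  have C: "C1_box a1 b1 a2 b2 (\<lambda>z. D 1 1 z - k11) (\<lambda>z. D 2 1 z - 0) (\<lambda>z. D 1 2 z - 0)"
    using C1_box_diff[OF smooth2_C1_box[OF D ab, of 1 1] C1_box_const[OF ab]] by (simp add: numeral_2_eq_2)
  have c: "continuous_on {c..d} (\<lambda>r. D 1 1 (\<gamma> r) - k11)"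
    and b: "(LINT r|lebesgue_on {c..d}. \<bar>D 1 1 (\<gamma> r) - k11\<bar>) \<le> (LINT z:{a1..b1} \<times> {a2..b2}|lborel. \<bar>D 1 1 z - k11\<bar>) / L
       + (LINT z:{a1..b1} \<times> {a2..b2}|lborel. \<bar>D 2 1 z\<bar>) + (LINT z:{a1..b1} \<times> {a2..b2}|lborel. \<bar>D 1 2 z\<bar>)"
    using \<gamma> C unfolding bounded_trace_def by auto
  have cD: "continuous_on ?R (D i j)" for i j by (rule smooth2_continuous[OF D])
  have ct: "continuous_on ?R (third D)" unfolding third_def[abs_def] by (intro continuous_intros cD)
  note E = integral_box_eq_lborel(2)[OF continuous_on_rabs[OF continuous_on_diff[OF cD continuous_on_const]], of 1 1 k11]
    integral_box_eq_lborel(2)[OF continuous_on_rabs[OF cD], of 2 1] integral_box_eq_lborel(2)[OF continuous_on_rabs[OF cD], of 1 2]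
  have "integral ?R (\<lambda>z. \<bar>D 2 1 z\<bar>) + integral ?R (\<lambda>z. \<bar>D 1 2 z\<bar>) = integral ?R (\<lambda>z. \<bar>D 2 1 z\<bar> + \<bar>D 1 2 z\<bar>)"
    by (intro integral_add[symmetric] integrable_continuous continuous_intros cD)
  also have "\<dots> \<le> ?S" by (intro integral_le integrable_continuous continuous_intros cD ct) (simp add: third_def)
  finally have S: "integral ?R (\<lambda>z. \<bar>D 2 1 z\<bar>) + integral ?R (\<lambda>z. \<bar>D 1 2 z\<bar>) \<le> ?S" .
  have L0: "L > 0" using L h by simp
  have "integral ?R (\<lambda>z. \<bar>D 1 1 z - k11\<bar>) / L \<le> 3 * h * ?S / L" using k(3) L0 by (simp add: divide_right_mono)
  also have "\<dots> \<le> 3 * ?S"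
  proof -
    have "h * ?S \<le> L * ?S" using L k(2) by (rule mult_right_mono)
    then show ?thesis using L0 by (simp add: pos_divide_le_eq mult.commute)
  qed
  finally have I: "(LINT r|lebesgue_on {c..d}. \<bar>D 1 1 (\<gamma> r) - k11\<bar>) \<le> 4 * ?S" using b S unfolding E[symmetric] by linarith
  have iq: "integrable (lebesgue_on {c..d}) q" and iDq: "integrable (lebesgue_on {c..d}) (\<lambda>r. (D 1 1 (\<gamma> r) - k11) * q r)"
    and iD: "integrable (lebesgue_on {c..d}) (\<lambda>r. \<bar>D 1 1 (\<gamma> r) - k11\<bar>)"
    by (intro continuous_imp_integrable_real continuous_intros q(1) c)+
  have iDq': "integrable (lebesgue_on {c..d}) (\<lambda>r. D 1 1 (\<gamma> r) * q r)"
    using Bochner_Integration.integrable_add[OF iDq integrable_mult_right[OF iq, of k11]] by (simp add: algebra_simps)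
  have "(LINT r|lebesgue_on {c..d}. D 1 1 (\<gamma> r) * q r) - k11 = (LINT r|lebesgue_on {c..d}. D 1 1 (\<gamma> r) * q r) - (LINT r|lebesgue_on {c..d}. k11 * q r)"
    using q(3) by simp
  also have "\<dots> = (LINT r|lebesgue_on {c..d}. D 1 1 (\<gamma> r) * q r - k11 * q r)"
    by (rule Bochner_Integration.integral_diff[OF iDq' integrable_mult_right[OF iq], symmetric])
  also have "\<dots> = (LINT r|lebesgue_on {c..d}. (D 1 1 (\<gamma> r) - k11) * q r)" by (simp add: algebra_simps)
  finally have "\<bar>(LINT r|lebesgue_on {c..d}. D 1 1 (\<gamma> r) * q r) - k11\<bar> = norm (LINT r|lebesgue_on {c..d}. (D 1 1 (\<gamma> r) - k11) * q r)" by simp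
  also have "\<dots> \<le> (LINT r|lebesgue_on {c..d}. (B / h) * \<bar>D 1 1 (\<gamma> r) - k11\<bar>)"
  proof (rule order_trans[OF integral_norm_bound], rule integral_mono)
    fix r assume "r \<in> space (lebesgue_on {c..d})"
    then have "\<bar>q r\<bar> \<le> B / h" using q(2) by simp
    then show "norm ((D 1 1 (\<gamma> r) - k11) * q r) \<le> (B / h) * \<bar>D 1 1 (\<gamma> r) - k11\<bar>"
      unfolding real_norm_def abs_mult mult.commute[of "B / h"] by (rule mult_left_mono) simp
  qed (use iDq iD in auto)
  also have "\<dots> = (B / h) * (LINT r|lebesgue_on {c..d}. \<bar>D 1 1 (\<gamma> r) - k11\<bar>)" by simp
  also have "\<dots> \<le> (B / h) * (4 * ?S)" using I B h by (intro mult_left_mono) auto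
  finally show ?thesis by (simp add: k(1) ac_simps)
qed

section \<open>Passage to the limit\<close>

context smooth_limit begin

text \<open>The approximants are the averages of \<open>D n 1 1\<close> over the same edge with the
  same dual function. The number 8800 is 4 times the bound 2200 of the dual functions.\<close>

lemma edge_average_approx:
  assumes h: "h > 0" and R: "h \<le> b1 - a1" "b1 - a1 \<le> 3 * h" "h \<le> b2 - a2" "b2 - a2 \<le> 3 * h"
    and v: "AE z in lebesgue_on \<Omega>. weak_deriv \<Omega> 1 1 u z = g 1 1 z"
    and X: "x k \<in> {a1..b1}" "y l \<in> {a2..b2}"
    and e: "horizontal_edge_in x y a1 b1 h k l e \<or> vertical_edge_in x y a2 b2 h k l e"
  obtains \<alpha> where "\<alpha> \<longlonglongrightarrow> edge_average x y Q u (x k) (y l) e"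
    "\<And>n. \<bar>\<alpha> n - integral (cbox (a1, a2) (b1, b2)) (D n 1 1) / ((b1 - a1) * (b2 - a2))\<bar> \<le> 8800 * integral (cbox (a1, a2) (b1, b2)) (third (D n)) / h"
  using e
proof
  assume "horizontal_edge_in x y a1 b1 h k l e"
  then obtain k' where k': "e = Horizontal k' l" "x (Suc k') = x k' + h" "a1 \<le> x k'" "x k' + h \<le> b1" "x k \<in> {x k', x (Suc k')}"
    unfolding horizontal_edge_in_def by blast
  let ?c = "x k'" and ?d = "x (Suc k')"
  have cd: "a1 \<le> ?c" "?d \<le> b1" "?c < ?d" using k' h by auto
  define q where "q = dual ?c ?d (x k)"
  have q: "continuous_on {?c..?d} q" "\<And>r. r \<in> {?c..?d} \<Longrightarrow> \<bar>q r\<bar> \<le> 2200 / h" "(LINT r|lebesgue_on {?c..?d}. q r) = 1"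
    using dual_continuous[OF cd(3) k'(5)] dual_bound[OF cd(3) k'(5)]
      set_lebesgue_integral_eq_has_integral[OF dual_continuous[OF cd(3) k'(5)] dual_has_integral[OF cd(3) k'(5)]] k'(2)
    unfolding q_def by auto
  note \<gamma> = bounded_trace_horizontal[OF a1b1 a2b2 X(2) cd(1,2)]
  show thesis
  proof (rule that)
    show "(\<lambda>n. LINT r|lebesgue_on {?c..?d}. D n 1 1 (r, y l) * q r) \<longlonglongrightarrow> edge_average x y Q u (x k) (y l) e"
      using average_limit[OF v \<gamma> is_trace_horizontal[OF v X(2) cd(1,2)] q(1,2)] unfolding k'(1) edge_average.simps interior_Q q_def .
    show "\<bar>(LINT r|lebesgue_on {?c..?d}. D n 1 1 (r, y l) * q r) - integral (cbox (a1, a2) (b1, b2)) (D n 1 1) / ((b1 - a1) * (b2 - a2))\<bar>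
      \<le> 8800 * integral (cbox (a1, a2) (b1, b2)) (third (D n)) / h" for n
      using average_bound[OF D_smooth[of n] h R \<gamma> R(3) q] by simp
  qed
next
  assume "vertical_edge_in x y a2 b2 h k l e"
  then obtain l' where l': "e = Vertical k l'" "y (Suc l') = y l' + h" "a2 \<le> y l'" "y l' + h \<le> b2" "y l \<in> {y l', y (Suc l')}"
    unfolding vertical_edge_in_def by blast
  let ?c = "y l'" and ?d = "y (Suc l')"
  have cd: "a2 \<le> ?c" "?d \<le> b2" "?c < ?d" using l' h by auto
  define q where "q = dual ?c ?d (y l)"
  have q: "continuous_on {?c..?d} q" "\<And>r. r \<in> {?c..?d} \<Longrightarrow> \<bar>q r\<bar> \<le> 2200 / h" "(LINT r|lebesgue_on {?c..?d}. q r) = 1"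
    using dual_continuous[OF cd(3) l'(5)] dual_bound[OF cd(3) l'(5)]
      set_lebesgue_integral_eq_has_integral[OF dual_continuous[OF cd(3) l'(5)] dual_has_integral[OF cd(3) l'(5)]] l'(2)
    unfolding q_def by auto
  note \<gamma> = bounded_trace_vertical[OF a1b1 a2b2 X(1) cd(1,2)]
  show thesis
  proof (rule that)
    show "(\<lambda>n. LINT r|lebesgue_on {?c..?d}. D n 1 1 (x k, r) * q r) \<longlonglongrightarrow> edge_average x y Q u (x k) (y l) e"
      using average_limit[OF v \<gamma> is_trace_vertical[OF v X(1) cd(1,2)] q(1,2)] unfolding l'(1) edge_average.simps interior_Q q_def .
    show "\<bar>(LINT r|lebesgue_on {?c..?d}. D n 1 1 (x k, r) * q r) - integral (cbox (a1, a2) (b1, b2)) (D n 1 1) / ((b1 - a1) * (b2 - a2))\<bar>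
      \<le> 8800 * integral (cbox (a1, a2) (b1, b2)) (third (D n)) / h" for n
      using average_bound[OF D_smooth[of n] h R \<gamma> R(1) q] by simp
  qed
qed

lemma third_limit:
  assumes g0: "\<And>i j z. i + j \<le> 3 \<Longrightarrow> z \<notin> Q \<Longrightarrow> g i j z = 0"
  shows "integrable lborel (third g)" "integrable lborel (\<lambda>z. indicator Q z * third (D n) z)"
    "(\<lambda>n. LINT z|lborel. \<bar>indicator Q z * third (D n) z - third g z\<bar>) \<longlonglongrightarrow> 0"
proof -
  show gi: "integrable lborel (third g)" unfolding third_def[abs_def]
    by (intro Bochner_Integration.integrable_add integrable_abs g_int) auto
  have ct: "continuous_on Q (third (D n))" for n unfolding third_def[abs_def] by (intro continuous_intros D_continuous)
  show Di: "integrable lborel (\<lambda>z. indicator Q z * third (D n) z)" for n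
    using continuous_set_int[OF ct[of n]] by (simp add: set_integrable_def)
  let ?d = "\<lambda>n i j z. indicator Q z * \<bar>D n i j z - g i j z\<bar>"
  have id: "integrable lborel (?d n i j)" if "i + j \<le> 3" for n i j
    using set_integrable_abs[OF set_integral_diff(1)[OF D_set_int g_set_int[OF that Q_borel]], of n i j] by (simp add: set_integrable_def)
  have lim: "(\<lambda>n. LINT z|lborel. ?d n i j z) \<longlonglongrightarrow> 0" if "i + j \<le> 3" for i j
    using D_lim[OF that] by (simp add: set_lebesgue_integral_def)
  let ?B = "\<lambda>n. (LINT z|lborel. ?d n 3 0 z) + (LINT z|lborel. ?d n 2 1 z) + (LINT z|lborel. ?d n 1 2 z) + (LINT z|lborel. ?d n 0 3 z)"
  have B: "?B \<longlonglongrightarrow> 0" using tendsto_add[OF tendsto_add[OF tendsto_add[OF lim[of 3 0] lim[of 2 1]] lim[of 1 2]] lim[of 0 3]] by simp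
  show "(\<lambda>n. LINT z|lborel. \<bar>indicator Q z * third (D n) z - third g z\<bar>) \<longlonglongrightarrow> 0"
  proof (rule tendsto_sandwich[OF _ _ tendsto_const B])
    have "(LINT z|lborel. \<bar>indicator Q z * third (D n) z - third g z\<bar>) \<le> ?B n" for n
    proof -
      have "(LINT z|lborel. \<bar>indicator Q z * third (D n) z - third g z\<bar>) \<le> (LINT z|lborel. ?d n 3 0 z + ?d n 2 1 z + ?d n 1 2 z + ?d n 0 3 z)"
      proof (rule integral_mono)
        show "\<bar>indicator Q z * third (D n) z - third g z\<bar> \<le> ?d n 3 0 z + ?d n 2 1 z + ?d n 1 2 z + ?d n 0 3 z" for z
        proof (cases "z \<in> Q")
          case True
          have "\<bar>\<bar>D n i j z\<bar> - \<bar>g i j z\<bar>\<bar> \<le> \<bar>D n i j z - g i j z\<bar>" for i j by (rule abs_triangle_ineq3)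
          note d = this
          have "\<bar>(a + b + c + e) - (a' + b' + c' + e')\<bar> \<le> A + B + C + E"
            if "\<bar>a - a'\<bar> \<le> A" "\<bar>b - b'\<bar> \<le> B" "\<bar>c - c'\<bar> \<le> C" "\<bar>e - e'\<bar> \<le> E" for a b c e a' b' c' e' A B C E :: real
            using that by linarith
          from this[OF d[of 3 0] d[of 2 1] d[of 1 2] d[of 0 3]]
          show ?thesis using True unfolding third_def by simp
        next
          case False
          then show ?thesis using g0[of 3 0 z] g0[of 2 1 z] g0[of 1 2 z] g0[of 0 3 z] by (simp add: third_def)
        qed
        show "integrable lborel (\<lambda>z. ?d n 3 0 z + ?d n 2 1 z + ?d n 1 2 z + ?d n 0 3 z)"
          by (intro Bochner_Integration.integrable_add id) auto
      qed (use gi Di in auto)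
      also have "\<dots> = ?B n" using id[of 3 0 n] id[of 2 1 n] id[of 1 2 n] id[of 0 3 n] by simp
      finally show ?thesis .
    qed
    then show "\<forall>\<^sub>F n in sequentially. (LINT z|lborel. \<bar>indicator Q z * third (D n) z - third g z\<bar>) \<le> ?B n" by simp
  qed simp
qed

text \<open>The estimate for smooth functions is an inequality at points whose right-hand side
  contains only L_1 quantities, so it survives almost everywhere along a suitable
  subsequence.\<close>

lemma limit_estimate:
  assumes h: "h > 0" and R: "h \<le> b1 - a1" "b1 - a1 \<le> 3 * h" "h \<le> b2 - a2" "b2 - a2 \<le> 3 * h"
    and M: "a1 \<le> s0" "s0 + h \<le> b1" "a2 \<le> t0" "t0 + h \<le> b2"
    and g0: "\<And>i j z. i + j \<le> 3 \<Longrightarrow> z \<notin> Q \<Longrightarrow> g i j z = 0"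
    and U: "\<And>e f. e \<in> {s0, s0 + h} \<Longrightarrow> f \<in> {t0, t0 + h} \<Longrightarrow> (\<lambda>n. D n 0 0 (e, f)) \<longlonglongrightarrow> U e f"
    and X: "\<And>e f. e \<in> {s0, s0 + h} \<Longrightarrow> f \<in> {t0, t0 + h} \<Longrightarrow> (\<lambda>n. D n 1 0 (e, f)) \<longlonglongrightarrow> X e f"
    and Y: "\<And>e f. e \<in> {s0, s0 + h} \<Longrightarrow> f \<in> {t0, t0 + h} \<Longrightarrow> (\<lambda>n. D n 0 1 (e, f)) \<longlonglongrightarrow> Y e f"
    and Z: "\<And>e f. e \<in> {s0, s0 + h} \<Longrightarrow> f \<in> {t0, t0 + h} \<Longrightarrow> (\<lambda>n. W n e f) \<longlonglongrightarrow> Z e f"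
    and W: "\<And>n e f. e \<in> {s0, s0 + h} \<Longrightarrow> f \<in> {t0, t0 + h} \<Longrightarrow>
       \<bar>W n e f - integral (cbox (a1, a2) (b1, b2)) (D n 1 1) / ((b1 - a1) * (b2 - a2))\<bar> \<le> \<kappa> * integral (cbox (a1, a2) (b1, b2)) (third (D n)) / h"
    and \<kappa>: "\<kappa> \<ge> 0" and ij: "i + j \<le> 2"
  shows "AE z in lborel. z \<in> {s0..s0 + h} \<times> {t0..t0 + h} \<longrightarrow> \<bar>g i j z - hermite_interp s0 (s0 + h) t0 (t0 + h) U X Y Z i j z\<bar>
    \<le> (7744 * (197 + \<kappa>) + 147) * (h\<^sup>2 / h ^ (i + j)) * ((LINT r|lborel. third g (r, snd z)) + (LINT z|lborel. third g z) / h)"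
proof -
  let ?R = "cbox (a1, a2) (b1, b2)" and ?K = "(7744 * (197 + \<kappa>) + 147) * (h\<^sup>2 / h ^ (i + j))"
  let ?G = "\<lambda>n z. indicator Q z * third (D n) z"
  let ?w = "\<lambda>n t. (LINT r|lborel. ?G n (r, t)) - (LINT r|lborel. third g (r, t))"
  let ?H = "\<lambda>n. hermite_interp s0 (s0 + h) t0 (t0 + h) (\<lambda>e f. D n 0 0 (e, f)) (\<lambda>e f. D n 1 0 (e, f)) (\<lambda>e f. D n 0 1 (e, f)) (W n) i j"
  note T = third_limit[OF g0, simplified]
  have gi: "integrable lborel (third g)" "integrable lborel (?G n)" for n using T(1,2) by auto
  have w: "(\<lambda>n. LINT t|lborel. \<bar>?w n t\<bar>) \<longlonglongrightarrow> 0"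
    by (rule tendsto_sandwich[OF _ _ tendsto_const T(3)]) (auto intro!: always_eventually slice_L1(2) gi)
  have iw: "integrable lborel (?w n)" for n using lborel_fubini(3)[OF gi(1)] lborel_fubini(3)[OF gi(2)[of n]] by simp
  \<comment> \<open>L_1 convergence of the line integrals gives convergence on almost every
    horizontal line only along a subsequence; a second extraction below makes the derivative of
    order (i, j) itself converge almost everywhere.\<close>
  obtain r1 where r1: "strict_mono r1" "AE t in lborel. (\<lambda>n. ?w (r1 n) t) \<longlonglongrightarrow> 0"
    using tendsto_L1_AE_subseq[of lborel ?w] iw w by auto
  let ?u = "\<lambda>n z. indicator Q z * (D n i j z - g i j z)"
  have ij3: "i + j \<le> 3" using ij by simp
  have iu: "integrable lborel (?u n)" for n
    using set_integral_diff(1)[OF D_set_int g_set_int[OF ij3 Q_borel], of n i j] by (simp add: set_integrable_def)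
  have "(\<lambda>n. LINT z|lborel. \<bar>?u n z\<bar>) \<longlonglongrightarrow> 0" using D_lim[OF ij3] by (simp add: set_lebesgue_integral_def abs_mult)
  from LIMSEQ_subseq_LIMSEQ[OF this r1(1)]
  obtain r2 where r2: "strict_mono r2" "AE z in lborel. (\<lambda>n. ?u (r1 (r2 n)) z) \<longlonglongrightarrow> 0"
    using tendsto_L1_AE_subseq[of lborel "\<lambda>n. ?u (r1 n)"] iu by (auto simp: o_def)
  define r where "r = r1 \<circ> r2"
  have r: "strict_mono r" unfolding r_def using r1(1) r2(1) by (rule strict_mono_o)
  have S: "(\<lambda>n. integral ?R (third (D (r n)))) \<longlonglongrightarrow> (LINT z|lborel. third g z)"
  proof -
    have ct: "continuous_on ?R (third (D n))" for n unfolding third_def[abs_def] by (intro continuous_intros D_continuous)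
    have e: "integral ?R (third (D n)) = (LINT z|lborel. ?G n z)" for n
      using integral_box_eq_lborel(2)[OF ct[of n]] by (simp add: set_lebesgue_integral_def)
    have "(\<lambda>n. (LINT z|lborel. ?G n z) - (LINT z|lborel. third g z)) \<longlonglongrightarrow> 0"
    proof (rule Lim_null_comparison[OF _ T(3)], intro always_eventually allI)
      show "norm ((LINT z|lborel. ?G n z) - (LINT z|lborel. third g z)) \<le> (LINT z|lborel. \<bar>?G n z - third g z\<bar>)" for n
        using integral_norm_bound[of lborel "\<lambda>z. ?G n z - third g z"] gi(1) gi(2)[of n] by simp
    qed
    then have "(\<lambda>n. integral ?R (third (D n))) \<longlonglongrightarrow> (LINT z|lborel. third g z)" unfolding e by (simp add: LIM_zero_iff)
    from LIMSEQ_subseq_LIMSEQ[OF this r] show ?thesis by (simp add: o_def)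
  qed
  have V: "(\<lambda>n. ?H (r n) z) \<longlonglongrightarrow> hermite_interp s0 (s0 + h) t0 (t0 + h) U X Y Z i j z" for z
    unfolding hermite_interp_def
    by (intro tendsto_sum tendsto_add tendsto_mult tendsto_const LIMSEQ_subseq_LIMSEQ[OF U r, unfolded o_def]
      LIMSEQ_subseq_LIMSEQ[OF X r, unfolded o_def] LIMSEQ_subseq_LIMSEQ[OF Y r, unfolded o_def] LIMSEQ_subseq_LIMSEQ[OF Z r, unfolded o_def])
  show ?thesis using r2(2) AE_lborel_snd[OF r1(2)]
  proof eventually_elim
    case (elim z)
    show ?case
    proof
      assume zM: "z \<in> {s0..s0 + h} \<times> {t0..t0 + h}"
      then have zQ: "z \<in> Q" using M by auto
      have "(\<lambda>n. D (r n) i j z - g i j z) \<longlonglongrightarrow> 0" using elim(1) zQ by (simp add: r_def)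
      then have dg: "(\<lambda>n. D (r n) i j z) \<longlonglongrightarrow> g i j z" by (simp add: LIM_zero_iff)
      have "(\<lambda>n. ?w (r n) (snd z)) \<longlonglongrightarrow> 0" using LIMSEQ_subseq_LIMSEQ[OF elim(2) r2(1)] by (simp add: r_def o_def)
      then have tg: "(\<lambda>n. LINT r'|lborel. ?G (r n) (r', snd z)) \<longlonglongrightarrow> (LINT r'|lborel. third g (r', snd z))" by (simp add: LIM_zero_iff)
      have te: "(LINT r'|lborel. ?G n (r', snd z)) = integral {a1..b1} (\<lambda>r'. third (D n) (r', snd z))" for n
      proof -
        have c: "continuous_on {a1..b1} (\<lambda>r'. third (D n) (r', snd z))"
        proof (rule continuous_box_slice_x)
          show "continuous_on ?R (third (D n))" unfolding third_def[abs_def] by (intro continuous_intros D_continuous)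
          show "snd z \<in> {a2..b2}" using zQ by auto
        qed
        have "(LINT r'|lborel. ?G n (r', snd z)) = (LINT r':{a1..b1}|lborel. third (D n) (r', snd z))"
          unfolding set_lebesgue_integral_def using zQ by (intro Bochner_Integration.integral_cong) (auto simp: indicator_def)
        also have "\<dots> = integral {a1..b1} (\<lambda>r'. third (D n) (r', snd z))"
          by (intro set_borel_integral_eq_integral(2)) (unfold set_integrable_def, rule borel_integrable_compact, use c in auto)
        finally show ?thesis .
      qed
      show "\<bar>g i j z - hermite_interp s0 (s0 + h) t0 (t0 + h) U X Y Z i j z\<bar> \<le> ?K * ((LINT r|lborel. third g (r, snd z)) + (LINT z|lborel. third g z) / h)"
      proof (rule LIMSEQ_le)
        show "(\<lambda>n. \<bar>D (r n) i j z - ?H (r n) z\<bar>) \<longlonglongrightarrow> \<bar>g i j z - hermite_interp s0 (s0 + h) t0 (t0 + h) U X Y Z i j z\<bar>"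
          by (intro tendsto_rabs tendsto_diff dg V)
        show "(\<lambda>n. ?K * ((LINT r'|lborel. ?G (r n) (r', snd z)) + integral ?R (third (D (r n))) / h))
          \<longlonglongrightarrow> ?K * ((LINT r|lborel. third g (r, snd z)) + (LINT z|lborel. third g z) / h)"
          using h by (intro tendsto_mult tendsto_add tendsto_divide tendsto_const tg S) auto
        show "\<exists>N. \<forall>n\<ge>N. \<bar>D (r n) i j z - ?H (r n) z\<bar> \<le> ?K * ((LINT r'|lborel. ?G (r n) (r', snd z)) + integral ?R (third (D (r n))) / h)"
        proof (intro exI allI impI)
          fix n
          show "\<bar>D (r n) i j z - ?H (r n) z\<bar> \<le> ?K * ((LINT r'|lborel. ?G (r n) (r', snd z)) + integral ?R (third (D (r n))) / h)"
            using smooth_estimate[OF D_smooth[of "r n"] h R M W[of _ _ "r n"] \<kappa> _ _ ij, where s="fst z" and t="snd z"] zM unfolding te by auto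
        qed
      qed
    qed
  qed
qed

end

section \<open>Assembly of the Sobolev estimate\<close>

text \<open>Adding up k + 1 components costs the factor k + 1 to the power 1/q, at most k + 1 for
  every q at least 1.\<close>

lemma sobolev_seminorm_le:
  assumes \<Omega>: "open \<Omega>" and p: "1 \<le> p" and X: "X \<ge> 0"
    and e: "\<And>i j. i + j \<le> k \<Longrightarrow> is_weak_deriv \<Omega> i j f (e i j)" "\<And>i j. i + j \<le> k \<Longrightarrow> lp_norm (lebesgue_on \<Omega>) p (e i j) < \<infinity>"
    and le: "\<And>i. i \<le> k \<Longrightarrow> lp_norm (lebesgue_on \<Omega>) p (e i (k - i)) \<le> ennreal X"
  shows "sobolev_seminorm k p \<Omega> f \<le> ennreal (real (k + 1) * X)"
proof -
  have s: "f \<in> sobolev k p \<Omega>" unfolding sobolev_def using e by blast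
  define N where "N i = lp_norm (lebesgue_on \<Omega>) p (weak_deriv \<Omega> i (k - i) f)" for i
  have N: "N i \<le> ennreal X" if "i \<le> k" for i
    unfolding N_def using weak_deriv_eq_AE(3)[OF \<Omega> e(1), of i "k - i" p] le[OF that] that by simp
  show ?thesis
  proof (cases "p = \<infinity>")
    case True
    have "Max (N ` {..k}) \<le> ennreal X" using N by simp
    also have "\<dots> \<le> ennreal (real (k + 1) * X)" using X by (intro ennreal_leI) (simp add: distrib_right)
    finally show ?thesis using s True by (simp add: sobolev_seminorm_def N_def[abs_def])
  next
    case False
    define q where "q = enn2real p"
    have q: "q \<ge> 1" unfolding q_def by (rule enn2real_ge_1[OF p False])
    have "(\<Sum>i\<le>k. enn2real (N i) powr q) \<le> (\<Sum>i\<le>k. X powr q)"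
      using N X q by (intro sum_mono powr_mono2 enn2real_leI) auto
    also have "\<dots> = real (k + 1) * X powr q" by simp
    finally have "(\<Sum>i\<le>k. enn2real (N i) powr q) powr (1 / q) \<le> (real (k + 1) * X powr q) powr (1 / q)"
      using q by (intro powr_mono2 sum_nonneg) auto
    also have "\<dots> = real (k + 1) powr (1 / q) * X" using q X by (simp add: powr_mult powr_powr)
    also have "\<dots> \<le> real (k + 1) powr 1 * X" using q X by (intro mult_right_mono powr_mono) auto
    finally have "(\<Sum>i\<le>k. enn2real (N i) powr q) powr (1 / q) \<le> real (k + 1) * X" by simp
    then show ?thesis using s False by (simp add: sobolev_seminorm_def N_def q_def Let_def ennreal_leI)
  qed
qed

text \<open>The sum is at most four times the largest term, and the power of that term occurs on the
  right.\<close>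

lemma sum4_powr_le:
  fixes a b c d :: real
  assumes "a \<ge> 0" "b \<ge> 0" "c \<ge> 0" "d \<ge> 0" "q \<ge> 0"
  shows "(a + b + c + d) powr q \<le> 4 powr q * (a powr q + b powr q + c powr q + d powr q)"
proof -
  define m where "m = max (max a b) (max c d)"
  have m: "m \<ge> 0" "a \<le> m" "b \<le> m" "c \<le> m" "d \<le> m" using assms by (auto simp: m_def)
  have "(a + b + c + d) powr q \<le> (4 * m) powr q" using m assms by (intro powr_mono2) auto
  also have "\<dots> = 4 powr q * m powr q" using m by (simp add: powr_mult)
  also have "m = a \<or> m = b \<or> m = c \<or> m = d" unfolding m_def by (auto simp: max_def)
  then have "m powr q \<le> a powr q + b powr q + c powr q + d powr q"
    by (elim disjE) auto
  finally show ?thesis by simp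
qed

text \<open>Returns to the exponent p: \<open>K\<close> is a finite real stand-in for four times the
  seminorm, in the form in which \<open>lp_norm_slice_bound\<close> takes it. The 4 counts the third
  derivatives.\<close>

lemma third_lp_bound:
  fixes a1 b1 a2 b2 :: real
  defines "\<Omega> \<equiv> {a1<..<b1} \<times> {a2<..<b2}"
  assumes p: "1 \<le> p" and u: "u \<in> sobolev 3 p \<Omega>"
    and g: "\<And>i j. i + j \<le> 3 \<Longrightarrow> integrable lborel (g i j)" "\<And>i j z. i + j \<le> 3 \<Longrightarrow> z \<notin> \<Omega> \<Longrightarrow> g i j z = 0"
    and ae: "\<And>i j. i + j \<le> 3 \<Longrightarrow> AE z in lebesgue_on \<Omega>. weak_deriv \<Omega> i j u z = g i j z"
  obtains K where "K \<ge> 0" "ennreal K \<le> 4 * sobolev_seminorm 3 p \<Omega> u"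
    "p = \<infinity> \<Longrightarrow> AE z in lborel. third g z \<le> K"
    "p \<noteq> \<infinity> \<Longrightarrow> integrable lborel (\<lambda>z. third g z powr enn2real p) \<and> (LINT z|lborel. third g z powr enn2real p) \<le> K powr enn2real p"
proof -
  have op: "open \<Omega>" unfolding \<Omega>_def by (simp add: open_Times)
  then have \<Omega>: "\<Omega> \<in> sets lebesgue" by (simp add: borel_open)
  define N where "N i = lp_norm (lebesgue_on \<Omega>) p (weak_deriv \<Omega> i (3 - i) u)" for i
  have N: "N i < \<infinity>" if "i \<le> 3" for i unfolding N_def using sobolev_weak_deriv(2)[OF op u, of i "3 - i"] that by simp
  have wm: "weak_deriv \<Omega> i (3 - i) u \<in> borel_measurable (lebesgue_on \<Omega>)" if "i \<le> 3" for i
    using is_weak_deriv_measurable[OF op sobolev_weak_deriv(1)[OF op u, of i "3 - i"]] that by simp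
  have S4: "{..3::nat} = {0, 1, 2, 3}" by auto
  show thesis
  proof (cases "p = \<infinity>")
    case True
    define m where "m = Max (N ` {..3})"
    have mf: "m < \<infinity>" unfolding m_def using N by simp
    have Nm: "enn2real (N i) \<le> enn2real m" if "i \<le> 3" for i
      using mf that unfolding m_def by (intro enn2real_mono Max_ge) auto
    have b: "AE z in lborel. \<bar>g i (3 - i) z\<bar> \<le> enn2real m" if i: "i \<le> 3" for i
    proof -
      have ij: "i + (3 - i) \<le> 3" using i by simp
      have "AE z in lebesgue_on \<Omega>. \<bar>weak_deriv \<Omega> i (3 - i) u z\<bar> \<le> enn2real (N i)"
        using lp_norm_infinity_bound[OF wm[OF i]] N[OF i] unfolding N_def True by simp
      with ae[OF ij] have "AE z in lebesgue_on \<Omega>. \<bar>g i (3 - i) z\<bar> \<le> enn2real m"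
        by eventually_elim (use Nm[OF i] in auto)
      then have "AE z in lebesgue. z \<in> \<Omega> \<longrightarrow> \<bar>g i (3 - i) z\<bar> \<le> enn2real m" using \<Omega> by (simp add: AE_restrict_space_iff)
      then have "AE z in lebesgue. \<bar>g i (3 - i) z\<bar> \<le> enn2real m"
      proof eventually_elim
        case (elim z)
        then show ?case using g(2)[OF ij, of z] by (cases "z \<in> \<Omega>") auto
      qed
      then show ?thesis by (simp add: AE_completion_iff)
    qed
    show thesis
    proof (rule that[of "4 * enn2real m"])
      show "ennreal (4 * enn2real m) \<le> 4 * sobolev_seminorm 3 p \<Omega> u"
        using u True mf by (simp add: sobolev_seminorm_def m_def N_def[abs_def] ennreal_mult ennreal_enn2real)
      show "AE z in lborel. third g z \<le> 4 * enn2real m"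
      proof -
        have "AE z in lborel. \<bar>g 3 0 z\<bar> \<le> enn2real m" "AE z in lborel. \<bar>g 2 1 z\<bar> \<le> enn2real m"
          "AE z in lborel. \<bar>g 1 2 z\<bar> \<le> enn2real m" "AE z in lborel. \<bar>g 0 3 z\<bar> \<le> enn2real m"
          using b[of 0] b[of 1] b[of 2] b[of 3] by simp_all
        then show ?thesis by eventually_elim (simp add: third_def)
      qed
    qed (use True in auto)
  next
    case False
    define q where "q = enn2real p"
    have q: "q \<ge> 1" unfolding q_def by (rule enn2real_ge_1[OF p False])
    define A where "A i = enn2real (N i) powr q" for i
    have I: "integrable lborel (\<lambda>z. \<bar>g i (3 - i) z\<bar> powr q)" "(LINT z|lborel. \<bar>g i (3 - i) z\<bar> powr q) = A i" if i: "i \<le> 3" for i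
    proof -
      have ij: "i + (3 - i) \<le> 3" using i by simp
      have gm: "(\<lambda>z. \<bar>g i (3 - i) z\<bar> powr q) \<in> borel_measurable lborel" using borel_measurable_integrable[OF g(1)[OF ij]] by simp
      then have gm': "(\<lambda>z. \<bar>g i (3 - i) z\<bar> powr q) \<in> borel_measurable (lebesgue_on \<Omega>)"
        by (intro measurable_restrict_space1 measurable_completion)
      note P = lp_norm_finite_powr_integrable[OF wm[OF i] N[OF i, unfolded N_def] p False, folded q_def N_def]
      have ae': "AE z in lebesgue_on \<Omega>. \<bar>weak_deriv \<Omega> i (3 - i) u z\<bar> powr q = \<bar>g i (3 - i) z\<bar> powr q"
        using ae[OF ij] by eventually_elim simp
      have z: "(\<lambda>z. indicator \<Omega> z * \<bar>g i (3 - i) z\<bar> powr q) = (\<lambda>z. \<bar>g i (3 - i) z\<bar> powr q)"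
        using g(2)[OF ij] by (intro ext) (auto simp: indicator_def)
      have 1: "integrable (lebesgue_on \<Omega>) (\<lambda>z. \<bar>g i (3 - i) z\<bar> powr q)"
        by (rule integrable_cong_AE_imp[OF P(1) gm' ae'])
      have 2: "(LINT z|lebesgue_on \<Omega>. \<bar>g i (3 - i) z\<bar> powr q) = A i"
        using integral_cong_AE[OF borel_measurable_integrable[OF P(1)] gm' ae'] P(2) by (simp add: A_def)
      show "integrable lborel (\<lambda>z. \<bar>g i (3 - i) z\<bar> powr q)"
        using 1 gm by (simp add: integrable_lebesgue_on_iff[OF \<Omega>] z integrable_completion)
      show "(LINT z|lborel. \<bar>g i (3 - i) z\<bar> powr q) = A i"
        using 2 gm by (simp add: integral_lebesgue_on_eq[OF \<Omega>] z integral_completion)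
    qed
    have A: "A i \<ge> 0" for i by (simp add: A_def)
    let ?K = "4 * (\<Sum>i\<le>3. A i) powr (1 / q)"
    have sn: "sobolev_seminorm 3 p \<Omega> u = ennreal ((\<Sum>i\<le>3. A i) powr (1 / q))"
      using u False by (simp add: sobolev_seminorm_def Let_def A_def N_def q_def)
    have Kq: "?K powr q = 4 powr q * (A 0 + A 1 + A 2 + A 3)"
      using q A[of 0] A[of 1] A[of 2] A[of 3] by (simp add: powr_mult powr_powr S4)
    let ?F = "\<lambda>z. 4 powr q * (\<bar>g 3 0 z\<bar> powr q + \<bar>g 2 1 z\<bar> powr q + \<bar>g 1 2 z\<bar> powr q + \<bar>g 0 3 z\<bar> powr q)"
    have J: "integrable lborel (\<lambda>z. \<bar>g 3 0 z\<bar> powr q)" "integrable lborel (\<lambda>z. \<bar>g 2 1 z\<bar> powr q)"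
      "integrable lborel (\<lambda>z. \<bar>g 1 2 z\<bar> powr q)" "integrable lborel (\<lambda>z. \<bar>g 0 3 z\<bar> powr q)"
      "(LINT z|lborel. \<bar>g 3 0 z\<bar> powr q) = A 3" "(LINT z|lborel. \<bar>g 2 1 z\<bar> powr q) = A 2"
      "(LINT z|lborel. \<bar>g 1 2 z\<bar> powr q) = A 1" "(LINT z|lborel. \<bar>g 0 3 z\<bar> powr q) = A 0"
      using I[of 3] I[of 2] I[of 1] I[of 0] by simp_all
    have iF: "integrable lborel ?F" using J by (intro integrable_mult_right Bochner_Integration.integrable_add)
    have F: "third g z powr q \<le> ?F z" for z unfolding third_def using q by (intro sum4_powr_le) auto
    have tm: "third g \<in> borel_measurable lborel"
      unfolding third_def[abs_def] using borel_measurable_integrable[OF g(1)] by (intro borel_measurable_add borel_measurable_abs) auto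
    have it: "integrable lborel (\<lambda>z. third g z powr q)"
      by (rule Bochner_Integration.integrable_bound[OF iF]) (use tm F in \<open>auto intro!: AE_I2\<close>)
    show thesis
    proof (rule that[of ?K])
      show "ennreal ?K \<le> 4 * sobolev_seminorm 3 p \<Omega> u" unfolding sn by (simp add: ennreal_mult)
      have "(LINT z|lborel. third g z powr q) \<le> (LINT z|lborel. ?F z)" by (rule integral_mono[OF it iF F])
      also have "\<dots> = ?K powr q" unfolding Kq using J by simp
      finally show "integrable lborel (\<lambda>z. third g z powr enn2real p) \<and> (LINT z|lborel. third g z powr enn2real p) \<le> ?K powr enn2real p"
        using it unfolding q_def by simp
    qed (use False in auto)
  qed
qed

text \<open>\<open>quasi_interp\<close> indexes the vertices by node numbers and
  \<open>hermite_interp\<close> by coordinates; \<open>Z\<close> translates the edge averages. On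
  the element itself the splines cut off by zero coincide with the explicit ones.\<close>

lemma quasi_interp_eq_hermite_interp:
  assumes xy: "x i < x (Suc i)" "y j < y (Suc j)" and z: "z \<in> elem x y i j"
    and Z: "\<And>k l. k \<in> {i, Suc i} \<Longrightarrow> l \<in> {j, Suc j} \<Longrightarrow> Z (x k) (y l) = edge_average x y \<omega> u (x k) (y l) (\<sigma> k l)"
  shows "quasi_interp x y \<sigma> \<omega> i j u z = hermite_interp (x i) (x (Suc i)) (y j) (y (Suc j)) (\<lambda>e f. u (e, f))
    (\<lambda>e f. dx (elem x y i j) u (e, f)) (\<lambda>e f. dy (elem x y i j) u (e, f)) Z 0 0 z"
proof -
  obtain s t where st: "z = (s, t)" "s \<in> {x i..x (Suc i)}" "t \<in> {y j..y (Suc j)}" using z by (auto simp: elem_def)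
  have P: "phi (x i) (x (Suc i)) (x k) s = hphi (x i) (x (Suc i)) (x k) 0 s" "psi (x i) (x (Suc i)) (x k) s = hpsi (x i) (x (Suc i)) (x k) 0 s"
    if "k \<in> {i, Suc i}" for k
    using phi_eq_hphi[OF xy(1), of "x k"] psi_eq_hpsi(1)[OF xy(1), of "x k"] that st by auto
  have P': "phi (y j) (y (Suc j)) (y l) t = hphi (y j) (y (Suc j)) (y l) 0 t" "psi (y j) (y (Suc j)) (y l) t = hpsi (y j) (y (Suc j)) (y l) 0 t"
    if "l \<in> {j, Suc j}" for l
    using phi_eq_hphi[OF xy(2), of "y l"] psi_eq_hpsi(1)[OF xy(2), of "y l"] that st by auto
  have S: "(\<Sum>e\<in>{x i, x (Suc i)}. \<Sum>f\<in>{y j, y (Suc j)}. F e f) = (\<Sum>k\<in>{i, Suc i}. \<Sum>l\<in>{j, Suc j}. F (x k) (y l))" for F :: "real \<Rightarrow> real \<Rightarrow> real"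
    using xy by simp
  show ?thesis unfolding quasi_interp_def hermite_interp_def S Let_def st(1) case_prod_conv fst_conv snd_conv
    by (intro sum.cong refl) (simp only: P P' Z mult.assoc)
qed

theorem theorem18:
  fixes p :: ennreal and k :: nat
  assumes "1 \<le> p" and "k \<in> {0, 1, 2}"
  shows "\<exists>C::real. \<forall>(n::nat) (m::nat) (x::nat \<Rightarrow> real) (y::nat \<Rightarrow> real) (\<sigma>::nat \<Rightarrow> nat \<Rightarrow> edge)
            (i::nat) (j::nat) (h::real) (\<omega>::(real \<times> real) set) (u::real \<times> real \<Rightarrow> real).
     mesh n m x y \<and> edge_assignment n m x y \<sigma> \<and> i < n \<and> j < m \<and>
     \<omega> = macro_patch n m x y \<sigma> i j \<and> uniform_on n m x y \<omega> h \<and>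
     u \<in> sobolev 3 p (interior \<omega>) \<and> cont_diff 1 (elem x y i j) u \<longrightarrow>
     sobolev_seminorm k p (interior (elem x y i j)) (\<lambda>z. u z - quasi_interp x y \<sigma> \<omega> i j u z)
       \<le> ennreal (C * h ^ (3 - k)) * sobolev_seminorm 3 p (interior \<omega>) u"
\<comment> \<open>The factor 432 = 3 * 36 * 4 combines at most three derivatives in the seminorm on
  the left, the passage from line integrals to L_p, and the four third derivatives. The other factor
  is the constant of \<open>smooth_estimate\<close> with \<kappa> = 8800. Neither depends on p or
  k.\<close>
proof (intro exI[of _ "432 * (7744 * (197 + 8800) + 147)"] allI impI, elim conjE)
  fix n m :: nat and x y :: "nat \<Rightarrow> real" and \<sigma> :: "nat \<Rightarrow> nat \<Rightarrow> edge" and i j :: nat and h :: real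
    and \<omega> :: "(real \<times> real) set" and u :: "real \<times> real \<Rightarrow> real"
  assume mesh: "mesh n m x y" "edge_assignment n m x y \<sigma>" "i < n" "j < m" and \<omega>: "\<omega> = macro_patch n m x y \<sigma> i j"
    and uni: "uniform_on n m x y \<omega> h" and u: "u \<in> sobolev 3 p (interior \<omega>)" and uC: "cont_diff 1 (elem x y i j) u"
  let ?K0 = "7744 * (197 + 8800) + 147 :: real"
  obtain a1 b1 a2 b2 where Q: "\<omega> = {a1..b1} \<times> {a2..b2}" and h: "h > 0"
    and R: "h \<le> b1 - a1" "b1 - a1 \<le> 3 * h" "h \<le> b2 - a2" "b2 - a2 \<le> 3 * h"
    and xS: "x (Suc i) = x i + h" and yS: "y (Suc j) = y j + h" and M: "a1 \<le> x i" "x i + h \<le> b1" "a2 \<le> y j" "y j + h \<le> b2"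
    and E: "\<And>k l. k \<in> {i, Suc i} \<Longrightarrow> l \<in> {j, Suc j} \<Longrightarrow> horizontal_edge_in x y a1 b1 h k l (\<sigma> k l) \<or> vertical_edge_in x y a2 b2 h k l (\<sigma> k l)"
    using uniform_macro_patch[OF mesh uni[unfolded \<omega>]] unfolding \<omega> by metis
  have ab: "a1 < b1" "a2 < b2" using h R by auto
  define B where "B = {a1<..<b1} \<times> {a2<..<b2}"
  define M0 where "M0 = {x i<..<x i + h} \<times> {y j<..<y j + h}"
  have el: "elem x y i j = {x i..x i + h} \<times> {y j..y j + h}" by (simp add: elem_def xS yS)
  have int: "interior \<omega> = B" "interior (elem x y i j) = M0" by (simp_all add: Q el B_def M0_def interior_Times)
  have op: "open B" "open M0" by (simp_all add: B_def M0_def open_Times)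
  have sets: "B \<in> sets lebesgue" "M0 \<in> sets lebesgue" using op by (auto simp: borel_open)
  have sub: "M0 \<subseteq> B" "M0 \<subseteq> elem x y i j" using M by (auto simp: M0_def B_def el)
  note u = u[unfolded int]
  show "sobolev_seminorm k p (interior (elem x y i j)) (\<lambda>z. u z - quasi_interp x y \<sigma> \<omega> i j u z)
       \<le> ennreal (432 * ?K0 * h ^ (3 - k)) * sobolev_seminorm 3 p (interior \<omega>) u"
  proof (rule sobolev_smooth_approximation[OF ab assms(1) u[unfolded B_def], folded B_def])
    fix g :: "nat \<Rightarrow> nat \<Rightarrow> real \<times> real \<Rightarrow> real" and D :: "nat \<Rightarrow> nat \<Rightarrow> nat \<Rightarrow> real \<times> real \<Rightarrow> real"
    assume g: "\<And>i j. i + j \<le> 3 \<Longrightarrow> integrable lborel (g i j)"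
        "\<And>i j z. i + j \<le> 3 \<Longrightarrow> z \<notin> B \<Longrightarrow> g i j z = 0"
        "\<And>i j. i + j \<le> 3 \<Longrightarrow> AE z in lebesgue_on B. weak_deriv B i j u z = g i j z"
        "\<And>i j. i + j \<le> 3 \<Longrightarrow> is_weak_deriv B i j u (g i j)"
        "AE z in lebesgue_on B. u z = g 0 0 z"
        "\<And>n. smooth2 (D n)"
        "\<And>i j. i + j \<le> 3 \<Longrightarrow> (\<lambda>n. LINT z:{a1..b1} \<times> {a2..b2}|lborel. \<bar>D n i j z - g i j z\<bar>) \<longlonglongrightarrow> 0"
    interpret smooth_limit a1 b1 a2 b2 g D
      by unfold_locales (use ab g in auto)
    have gQ: "g r s z = 0" if "r + s \<le> 3" "z \<notin> Q" for r s z using g(2)[OF that(1), of z] that(2) by (auto simp: B_def mem_Times_iff)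
    have xk: "x k \<in> {a1..b1}" if "k \<in> {i, Suc i}" for k using that M h R by (auto simp: xS)
    have yl: "y l \<in> {a2..b2}" if "l \<in> {j, Suc j}" for l using that M h R by (auto simp: yS)
    have "\<exists>\<alpha>. \<alpha> \<longlonglongrightarrow> edge_average x y \<omega> u (x k) (y l) (\<sigma> k l) \<and>
      (\<forall>n. \<bar>\<alpha> n - integral (cbox (a1, a2) (b1, b2)) (D n 1 1) / ((b1 - a1) * (b2 - a2))\<bar> \<le> 8800 * integral (cbox (a1, a2) (b1, b2)) (third (D n)) / h)"
      if k: "k \<in> {i, Suc i}" and l: "l \<in> {j, Suc j}" for k l
      unfolding Q by (rule edge_average_approx[where u=u, OF h R g(3)[of 1 1, unfolded B_def] xk[OF k] yl[OF l] E[OF k l]]) auto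
    then obtain \<alpha> where \<alpha>: "\<And>k l. k \<in> {i, Suc i} \<Longrightarrow> l \<in> {j, Suc j} \<Longrightarrow> \<alpha> k l \<longlonglongrightarrow> edge_average x y \<omega> u (x k) (y l) (\<sigma> k l)"
      "\<And>k l n. k \<in> {i, Suc i} \<Longrightarrow> l \<in> {j, Suc j} \<Longrightarrow> \<bar>\<alpha> k l n - integral (cbox (a1, a2) (b1, b2)) (D n 1 1) / ((b1 - a1) * (b2 - a2))\<bar>
         \<le> 8800 * integral (cbox (a1, a2) (b1, b2)) (third (D n)) / h"
      by metis
    \<comment> \<open>Node indices are recovered from the coordinates of the vertices, since the
      sequences \<alpha> are indexed by nodes.\<close>
    define kx where "kx e = (if e = x i then i else Suc i)" for e
    define ly where "ly f = (if f = y j then j else Suc j)" for f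
    have kx: "kx e \<in> {i, Suc i}" "x (kx e) = e" if "e \<in> {x i, x i + h}" for e using that h by (auto simp: kx_def xS)
    have ly: "ly f \<in> {j, Suc j}" "y (ly f) = f" if "f \<in> {y j, y j + h}" for f using that h by (auto simp: ly_def yS)
    define Z where "Z e f = edge_average x y \<omega> u (x (kx e)) (y (ly f)) (\<sigma> (kx e) (ly f))" for e f
    let ?H = "hermite_interp (x i) (x i + h) (y j) (y j + h) (\<lambda>e f. u (e, f)) (\<lambda>e f. dx (elem x y i j) u (e, f)) (\<lambda>e f. dy (elem x y i j) u (e, f)) Z"
    note pv = point_values[OF _ _ M(1,2,3,4) uC[unfolded el] g(5)[unfolded B_def], folded el]
    have est: "AE z in lborel. z \<in> {x i..x i + h} \<times> {y j..y j + h} \<longrightarrow> \<bar>g r s z - ?H r s z\<bar>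
        \<le> ?K0 * (h\<^sup>2 / h ^ (r + s)) * ((LINT r|lborel. third g (r, snd z)) + (LINT z|lborel. third g z) / h)" if rs: "r + s \<le> 2" for r s
    proof (rule limit_estimate[OF h R M gQ _ _ _ _ _ _ rs])
      show "(\<lambda>n. \<alpha> (kx e) (ly f) n) \<longlonglongrightarrow> Z e f" if "e \<in> {x i, x i + h}" "f \<in> {y j, y j + h}" for e f
        unfolding Z_def using \<alpha>(1)[OF kx(1)[OF that(1)] ly(1)[OF that(2)]] .
      show "\<bar>\<alpha> (kx e) (ly f) n - integral (cbox (a1, a2) (b1, b2)) (D n 1 1) / ((b1 - a1) * (b2 - a2))\<bar>
        \<le> 8800 * integral (cbox (a1, a2) (b1, b2)) (third (D n)) / h" if "e \<in> {x i, x i + h}" "f \<in> {y j, y j + h}" for n e f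
        by (rule \<alpha>(2)[OF kx(1)[OF that(1)] ly(1)[OF that(2)]])
      show "(\<lambda>n. D n 0 0 (e, f)) \<longlonglongrightarrow> u (e, f)" "(\<lambda>n. D n 1 0 (e, f)) \<longlonglongrightarrow> dx (elem x y i j) u (e, f)"
        "(\<lambda>n. D n 0 1 (e, f)) \<longlonglongrightarrow> dy (elem x y i j) u (e, f)" if "e \<in> {x i, x i + h}" "f \<in> {y j, y j + h}" for e f
        using pv[of "(e, f)"] that h by (auto simp: el)
    qed auto
    have qH: "quasi_interp x y \<sigma> \<omega> i j u z = ?H 0 0 z" if "z \<in> M0" for z
      unfolding xS[symmetric] yS[symmetric]
      by (rule quasi_interp_eq_hermite_interp) (use that sub h in \<open>auto simp: xS yS Z_def kx_def ly_def\<close>)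
    define e where "e r s z = g r s z - ?H r s z" for r s z
    have wd: "is_weak_deriv M0 r s (\<lambda>z. u z - quasi_interp x y \<sigma> \<omega> i j u z) (e r s)" if rs: "r + s \<le> 2" for r s
    proof -
      have "is_weak_deriv M0 r s (?H 0 0) (?H r s)" unfolding M0_def by (rule is_weak_deriv_hermite_interp) (use h rs in auto)
      moreover have "is_weak_deriv M0 r s u (g r s)" using is_weak_deriv_subset[OF sets sub(1) g(4)] rs by simp
      ultimately have "is_weak_deriv M0 r s (\<lambda>z. u z - ?H 0 0 z) (e r s)"
        unfolding e_def[abs_def] by (intro is_weak_deriv_diff[OF sets(2)])
      \<comment> \<open>The quasi-interpolant agrees with the explicit Hermite interpolant on the
        open element, which is all that a weak derivative there can see.\<close>
      then show ?thesis by (rule is_weak_deriv_AE_cong) (use sets qH in \<open>auto intro!: AE_I2\<close>)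
    qed
    obtain K where K: "K \<ge> 0" "ennreal K \<le> 4 * sobolev_seminorm 3 p B u" "p = \<infinity> \<Longrightarrow> AE z in lborel. third g z \<le> K"
      "p \<noteq> \<infinity> \<Longrightarrow> integrable lborel (\<lambda>z. third g z powr enn2real p) \<and> (LINT z|lborel. third g z powr enn2real p) \<le> K powr enn2real p"
      using third_lp_bound[OF assms(1) u[unfolded B_def] g(1) g(2)[unfolded B_def] g(3)[unfolded B_def]] unfolding B_def[symmetric] by metis
    define c where "c r = ?K0 * (h\<^sup>2 / h ^ r)" for r
    have lp: "lp_norm (lebesgue_on M0) p (e r s) \<le> ennreal (36 * c (r + s) * h * K)" if rs: "r + s \<le> 2" for r s
      unfolding M0_def
    proof (rule lp_norm_slice_bound[OF assms(1) h _ R(2) _ R(4) third_limit(1)[OF gQ] _ _ _ _ K(1) _ K(3,4)])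
      show "e r s \<in> borel_measurable (lebesgue_on ({x i<..<x i + h} \<times> {y j<..<y j + h}))"
        unfolding M0_def[symmetric] by (rule is_weak_deriv_measurable[OF op(2) wd[OF rs]])
      have "AE z in lebesgue. z \<in> {x i..x i + h} \<times> {y j..y j + h} \<longrightarrow> \<bar>e r s z\<bar> \<le> c (r + s) * ((LINT r|lborel. third g (r, snd z)) + (LINT z|lborel. third g z) / h)"
        using AE_completion[OF est[OF rs]] unfolding e_def c_def .
      then have "AE z in lebesgue. z \<in> M0 \<longrightarrow> \<bar>e r s z\<bar> \<le> c (r + s) * ((LINT r|lborel. third g (r, snd z)) + (LINT z|lborel. third g z) / h)"
        by eventually_elim (use sub(2)[unfolded el] in auto)
      then show "AE z in lebesgue_on ({x i<..<x i + h} \<times> {y j<..<y j + h}). \<bar>e r s z\<bar> \<le> c (r + s) * ((LINT r|lborel. third g (r, snd z)) + (LINT z|lborel. third g z) / h)"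
        unfolding M0_def[symmetric] using sets(2) by (simp add: AE_restrict_space_iff)
      show "third g z = 0" if "z \<notin> Q" for z using gQ[OF _ that] by (simp add: third_def)
      show "third g z \<ge> 0" for z by (simp add: third_def)
      show "c (r + s) \<ge> 0" using h by (simp add: c_def)
    qed (use R h in auto)
    have k2: "k \<le> 2" using assms(2) by auto
    have c0: "c r \<ge> 0" for r using h by (simp add: c_def)
    let ?X = "36 * c k * h * K"
    have "sobolev_seminorm k p M0 (\<lambda>z. u z - quasi_interp x y \<sigma> \<omega> i j u z) \<le> ennreal (real (k + 1) * ?X)"
    proof (rule sobolev_seminorm_le[OF op(2) assms(1)])
      show "0 \<le> ?X" using h K(1) c0 by simp
      show "is_weak_deriv M0 r s (\<lambda>z. u z - quasi_interp x y \<sigma> \<omega> i j u z) (e r s)" if "r + s \<le> k" for r s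
        using wd that k2 by simp
      show "lp_norm (lebesgue_on M0) p (e r s) < \<infinity>" if "r + s \<le> k" for r s
        using le_less_trans[OF lp[of r s]] that k2 by simp
      show "lp_norm (lebesgue_on M0) p (e r (k - r)) \<le> ennreal ?X" if "r \<le> k" for r
        using lp[of r "k - r"] that k2 by simp
    qed
    also have "\<dots> \<le> ennreal (3 * ?X)" using k2 h K(1) c0 by (intro ennreal_leI mult_right_mono) auto
    also have "3 * ?X = 108 * ?K0 * h ^ (3 - k) * K"
      using assms(2) h by (auto simp: c_def power2_eq_square power3_eq_cube)
    also have "ennreal (108 * ?K0 * h ^ (3 - k) * K) = ennreal (108 * ?K0 * h ^ (3 - k)) * ennreal K" using h by (intro ennreal_mult) (simp_all add: K(1))
    also have "\<dots> \<le> ennreal (108 * ?K0 * h ^ (3 - k)) * (4 * sobolev_seminorm 3 p B u)" by (rule mult_left_mono[OF K(2)]) simp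
    also have "\<dots> = ennreal (108 * ?K0 * h ^ (3 - k) * 4) * sobolev_seminorm 3 p B u"
      using h by (subst ennreal_mult) (simp_all add: mult.assoc)
    also have "108 * ?K0 * h ^ (3 - k) * 4 = 432 * ?K0 * h ^ (3 - k)" by simp
    finally show "sobolev_seminorm k p (interior (elem x y i j)) (\<lambda>z. u z - quasi_interp x y \<sigma> \<omega> i j u z)
         \<le> ennreal (432 * ?K0 * h ^ (3 - k)) * sobolev_seminorm 3 p (interior \<omega>) u"
      unfolding int .
  qed
qed

end
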